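(* Let $\mathbb{K}$ be a field, $\mathcal{S}$ a linear subspace of $\mathrm{M}_{n,p}(\mathbb{K})$ with $\operatorname{codim}\mathcal{S}\leq d_n(\mathbb{K})$, and $q\geq 1$. Then the linear range-restricting maps $F:\mathcal{S}\to\mathrm{M}_{n,q}(\mathbb{K})$ are exactly the maps $M\mapsto MP$ with $P\in\mathrm{M}_{p,q}(\mathbb{K})$. If moreover $\mathcal{S}$ has none of Types 1, 2, 3, these maps are also exactly the range-restricting group homomorphisms from $\mathcal{S}$ to $\mathrm{M}_{n,q}(\mathbb{K})$.
   Context: $d_n(\mathbb{K}):=2n-3$ if $\mathbb{K}$ has more than $2$ elements and $d_n(\mathbb{K}):=2n-4$ if $\mathbb{K}$ has $2$ elements. A map $F:\mathcal{S}\to\mathrm{M}_{n,q}(\mathbb{K})$ is range-restricting when $\operatorname{im}F(M)\subset\operatorname{im}M$ (column spaces) for all $M\in\mathcal{S}$. Types (for $\mathcal{S}\subset\mathrm{M}_{n,p}(\mathbb{K})$ seen as operators $\mathbb{K}^p\to\mathbb{K}^n$; $\mathcal{S}x=\{Mx:M\in\mathcal{S}\}$): Type 1 when $\dim\mathcal{S}x=1$ for some $x\in\mathbb{K}^p$; Type 2 when $\mathbb{K}$ has characteristic $2$ and $P\mathcal{S}Q^{-1}=\mathrm{S}_2(\mathbb{K})\vee\mathrm{M}_{n-2,p-2}(\mathbb{K})$ for some invertible $P,Q$, where this is the set of matrices $\begin{bmatrix}A&C\\0&B\end{bmatrix}$ with $A$ a $2\times 2$ symmetric matrix, $B\in\mathrm{M}_{n-2,p-2}(\mathbb{K})$,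 $C\in\mathrm{M}_{2,p-2}(\mathbb{K})$ arbitrary; Type 3 when $\mathbb{K}$ has characteristic $2$, $n=3$ and $P\mathcal{S}Q^{-1}$ is the set of matrices $\begin{bmatrix}A&B\end{bmatrix}$ with $A$ a $3\times 3$ symmetric matrix and $B\in\mathrm{M}_{3,p-3}(\mathbb{K})$ arbitrary, for some invertible $P,Q$. *)

theory Defs
  imports "Jordan_Normal_Form.Matrix"
begin

definition d_bound :: "'a::field itself \<Rightarrow> nat \<Rightarrow> int" where
  "d_bound (_::'a itself) n = (if card (UNIV::'a set) = 2 then 2 * int n - 4 else 2 * int n - 3)"

definition mat_subspace :: "nat \<Rightarrow> nat \<Rightarrow> 'a::field mat set \<Rightarrow> bool" where
  "mat_subspace n p S \<longleftrightarrow> S \<subseteq> carrier_mat n p \<and> 0\<^sub>m n p \<in> S \<and>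
     (\<forall>A\<in>S. \<forall>B\<in>S. A + B \<in> S) \<and> (\<forall>c. \<forall>A\<in>S. c \<cdot>\<^sub>m A \<in> S)"

definition lin_comb_mat :: "nat \<Rightarrow> nat \<Rightarrow> (nat \<Rightarrow> 'a::field) \<Rightarrow> 'a mat list \<Rightarrow> 'a mat" where
  "lin_comb_mat n p c Ms = foldr (\<lambda>i acc. c i \<cdot>\<^sub>m (Ms ! i) + acc) [0..<length Ms] (0\<^sub>m n p)"

definition mat_lin_indep :: "nat \<Rightarrow> nat \<Rightarrow> 'a::field mat list \<Rightarrow> bool" where
  "mat_lin_indep n p Ms \<longleftrightarrow> set Ms \<subseteq> carrier_mat n p \<and>
     (\<forall>c. lin_comb_mat n p c Ms = 0\<^sub>m n p \<longrightarrow> (\<forall>i<length Ms. c i = 0))"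

definition mat_space_dim :: "nat \<Rightarrow> nat \<Rightarrow> 'a::field mat set \<Rightarrow> nat" where
  "mat_space_dim n p S = Max {length Ms | Ms. set Ms \<subseteq> S \<and> mat_lin_indep n p Ms}"

definition mat_codim :: "nat \<Rightarrow> nat \<Rightarrow> 'a::field mat set \<Rightarrow> int" where
  "mat_codim n p S = int (n * p) - int (mat_space_dim n p S)"

definition col_space :: "'a::field mat \<Rightarrow> 'a vec set" where
  "col_space M = {M *\<^sub>v x | x. x \<in> carrier_vec (dim_col M)}"

definition range_restricting :: "'a::field mat set \<Rightarrow> ('a mat \<Rightarrow> 'a mat) \<Rightarrow> bool" where
  "range_restricting S F \<longleftrightarrow> (\<forall>M\<in>S. col_space (F M) \<subseteq> col_space M)"

definition additive_on :: "'a::field mat set \<Rightarrow> ('a mat \<Rightarrow> 'a mat) \<Rightarrow> bool" where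
  "additive_on S F \<longleftrightarrow> (\<forall>A\<in>S. \<forall>B\<in>S. F (A + B) = F A + F B)"

definition linear_on :: "'a::field mat set \<Rightarrow> ('a mat \<Rightarrow> 'a mat) \<Rightarrow> bool" where
  "linear_on S F \<longleftrightarrow> additive_on S F \<and> (\<forall>c. \<forall>A\<in>S. F (c \<cdot>\<^sub>m A) = c \<cdot>\<^sub>m F A)"

definition type1 :: "nat \<Rightarrow> nat \<Rightarrow> 'a::field mat set \<Rightarrow> bool" where
  "type1 n p S \<longleftrightarrow> (\<exists>x\<in>carrier_vec p. \<exists>y\<in>carrier_vec n. y \<noteq> 0\<^sub>v n \<and>
      {M *\<^sub>v x | M. M \<in> S} = {c \<cdot>\<^sub>v y | c. True})"

definition sym2_join :: "nat \<Rightarrow> nat \<Rightarrow> 'a::field mat set" where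
  "sym2_join n p = {A \<in> carrier_mat n p. A $$ (0,1) = A $$ (1,0) \<and>
      (\<forall>i j. 2 \<le> i \<and> i < n \<and> j < 2 \<longrightarrow> A $$ (i,j) = 0)}"

definition type2 :: "nat \<Rightarrow> nat \<Rightarrow> 'a::field mat set \<Rightarrow> bool" where
  "type2 n p S \<longleftrightarrow> CHAR('a) = 2 \<and> 2 \<le> n \<and> 2 \<le> p \<and>
     (\<exists>P Q Qi. P \<in> carrier_mat n n \<and> invertible_mat P \<and> Q \<in> carrier_mat p p \<and>
        Qi \<in> carrier_mat p p \<and> Q * Qi = 1\<^sub>m p \<and> Qi * Q = 1\<^sub>m p \<and>
        (\<lambda>M. P * M * Qi) ` S = sym2_join n p)"

definition sym3_row :: "nat \<Rightarrow> 'a::field mat set" where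
  "sym3_row p = {A \<in> carrier_mat 3 p. \<forall>i<3. \<forall>j<3. A $$ (i,j) = A $$ (j,i)}"

definition type3 :: "nat \<Rightarrow> nat \<Rightarrow> 'a::field mat set \<Rightarrow> bool" where
  "type3 n p S \<longleftrightarrow> CHAR('a) = 2 \<and> n = 3 \<and> 3 \<le> p \<and>
     (\<exists>P Q Qi. P \<in> carrier_mat n n \<and> invertible_mat P \<and> Q \<in> carrier_mat p p \<and>
        Qi \<in> carrier_mat p p \<and> Q * Qi = 1\<^sub>m p \<and> Qi * Q = 1\<^sub>m p \<and>
        (\<lambda>M. P * M * Qi) ` S = sym3_row p)"

end

theory Submission
  imports Defs "HOL-Library.Function_Algebras"
begin

text \<open>
  A space \<open>S\<close> of matrices is encoded by its annihilator \<open>T\<close> in the space of tensors \<open>x \<Otimes> \<xi>\<close>, where \<open>x\<close> is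
  a column vector of length \<open>p\<close> and \<open>\<xi>\<close> a row vector of length \<open>n\<close>: a matrix \<open>M\<close> acts on tensors by
  \<open>x \<Otimes> \<xi> \<mapsto> \<xi> M x\<close>. A column of \<open>F\<close> becomes a map \<open>(s, \<xi>) \<mapsto> F s \<xi>\<close> that is linear in \<open>\<xi>\<close>, additive in \<open>s\<close>,
  and vanishes whenever \<open>s\<close> kills all \<open>x \<Otimes> \<xi>\<close>; it comes from a right multiplication iff
  \<open>F s \<xi> = s (x \<Otimes> \<xi>)\<close> for a fixed \<open>x\<close>.

  The row vectors are then allowed to range over a space \<open>X\<close> of dimension \<open>m\<close>, and one inducts on \<open>m\<close> under
  the assumption \<open>dim T \<le> 2 m - 3\<close>. Passing to the hyperplane \<open>ker z\<close> of \<open>X\<close> replaces \<open>T\<close> by the tensors whose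
  contraction with \<open>z\<close> vanishes; call \<open>z\<close> bad if this lowers the dimension by less than two. For all other
  \<open>z\<close> the induction hypothesis says that on \<open>ker z\<close> the map is a right multiplication, or inhomogeneous
  of Type 1, or, in characteristic 2, of the form \<open>s (x \<Otimes> \<xi>) + \<alpha> (s (J \<xi> \<Otimes> \<xi>))\<close> with
  \<open>\<alpha> (c\<^sup>2 a) = c \<alpha> a\<close>. If an outcome occurs on sufficiently many hyperplanes, one of the outcomes holds on \<open>X\<close>;
  otherwise all \<open>z\<close> with that outcome vanish at a common nonzero vector. A dual basis avoiding these (at most three) vectors
  consists of bad functionals, which is only possible if \<open>m = 3\<close> and \<open>T\<close> is spanned by three tensors of rank
  one. The field with two elements needs a separate, similar argument. Finally, the exceptional form yields
  Type 2 if \<open>J\<close> has rank two and Type 3 if \<open>J\<close> has larger rank.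
\<close>

subsection \<open>Linear functionals on function spaces\<close>

text \<open>The bound is shaped by the induction: passing to \<open>ker z\<close> lowers
  \<open>m\<close> by one and \<open>2 m - 3\<close> by two, so the hypothesis survives when
  contraction with \<open>z\<close> has rank at least two on \<open>T\<close>. For
  \<open>m = 2\<close> at most one tensor is left. If it has rank two, the problem is that of
  additive range-restricting maps on symmetric 2 x 2 matrices, whose functional equation has
  nonlinear solutions only in characteristic 2; this is the origin of \<open>J\<close> and
  \<open>\<alpha>\<close>. Additive maps are controlled by one principle: an additive map
  multiplying every vector by some scalar uses the same scalar throughout, provided the dimension is
  at least two. Type 1 is the failure of this in dimension one. Homogeneity is carried along as an
  alternative, so that the linear and the additive assertion come out of one induction. A dual basis
  can avoid as many vectors as there are nonzero scalars. These are at least three in characteristic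
  2 beyond two elements, and at least two in other characteristics, where the exceptional form is
  absent. Over two elements only one vector can be avoided, but additive maps are linear there and
  the bound \<open>2 m - 4\<close> starts the induction at \<open>T = 0\<close>.\<close>

definition scl :: "'a::field \<Rightarrow> ('i \<Rightarrow> 'a) \<Rightarrow> 'i \<Rightarrow> 'a" (infixr "\<star>" 75) where
  "c \<star> f = (\<lambda>i. c * f i)"

lemma scl_apply [simp]: "(c \<star> f) i = c * f i"
  by (simp add: scl_def)

lemma sum_fun_apply: "(\<Sum>i\<in>I. f i) x = (\<Sum>i\<in>I. (f i x :: 'a::comm_monoid_add))"
  by (induction I rule: infinite_finite_induct) auto

lemma minus_fun_apply [simp]: "(f - g) x = f x - (g x :: 'a::ab_group_add)"
  by (simp add: fun_diff_def)

interpretation fs: vector_space "scl :: 'a::field \<Rightarrow> ('i \<Rightarrow> 'a) \<Rightarrow> 'i \<Rightarrow> 'a"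
  by unfold_locales (auto simp: fun_eq_iff algebra_simps)

lemma vector_space_field: "vector_space ((*) :: 'a::field \<Rightarrow> 'a \<Rightarrow> 'a)"
  by unfold_locales (auto simp: algebra_simps)

text \<open>Functionals are linear on the whole function space although only their values on
  \<open>X\<close> or \<open>WW p X\<close> matter. Two functionals agreeing there may differ
  elsewhere, which later statements have to allow for.\<close>

definition lin :: "(('i \<Rightarrow> 'a::field) \<Rightarrow> 'a) \<Rightarrow> bool" where
  "lin z \<longleftrightarrow> (\<forall>u v. z (u + v) = z u + z v) \<and> (\<forall>c u. z (c \<star> u) = c * z u)"

lemma linI: "(\<And>u v. z (u + v) = z u + z v) \<Longrightarrow> (\<And>c u. z (c \<star> u) = c * z u) \<Longrightarrow> lin z"
  by (simp add: lin_def)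

lemma lin_add: "lin z \<Longrightarrow> z (u + v) = z u + z v"
  and lin_scl: "lin z \<Longrightarrow> z (c \<star> u) = c * z u"
  by (simp_all add: lin_def)

lemma lin_0: "lin z \<Longrightarrow> z 0 = 0"
  using lin_scl[of z 0 0] by simp

lemma lin_uminus: "lin z \<Longrightarrow> z (- u) = - z u"
  using lin_scl[of z "-1" u] by (simp add: fs.scale_minus_left)

lemma lin_diff: "lin z \<Longrightarrow> z (u - v) = z u - z v"
  using lin_add[of z u "- v"] by (simp add: lin_uminus)

lemma lin_sum: "lin z \<Longrightarrow> z (\<Sum>i\<in>I. f i) = (\<Sum>i\<in>I. z (f i))"
  by (induction I rule: infinite_finite_induct) (auto simp: lin_0 lin_add)

lemmas lin_simps = lin_add lin_scl lin_0 lin_uminus lin_diff lin_sum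

lemma lin_plus [intro]: "lin y \<Longrightarrow> lin z \<Longrightarrow> lin (y + z)"
  and lin_star [intro]: "lin y \<Longrightarrow> lin (c \<star> y)"
  and lin_minus [intro]: "lin y \<Longrightarrow> lin z \<Longrightarrow> lin (y - z)"
  and lin_zero [intro, simp]: "lin 0"
  by (auto simp: lin_def algebra_simps)

lemma lin_setsum [intro]: "(\<And>i. i \<in> I \<Longrightarrow> lin (f i)) \<Longrightarrow> lin (\<Sum>i\<in>I. f i)"
  by (induction I rule: infinite_finite_induct) auto

lemma lin_coord [intro, simp]: "lin (\<lambda>u. u i)"
  by (auto simp: lin_def)

text \<open>The same notion serves sets of vectors, of tensors and of functionals, which are
  functions too; \<open>additive_scalar\<close> uses it on the last level.\<close>

definition sub :: "('i \<Rightarrow> 'a::field) set \<Rightarrow> bool" where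
  "sub A \<longleftrightarrow> 0 \<in> A \<and> (\<forall>u\<in>A. \<forall>v\<in>A. u + v \<in> A) \<and> (\<forall>c. \<forall>u\<in>A. c \<star> u \<in> A)"

lemma sub_0: "sub A \<Longrightarrow> 0 \<in> A"
  and sub_add: "sub A \<Longrightarrow> u \<in> A \<Longrightarrow> v \<in> A \<Longrightarrow> u + v \<in> A"
  and sub_scl: "sub A \<Longrightarrow> u \<in> A \<Longrightarrow> c \<star> u \<in> A"
  by (auto simp: sub_def)

lemma sub_uminus: "sub A \<Longrightarrow> u \<in> A \<Longrightarrow> - u \<in> A"
  using sub_scl[of A u "-1"] by (simp add: fs.scale_minus_left)

lemma sub_diff: "sub A \<Longrightarrow> u \<in> A \<Longrightarrow> v \<in> A \<Longrightarrow> u - v \<in> A"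
  using sub_add[of A u "- v"] by (simp add: sub_uminus)

lemma sub_sum: "sub A \<Longrightarrow> (\<And>i. i \<in> I \<Longrightarrow> f i \<in> A) \<Longrightarrow> (\<Sum>i\<in>I. f i) \<in> A"
  by (induction I rule: infinite_finite_induct) (auto simp: sub_0 sub_add)

lemmas sub_intros = sub_0 sub_add sub_scl sub_uminus sub_diff sub_sum

lemma sub_iff_subspace: "sub A \<longleftrightarrow> fs.subspace A"
  by (auto simp: sub_def fs.subspace_def)

lemma sub_add_line: "sub A \<Longrightarrow> sub {u + c \<star> v | u c. u \<in> A}"
proof -
  assume A: "sub A"
  show ?thesis
    unfolding sub_def
  proof (intro conjI ballI allI)
    show "0 \<in> {u + c \<star> v |u c. u \<in> A}"
      using sub_0[OF A] by (auto intro!: exI[of _ 0])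
  next
    fix x y assume "x \<in> {u + c \<star> v |u c. u \<in> A}" "y \<in> {u + c \<star> v |u c. u \<in> A}"
    then obtain u c u' c' where "x = u + c \<star> v" "y = u' + c' \<star> v" "u \<in> A" "u' \<in> A" by blast
    then have "x + y = (u + u') + (c + c') \<star> v" "u + u' \<in> A"
      using sub_add[OF A] by (auto simp: fs.scale_left_distrib)
    then show "x + y \<in> {u + c \<star> v |u c. u \<in> A}" by blast
  next
    fix d x assume "x \<in> {u + c \<star> v |u c. u \<in> A}"
    then obtain u c where "x = u + c \<star> v" "u \<in> A" by blast
    then have "d \<star> x = d \<star> u + (d * c) \<star> v" "d \<star> u \<in> A"
      using sub_scl[OF A] by (auto simp: fs.scale_right_distrib)
    then show "d \<star> x \<in> {u + c \<star> v |u c. u \<in> A}" by blast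
  qed
qed

lemma lin_exists_on_independent:
  fixes B :: "('i \<Rightarrow> 'a::field) set"
  assumes "fs.independent B"
  shows "\<exists>s. lin s \<and> (\<forall>x\<in>B. s x = f x)"
proof -
  interpret vp: vector_space_pair "scl :: 'a \<Rightarrow> ('i \<Rightarrow> 'a) \<Rightarrow> 'i \<Rightarrow> 'a" "(*) :: 'a \<Rightarrow> 'a \<Rightarrow> 'a"
    unfolding vector_space_pair_def using fs.vector_space_axioms vector_space_field by blast
  show ?thesis
    using vp.linear_independent_extend[OF assms, of f]
    unfolding lin_def Vector_Spaces.linear_iff by blast
qed

text \<open>The requirements on \<open>A\<close> and on \<open>T\<close> are compatible because
  \<open>g\<close> vanishes on the intersection. It suffices to extend a basis of \<open>A\<close>
  by vectors of \<open>T\<close> and to prescribe zero on the new ones.\<close>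

lemma lin_extend:
  fixes A T :: "('i \<Rightarrow> 'a::field) set"
  assumes A: "sub A" and T: "sub T" and g: "lin g" and gAT: "\<And>w. w \<in> A \<Longrightarrow> w \<in> T \<Longrightarrow> g w = 0"
  obtains s where "lin s" "\<And>a. a \<in> A \<Longrightarrow> s a = g a" "\<And>t. t \<in> T \<Longrightarrow> s t = 0"
proof -
  obtain B where B: "B \<subseteq> A" "fs.independent B" "A \<subseteq> fs.span B"
    using fs.maximal_independent_subset by blast
  have spB: "fs.span B = A"
    using fs.span_subspace[OF B(1) B(3)] A by (simp add: sub_iff_subspace)
  obtain B' where B': "B \<subseteq> B'" "B' \<subseteq> A \<union> T" "fs.independent B'" "A \<union> T \<subseteq> fs.span B'"
    using fs.maximal_independent_subset_extend[of B "A \<union> T"] B by blast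
  obtain s where ls: "lin s" and s: "\<forall>x\<in>B'. s x = (if x \<in> B then g x else 0)"
    using lin_exists_on_independent[OF B'(3), of "\<lambda>x. if x \<in> B then g x else 0"] by blast
  have agree: "fs.span C \<subseteq> {w. s w = h w}" if "lin h" "\<And>x. x \<in> C \<Longrightarrow> s x = h x" for C h
  proof (rule fs.span_minimal)
    show "fs.subspace {w. s w = h w}"
      unfolding sub_iff_subspace[symmetric] sub_def
      using lin_simps[OF ls] lin_simps[OF that(1)] by simp
  qed (use that(2) in blast)
  have sub_eq: "s w = g w" if "w \<in> fs.span B" for w
  proof -
    have "s x = g x" if "x \<in> B" for x using s B'(1) that by auto
    from agree[OF g this] that show ?thesis by blast
  qed
  \<comment> \<open>A new basis vector cannot lie in \<open>A\<close>, which the old ones already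
    span.\<close>
  have "B' - B \<subseteq> T"
  proof
    fix b assume b: "b \<in> B' - B"
    have "b \<notin> A"
    proof
      assume "b \<in> A"
      then have "b \<in> fs.span (B' - {b})"
        using spB fs.span_mono[of B "B' - {b}"] B'(1) b by blast
      then show False using B'(3) b unfolding fs.dependent_def by blast
    qed
    then show "b \<in> T" using B'(2) b by blast
  qed
  then have spT: "fs.span (B' - B) \<subseteq> T"
    using T fs.span_minimal by (simp add: sub_iff_subspace)
  have s0: "s w = 0" if "w \<in> fs.span (B' - B)" for w
  proof -
    have "s x = 0 x" if "x \<in> B' - B" for x using s that by auto
    from agree[OF lin_zero this] that show ?thesis by auto
  qed
  \<comment> \<open>Splitting \<open>t = a + k\<close> along the basis puts \<open>a\<close> into
    both \<open>A\<close> and \<open>T\<close>, where \<open>g\<close> vanishes.\<close>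
  have "s t = 0" if "t \<in> T" for t
  proof -
    have "t \<in> fs.span (B \<union> (B' - B))" using that B'(1,4) Un_absorb1[OF B'(1)] by auto
    then obtain a k where t: "t = a + k" "a \<in> fs.span B" "k \<in> fs.span (B' - B)"
      unfolding fs.span_Un by blast
    have "a \<in> T" using sub_diff[OF T that, of k] t(1,3) spT by auto
    then have "g a = 0" using gAT t(2) spB by blast
    then show ?thesis using t sub_eq s0 by (simp add: lin_add[OF ls])
  qed
  then show thesis using that[OF ls] sub_eq spB by blast
qed

definition Ann :: "('i \<Rightarrow> 'a::field) set \<Rightarrow> (('i \<Rightarrow> 'a) \<Rightarrow> 'a) set" where
  "Ann T = {s. lin s \<and> (\<forall>t\<in>T. s t = 0)}"

lemma AnnD: "s \<in> Ann T \<Longrightarrow> lin s" "s \<in> Ann T \<Longrightarrow> t \<in> T \<Longrightarrow> s t = 0"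
  by (auto simp: Ann_def)

lemma AnnI: "lin s \<Longrightarrow> (\<And>t. t \<in> T \<Longrightarrow> s t = 0) \<Longrightarrow> s \<in> Ann T"
  by (auto simp: Ann_def)

lemma sub_Ann: "sub (Ann T)"
  by (auto simp: sub_def Ann_def)

lemma sub_line: "sub (range (\<lambda>c. c \<star> w))"
  unfolding sub_def
  by (auto simp: image_def fs.scale_left_distrib[symmetric] intro: exI[of _ 0])

text \<open>The line of \<open>w\<close> meets \<open>T\<close> only in zero, so a coordinate
  functional normalised at \<open>w\<close> can be extended by zero on \<open>T\<close>.\<close>

lemma Ann_separates:
  fixes T :: "('i \<Rightarrow> 'a::field) set"
  assumes T: "sub T" and w: "w \<notin> T"
  obtains s where "s \<in> Ann T" "s w = 1"
proof -
  have "w \<noteq> 0" using w sub_0[OF T] by auto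
  then obtain i where i: "w i \<noteq> 0" by (auto simp: fun_eq_iff)
  define g where "g f = f i / w i" for f :: "'i \<Rightarrow> 'a"
  have g: "lin g" by (auto simp: lin_def g_def add_divide_distrib)
  have "g v = 0" if vw: "v \<in> range (\<lambda>c. c \<star> w)" and vT: "v \<in> T" for v
  proof -
    obtain c where v: "v = c \<star> w" using vw by blast
    have "c = 0"
    proof (rule ccontr)
      assume "c \<noteq> 0"
      then have "w = inverse c \<star> v" by (simp add: v)
      then show False using w sub_scl[OF T vT] by metis
    qed
    then show ?thesis by (simp add: v g_def)
  qed
  then obtain s where "lin s" "\<And>a. a \<in> range (\<lambda>c. c \<star> w) \<Longrightarrow> s a = g a" "\<And>t. t \<in> T \<Longrightarrow> s t = 0"
    using lin_extend[OF sub_line T g] by metis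
  moreover have "w \<in> range (\<lambda>c. c \<star> w)" by (auto intro: image_eqI[of _ _ 1])
  ultimately show thesis using that[of s] i by (auto simp: Ann_def g_def)
qed

text \<open>A subspace is its own double annihilator, whatever its dimension. This turns an identity
  valid for all \<open>s\<close> into a tensor lying in \<open>T\<close>; it is how values of
  \<open>F\<close> give information on \<open>T\<close>.\<close>

lemma mem_if_Ann_vanishes:
  assumes "sub T" "\<And>s. s \<in> Ann T \<Longrightarrow> s w = 0"
  shows "w \<in> T"
  using Ann_separates[OF assms(1), of w] assms(2) by (metis zero_neq_one)

text \<open>Independence of the pair as a family: equal vectors are dependent.\<close>

definition indep2 :: "('i \<Rightarrow> 'a::field) \<Rightarrow> ('i \<Rightarrow> 'a) \<Rightarrow> bool" where
  "indep2 u v \<longleftrightarrow> (\<forall>a b. a \<star> u + b \<star> v = 0 \<longrightarrow> a = 0 \<and> b = 0)"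

lemma indep2D: "indep2 u v \<Longrightarrow> a \<star> u + b \<star> v = 0 \<Longrightarrow> a = 0 \<and> b = 0"
  by (simp add: indep2_def)

lemma indep2_nonzero: "indep2 u v \<Longrightarrow> u \<noteq> 0" "indep2 u v \<Longrightarrow> v \<noteq> 0"
  using indep2D[of u v 1 0] indep2D[of u v 0 1] by auto

lemma indep2_sym: "indep2 u v \<Longrightarrow> indep2 v u"
  unfolding indep2_def by (metis add.commute)

lemma not_indep2:
  assumes "\<not> indep2 u v" "u \<noteq> 0"
  obtains c where "v = c \<star> u"
proof -
  obtain a b where ab: "a \<star> u + b \<star> v = 0" "a \<noteq> 0 \<or> b \<noteq> 0"
    using assms(1) unfolding indep2_def by blast
  have b: "b \<noteq> 0"
    using ab assms(2) by auto
  have "a * u i + b * v i = 0" for i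
    using fun_cong[OF ab(1), of i] by simp
  then have "v i = (- a / b) * u i" for i
    using b by (simp add: field_simps add_eq_0_iff)
  then have "v = (- a / b) \<star> u"
    by (simp add: fun_eq_iff)
  then show thesis using that by blast
qed

lemma indep2_iff: "indep2 u v \<longleftrightarrow> u \<noteq> 0 \<and> (\<forall>c. v \<noteq> c \<star> u)"
proof
  assume i: "indep2 u v"
  have "v \<noteq> c \<star> u" for c
  proof
    assume "v = c \<star> u"
    then have "c \<star> u + (-1) \<star> v = 0" by (simp add: fs.scale_minus_left)
    then show False using indep2D[OF i, of c "-1"] by simp
  qed
  then show "u \<noteq> 0 \<and> (\<forall>c. v \<noteq> c \<star> u)" using i indep2_nonzero by blast
next
  assume "u \<noteq> 0 \<and> (\<forall>c. v \<noteq> c \<star> u)"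
  then show "indep2 u v" using not_indep2 by blast
qed

subsection \<open>Tensors, dual bases and dimension\<close>

definition tensor :: "(nat \<Rightarrow> 'a::field) \<Rightarrow> (nat \<Rightarrow> 'a) \<Rightarrow> nat \<times> nat \<Rightarrow> 'a" (infix "\<Otimes>" 80) where
  "x \<Otimes> \<xi> = (\<lambda>(j, i). x j * \<xi> i)"

definition col :: "(nat \<times> nat \<Rightarrow> 'a) \<Rightarrow> nat \<Rightarrow> nat \<Rightarrow> 'a" where
  "col t j = (\<lambda>i. t (j, i))"

text \<open>In \<open>t (j, i)\<close> the index \<open>j\<close> belongs to the column vector; \<open>UU\<close> and \<open>WW\<close> realise vectors and tensors of
  finite size as functions vanishing outside the index range.\<close>

definition contr :: "(nat \<times> nat \<Rightarrow> 'a) \<Rightarrow> ((nat \<Rightarrow> 'a) \<Rightarrow> 'a) \<Rightarrow> nat \<Rightarrow> 'a" where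
  "contr t y = (\<lambda>j. y (col t j))"

text \<open>The functional on tensors that belongs to the rank-one matrix with column
  \<open>y\<close> and row \<open>\<phi>\<close>; see \<open>rk1_tensor\<close>.\<close>

definition rk1 :: "((nat \<Rightarrow> 'a) \<Rightarrow> 'a) \<Rightarrow> ((nat \<Rightarrow> 'a) \<Rightarrow> 'a) \<Rightarrow> (nat \<times> nat \<Rightarrow> 'a) \<Rightarrow> 'a" where
  "rk1 \<phi> y = (\<lambda>t. \<phi> (contr t y))"

definition UU :: "nat \<Rightarrow> (nat \<Rightarrow> 'a::field) set" where
  "UU p = {x. \<forall>j\<ge>p. x j = 0}"

definition WW :: "nat \<Rightarrow> (nat \<Rightarrow> 'a::field) set \<Rightarrow> (nat \<times> nat \<Rightarrow> 'a) set" where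
  "WW p X = {t. (\<forall>j. col t j \<in> X) \<and> (\<forall>j\<ge>p. col t j = 0)}"

definition kerin :: "(nat \<Rightarrow> 'a::field) set \<Rightarrow> ((nat \<Rightarrow> 'a) \<Rightarrow> 'a) \<Rightarrow> (nat \<Rightarrow> 'a) set" where
  "kerin X z = {\<xi> \<in> X. z \<xi> = 0}"

text \<open>For \<open>T\<close> inside \<open>WW p X\<close> this is, by \<open>WW_kerin\<close>,
  the part of \<open>T\<close> that consists of tensors over the hyperplane
  \<open>ker z\<close>.\<close>

definition Tker :: "(nat \<times> nat \<Rightarrow> 'a::field) set \<Rightarrow> ((nat \<Rightarrow> 'a) \<Rightarrow> 'a) \<Rightarrow> (nat \<times> nat \<Rightarrow> 'a) set" where
  "Tker T z = {t \<in> T. contr t z = 0}"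

lemma tensor_add_left: "(x + y) \<Otimes> \<xi> = x \<Otimes> \<xi> + y \<Otimes> \<xi>"
  and tensor_add_right: "x \<Otimes> (\<xi> + \<eta>) = x \<Otimes> \<xi> + x \<Otimes> \<eta>"
  and tensor_diff_left: "(x - y) \<Otimes> \<xi> = x \<Otimes> \<xi> - y \<Otimes> \<xi>"
  and tensor_diff_right: "x \<Otimes> (\<xi> - \<eta>) = x \<Otimes> \<xi> - x \<Otimes> \<eta>"
  and tensor_scl_left: "(c \<star> x) \<Otimes> \<xi> = c \<star> x \<Otimes> \<xi>"
  and tensor_scl_right: "x \<Otimes> (c \<star> \<xi>) = c \<star> x \<Otimes> \<xi>"
  and tensor_zero_left [simp]: "0 \<Otimes> \<xi> = 0"
  and tensor_zero_right [simp]: "x \<Otimes> 0 = 0"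
  and tensor_uminus_left: "(- x) \<Otimes> \<xi> = - (x \<Otimes> \<xi>)"
  and tensor_uminus_right: "x \<Otimes> (- \<xi>) = - (x \<Otimes> \<xi>)"
  by (auto simp: tensor_def fun_eq_iff algebra_simps)

lemma tensor_sum_left: "(\<Sum>i\<in>I. f i) \<Otimes> \<xi> = (\<Sum>i\<in>I. f i \<Otimes> \<xi>)"
  by (auto simp: tensor_def fun_eq_iff sum_fun_apply sum_distrib_right)

lemma tensor_sum_right: "x \<Otimes> (\<Sum>i\<in>I. f i) = (\<Sum>i\<in>I. x \<Otimes> f i)"
  by (auto simp: tensor_def fun_eq_iff sum_fun_apply sum_distrib_left)

lemmas tensor_simps = tensor_add_left tensor_add_right tensor_diff_left tensor_diff_right
  tensor_scl_left tensor_scl_right tensor_uminus_left tensor_uminus_right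

lemma tensor_eq_0: "x \<Otimes> \<xi> = 0 \<longleftrightarrow> x = 0 \<or> \<xi> = 0"
  by (auto simp: tensor_def fun_eq_iff)

lemma col_add [simp]: "col (t + u) j = col t j + col u j"
  and col_diff [simp]: "col (t' - u') j = col t' j - col (u' :: nat \<times> nat \<Rightarrow> 'a::field) j"
  and col_scl [simp]: "col (c \<star> t') j = c \<star> col t' j"
  and col_0 [simp]: "col 0 j = (0 :: nat \<Rightarrow> 'a)"
  and col_tensor [simp]: "col (x \<Otimes> \<xi>) j = x j \<star> \<xi>"
  by (auto simp: col_def fun_eq_iff tensor_def)

lemma contr_tensor: "lin y \<Longrightarrow> contr (x \<Otimes> \<xi>) y = y \<xi> \<star> x"
  by (simp add: contr_def fun_eq_iff lin_scl[of y])

lemma contr_add: "lin y \<Longrightarrow> contr (t + u) y = contr t y + contr u y"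
  and contr_diff: "lin y \<Longrightarrow> contr (t - u) y = contr t y - contr u y"
  and contr_scl: "lin y \<Longrightarrow> contr (c \<star> t) y = c \<star> contr t y"
  and contr_0: "lin y \<Longrightarrow> contr 0 y = 0"
  by (simp_all add: contr_def fun_eq_iff lin_add[of y] lin_diff[of y] lin_scl[of y] lin_0[of y])

lemma contr_sum: "lin y \<Longrightarrow> contr (\<Sum>i\<in>I. f i) y = (\<Sum>i\<in>I. contr (f i) y)"
  by (induction I rule: infinite_finite_induct) (auto simp: contr_0 contr_add)

lemmas contr_simps = contr_tensor contr_add contr_diff contr_scl contr_0 contr_sum

lemma contr_fun_add: "contr t (y + z) = contr t y + contr t z"
  and contr_fun_scl: "contr t' (c \<star> y') = c \<star> contr t' y'"
  by (simp_all add: contr_def fun_eq_iff)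

lemma sub_UU: "sub (UU p)"
  by (auto simp: sub_def UU_def)

lemma sub_WW: "sub X \<Longrightarrow> sub (WW p X)"
  by (auto simp: sub_def WW_def)

lemma contr_UU: "t \<in> WW p X \<Longrightarrow> lin y \<Longrightarrow> contr t y \<in> UU p"
  by (auto simp: WW_def UU_def contr_def lin_0[of y])

lemma tensor_WW: "x \<in> UU p \<Longrightarrow> \<xi> \<in> X \<Longrightarrow> sub X \<Longrightarrow> x \<Otimes> \<xi> \<in> WW p X"
  by (auto simp: WW_def UU_def sub_scl)

lemma lin_rk1: "lin \<phi> \<Longrightarrow> lin y \<Longrightarrow> lin (rk1 \<phi> y)"
  by (rule linI) (simp_all add: rk1_def contr_add contr_scl lin_add[of \<phi>] lin_scl[of \<phi>])

lemma rk1_tensor: "lin \<phi> \<Longrightarrow> lin y \<Longrightarrow> rk1 \<phi> y (x \<Otimes> \<xi>) = y \<xi> * \<phi> x"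
  by (simp add: rk1_def contr_tensor lin_scl[of \<phi>])

lemma rk1_fun_add: "lin \<phi> \<Longrightarrow> rk1 \<phi> (y + z) = rk1 \<phi> y + rk1 \<phi> z"
  and rk1_fun_scl: "lin \<phi> \<Longrightarrow> rk1 \<phi> (c \<star> y) = c \<star> rk1 \<phi> y"
  by (simp_all add: rk1_def fun_eq_iff contr_fun_add contr_fun_scl lin_add[of \<phi>] lin_scl[of \<phi>])

lemma sub_kerin: "sub X \<Longrightarrow> lin z \<Longrightarrow> sub (kerin X z)"
  by (auto simp: sub_def kerin_def lin_add[of z] lin_scl[of z] lin_0[of z])

lemma sub_Tker: "sub T \<Longrightarrow> lin z \<Longrightarrow> sub (Tker T z)"
  by (auto simp: sub_def Tker_def contr_add contr_scl contr_0)

lemma WW_kerin: "t \<in> WW p (kerin X z) \<longleftrightarrow> t \<in> WW p X \<and> contr t z = 0"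
  by (auto simp: WW_def kerin_def contr_def fun_eq_iff)

text \<open>The index set is an arbitrary finite set, so that exchanging a vector or a functional
  keeps the other indices, and dropping an index gives a dual basis of a hyperplane.
  \<open>card I\<close> plays the role of \<open>dim X\<close>.\<close>

definition db :: "nat set \<Rightarrow> (nat \<Rightarrow> 'a::field) set \<Rightarrow> (nat \<Rightarrow> nat \<Rightarrow> 'a) \<Rightarrow> (nat \<Rightarrow> (nat \<Rightarrow> 'a) \<Rightarrow> 'a) \<Rightarrow> bool" where
  "db I X \<xi> y \<longleftrightarrow> finite I \<and> (\<forall>i\<in>I. \<xi> i \<in> X \<and> lin (y i)) \<and>
     (\<forall>i\<in>I. \<forall>j\<in>I. y i (\<xi> j) = (if i = j then 1 else 0)) \<and>
     (\<forall>\<eta>\<in>X. \<eta> = (\<Sum>i\<in>I. y i \<eta> \<star> \<xi> i))"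

lemma db_finite: "db I X \<xi> y \<Longrightarrow> finite I"
  and db_mem: "db I X \<xi> y \<Longrightarrow> i \<in> I \<Longrightarrow> \<xi> i \<in> X"
  and db_lin: "db I X \<xi> y \<Longrightarrow> i \<in> I \<Longrightarrow> lin (y i)"
  and db_dual: "db I X \<xi> y \<Longrightarrow> i \<in> I \<Longrightarrow> j \<in> I \<Longrightarrow> y i (\<xi> j) = (if i = j then 1 else 0)"
  and db_expand: "db I X \<xi> y \<Longrightarrow> \<eta> \<in> X \<Longrightarrow> \<eta> = (\<Sum>i\<in>I. y i \<eta> \<star> \<xi> i)"
  by (auto simp: db_def)

lemma db_nonzero: "db I X \<xi> y \<Longrightarrow> i \<in> I \<Longrightarrow> \<xi> i \<noteq> 0"
  using db_dual[of I X \<xi> y i i] db_lin[of I X \<xi> y i] lin_0[of "y i"] by auto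

lemma db_expand_lin:
  assumes "db I X \<xi> y" "lin z" "\<eta> \<in> X"
  shows "z \<eta> = (\<Sum>i\<in>I. y i \<eta> * z (\<xi> i))"
  using arg_cong[OF db_expand[OF assms(1,3)], of z] by (simp add: lin_sum[OF assms(2)] lin_scl[OF assms(2)])

lemma db_eq_lin:
  assumes "db I X \<xi> y" "lin z" "lin z'" "\<And>i. i \<in> I \<Longrightarrow> z (\<xi> i) = z' (\<xi> i)" "\<eta> \<in> X"
  shows "z \<eta> = z' \<eta>"
  using db_expand_lin[OF assms(1,2,5)] db_expand_lin[OF assms(1,3,5)] assms(4) by simp

lemma db_ex_nonzero:
  assumes "db I X \<xi> y" "lin z" "\<eta> \<in> X" "z \<eta> \<noteq> 0"
  obtains k where "k \<in> I" "z (\<xi> k) \<noteq> 0"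
proof (rule ccontr)
  assume "\<not> thesis"
  then have "z (\<xi> i) = 0 (\<xi> i)" if "i \<in> I" for i
    using that \<open>\<And>k. k \<in> I \<Longrightarrow> z (\<xi> k) \<noteq> 0 \<Longrightarrow> thesis\<close> by auto
  from db_eq_lin[OF assms(1,2) lin_zero this assms(3)] show False using assms(4) by simp
qed

lemma db_ex_coord:
  assumes "db I X \<xi> y" "\<eta> \<in> X" "\<eta> \<noteq> 0"
  obtains k where "k \<in> I" "y k \<eta> \<noteq> 0"
proof (rule ccontr)
  assume "\<not> thesis"
  then have "y i \<eta> = 0" if "i \<in> I" for i using that \<open>\<And>k. k \<in> I \<Longrightarrow> y k \<eta> \<noteq> 0 \<Longrightarrow> thesis\<close> by blast
  then have "(\<Sum>i\<in>I. y i \<eta> \<star> \<xi> i) = 0" by simp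
  then show False using db_expand[OF assms(1,2)] assms(3) by simp
qed

text \<open>Exchange on the side of the functionals: \<open>\<xi> k\<close> is normalised by
  \<open>z\<close> and the other vectors are projected along it into \<open>ker z\<close>. The
  remaining functionals vanish at \<open>\<xi> k\<close> and can be kept.\<close>

lemma db_fun_exchange:
  assumes db: "db I X \<xi> y" and X: "sub X" and k: "k \<in> I" and z: "lin z" and zk: "z (\<xi> k) \<noteq> 0"
  obtains \<xi>' where "db I X \<xi>' (y(k := z))" "\<xi>' k = inverse (z (\<xi> k)) \<star> \<xi> k"
    "\<And>i. i \<noteq> k \<Longrightarrow> \<xi>' i = \<xi> i - z (\<xi> i) \<star> (inverse (z (\<xi> k)) \<star> \<xi> k)"
proof -
  define e where "e = inverse (z (\<xi> k)) \<star> \<xi> k"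
  define \<xi>' where "\<xi>' i = (if i = k then e else \<xi> i - z (\<xi> i) \<star> e)" for i
  have ze: "z e = 1" using zk by (simp add: e_def lin_scl[OF z])
  have eX: "e \<in> X" using sub_scl[OF X] db_mem[OF db k] by (simp add: e_def)
  have ye: "y i e = (if i = k then inverse (z (\<xi> k)) else 0)" if "i \<in> I" for i
    using db_dual[OF db that k] by (simp add: e_def lin_scl[OF db_lin[OF db that]])
  have "db I X \<xi>' (y(k := z))"
    unfolding db_def
  proof (intro conjI ballI)
    show "finite I" using db by (rule db_finite)
  next
    fix i assume i: "i \<in> I"
    show "\<xi>' i \<in> X" using eX db_mem[OF db i] sub_diff[OF X] sub_scl[OF X] by (simp add: \<xi>'_def)
    show "lin ((y(k := z)) i)" using z db_lin[OF db i] by simp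
  next
    fix i j assume i: "i \<in> I" and j: "j \<in> I"
    show "(y(k := z)) i (\<xi>' j) = (if i = j then 1 else 0)"
      using ze ye[OF i] ye[OF j] db_dual[OF db i j] db_dual[OF db j j]
      by (simp add: \<xi>'_def lin_diff[OF z] lin_scl[OF z] lin_diff[OF db_lin[OF db i]] lin_scl[OF db_lin[OF db i]]
          lin_diff[OF db_lin[OF db j]] lin_scl[OF db_lin[OF db j]])
  next
    fix \<eta> assume \<eta>: "\<eta> \<in> X"
    have fin: "finite I" using db by (rule db_finite)
    have "z \<eta> = (\<Sum>i\<in>I. y i \<eta> * z (\<xi> i))" by (rule db_expand_lin[OF db z \<eta>])
    also have "\<dots> = y k \<eta> * z (\<xi> k) + (\<Sum>i\<in>I-{k}. y i \<eta> * z (\<xi> i))"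
      by (rule sum.remove[OF fin k])
    finally have z\<eta>: "z \<eta> = y k \<eta> * z (\<xi> k) + (\<Sum>i\<in>I-{k}. y i \<eta> * z (\<xi> i))" .
    have "(\<Sum>i\<in>I. (y(k := z)) i \<eta> \<star> \<xi>' i) = z \<eta> \<star> e + (\<Sum>i\<in>I-{k}. y i \<eta> \<star> (\<xi> i - z (\<xi> i) \<star> e))"
      by (subst sum.remove[OF fin k]) (auto simp: \<xi>'_def)
    also have "\<dots> = (y k \<eta> * z (\<xi> k)) \<star> e + (\<Sum>i\<in>I-{k}. y i \<eta> \<star> \<xi> i)"
      unfolding z\<eta>
      by (simp add: fun_eq_iff sum_fun_apply algebra_simps sum_subtractf sum_distrib_left sum_distrib_right)
    also have "(y k \<eta> * z (\<xi> k)) \<star> e = y k \<eta> \<star> \<xi> k"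
      using zk by (simp add: e_def fun_eq_iff)
    also have "y k \<eta> \<star> \<xi> k + (\<Sum>i\<in>I-{k}. y i \<eta> \<star> \<xi> i) = (\<Sum>i\<in>I. y i \<eta> \<star> \<xi> i)"
      by (rule sum.remove[OF fin k, symmetric])
    also have "\<dots> = \<eta>" using db_expand[OF db \<eta>] by simp
    finally show "\<eta> = (\<Sum>i\<in>I. (y(k := z)) i \<eta> \<star> \<xi>' i)" by (rule sym)
  qed
  then show thesis using that by (simp add: \<xi>'_def e_def)
qed

text \<open>The dual exchange: the other vectors are kept, and each \<open>y i\<close> is corrected
  by a multiple of the normalised \<open>y k\<close> so as to vanish at
  \<open>\<eta>\<close>.\<close>

lemma db_vec_exchange:
  assumes db: "db I X \<xi> y" and k: "k \<in> I" and \<eta>: "\<eta> \<in> X" and yk: "y k \<eta> \<noteq> 0"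
  obtains y' where "db I X (\<xi>(k := \<eta>)) y'"
proof -
  define z where "z = inverse (y k \<eta>) \<star> y k"
  define y' where "y' i = (if i = k then z else y i - y i \<eta> \<star> z)" for i
  have fin: "finite I" using db by (rule db_finite)
  have z: "lin z" using db_lin[OF db k] by (auto simp: z_def)
  have z\<eta>: "z \<eta> = 1" using yk by (simp add: z_def)
  have "db I X (\<xi>(k := \<eta>)) y'"
    unfolding db_def
  proof (intro conjI ballI)
    fix i assume i: "i \<in> I"
    show "(\<xi>(k := \<eta>)) i \<in> X" using \<eta> db_mem[OF db i] by simp
    show "lin (y' i)" using z db_lin[OF db i] by (auto simp: y'_def)
  next
    fix i j assume i: "i \<in> I" and j: "j \<in> I"
    show "y' i ((\<xi>(k := \<eta>)) j) = (if i = j then 1 else 0)"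
      using z\<eta> db_dual[OF db i j] db_dual[OF db k j] by (auto simp: y'_def z_def)
  next
    fix \<zeta> assume \<zeta>: "\<zeta> \<in> X"
    have "(\<Sum>i\<in>I. y' i \<zeta> \<star> (\<xi>(k := \<eta>)) i) = z \<zeta> \<star> \<eta> + (\<Sum>i\<in>I-{k}. (y i \<zeta> - y i \<eta> * z \<zeta>) \<star> \<xi> i)"
      by (subst sum.remove[OF fin k]) (auto simp: y'_def)
    also have "\<dots> = z \<zeta> \<star> (\<eta> - (\<Sum>i\<in>I-{k}. y i \<eta> \<star> \<xi> i)) + (\<Sum>i\<in>I-{k}. y i \<zeta> \<star> \<xi> i)"
      by (simp add: fun_eq_iff sum_fun_apply algebra_simps sum_subtractf sum_distrib_left)
    also have "\<eta> - (\<Sum>i\<in>I-{k}. y i \<eta> \<star> \<xi> i) = y k \<eta> \<star> \<xi> k"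
      using db_expand[OF db \<eta>] sum.remove[OF fin k, of "\<lambda>i. y i \<eta> \<star> \<xi> i"]
      by (simp add: algebra_simps)
    also have "z \<zeta> \<star> y k \<eta> \<star> \<xi> k = y k \<zeta> \<star> \<xi> k"
      using yk by (simp add: z_def fun_eq_iff)
    also have "y k \<zeta> \<star> \<xi> k + (\<Sum>i\<in>I-{k}. y i \<zeta> \<star> \<xi> i) = (\<Sum>i\<in>I. y i \<zeta> \<star> \<xi> i)"
      by (rule sum.remove[OF fin k, symmetric])
    also have "\<dots> = \<zeta>" using db_expand[OF db \<zeta>] by simp
    finally show "\<zeta> = (\<Sum>i\<in>I. y' i \<zeta> \<star> (\<xi>(k := \<eta>)) i)" by (rule sym)
  qed (fact fin)
  then show thesis using that by blast
qed

lemma db_kerin: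
  assumes db: "db I X \<xi> y" and k: "k \<in> I"
  shows "db (I - {k}) (kerin X (y k)) \<xi> y"
  unfolding db_def
proof (intro conjI ballI)
  show "finite (I - {k})" using db_finite[OF db] by simp
next
  fix i assume i: "i \<in> I - {k}"
  show "\<xi> i \<in> kerin X (y k)" using i db_mem[OF db] db_dual[OF db k] by (simp add: kerin_def)
  show "lin (y i)" using db_lin[OF db] i by simp
next
  fix i j assume "i \<in> I - {k}" "j \<in> I - {k}"
  then show "y i (\<xi> j) = (if i = j then 1 else 0)" using db_dual[OF db] by simp
next
  fix \<eta> assume "\<eta> \<in> kerin X (y k)"
  then show "\<eta> = (\<Sum>i\<in>I - {k}. y i \<eta> \<star> \<xi> i)"
    using db_expand[OF db, of \<eta>] sum.remove[OF db_finite[OF db] k, of "\<lambda>i. y i \<eta> \<star> \<xi> i"]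
    by (simp add: kerin_def)
qed

lemma db_UU: "db {..<p} (UU p) (\<lambda>j i. if j = i then 1 else 0) (\<lambda>j u. u j)"
proof -
  have "(\<Sum>i<p. \<eta> i * (if i = x then 1 else 0)) = \<eta> x" if "\<forall>j\<ge>p. \<eta> j = 0" for \<eta> :: "nat \<Rightarrow> 'a" and x
    using that by (simp add: if_distrib cong: if_cong)
  then show ?thesis by (auto simp: db_def UU_def fun_eq_iff sum_fun_apply)
qed

lemma db_one_vec:
  assumes db: "db I X \<xi> y" and x: "x \<in> X" "x \<noteq> 0"
  obtains k \<xi>' y' where "k \<in> I" "db I X \<xi>' y'" "\<xi>' k = x"
proof -
  obtain k where k: "k \<in> I" "y k x \<noteq> 0" using db_ex_coord[OF db x] .
  obtain y' where "db I X (\<xi>(k := x)) y'" using db_vec_exchange[OF db k(1) x(1) k(2)] .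
  then show thesis using that k(1) by (metis fun_upd_same)
qed

text \<open>After \<open>x1\<close> has been placed, some other coordinate of \<open>x2\<close> is
  nonzero, as otherwise \<open>x2\<close> would be a multiple of \<open>x1\<close>.\<close>

lemma db_two_vec:
  assumes db: "db I X \<xi> y" and x: "x1 \<in> X" "x2 \<in> X" "indep2 x1 x2"
  obtains k1 k2 \<xi>' y' where "k1 \<in> I" "k2 \<in> I" "k1 \<noteq> k2" "db I X \<xi>' y'" "\<xi>' k1 = x1" "\<xi>' k2 = x2"
proof -
  obtain k1 \<xi>1 y1 where 1: "k1 \<in> I" "db I X \<xi>1 y1" "\<xi>1 k1 = x1"
    using db_one_vec[OF db x(1) indep2_nonzero(1)[OF x(3)]] .
  have "\<exists>k2\<in>I-{k1}. y1 k2 x2 \<noteq> 0"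
  proof (rule ccontr)
    assume "\<not> (\<exists>k2\<in>I-{k1}. y1 k2 x2 \<noteq> 0)"
    then have "x2 = y1 k1 x2 \<star> x1"
      using db_expand[OF 1(2) x(2)] sum.remove[OF db_finite[OF db] 1(1), of "\<lambda>i. y1 i x2 \<star> \<xi>1 i"] 1(3) by simp
    then show False using x(3) indep2_iff by blast
  qed
  then obtain k2 where k2: "k2 \<in> I" "k2 \<noteq> k1" "y1 k2 x2 \<noteq> 0" by blast
  obtain y' where "db I X (\<xi>1(k2 := x2)) y'" using db_vec_exchange[OF 1(2) k2(1) x(2) k2(3)] .
  then show thesis using that[of k1 k2 "\<xi>1(k2 := x2)" y'] 1 k2 by auto
qed

lemma db_decompose:
  assumes db: "db I X \<xi> y" and t: "t \<in> WW p X"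
  shows "t = (\<Sum>b\<in>I. contr t (y b) \<Otimes> \<xi> b)"
proof (rule ext)
  fix ji :: "nat \<times> nat"
  obtain j i where ji: "ji = (j, i)" by fastforce
  have "col t j \<in> X" using t by (simp add: WW_def)
  from fun_cong[OF db_expand[OF db this], of i]
  show "t ji = (\<Sum>b\<in>I. contr t (y b) \<Otimes> \<xi> b) ji"
    by (simp add: ji col_def contr_def tensor_def sum_fun_apply)
qed

text \<open>The rank-one tensors generate \<open>WW p X\<close>, by
  \<open>db_decompose\<close>.\<close>

lemma WW_lin_eqI:
  assumes db: "db I X \<xi> y" and t: "t \<in> WW p X" and s: "lin s" "lin s'"
    and eq: "\<And>x \<xi>. x \<in> UU p \<Longrightarrow> \<xi> \<in> X \<Longrightarrow> s (x \<Otimes> \<xi>) = s' (x \<Otimes> \<xi>)"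
  shows "s t = s' t"
proof -
  have "s (\<Sum>b\<in>I. contr t (y b) \<Otimes> \<xi> b) = s' (\<Sum>b\<in>I. contr t (y b) \<Otimes> \<xi> b)"
    unfolding lin_sum[OF s(1)] lin_sum[OF s(2)]
    by (rule sum.cong[OF refl], rule eq) (auto simp: contr_UU[OF t] db_lin[OF db] db_mem[OF db])
  then show ?thesis using db_decompose[OF db t] by simp
qed

lemma lin_ex_nonzero:
  assumes "u \<noteq> (0 :: 'i \<Rightarrow> 'a::field)"
  obtains z where "lin z" "z u = 1"
  using Ann_separates[of "{0}" u] assms by (auto simp: sub_def Ann_def)

section \<open>Upper bounds for dimensions\<close>

definition indf :: "'k set \<Rightarrow> ('k \<Rightarrow> 'i \<Rightarrow> 'a::field) \<Rightarrow> bool" where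
  "indf J t \<longleftrightarrow> (\<forall>c. (\<Sum>j\<in>J. c j \<star> t j) = 0 \<longrightarrow> (\<forall>j\<in>J. c j = 0))"

text \<open>The counting arguments work with upper bounds and their negations, so no dimension
  function is introduced. The bound is tested on independent families indexed by natural numbers;
  \<open>dimleD\<close> extends it to all index types.\<close>

definition dimle :: "('i \<Rightarrow> 'a::field) set \<Rightarrow> nat \<Rightarrow> bool" where
  "dimle T d \<longleftrightarrow> (\<forall>J t. finite (J :: nat set) \<and> (\<forall>j\<in>J. t j \<in> T) \<and> indf J t \<longrightarrow> card J \<le> d)"

lemma indfD: "indf J t \<Longrightarrow> (\<Sum>j\<in>J. c j \<star> t j) = 0 \<Longrightarrow> j \<in> J \<Longrightarrow> c j = 0"
  by (simp add: indf_def)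

lemma indfI: "(\<And>c j. (\<Sum>j\<in>J. c j \<star> t j) = 0 \<Longrightarrow> j \<in> J \<Longrightarrow> c j = 0) \<Longrightarrow> indf J t"
  by (simp add: indf_def)

lemma indf_reindex:
  assumes "bij_betw h J' J" "indf J t"
  shows "indf J' (t \<circ> h)"
proof (rule indfI)
  fix c j assume c: "(\<Sum>j\<in>J'. c j \<star> (t \<circ> h) j) = 0" and j: "j \<in> J'"
  define g where "g = the_inv_into J' h"
  have inj: "inj_on h J'" and im: "h ` J' = J" using assms(1) by (auto simp: bij_betw_def)
  have gh: "g (h i) = i" if "i \<in> J'" for i using that inj by (simp add: g_def the_inv_into_f_f)
  have "(\<Sum>j\<in>J. c (g j) \<star> t j) = (\<Sum>j\<in>J'. c (g (h j)) \<star> t (h j))"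
    using sum.reindex_bij_betw[OF assms(1), of "\<lambda>j. c (g j) \<star> t j"] by simp
  also have "\<dots> = 0" using c gh by (simp cong: sum.cong)
  finally have "c (g (h j)) = 0" using indfD[OF assms(2), of "\<lambda>j. c (g j)" "h j"] im j by blast
  then show "c j = 0" using gh j by simp
qed

lemma dimleD:
  assumes "dimle T d" "finite J" "\<And>j. j \<in> J \<Longrightarrow> t j \<in> T" "indf J t"
  shows "card J \<le> d"
proof -
  obtain h where h: "bij_betw h {0..<card J} J" using ex_bij_betw_nat_finite[OF assms(2)] by blast
  have "\<forall>i\<in>{0..<card J}. (t \<circ> h) i \<in> T" using h assms(3) by (auto simp: bij_betw_def)
  then show ?thesis using assms(1) indf_reindex[OF h assms(4)] unfolding dimle_def
    by (metis card_atLeastLessThan diff_zero finite_atLeastLessThan)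
qed

lemma dimleI: "(\<And>J t. finite (J :: nat set) \<Longrightarrow> (\<And>j. j \<in> J \<Longrightarrow> t j \<in> T) \<Longrightarrow> indf J t \<Longrightarrow> card J \<le> d) \<Longrightarrow> dimle T d"
  by (auto simp: dimle_def)

lemma dimle_mono: "dimle T d \<Longrightarrow> T' \<subseteq> T \<Longrightarrow> d \<le> d' \<Longrightarrow> dimle T' d'"
  unfolding dimle_def by (meson order_trans subsetD)

lemma indf_single: "t \<noteq> 0 \<Longrightarrow> indf {k} (\<lambda>_. t)"
  by (auto simp: indf_def)

lemma dimle_0: "dimle T 0 \<Longrightarrow> t \<in> T \<Longrightarrow> t = 0"
  using dimleD[of T 0 "{0::nat}" "\<lambda>_. t"] indf_single[of t] by fastforce

text \<open>A vector of \<open>T\<close> outside \<open>T'\<close> extends every independent family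
  of \<open>T'\<close>. The dimension counts below are made of such single drops.\<close>

lemma dimle_drop:
  assumes dT: "dimle T (Suc d)" and sub: "sub T'" "T' \<subseteq> T" and w: "w \<in> T" "w \<notin> T'"
  shows "dimle T' d"
proof (rule dimleI)
  fix J :: "nat set" and t
  assume J: "finite J" "\<And>j. j \<in> J \<Longrightarrow> t j \<in> T'" "indf J t"
  obtain n where n: "n \<notin> J" using J(1) ex_new_if_finite infinite_UNIV_nat by blast
  have "indf (insert n J) (t(n := w))"
  proof (rule indfI)
    fix c j assume c: "(\<Sum>j\<in>insert n J. c j \<star> (t(n := w)) j) = 0" and j: "j \<in> insert n J"
    have "(\<Sum>j\<in>J. c j \<star> (t(n := w)) j) = (\<Sum>j\<in>J. c j \<star> t j)"
      using n by (intro sum.cong) auto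
    then have eq: "c n \<star> w + (\<Sum>j\<in>J. c j \<star> t j) = 0" using c n J(1) by simp
    have mem: "(\<Sum>j\<in>J. c j \<star> t j) \<in> T'" by (intro sub_sum sub_scl sub(1) J(2))
    have cn: "c n = 0"
    proof (rule ccontr)
      assume cn: "c n \<noteq> 0"
      have "c n \<star> w = - (\<Sum>j\<in>J. c j \<star> t j)" using eq by (simp add: eq_neg_iff_add_eq_0)
      then have "inverse (c n) \<star> (c n \<star> w) = inverse (c n) \<star> (- (\<Sum>j\<in>J. c j \<star> t j))" by (rule arg_cong)
      then have "w = inverse (c n) \<star> (- (\<Sum>j\<in>J. c j \<star> t j))" by (simp only: fs.scale_scale left_inverse[OF cn] fs.scale_one)
      then show False using w(2) sub_scl[OF sub(1) sub_uminus[OF sub(1) mem]] by metis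
    qed
    then show "c j = 0" using eq indfD[OF J(3), of c j] j by auto
  qed
  moreover have "(t(n := w)) j \<in> T" if "j \<in> insert n J" for j
    using that J(2) w(1) sub(2) by auto
  ultimately have "card (insert n J) \<le> Suc d"
    using dimleD[OF dT, of "insert n J" "t(n := w)"] J(1) by blast
  then show "card J \<le> d" using n J(1) by simp
qed

text \<open>An independent family is injective and has an independent image, so the exchange bound
  for sets applies.\<close>

lemma dimle_span:
  fixes g :: "'k \<Rightarrow> 'i \<Rightarrow> 'a::field"
  assumes "finite I" "\<And>w. w \<in> T \<Longrightarrow> \<exists>c. w = (\<Sum>i\<in>I. c i \<star> g i)"
  shows "dimle T (card I)"
proof (rule dimleI)
  fix J :: "nat set" and t
  assume J: "finite J" "\<And>j. j \<in> J \<Longrightarrow> t j \<in> T" "indf J t"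
  have inj: "inj_on t J"
  proof (rule inj_onI, rule ccontr)
    fix i j assume ij: "i \<in> J" "j \<in> J" "t i = t j" "i \<noteq> j"
    have "(\<Sum>l\<in>J. ((if l = i then 1 else 0) - (if l = j then 1 else 0)) \<star> t l) = t i - t j"
      using J(1) ij by (simp add: fs.scale_left_diff_distrib sum_subtractf if_distrib[where f = "\<lambda>c. c \<star> _"] cong: if_cong)
    then show False using indfD[OF J(3), of "\<lambda>l. (if l = i then 1 else 0) - (if l = j then 1 else 0)" i] ij by auto
  qed
  have "fs.independent (t ` J)"
  proof (rule fs.independent_if_scalars_zero)
    fix f x assume f: "(\<Sum>x\<in>t ` J. f x \<star> x) = 0" and x: "x \<in> t ` J"
    then have "(\<Sum>j\<in>J. f (t j) \<star> t j) = 0" by (simp add: sum.reindex[OF inj])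
    then show "f x = 0" using indfD[OF J(3), of "\<lambda>j. f (t j)"] x by blast
  qed (use J(1) in simp)
  moreover have "t ` J \<subseteq> fs.span (g ` I)"
  proof
    fix w assume "w \<in> t ` J"
    then obtain c where "w = (\<Sum>i\<in>I. c i \<star> g i)" using J(2) assms(2) by (metis imageE)
    moreover have "(\<Sum>i\<in>I. c i \<star> g i) \<in> fs.span (g ` I)" for c
      by (intro fs.span_sum fs.span_scale fs.span_base imageI)
    ultimately show "w \<in> fs.span (g ` I)" by simp
  qed
  ultimately have "card (t ` J) \<le> card (g ` I)" using fs.independent_span_bound assms(1) by blast
  then show "card J \<le> card I" using card_image[OF inj] card_image_le[OF assms(1), of g] by simp
qed

lemma sub_spanned: "sub {(\<Sum>j\<in>J. c j \<star> t j) | c. True}"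
  unfolding sub_def
proof (intro conjI ballI allI)
  show "0 \<in> {(\<Sum>j\<in>J. c j \<star> t j) |c. True}" by (auto intro!: exI[of _ "\<lambda>_. 0"])
next
  fix u v assume "u \<in> {(\<Sum>j\<in>J. c j \<star> t j) |c. True}" "v \<in> {(\<Sum>j\<in>J. c j \<star> t j) |c. True}"
  then obtain c d where "u = (\<Sum>j\<in>J. c j \<star> t j)" "v = (\<Sum>j\<in>J. d j \<star> t j)" by blast
  then have "u + v = (\<Sum>j\<in>J. (c j + d j) \<star> t j)" by (simp add: fs.scale_left_distrib sum.distrib)
  then show "u + v \<in> {(\<Sum>j\<in>J. c j \<star> t j) |c. True}"
    unfolding mem_Collect_eq by (intro exI[of _ "\<lambda>j. c j + d j"] conjI TrueI)
next
  fix a u assume "u \<in> {(\<Sum>j\<in>J. c j \<star> t j) |c. True}"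
  then obtain c where "u = (\<Sum>j\<in>J. c j \<star> t j)" by blast
  then have "a \<star> u = (\<Sum>j\<in>J. (a * c j) \<star> t j)" by (simp add: fs.scale_sum_right)
  then show "a \<star> u \<in> {(\<Sum>j\<in>J. c j \<star> t j) |c. True}"
    unfolding mem_Collect_eq by (intro exI[of _ "\<lambda>j. a * c j"] conjI TrueI)
qed

text \<open>If \<open>w\<close> were outside the span, \<open>dimle_drop\<close> would bound the
  dimension of the span by \<open>d - 1\<close>, although it contains the \<open>d\<close> vectors
  of the family.\<close>

lemma dimle_spanned:
  assumes dT: "dimle T d" and sub: "sub T" and J: "finite J" "\<And>j. j \<in> J \<Longrightarrow> t j \<in> T" "indf J t" "card J = d"
    and w: "w \<in> T"
  obtains c where "w = (\<Sum>j\<in>J. c j \<star> t j)"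
proof -
  let ?S = "{(\<Sum>j\<in>J. c j \<star> t j) | c. True}"
  have ST: "?S \<subseteq> T" using sub_sum[OF sub, of J] sub_scl[OF sub] J(2) by auto
  have tS: "t j \<in> ?S" if "j \<in> J" for j
    using J(1) that by (auto intro!: exI[of _ "\<lambda>i. if i = j then 1 else 0"] simp: if_distrib[where f = "\<lambda>c. c \<star> _"] cong: if_cong)
  have "w \<in> ?S"
  proof (rule ccontr)
    assume nw: "w \<notin> ?S"
    show False
    proof (cases d)
      case 0
      then show False using dimle_0[of T w] dT w nw sub_0[OF sub_spanned[where J = J and t = t]] by simp
    next
      case (Suc d')
      have "dimle ?S d'" using dimle_drop[OF _ sub_spanned ST w nw] dT Suc by blast
      from dimleD[OF this J(1) tS J(3)] show False using J(4) Suc by simp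
    qed
  qed
  then show thesis using that by blast
qed

subsection \<open>Range-restricting maps on spaces of functionals\<close>

lemma lin_proportional:
  assumes X: "sub X" and f: "lin f" and y: "lin y" and van: "\<And>\<xi>. \<xi> \<in> X \<Longrightarrow> y \<xi> = 0 \<Longrightarrow> f \<xi> = 0"
  obtains c where "\<And>\<xi>. \<xi> \<in> X \<Longrightarrow> f \<xi> = c * y \<xi>"
proof (cases "\<forall>\<xi>\<in>X. y \<xi> = 0")
  case True
  then show thesis using that[of 0] van by simp
next
  case False
  then obtain \<eta> where \<eta>: "\<eta> \<in> X" "y \<eta> \<noteq> 0" by blast
  have "f \<xi> = (f \<eta> / y \<eta>) * y \<xi>" if \<xi>: "\<xi> \<in> X" for \<xi>
  proof -
    let ?d = "y \<xi> / y \<eta>"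
    have "\<xi> - ?d \<star> \<eta> \<in> X" using \<xi> \<eta>(1) sub_diff[OF X] sub_scl[OF X] by blast
    moreover have "y (\<xi> - ?d \<star> \<eta>) = 0" using \<eta>(2) by (simp add: lin_diff[OF y] lin_scl[OF y])
    ultimately have "f (\<xi> - ?d \<star> \<eta>) = 0" using van by blast
    then show ?thesis by (simp add: lin_diff[OF f] lin_scl[OF f])
  qed
  then show thesis using that by blast
qed

lemma lin_proportional2:
  fixes X :: "(nat \<Rightarrow> 'a::field) set"
  assumes X: "sub X" and f: "lin f" and y: "lin y1" "lin y2"
    and van: "\<And>\<xi>. \<xi> \<in> X \<Longrightarrow> y1 \<xi> = 0 \<Longrightarrow> y2 \<xi> = 0 \<Longrightarrow> f \<xi> = 0"
  obtains a b where "\<And>\<xi>. \<xi> \<in> X \<Longrightarrow> f \<xi> = a * y1 \<xi> + b * y2 \<xi>"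
proof -
  have K: "sub (kerin X y1)" using sub_kerin[OF X y(1)] .
  obtain b where b: "\<And>\<xi>. \<xi> \<in> kerin X y1 \<Longrightarrow> f \<xi> = b * y2 \<xi>"
    using lin_proportional[OF K f y(2)] van by (auto simp: kerin_def)
  have "lin (f - b \<star> y2)" using f y by blast
  moreover have "\<And>\<xi>. \<xi> \<in> X \<Longrightarrow> y1 \<xi> = 0 \<Longrightarrow> (f - b \<star> y2) \<xi> = 0" using b by (simp add: kerin_def)
  ultimately obtain a where "\<And>\<xi>. \<xi> \<in> X \<Longrightarrow> (f - b \<star> y2) \<xi> = a * y1 \<xi>"
    using lin_proportional[OF X _ y(1)] by metis
  then have "f \<xi> = a * y1 \<xi> + b * y2 \<xi>" if "\<xi> \<in> X" for \<xi> using that by (simp add: algebra_simps)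
  then show thesis using that by blast
qed

text \<open>Independence of the restrictions to \<open>X\<close>; the functionals themselves live on
  a larger space.\<close>

definition indX :: "(nat \<Rightarrow> 'a::field) set \<Rightarrow> ((nat \<Rightarrow> 'a) \<Rightarrow> 'a) \<Rightarrow> ((nat \<Rightarrow> 'a) \<Rightarrow> 'a) \<Rightarrow> bool" where
  "indX X v w \<longleftrightarrow> (\<forall>a b. (\<forall>\<xi>\<in>X. a * v \<xi> + b * w \<xi> = 0) \<longrightarrow> a = 0 \<and> b = 0)"

lemma indXD: "indX X v w \<Longrightarrow> (\<And>\<xi>. \<xi> \<in> X \<Longrightarrow> a * v \<xi> + b * w \<xi> = 0) \<Longrightarrow> a = 0 \<and> b = 0"
  unfolding indX_def by blast

lemma not_indX:
  assumes "\<not> indX X v w" "\<xi>0 \<in> X" "v \<xi>0 \<noteq> 0"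
  obtains c where "\<And>\<xi>. \<xi> \<in> X \<Longrightarrow> w \<xi> = c * v \<xi>"
proof -
  obtain a b where ab: "\<forall>\<xi>\<in>X. a * v \<xi> + b * w \<xi> = 0" "a \<noteq> 0 \<or> b \<noteq> 0"
    using assms(1) by (auto simp: indX_def)
  have b: "b \<noteq> 0" using ab assms(2,3) by auto
  have "w \<xi> = (- a / b) * v \<xi>" if "\<xi> \<in> X" for \<xi>
    using bspec[OF ab(1) that] b by (simp add: field_simps add_eq_0_iff)
  then show thesis using that by blast
qed

lemma indX_db:
  assumes db: "db I X \<xi> y" and ij: "i \<in> I" "j \<in> I" "i \<noteq> j"
  shows "indX X (y i) (y j)"
  unfolding indX_def
proof (intro allI impI)
  fix a b assume h: "\<forall>\<eta>\<in>X. a * y i \<eta> + b * y j \<eta> = 0"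
  show "a = 0 \<and> b = 0"
    using bspec[OF h db_mem[OF db ij(1)]] bspec[OF h db_mem[OF db ij(2)]] ij
    by (simp add: db_dual[OF db])
qed

text \<open>Comparing \<open>g (v + w)\<close> with \<open>g v + g w\<close> for independent
  \<open>v\<close>, \<open>w\<close> shows that their scalars agree. Dimension at least two is
  essential: on a line \<open>g\<close> may follow any additive function of the scalar, which is the
  source of Type 1.\<close>

lemma additive_scalar:
  assumes P: "sub P"
    and g: "\<forall>v\<in>P. \<exists>c. \<forall>\<xi>\<in>X. g v \<xi> = c * v \<xi>"
    and add: "\<forall>v\<in>P. \<forall>w\<in>P. \<forall>\<xi>\<in>X. g (v + w) \<xi> = g v \<xi> + g w \<xi>"
    and v12: "v1 \<in> P" "v2 \<in> P" "indX X v1 v2"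
  shows "\<exists>c. \<forall>v\<in>P. \<forall>\<xi>\<in>X. g v \<xi> = c * v \<xi>"
proof -
  obtain c where c: "\<And>v. v \<in> P \<Longrightarrow> \<forall>\<xi>\<in>X. g v \<xi> = c v * v \<xi>" using g by metis
  have eq: "c v = c w" if v: "v \<in> P" and w: "w \<in> P" and i: "indX X v w" for v w
  proof -
    have "(c (v + w) - c v) * v \<xi> + (c (v + w) - c w) * w \<xi> = 0" if "\<xi> \<in> X" for \<xi>
    proof -
      have "c (v + w) * (v \<xi> + w \<xi>) = c v * v \<xi> + c w * w \<xi>"
        using c[OF sub_add[OF P v w]] c[OF v] c[OF w] add v w that by simp
      then show ?thesis by (simp add: algebra_simps)
    qed
    from indXD[OF i this] show ?thesis by (metis right_minus_eq)
  qed
  have ex1: "\<exists>\<xi>\<in>X. v1 \<xi> \<noteq> 0" using indXD[OF v12(3), of 1 0] by auto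
  have "g v \<xi> = c v1 * v \<xi>" if v: "v \<in> P" and \<xi>: "\<xi> \<in> X" for v \<xi>
  proof (cases "indX X v1 v")
    case True
    then show ?thesis using eq[OF v12(1) v] c[OF v] \<xi> by simp
  next
    case False
    obtain d where d: "\<And>\<xi>. \<xi> \<in> X \<Longrightarrow> v \<xi> = d * v1 \<xi>" using not_indX[OF False] ex1 by metis
    show ?thesis
    proof (cases "d = 0")
      case True
      then show ?thesis using c[OF v] d \<xi> by simp
    next
      case False
      \<comment> \<open>A nonzero multiple of \<open>v1\<close> cannot be compared with
        \<open>v1\<close> itself, but it can with \<open>v2\<close>.\<close>
      have "indX X v v2"
        unfolding indX_def
      proof (intro allI impI)
        fix a b assume "\<forall>\<xi>\<in>X. a * v \<xi> + b * v2 \<xi> = 0"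
        then have "\<And>\<xi>. \<xi> \<in> X \<Longrightarrow> (a * d) * v1 \<xi> + b * v2 \<xi> = 0" using d by (simp add: mult.assoc)
        from indXD[OF v12(3) this] show "a = 0 \<and> b = 0" using False by simp
      qed
      then have "c v = c v1" using eq[OF v v12(2)] eq[OF v12] by simp
      then show ?thesis using c[OF v] \<xi> by simp
    qed
  qed
  then show ?thesis by blast
qed

definition linm :: "((nat \<Rightarrow> 'a::field) \<Rightarrow> nat \<Rightarrow> 'a) \<Rightarrow> bool" where
  "linm J \<longleftrightarrow> (\<forall>u v. J (u + v) = J u + J v) \<and> (\<forall>c u. J (c \<star> u) = c \<star> J u)"

lemma linm_add: "linm J \<Longrightarrow> J (u + v) = J u + J v"
  and linm_scl: "linm J \<Longrightarrow> J (c \<star> u) = c \<star> J u"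
  by (auto simp: linm_def)

lemma linm_0: "linm J \<Longrightarrow> J 0 = 0"
  using linm_scl[of J 0 0] by simp

text \<open>For \<open>X = UU n\<close>, \<open>localF\<close> says that the column of \<open>F\<close> is \<open>M \<mapsto> M x\<close>.\<close>

definition localF :: "nat \<Rightarrow> (nat \<Rightarrow> 'a::field) set \<Rightarrow> (nat \<times> nat \<Rightarrow> 'a) set \<Rightarrow>
    (((nat \<times> nat \<Rightarrow> 'a) \<Rightarrow> 'a) \<Rightarrow> (nat \<Rightarrow> 'a) \<Rightarrow> 'a) \<Rightarrow> bool" where
  "localF p X T F \<longleftrightarrow> (\<exists>x\<in>UU p. \<forall>s\<in>Ann T. \<forall>\<xi>\<in>X. F s \<xi> = s (x \<Otimes> \<xi>))"

text \<open>A linear map is homogeneous in the matrix argument. The outcome of Type 1 is stated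
  together with the negation of this property, so that one induction serves both assertions of the
  theorem.\<close>

definition homogF :: "(nat \<Rightarrow> 'a::field) set \<Rightarrow> (nat \<times> nat \<Rightarrow> 'a) set \<Rightarrow>
    (((nat \<times> nat \<Rightarrow> 'a) \<Rightarrow> 'a) \<Rightarrow> (nat \<Rightarrow> 'a) \<Rightarrow> 'a) \<Rightarrow> bool" where
  "homogF X T F \<longleftrightarrow> (\<forall>c. \<forall>s\<in>Ann T. \<forall>\<xi>\<in>X. F (c \<star> s) \<xi> = c * F s \<xi>)"

text \<open>Read as functionals of \<open>\<xi>\<close>, the vectors \<open>M x\<close> are those
  vanishing wherever \<open>x \<Otimes> \<xi> \<in> T\<close>; the condition says that they fill
  exactly the line of \<open>z\<close>.\<close>

definition type1F :: "nat \<Rightarrow> (nat \<Rightarrow> 'a::field) set \<Rightarrow> (nat \<times> nat \<Rightarrow> 'a) set \<Rightarrow> bool" where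
  "type1F p X T \<longleftrightarrow> (\<exists>x\<in>UU p. \<exists>z. lin z \<and> (\<exists>\<xi>\<in>X. z \<xi> \<noteq> 0) \<and> (\<forall>\<xi>\<in>X. x \<Otimes> \<xi> \<in> T \<longleftrightarrow> z \<xi> = 0))"

text \<open>Semilinearity with respect to the inverse of squaring, as for the square root on a
  perfect field of characteristic 2. Replacing \<open>c\<close> by \<open>1 + c\<close> shows that
  such an \<open>\<alpha>\<close> is zero when \<open>2 \<noteq> 0\<close>.\<close>

definition rootlin :: "('a::field \<Rightarrow> 'a) \<Rightarrow> bool" where
  "rootlin \<alpha> \<longleftrightarrow> (\<forall>a b. \<alpha> (a + b) = \<alpha> a + \<alpha> b) \<and> (\<forall>a c. \<alpha> (c * c * a) = c * \<alpha> a)"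

text \<open>The exceptional additive maps of characteristic 2.\<close>

definition formC :: "nat \<Rightarrow> (nat \<Rightarrow> 'a::field) set \<Rightarrow> (nat \<times> nat \<Rightarrow> 'a) set \<Rightarrow>
    (((nat \<times> nat \<Rightarrow> 'a) \<Rightarrow> 'a) \<Rightarrow> (nat \<Rightarrow> 'a) \<Rightarrow> 'a) \<Rightarrow>
    (nat \<Rightarrow> 'a) \<Rightarrow> ((nat \<Rightarrow> 'a) \<Rightarrow> nat \<Rightarrow> 'a) \<Rightarrow> ('a \<Rightarrow> 'a) \<Rightarrow> bool" where
  "formC p X T F x J \<alpha> \<longleftrightarrow> x \<in> UU p \<and> linm J \<and> (\<forall>\<xi>\<in>X. J \<xi> \<in> UU p) \<and> rootlin \<alpha> \<and> (\<exists>a. \<alpha> a \<noteq> 0) \<and>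
     (\<forall>s\<in>Ann T. \<forall>\<xi>\<in>X. F s \<xi> = s (x \<Otimes> \<xi>) + \<alpha> (s (J \<xi> \<Otimes> \<xi>)))"

definition typeC :: "nat \<Rightarrow> (nat \<Rightarrow> 'a::field) set \<Rightarrow> (nat \<times> nat \<Rightarrow> 'a) set \<Rightarrow>
    (((nat \<times> nat \<Rightarrow> 'a) \<Rightarrow> 'a) \<Rightarrow> (nat \<Rightarrow> 'a) \<Rightarrow> 'a) \<Rightarrow> bool" where
  "typeC p X T F \<longleftrightarrow> (2 :: 'a) = 0 \<and> (\<exists>x J \<alpha>. formC p X T F x J \<alpha>)"

text \<open>\<open>rc\<close> is range restriction read through left kernels: the range of
  \<open>F(M)\<close> lies in that of \<open>M\<close> iff every row vector killing \<open>M\<close>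
  kills \<open>F(M)\<close>. Nothing is assumed about \<open>F\<close> outside
  \<open>Ann T\<close>.\<close>

locale rcs =
  fixes p :: nat and X :: "(nat \<Rightarrow> 'a::field) set" and T :: "(nat \<times> nat \<Rightarrow> 'a) set"
    and F :: "((nat \<times> nat \<Rightarrow> 'a) \<Rightarrow> 'a) \<Rightarrow> (nat \<Rightarrow> 'a) \<Rightarrow> 'a"
  assumes X: "sub X" and T: "sub T" and TW: "T \<subseteq> WW p X"
    and linF: "s \<in> Ann T \<Longrightarrow> lin (F s)"
    and addF: "s \<in> Ann T \<Longrightarrow> s' \<in> Ann T \<Longrightarrow> \<xi> \<in> X \<Longrightarrow> F (s + s') \<xi> = F s \<xi> + F s' \<xi>"
    and rc: "s \<in> Ann T \<Longrightarrow> \<xi> \<in> X \<Longrightarrow> (\<And>x. x \<in> UU p \<Longrightarrow> s (x \<Otimes> \<xi>) = 0) \<Longrightarrow> F s \<xi> = 0"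
begin

lemmas Ann_intros = sub_intros[OF sub_Ann]

lemma F_diff: "s \<in> Ann T \<Longrightarrow> s' \<in> Ann T \<Longrightarrow> \<xi> \<in> X \<Longrightarrow> F (s - s') \<xi> = F s \<xi> - F s' \<xi>"
  using addF[of "s - s'" s' \<xi>] sub_diff[OF sub_Ann, of s T s'] by simp

lemma F_0: "\<xi> \<in> X \<Longrightarrow> F 0 \<xi> = 0"
  by (rule rc[OF sub_0[OF sub_Ann]]) simp_all

lemma F_sum:
  assumes "\<And>i. i \<in> A \<Longrightarrow> f i \<in> Ann T" "\<xi> \<in> X"
  shows "F (\<Sum>i\<in>A. f i) \<xi> = (\<Sum>i\<in>A. F (f i) \<xi>)"
  using assms(1)
proof (induction A rule: infinite_finite_induct)
  case (insert a A)
  have "F (f a + (\<Sum>i\<in>A. f i)) \<xi> = F (f a) \<xi> + F (\<Sum>i\<in>A. f i) \<xi>"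
    by (rule addF) (use insert assms(2) in \<open>auto intro!: Ann_intros\<close>)
  moreover have "F (sum f A) \<xi> = (\<Sum>i\<in>A. F (f i) \<xi>)" using insert by blast
  ultimately show ?case by (simp only: sum.insert[OF insert(1,2)])
qed (simp_all only: sum.infinite sum.empty F_0[OF assms(2)] not_False_eq_True)

text \<open>Apply \<open>rc\<close> to the difference: \<open>F s \<xi>\<close> depends only on the
  row \<open>x \<mapsto> s (x \<Otimes> \<xi>)\<close>. Hence values of \<open>s\<close> away from
  such tensors are harmless.\<close>

lemma F_cong:
  assumes "s \<in> Ann T" "s' \<in> Ann T" "\<xi> \<in> X" "\<And>x. x \<in> UU p \<Longrightarrow> s (x \<Otimes> \<xi>) = s' (x \<Otimes> \<xi>)"
  shows "F s \<xi> = F s' \<xi>"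
proof -
  have "F (s - s') \<xi> = 0"
    by (rule rc) (use assms in \<open>auto intro: Ann_intros\<close>)
  then show ?thesis using F_diff[OF assms(1,2,3)] by simp
qed

text \<open>The range of a rank-one matrix is a line, so its value under \<open>F\<close> is a
  multiple of the same column.\<close>

lemma F_rank1:
  assumes "rk1 \<phi> v \<in> Ann T" "lin \<phi>" "lin v"
  shows "\<exists>c. \<forall>\<xi>\<in>X. F (rk1 \<phi> v) \<xi> = c * v \<xi>"
proof -
  have "F (rk1 \<phi> v) \<xi> = 0" if "\<xi> \<in> X" "v \<xi> = 0" for \<xi>
    by (rule rc[OF assms(1) that(1)]) (simp add: rk1_tensor assms(2,3) that(2))
  from lin_proportional[OF X linF[OF assms(1)] assms(3) this] show ?thesis by metis
qed

text \<open>Extend \<open>s'\<close> from the tensors over \<open>ker z\<close> by zero on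
  \<open>T\<close>; the two spaces meet in \<open>Tker T z\<close>, where \<open>s'\<close>
  vanishes.\<close>

lemma Ann_lift:
  assumes z: "lin z" and s': "s' \<in> Ann (Tker T z)"
  shows "\<exists>s\<in>Ann T. \<forall>t\<in>WW p (kerin X z). s t = s' t"
proof -
  have "s' w = 0" if "w \<in> WW p (kerin X z)" "w \<in> T" for w
    using that AnnD(2)[OF s'] by (auto simp: Tker_def WW_kerin)
  from lin_extend[OF sub_WW[OF sub_kerin[OF X z]] T AnnD(1)[OF s'] this]
  show ?thesis by (metis AnnI)
qed

lemma Ann_Tker: "Ann T \<subseteq> Ann (Tker T z)"
  by (auto simp: Ann_def Tker_def)

text \<open>A functional annihilating \<open>Tker T z\<close> is evaluated through an arbitrarily
  chosen lift to \<open>Ann T\<close>. By \<open>F_cong\<close> the result on \<open>ker z\<close>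
  does not depend on the lift, so additivity passes to \<open>G\<close>. The last clause returns the
  lift, from which homogeneity is transferred later.\<close>

lemma restrict:
  assumes z: "lin z"
  obtains G where "rcs p (kerin X z) (Tker T z) G"
    "\<And>s \<xi>. s \<in> Ann T \<Longrightarrow> \<xi> \<in> kerin X z \<Longrightarrow> G s \<xi> = F s \<xi>"
    "\<And>s'. s' \<in> Ann (Tker T z) \<Longrightarrow> \<exists>s\<in>Ann T. (\<forall>t\<in>WW p (kerin X z). s t = s' t) \<and> (\<forall>\<xi>\<in>kerin X z. G s' \<xi> = F s \<xi>)"
proof -
  let ?K = "kerin X z"
  obtain h where h: "\<And>s'. s' \<in> Ann (Tker T z) \<Longrightarrow> h s' \<in> Ann T \<and> (\<forall>t\<in>WW p ?K. h s' t = s' t)"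
    using Ann_lift[OF z] by metis
  define G where "G s' = F (h s')" for s'
  have K: "sub ?K" by (rule sub_kerin[OF X z])
  have KX: "\<xi> \<in> X" if "\<xi> \<in> ?K" for \<xi> using that by (simp add: kerin_def)
  have hten: "h s' (x \<Otimes> \<xi>) = s' (x \<Otimes> \<xi>)" if "s' \<in> Ann (Tker T z)" "x \<in> UU p" "\<xi> \<in> ?K" for s' x \<xi>
    using h[OF that(1)] tensor_WW[OF that(2,3) K] by blast
  have "rcs p ?K (Tker T z) G"
  proof
    show "Tker T z \<subseteq> WW p ?K" using TW by (auto simp: Tker_def WW_kerin)
    fix s assume s: "s \<in> Ann (Tker T z)"
    show "lin (G s)" using linF h[OF s] by (simp add: G_def)
    fix \<xi> assume \<xi>: "\<xi> \<in> ?K"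
    { fix s' assume s': "s' \<in> Ann (Tker T z)"
      have ss: "s + s' \<in> Ann (Tker T z)" using sub_add[OF sub_Ann s s'] .
      have "F (h (s + s')) \<xi> = F (h s + h s') \<xi>"
        by (rule F_cong) (use h[OF s] h[OF s'] h[OF ss] KX[OF \<xi>] hten[OF s _ \<xi>] hten[OF s' _ \<xi>] hten[OF ss _ \<xi>]
            in \<open>auto intro: Ann_intros\<close>)
      then show "G (s + s') \<xi> = G s \<xi> + G s' \<xi>"
        using addF h[OF s] h[OF s'] KX[OF \<xi>] by (simp add: G_def) }
    assume "\<And>x. x \<in> UU p \<Longrightarrow> s (x \<Otimes> \<xi>) = 0"
    then show "G s \<xi> = 0" unfolding G_def
      using rc[of "h s" \<xi>] h[OF s] hten[OF s _ \<xi>] KX[OF \<xi>] by simp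
  qed (use K sub_Tker[OF T z] in auto)
  moreover have "G s \<xi> = F s \<xi>" if s: "s \<in> Ann T" and \<xi>: "\<xi> \<in> ?K" for s \<xi>
  proof -
    have s': "s \<in> Ann (Tker T z)" using Ann_Tker s by blast
    show ?thesis unfolding G_def
      by (rule F_cong) (use h[OF s'] s KX[OF \<xi>] hten[OF s' _ \<xi>] in auto)
  qed
  moreover have "\<exists>s\<in>Ann T. (\<forall>t\<in>WW p ?K. s t = s' t) \<and> (\<forall>\<xi>\<in>?K. G s' \<xi> = F s \<xi>)"
    if "s' \<in> Ann (Tker T z)" for s'
    using h[OF that] by (auto simp: G_def)
  ultimately show thesis using that by blast
qed

lemma subtract:
  assumes "x0 \<in> UU p"
  shows "rcs p X T (\<lambda>s \<xi>. F s \<xi> - s (x0 \<Otimes> \<xi>))"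
proof
  fix s assume s: "s \<in> Ann T"
  show "lin (\<lambda>\<xi>. F s \<xi> - s (x0 \<Otimes> \<xi>))"
    using linF[OF s] AnnD(1)[OF s]
    by (intro linI) (simp_all add: lin_add[of "F s"] lin_scl[of "F s"] tensor_simps lin_add[of s] lin_scl[of s] algebra_simps)
qed (use X T TW addF rc assms in auto)

lemma Ann_expand:
  assumes "db {..<p} (UU p) x \<phi>" "lin s" "u \<in> UU p"
  shows "s (u \<Otimes> \<xi>) = (\<Sum>k<p. \<phi> k u * s (x k \<Otimes> \<xi>))"
proof -
  have "u \<Otimes> \<xi> = (\<Sum>k<p. \<phi> k u \<star> x k \<Otimes> \<xi>)"
    using db_expand[OF assms(1,3)] by (metis (no_types, lifting) sum.cong tensor_scl_left tensor_sum_left)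
  then show ?thesis by (simp add: lin_sum[OF assms(2)] lin_scl[OF assms(2)])
qed

lemma lin_row: "lin s \<Longrightarrow> lin (\<lambda>\<xi>. s (u \<Otimes> \<xi>))"
  by (rule linI) (simp_all add: tensor_simps lin_add[of s] lin_scl[of s])

text \<open>A column whose entries are unconstrained by \<open>T\<close> is evaluated by \<open>F\<close> through a scalar.\<close>

lemma split_columns:
  assumes db: "db I X \<xi> y" "2 \<le> card I" and dbU: "db {..<p} (UU p) x \<phi>" and R: "R \<subseteq> {..<p}"
    and free: "\<forall>k\<in>{..<p} - R. \<forall>t\<in>T. \<forall>v. lin v \<longrightarrow> \<phi> k (contr t v) = 0"
  shows "\<exists>x0\<in>UU p. (\<forall>r\<in>R. \<phi> r x0 = 0) \<and>
    (\<forall>s\<in>Ann T. (\<Sum>r\<in>R. rk1 (\<phi> r) (\<lambda>\<xi>. s (x r \<Otimes> \<xi>))) \<in> Ann T \<and>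
       (\<forall>\<xi>\<in>X. F s \<xi> = s (x0 \<Otimes> \<xi>) + F (\<Sum>r\<in>R. rk1 (\<phi> r) (\<lambda>\<xi>. s (x r \<Otimes> \<xi>))) \<xi>))"
proof -
  have finR: "finite R" using R finite_subset by blast
  let ?N = "{..<p} - R"
  obtain i j where ij: "i \<in> I" "j \<in> I" "i \<noteq> j"
    using db(2) card_le_Suc0_iff_eq[OF db_finite[OF db(1)]] by fastforce
  have lin\<phi>: "lin (\<phi> k)" if "k < p" for k using db_lin[OF dbU] that by simp
  have mem: "rk1 (\<phi> k) v \<in> Ann T" if "k \<in> ?N" "lin v" for k v
    using that free lin_rk1[OF lin\<phi>, of k v] by (auto simp: Ann_def rk1_def)
  \<comment> \<open>A rank-one functional in a free column kills \<open>T\<close> whatever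
    \<open>v\<close> is, so \<open>additive_scalar\<close> applies to all linear \<open>v\<close>;
    \<open>2 \<le> card I\<close> supplies two independent ones.\<close>
  have "\<exists>c. \<forall>v \<xi>. lin v \<longrightarrow> \<xi> \<in> X \<longrightarrow> F (rk1 (\<phi> k) v) \<xi> = c * v \<xi>" if k: "k \<in> ?N" for k
  proof -
    have subP: "sub {v :: (nat \<Rightarrow> 'a) \<Rightarrow> 'a. lin v}" by (auto simp: sub_def)
    have g: "\<forall>v\<in>{v. lin v}. \<exists>c. \<forall>\<xi>\<in>X. F (rk1 (\<phi> k) v) \<xi> = c * v \<xi>"
      using F_rank1[OF mem[OF k] lin\<phi>] k by simp
    have a: "\<forall>v\<in>{v. lin v}. \<forall>w\<in>{v. lin v}. \<forall>\<xi>\<in>X.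
        F (rk1 (\<phi> k) (v + w)) \<xi> = F (rk1 (\<phi> k) v) \<xi> + F (rk1 (\<phi> k) w) \<xi>"
      using addF[OF mem[OF k] mem[OF k]] k lin\<phi> by (simp add: rk1_fun_add)
    have y: "y i \<in> {v. lin v}" "y j \<in> {v. lin v}" using db_lin[OF db(1)] ij by auto
    show ?thesis
      using additive_scalar[OF subP g a y indX_db[OF db(1) ij]] by blast
  qed
  then obtain c where c: "\<And>k v \<xi>. k \<in> ?N \<Longrightarrow> lin v \<Longrightarrow> \<xi> \<in> X \<Longrightarrow> F (rk1 (\<phi> k) v) \<xi> = c k * v \<xi>"
    by metis
  \<comment> \<open>The scalars found in the free columns are the coordinates of the
    multiplier.\<close>
  define x0 where "x0 = (\<Sum>k\<in>?N. c k \<star> x k)"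
  have x0: "x0 \<in> UU p" unfolding x0_def by (intro sub_sum sub_scl sub_UU db_mem[OF dbU]) auto
  have \<phi>x0: "\<phi> k x0 = (if k \<in> ?N then c k else 0)" if k: "k < p" for k
  proof -
    have "\<phi> k x0 = (\<Sum>l\<in>?N. c l * (if k = l then 1 else 0))"
      unfolding x0_def lin_sum[OF lin\<phi>[OF k]] lin_scl[OF lin\<phi>[OF k]]
      using db_dual[OF dbU, of k] k by (intro sum.cong) auto
    then show ?thesis by (simp add: if_distrib cong: if_cong)
  qed
  have main: "(\<Sum>r\<in>R. rk1 (\<phi> r) (\<lambda>\<xi>. s (x r \<Otimes> \<xi>))) \<in> Ann T \<and>
       (\<forall>\<xi>\<in>X. F s \<xi> = s (x0 \<Otimes> \<xi>) + F (\<Sum>r\<in>R. rk1 (\<phi> r) (\<lambda>\<xi>. s (x r \<Otimes> \<xi>))) \<xi>)" if s: "s \<in> Ann T" for s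
  proof -
    define f where "f k = rk1 (\<phi> k) (\<lambda>\<xi>. s (x k \<Otimes> \<xi>))" for k
    have row: "lin (\<lambda>\<xi>. s (x k \<Otimes> \<xi>))" for k using lin_row[OF AnnD(1)[OF s]] .
    have linf: "lin (f k)" if "k < p" for k unfolding f_def using lin_rk1[OF lin\<phi>[OF that] row] .
    have fN: "(\<Sum>k\<in>?N. f k) \<in> Ann T"
      unfolding f_def by (intro sub_sum sub_Ann mem row)
    have ften: "f k (u \<Otimes> \<zeta>) = s (x k \<Otimes> \<zeta>) * \<phi> k u" if "k < p" for k u \<zeta>
      unfolding f_def by (rule rk1_tensor[OF lin\<phi>[OF that] row])
    have split: "(\<Sum>k<p. f k) = (\<Sum>k\<in>R. f k) + (\<Sum>k\<in>?N. f k)"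
      using R finR by (metis add.commute finite_lessThan sum.subset_diff)
    have tot: "s (u \<Otimes> \<zeta>) = (\<Sum>k<p. f k) (u \<Otimes> \<zeta>)" if "u \<in> UU p" for u \<zeta>
      unfolding sum_fun_apply using ften Ann_expand[OF dbU AnnD(1)[OF s] that, of \<zeta>]
      by (simp add: mult.commute)
    have "(\<Sum>k<p. f k) \<in> Ann T"
    proof (rule AnnI)
      show l: "lin (\<Sum>k<p. f k)" using linf by (intro lin_setsum) auto
      fix t assume t: "t \<in> T"
      have "s t = (\<Sum>k<p. f k) t"
        by (rule WW_lin_eqI[OF db(1) _ AnnD(1)[OF s] l tot]) (use t TW in auto)
      then show "(\<Sum>k<p. f k) t = 0" using AnnD(2)[OF s t] by simp
    qed
    from sub_diff[OF sub_Ann this fN] have fR: "(\<Sum>k\<in>R. f k) \<in> Ann T" using split by simp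
    have "F s \<xi> = s (x0 \<Otimes> \<xi>) + F (\<Sum>r\<in>R. f r) \<xi>" if \<xi>: "\<xi> \<in> X" for \<xi>
    proof -
      have "F s \<xi> = F ((\<Sum>k\<in>R. f k) + (\<Sum>k\<in>?N. f k)) \<xi>"
        by (rule F_cong[OF s _ \<xi>]) (use tot split fR fN in \<open>auto intro: Ann_intros\<close>)
      also have "\<dots> = F (\<Sum>k\<in>R. f k) \<xi> + F (\<Sum>k\<in>?N. f k) \<xi>" by (rule addF[OF fR fN \<xi>])
      also have "F (\<Sum>k\<in>?N. f k) \<xi> = (\<Sum>k\<in>?N. F (f k) \<xi>)"
        by (rule F_sum[OF _ \<xi>]) (simp add: f_def mem row)
      also have "\<dots> = (\<Sum>k\<in>?N. \<phi> k x0 * s (x k \<Otimes> \<xi>))"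
        by (rule sum.cong) (simp_all add: f_def c[OF _ row \<xi>] \<phi>x0)
      also have "\<dots> = (\<Sum>k<p. \<phi> k x0 * s (x k \<Otimes> \<xi>))"
        by (rule sum.mono_neutral_left) (auto simp: \<phi>x0)
      also have "\<dots> = s (x0 \<Otimes> \<xi>)" using Ann_expand[OF dbU AnnD(1)[OF s] x0] by simp
      finally show ?thesis by simp
    qed
    then show ?thesis using fR unfolding f_def by blast
  qed
  show ?thesis
  proof (intro bexI[OF _ x0] conjI)
    show "\<forall>r\<in>R. \<phi> r x0 = 0" using \<phi>x0 R by auto
  qed (use main in blast)
qed

lemma local_if_T_trivial:
  assumes db: "db I X \<xi> y" "2 \<le> card I" and "\<And>t. t \<in> T \<Longrightarrow> t = 0"
  shows "localF p X T F"
proof -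
  have "contr t v = 0" if "t \<in> T" "lin v" for t v using assms(3)[OF that(1)] contr_0[OF that(2)] by simp
  then have free: "\<forall>k\<in>{..<p} - {}. \<forall>t\<in>T. \<forall>v. lin v \<longrightarrow> (contr t v) k = 0" by simp
  show ?thesis
    using split_columns[OF db db_UU empty_subsetI free] by (auto simp: localF_def F_0)
qed

text \<open>After the free columns are split off, \<open>F\<close> acts on a single column
  \<open>v\<close> ranging over the space \<open>P\<close> of functionals that vanish where
  \<open>u \<Otimes> \<xi>\<close> lies in \<open>T\<close>. If \<open>P\<close> has dimension at
  least two on \<open>X\<close>, \<open>additive_scalar\<close> applies; if it is zero there,
  nothing remains; if it is a line, this is Type 1, and a homogeneous map is still given by a
  scalar.\<close>

lemma one_column:
  assumes db: "db I X \<xi> y" "2 \<le> card I" and u: "u \<in> UU p" "u \<noteq> 0"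
    and Tu: "\<And>t. t \<in> T \<Longrightarrow> \<exists>\<eta>\<in>X. t = u \<Otimes> \<eta>"
  shows "localF p X T F \<or> \<not> homogF X T F \<and> type1F p X T \<and> (\<exists>\<eta>\<in>X. u \<Otimes> \<eta> \<notin> T)"
proof -
  obtain k x \<phi> where k: "k < p" and dbU: "db {..<p} (UU p) x \<phi>" and xk: "x k = u"
    using db_one_vec[OF db_UU u] by (metis lessThan_iff)
  have lin\<phi>: "lin (\<phi> l)" if "l < p" for l using db_lin[OF dbU] that by simp
  have "\<phi> l (contr t v) = 0" if l: "l \<in> {..<p} - {k}" and t: "t \<in> T" and v: "lin v" for l t v
  proof -
    obtain \<eta> where \<eta>: "t = u \<Otimes> \<eta>" using Tu[OF t] by blast
    show ?thesis using db_dual[OF dbU, of l k] l k xk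
      by (simp add: \<eta> contr_tensor[OF v] lin_scl[OF lin\<phi>])
  qed
  then have free: "\<forall>l\<in>{..<p} - {k}. \<forall>t\<in>T. \<forall>v. lin v \<longrightarrow> \<phi> l (contr t v) = 0" by blast
  have Rk: "{k} \<subseteq> {..<p}" using k by simp
  obtain x0 where x0: "x0 \<in> UU p"
    and Fs0: "\<forall>s\<in>Ann T. (\<Sum>r\<in>{k}. rk1 (\<phi> r) (\<lambda>\<xi>. s (x r \<Otimes> \<xi>))) \<in> Ann T \<and>
       (\<forall>\<xi>\<in>X. F s \<xi> = s (x0 \<Otimes> \<xi>) + F (\<Sum>r\<in>{k}. rk1 (\<phi> r) (\<lambda>\<xi>. s (x r \<Otimes> \<xi>))) \<xi>)"
    using split_columns[OF db dbU Rk free] by blast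
  have Fs: "F s \<xi> = s (x0 \<Otimes> \<xi>) + F (rk1 (\<phi> k) (\<lambda>\<xi>. s (u \<Otimes> \<xi>))) \<xi>" if "s \<in> Ann T" "\<xi> \<in> X" for s \<xi>
    using Fs0 that xk by simp
  define P where "P = {v. lin v \<and> (\<forall>\<xi>\<in>X. u \<Otimes> \<xi> \<in> T \<longrightarrow> v \<xi> = 0)}"
  have subP: "sub P" by (auto simp: P_def sub_def)
  have row: "(\<lambda>\<xi>. s (u \<Otimes> \<xi>)) \<in> P" if "s \<in> Ann T" for s
    using lin_row[OF AnnD(1)[OF that]] AnnD(2)[OF that] by (auto simp: P_def)
  have memP: "rk1 (\<phi> k) v \<in> Ann T" if v: "v \<in> P" for v
  proof (rule AnnI)
    show "lin (rk1 (\<phi> k) v)" using v lin_rk1[OF lin\<phi>[OF k]] by (simp add: P_def)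
    fix t assume t: "t \<in> T"
    obtain \<eta> where \<eta>: "\<eta> \<in> X" "t = u \<Otimes> \<eta>" using Tu[OF t] by blast
    then show "rk1 (\<phi> k) v t = 0" using v t rk1_tensor[OF lin\<phi>[OF k], of v u \<eta>] by (auto simp: P_def)
  qed
  define g where "g v = F (rk1 (\<phi> k) v)" for v
  have gP: "\<exists>c. \<forall>\<xi>\<in>X. g v \<xi> = c * v \<xi>" if "v \<in> P" for v
    unfolding g_def using F_rank1[OF memP[OF that] lin\<phi>[OF k]] that by (simp add: P_def)
  have gadd: "g (v + w) \<xi> = g v \<xi> + g w \<xi>" if "v \<in> P" "w \<in> P" "\<xi> \<in> X" for v w \<xi>
    unfolding g_def using addF[OF memP[OF that(1)] memP[OF that(2)] that(3)] by (simp add: rk1_fun_add[OF lin\<phi>[OF k]])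
  have loc: "localF p X T F" if c: "\<And>v \<xi>. v \<in> P \<Longrightarrow> \<xi> \<in> X \<Longrightarrow> g v \<xi> = c * v \<xi>" for c
    unfolding localF_def
  proof (intro bexI ballI)
    fix s \<xi> assume s: "s \<in> Ann T" and \<xi>: "\<xi> \<in> X"
    show "F s \<xi> = s ((x0 + c \<star> u) \<Otimes> \<xi>)"
      using Fs[OF s \<xi>] c[OF row[OF s] \<xi>] AnnD(1)[OF s]
      by (simp add: g_def tensor_simps lin_add[of s] lin_scl[of s])
  qed (use x0 u sub_add[OF sub_UU] sub_scl[OF sub_UU] in blast)
  consider (two) v w where "v \<in> P" "w \<in> P" "indX X v w"
    | (none) "\<forall>v\<in>P. \<forall>\<xi>\<in>X. v \<xi> = 0"
    | (one) v0 \<xi>0 where "v0 \<in> P" "\<xi>0 \<in> X" "v0 \<xi>0 \<noteq> 0" "\<And>w. w \<in> P \<Longrightarrow> \<not> indX X v0 w"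
    by blast
  then show ?thesis
  proof cases
    case two
    show ?thesis using additive_scalar[OF subP _ _ two, of g] gP gadd loc by blast
  next
    case none
    then have "g v \<xi> = 0 * v \<xi>" if "v \<in> P" "\<xi> \<in> X" for v \<xi> using gP[OF that(1)] that by fastforce
    then show ?thesis using loc by blast
  next
    case one
    have par: "\<exists>c. \<forall>\<xi>\<in>X. w \<xi> = c * v0 \<xi>" if "w \<in> P" for w
      using not_indX[OF one(4)[OF that] one(2,3)] by metis
    have t1: "type1F p X T"
      unfolding type1F_def
    proof (intro bexI exI conjI ballI)
      show "lin v0" using one(1) by (simp add: P_def)
      show "v0 \<xi>0 \<noteq> 0" "\<xi>0 \<in> X" "u \<in> UU p" using one u by auto
      fix \<xi> assume \<xi>: "\<xi> \<in> X"
      show "u \<Otimes> \<xi> \<in> T \<longleftrightarrow> v0 \<xi> = 0"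
      proof
        show "u \<Otimes> \<xi> \<in> T \<Longrightarrow> v0 \<xi> = 0" using one(1) \<xi> by (auto simp: P_def)
        assume v0: "v0 \<xi> = 0"
        show "u \<Otimes> \<xi> \<in> T"
        proof (rule mem_if_Ann_vanishes[OF T])
          fix s assume "s \<in> Ann T"
          then show "s (u \<Otimes> \<xi>) = 0" using par[OF row] \<xi> v0 by fastforce
        qed
      qed
    qed
    have "localF p X T F" if hom: "homogF X T F"
    proof -
      obtain c where c: "\<forall>\<xi>\<in>X. g v0 \<xi> = c * v0 \<xi>" using gP[OF one(1)] by blast
      have "g w \<xi> = c * w \<xi>" if w: "w \<in> P" and \<xi>: "\<xi> \<in> X" for w \<xi>
      proof -
        obtain d where d: "\<forall>\<xi>\<in>X. w \<xi> = d * v0 \<xi>" using par[OF w] by blast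
        have "g w \<xi> = F (d \<star> rk1 (\<phi> k) v0) \<xi>"
          unfolding g_def
          by (rule F_cong[OF memP[OF w] _ \<xi>])
            (use memP[OF one(1)] d \<xi> one(1) w in \<open>auto intro: Ann_intros simp: rk1_tensor[OF lin\<phi>[OF k]] P_def\<close>)
        also have "\<dots> = d * g v0 \<xi>" using hom memP[OF one(1)] \<xi> by (simp add: homogF_def g_def)
        finally show ?thesis using c d \<xi> by simp
      qed
      then show ?thesis using loc by blast
    qed
    moreover have "u \<Otimes> \<xi>0 \<notin> T" using one(1-3) by (auto simp: P_def)
    ultimately show ?thesis using t1 one(2) by blast
  qed
qed

end

subsection \<open>The two-dimensional case\<close>

text \<open>The equation is range restriction at the singular symmetric matrix with diagonal
  \<open>a\<close>, \<open>b * b / a\<close> and off-diagonal entry \<open>b\<close>. If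
  \<open>2 \<noteq> 0\<close>, replacing \<open>b\<close> by \<open>- b\<close> separates even and
  odd parts. In characteristic 2 squaring is additive, which makes \<open>b * h b\<close> and
  \<open>b * k b\<close> additive in \<open>b\<close> and so \<open>h\<close> and \<open>k\<close>
  linear; the common deviation of \<open>f\<close> and \<open>g\<close> from linearity is
  \<open>\<alpha>\<close>.\<close>

lemma sym2_functional_equation:
  fixes f g h k :: "'a::field \<Rightarrow> 'a"
  assumes f: "\<And>a b. f (a + b) = f a + f b" and g: "\<And>a b. g (a + b) = g a + g b"
    and h: "\<And>a b. h (a + b) = h a + h b" and k: "\<And>a b. k (a + b) = k a + k b"
    and eq: "\<And>a b. a \<noteq> 0 \<Longrightarrow> a * (k b + g (b * b / a)) = b * (f a + h b)"
  shows "\<exists>l m \<alpha>. rootlin \<alpha> \<and> ((2::'a) \<noteq> 0 \<longrightarrow> (\<forall>a. \<alpha> a = 0)) \<and>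
    (\<forall>a. f a = l * a + \<alpha> a) \<and> (\<forall>a. g a = m * a + \<alpha> a) \<and> (\<forall>a. h a = m * a) \<and> (\<forall>a. k a = l * a)"
proof -
  have f0: "f 0 = 0" using f[of 0 0] by (metis add.right_neutral add_left_cancel)
  have g0: "g 0 = 0" using g[of 0 0] by (metis add.right_neutral add_left_cancel)
  have h0: "h 0 = 0" using h[of 0 0] by (metis add.right_neutral add_left_cancel)
  have k0: "k 0 = 0" using k[of 0 0] by (metis add.right_neutral add_left_cancel)
  have hm: "h (- b) = - h b" for b using h[of b "- b"] h0 by (simp add: eq_neg_iff_add_eq_0 add.commute)
  have km: "k (- b) = - k b" for b using k[of b "- b"] k0 by (simp add: eq_neg_iff_add_eq_0 add.commute)
  show ?thesis
  proof (cases "(2::'a) = 0")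
    case False
    have e1: "a * g (b * b / a) = b * h b" if a: "a \<noteq> 0" for a b
    proof -
      have "a * (- k b + g (b * b / a)) = - b * (f a - h b)"
        using eq[OF a, of "- b"] by (simp add: hm km)
      then have "a * (- k b + g (b * b / a)) + a * (k b + g (b * b / a)) = - b * (f a - h b) + b * (f a + h b)"
        using eq[OF a, of b] by (simp only:)
      then have "2 * (a * g (b * b / a)) = 2 * (b * h b)"
        by (simp add: algebra_simps)
      then show ?thesis using False by simp
    qed
    have e2: "a * k b = b * f a" if a: "a \<noteq> 0" for a b
      using eq[OF a, of b] e1[OF a, of b] by (simp add: algebra_simps)
    have fl: "f a = k 1 * a" for a using e2[of a 1] f0 by (cases "a = 0") (auto simp: mult.commute)
    have kl: "k b = k 1 * b" for b using e2[of 1 b] fl[of 1] by (simp add: mult.commute)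
    have hl: "h b = g 1 * b" for b
      using e1[of "b * b" b] h0 by (cases "b = 0") (auto simp: mult.commute mult.assoc)
    have gl: "g c = g 1 * c" for c
      using e1[of c c] hl[of c] g0 by (cases "c = 0") auto
    have "rootlin (\<lambda>_. 0 :: 'a)" by (simp add: rootlin_def)
    moreover obtain l m where "l = k 1" "m = g 1" by blast
    then have "\<forall>a. f a = l * a + 0" "\<forall>a. g a = m * a + 0" "\<forall>a. h a = m * a" "\<forall>a. k a = l * a"
      unfolding add_0_right using fl kl hl gl by metis+
    ultimately show ?thesis by (intro exI[of _ l] exI[of _ m] exI[of _ "\<lambda>_. 0"]) blast
  next
    case True
    have two: "x + x = 0" for x :: 'a using True by (metis mult_2 mult_zero_left)
    have neg: "- x = x" for x :: 'a using two[of x] by (metis neg_eq_iff_add_eq_0)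
    have sq: "(b + c) * (b + c) = b * b + c * c" for b c :: 'a
      using two[of "b * c"] by (simp add: algebra_simps)
    \<comment> \<open>The case \<open>a = 1\<close>. The right-hand side is additive in
      \<open>b\<close>, which is exploited at \<open>1 + c\<close>.\<close>
    have hb: "b * h b = k b + g (b * b) + b * f 1" for b
      using eq[of 1 b] two[of "b * f 1"] by (simp add: algebra_simps)
    have hl: "h c = h 1 * c" for c
    proof -
      have "(1 + c) * h (1 + c) = 1 * h 1 + c * h c"
        unfolding hb sq by (simp add: k g algebra_simps)
      then have "h c + c * h 1 = 0" by (simp add: h algebra_simps)
      then show ?thesis by (metis add_eq_0_iff neg mult.commute)
    qed
    \<comment> \<open>The case \<open>a = b * b\<close>, with the same purpose for
      \<open>k\<close>.\<close>
    have kb: "b * k b = f (b * b) + h b + b * g 1" for b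
    proof (cases "b = 0")
      case False
      then have "b * (b * (k b + g 1)) = b * (f (b * b) + h b)" using eq[of "b * b" b] by (simp add: mult.assoc)
      then have "b * (k b + g 1) = f (b * b) + h b" using False by simp
      then have "b * k b = f (b * b) + h b + - (b * g 1)" by (simp add: algebra_simps)
      then show ?thesis by (simp only: neg)
    qed (simp add: f0 h0)
    have kl: "k c = k 1 * c" for c
    proof -
      have "(1 + c) * k (1 + c) = 1 * k 1 + c * k c"
        unfolding kb sq by (simp add: f h algebra_simps)
      then have "k c + c * k 1 = 0" by (simp add: k algebra_simps)
      then show ?thesis by (metis add_eq_0_iff neg mult.commute)
    qed
    define \<alpha> where "\<alpha> a = f a - k 1 * a" for a
    have fa: "f a = k 1 * a + \<alpha> a" for a by (simp add: \<alpha>_def)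
    have \<alpha>0: "\<alpha> 0 = 0" by (simp add: \<alpha>_def f0)
    \<comment> \<open>The case \<open>a = b\<close> ties \<open>g\<close> to \<open>f\<close>;
      further below the case \<open>b = c * a\<close> yields the square-root law of
      \<open>\<alpha>\<close>.\<close>
    have ga: "g b = h 1 * b + \<alpha> b" for b
    proof (cases "b = 0")
      case False
      then have "k b + g b = f b + h b" using eq[of b b] by simp
      then have "g b = k 1 * b + (k 1 * b + \<alpha> b + h 1 * b)" using kl[of b] hl[of b] fa[of b] two[of "k 1 * b"]
        by (metis add.assoc add.left_neutral)
      then show ?thesis using two[of "k 1 * b"] by (metis add.assoc add.commute add.left_neutral)
    qed (simp add: g0 \<alpha>0)
    have "\<alpha> (c * c * a) = c * \<alpha> a" for a c
    proof (cases "a = 0")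
      case False
      have "a * (k (c * a) + g (c * a * (c * a) / a)) = c * a * (f a + h (c * a))" by (rule eq[OF False])
      moreover have "c * a * (c * a) / a = c * c * a" using False by (simp add: field_simps)
      ultimately have "a * (k 1 * (c * a) + (h 1 * (c * c * a) + \<alpha> (c * c * a))) = a * (c * (k 1 * a + \<alpha> a + h 1 * (c * a)))"
        using kl[of "c * a"] hl[of "c * a"] ga[of "c * c * a"] fa[of a] by (simp add: mult.left_commute mult.assoc)
      then have "k 1 * (c * a) + (h 1 * (c * c * a) + \<alpha> (c * c * a)) = c * (k 1 * a + \<alpha> a + h 1 * (c * a))"
        using False by simp
      then show ?thesis by (simp add: algebra_simps)
    qed (simp add: \<alpha>0)
    moreover have "\<alpha> (a + b) = \<alpha> a + \<alpha> b" for a b by (simp add: \<alpha>_def f algebra_simps)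
    ultimately have "rootlin \<alpha>" by (simp add: rootlin_def)
    then show ?thesis using True fa ga hl kl by blast
  qed
qed

lemma linm_lincomb: "lin f \<Longrightarrow> lin g \<Longrightarrow> linm (\<lambda>\<xi>. f \<xi> \<star> u + g \<xi> \<star> v)"
  by (simp add: linm_def fun_eq_iff lin_add[of f] lin_scl[of f] lin_add[of g] lin_scl[of g] algebra_simps)

context rcs
begin

text \<open>Only the columns along \<open>ua\<close> and \<open>ub\<close> are constrained, and
  there killing \<open>\<tau>\<close> means being a symmetric 2 x 2 matrix up to sign and order of
  the columns. Range restriction at the singular ones is the functional equation above.\<close>

lemma base_rank_two:
  assumes ab: "a \<noteq> b" and db: "db {a, b} X \<xi> y" and \<tau>: "\<tau> \<in> T" and T\<tau>: "\<And>t. t \<in> T \<Longrightarrow> \<exists>c. t = c \<star> \<tau>"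
    and ind: "indep2 (contr \<tau> (y a)) (contr \<tau> (y b))"
  shows "localF p X T F \<or> typeC p X T F"
proof -
  define ua where "ua = contr \<tau> (y a)"
  define ub where "ub = contr \<tau> (y b)"
  have card: "2 \<le> card {a, b}" using ab by simp
  have ya: "lin (y a)" and yb: "lin (y b)" using db_lin[OF db] by auto
  have \<xi>a: "\<xi> a \<in> X" and \<xi>b: "\<xi> b \<in> X" using db_mem[OF db] by auto
  have dual: "y a (\<xi> a) = 1" "y a (\<xi> b) = 0" "y b (\<xi> a) = 0" "y b (\<xi> b) = 1"
    using db_dual[OF db] ab by auto
  have uaU: "ua \<in> UU p" and ubU: "ub \<in> UU p"
    unfolding ua_def ub_def using contr_UU[of \<tau> p X] \<tau> TW ya yb by auto
  have \<tau>eq: "\<tau> = ua \<Otimes> \<xi> a + ub \<Otimes> \<xi> b"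
    using db_decompose[OF db, of \<tau> p] \<tau> TW ab by (auto simp: ua_def ub_def)
  obtain k1 k2 x \<phi> where k: "k1 \<in> {..<p}" "k2 \<in> {..<p}" "k1 \<noteq> k2" and dbU: "db {..<p} (UU p) x \<phi>"
    and x: "x k1 = ua" "x k2 = ub"
    using db_two_vec[OF db_UU uaU ubU] ind unfolding ua_def ub_def by blast
  have lin1: "lin (\<phi> k1)" and lin2: "lin (\<phi> k2)" using db_lin[OF dbU] k by auto
  have \<phi>: "\<phi> k1 ua = 1" "\<phi> k1 ub = 0" "\<phi> k2 ua = 0" "\<phi> k2 ub = 1"
    using db_dual[OF dbU] k x by (metis, metis, metis, metis)
  have free: "\<forall>l\<in>{..<p} - {k1, k2}. \<forall>t\<in>T. \<forall>v. lin v \<longrightarrow> \<phi> l (contr t v) = 0"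
  proof (intro ballI allI impI)
    fix l t and v :: "(nat \<Rightarrow> 'a) \<Rightarrow> 'a"
    assume l: "l \<in> {..<p} - {k1, k2}" and t: "t \<in> T" and v: "lin v"
    have ll: "lin (\<phi> l)" using db_lin[OF dbU] l by simp
    have "\<phi> l ua = 0" "\<phi> l ub = 0" using db_dual[OF dbU, of l k1] db_dual[OF dbU, of l k2] l k x by auto
    moreover obtain c where "t = c \<star> \<tau>" using T\<tau>[OF t] by blast
    ultimately show "\<phi> l (contr t v) = 0"
      by (simp add: \<tau>eq contr_simps[OF v] lin_simps[OF ll])
  qed
  have R: "{k1, k2} \<subseteq> {..<p}" using k by simp
  obtain x0 where x0: "x0 \<in> UU p"
    and Fs0: "\<forall>s\<in>Ann T. (\<Sum>r\<in>{k1,k2}. rk1 (\<phi> r) (\<lambda>\<xi>. s (x r \<Otimes> \<xi>))) \<in> Ann T \<and>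
       (\<forall>\<xi>\<in>X. F s \<xi> = s (x0 \<Otimes> \<xi>) + F (\<Sum>r\<in>{k1,k2}. rk1 (\<phi> r) (\<lambda>\<xi>. s (x r \<Otimes> \<xi>))) \<xi>)"
    using split_columns[OF db card dbU R free] by blast
  \<comment> \<open>The values of \<open>S A B D\<close> are \<open>B\<close>, \<open>D\<close> at
    \<open>ua \<Otimes> \<xi> a\<close>, \<open>ua \<Otimes> \<xi> b\<close> and \<open>- A\<close>,
    \<open>- B\<close> at \<open>ub \<Otimes> \<xi> a\<close>, \<open>ub \<Otimes> \<xi> b\<close>;
    the two entries \<open>B\<close> cancel on \<open>\<tau>\<close>.\<close>
  define S where "S A B D = rk1 (\<phi> k1) (B \<star> y a + D \<star> y b) - rk1 (\<phi> k2) (A \<star> y a + B \<star> y b)" for A B D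
  have lins: "lin (B \<star> y a + D \<star> y b)" for B D using ya yb by blast
  have S: "S A B D \<in> Ann T" for A B D
  proof (rule AnnI)
    show l: "lin (S A B D)" unfolding S_def by (intro lin_minus lin_rk1 lin1 lin2 lins)
    fix t assume "t \<in> T"
    then obtain c where "t = c \<star> \<tau>" using T\<tau> by blast
    moreover have "S A B D \<tau> = 0"
      unfolding S_def rk1_def minus_fun_apply contr_fun_add contr_fun_scl ua_def[symmetric] ub_def[symmetric]
      by (simp add: lin_simps[OF lin1] lin_simps[OF lin2] \<phi>)
    ultimately show "S A B D t = 0" by (simp add: lin_scl[OF l])
  qed
  have Sten: "S A B D (u \<Otimes> \<eta>) = (B * y a \<eta> + D * y b \<eta>) * \<phi> k1 u - (A * y a \<eta> + B * y b \<eta>) * \<phi> k2 u" for A B D u \<eta>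
    unfolding S_def by (simp add: rk1_tensor[OF lin1 lins] rk1_tensor[OF lin2 lins])
  have Sadd: "S A B D + S A' B' D' = S (A + A') (B + B') (D + D')" for A B D A' B' D'
    unfolding S_def rk1_fun_add[OF lin1] rk1_fun_add[OF lin2] rk1_fun_scl[OF lin1] rk1_fun_scl[OF lin2]
    by (simp add: fun_eq_iff algebra_simps)
  have FSadd: "F (S (A + A') (B + B') (D + D')) \<eta> = F (S A B D) \<eta> + F (S A' B' D') \<eta>" if "\<eta> \<in> X" for A B D A' B' D' \<eta>
    using addF[OF S S that, of A B D A' B' D'] unfolding Sadd .
  define f where "f A = F (S A 0 0) (\<xi> a)" for A
  define g where "g D = F (S 0 0 D) (\<xi> b)" for D
  define h where "h B = F (S 0 B 0) (\<xi> a)" for B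
  define k' where "k' B = F (S 0 B 0) (\<xi> b)" for B
  have z1: "F (S A 0 0) (\<xi> b) = 0" for A by (rule rc[OF S \<xi>b]) (simp add: Sten dual)
  have z2: "F (S 0 0 D) (\<xi> a) = 0" for D by (rule rc[OF S \<xi>a]) (simp add: Sten dual)
  have Fa: "F (S A B D) (\<xi> a) = f A + h B" for A B D
    using FSadd[OF \<xi>a, of A 0 0 B 0 D] FSadd[OF \<xi>a, of 0 0 B 0 0 D] z2 by (simp add: f_def h_def)
  have Fb: "F (S A B D) (\<xi> b) = k' B + g D" for A B D
    using FSadd[OF \<xi>b, of A 0 0 B 0 D] FSadd[OF \<xi>b, of 0 0 B 0 0 D] z1 by (simp add: g_def k'_def)
  have "A * (k' B + g (B * B / A)) = B * (f A + h B)" if A: "A \<noteq> 0" for A B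
  proof -
    \<comment> \<open>With this last entry the matrix is singular, and the row
      \<open>?\<eta>\<close> kills it.\<close>
    let ?s = "S A B (B * B / A)" and ?\<eta> = "B \<star> \<xi> a - A \<star> \<xi> b"
    have \<eta>: "?\<eta> \<in> X" using \<xi>a \<xi>b sub_diff[OF X] sub_scl[OF X] by blast
    have "F ?s ?\<eta> = 0"
      by (rule rc[OF S \<eta>]) (use A in \<open>simp add: Sten lin_simps[OF ya] lin_simps[OF yb] dual\<close>)
    then show ?thesis by (simp add: lin_simps[OF linF[OF S]] Fa Fb)
  qed
  moreover have "f (A + A') = f A + f A'" for A A' unfolding f_def using FSadd[OF \<xi>a, of A A' 0 0 0 0] by simp
  moreover have "g (A + A') = g A + g A'" for A A' unfolding g_def using FSadd[OF \<xi>b, of 0 0 0 0 A A'] by simp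
  moreover have "h (A + A') = h A + h A'" for A A' unfolding h_def using FSadd[OF \<xi>a, of 0 0 A A' 0 0] by simp
  moreover have "k' (A + A') = k' A + k' A'" for A A' unfolding k'_def using FSadd[OF \<xi>b, of 0 0 A A' 0 0] by simp
  ultimately obtain l m \<alpha> where \<alpha>: "rootlin \<alpha>" "(2::'a) \<noteq> 0 \<Longrightarrow> (\<forall>a. \<alpha> a = 0)"
    and sol: "\<And>a. f a = l * a + \<alpha> a" "\<And>a. g a = m * a + \<alpha> a" "\<And>a. h a = m * a" "\<And>a. k' a = l * a"
    using sym2_functional_equation[of f g h k'] by blast
  define x1 where "x1 = x0 - l \<star> ub + m \<star> ua"
  \<comment> \<open>Chosen so that \<open>s (J \<eta> \<Otimes> \<eta>)\<close> is the quadratic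
    form of the symmetric matrix. In characteristic 2 its mixed terms cancel and
    \<open>\<alpha>\<close> can be taken termwise.\<close>
  define J where "J \<eta> = y b \<eta> \<star> ua + y a \<eta> \<star> (- ub)" for \<eta>
  have x1: "x1 \<in> UU p" unfolding x1_def using x0 uaU ubU sub_UU sub_add sub_diff sub_scl by metis
  have J: "linm J" unfolding J_def by (rule linm_lincomb[OF yb ya])
  have JU: "J \<eta> \<in> UU p" for \<eta> unfolding J_def using uaU ubU sub_UU sub_add sub_uminus sub_scl by metis
  have formula: "F s \<eta> = s (x1 \<Otimes> \<eta>) + y a \<eta> * \<alpha> (- s (ub \<Otimes> \<xi> a)) + y b \<eta> * \<alpha> (s (ua \<Otimes> \<xi> b))"
    and rel: "s (ub \<Otimes> \<xi> b) = - s (ua \<Otimes> \<xi> a)" and exps: "\<eta> = y a \<eta> \<star> \<xi> a + y b \<eta> \<star> \<xi> b"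
    if s: "s \<in> Ann T" and \<eta>: "\<eta> \<in> X" for s \<eta>
  proof -
    have ls: "lin s" using AnnD(1)[OF s] .
    have "s (ua \<Otimes> \<xi> a) + s (ub \<Otimes> \<xi> b) = 0" using AnnD(2)[OF s \<tau>] by (simp add: \<tau>eq lin_add[OF ls])
    then show r: "s (ub \<Otimes> \<xi> b) = - s (ua \<Otimes> \<xi> a)" by (simp add: eq_neg_iff_add_eq_0 add.commute)
    show e: "\<eta> = y a \<eta> \<star> \<xi> a + y b \<eta> \<star> \<xi> b" using db_expand[OF db \<eta>] ab by simp
    let ?A = "- s (ub \<Otimes> \<xi> a)" and ?B = "s (ua \<Otimes> \<xi> a)" and ?D = "s (ua \<Otimes> \<xi> b)"
    let ?s' = "\<Sum>r\<in>{k1,k2}. rk1 (\<phi> r) (\<lambda>\<xi>. s (x r \<Otimes> \<xi>))"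
    have s': "?s' \<in> Ann T" and Fs': "\<And>\<zeta>. \<zeta> \<in> X \<Longrightarrow> F s \<zeta> = s (x0 \<Otimes> \<zeta>) + F ?s' \<zeta>" using Fs0 s by blast+
    have "F ?s' \<zeta> = F (S ?A ?B ?D) \<zeta>" if \<zeta>: "\<zeta> \<in> X" for \<zeta>
    proof (rule F_cong[OF s' S \<zeta>])
      fix u
      have e\<zeta>: "\<zeta> = y a \<zeta> \<star> \<xi> a + y b \<zeta> \<star> \<xi> b" using db_expand[OF db \<zeta>] ab by simp
      have va: "s (ua \<Otimes> \<zeta>) = y a \<zeta> * ?B + y b \<zeta> * ?D" and vb: "s (ub \<Otimes> \<zeta>) = - (y a \<zeta> * ?A + y b \<zeta> * ?B)"
        by (subst e\<zeta>, simp add: tensor_simps lin_simps[OF ls] r algebra_simps)+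
      have "?s' (u \<Otimes> \<zeta>) = s (ua \<Otimes> \<zeta>) * \<phi> k1 u + s (ub \<Otimes> \<zeta>) * \<phi> k2 u"
        using k(3) by (simp add: rk1_tensor[OF lin1 lin_row[OF ls]] rk1_tensor[OF lin2 lin_row[OF ls]] x)
      then show "?s' (u \<Otimes> \<zeta>) = S ?A ?B ?D (u \<Otimes> \<zeta>)" unfolding Sten va vb by (simp add: algebra_simps)
    qed
    then have fa: "F s (\<xi> a) = s (x0 \<Otimes> \<xi> a) + (l * ?A + \<alpha> ?A + m * ?B)"
      and fb: "F s (\<xi> b) = s (x0 \<Otimes> \<xi> b) + (l * ?B + (m * ?D + \<alpha> ?D))"
      using Fs' \<xi>a \<xi>b by (simp_all add: Fa Fb sol)
    have F\<eta>: "F s \<eta> = y a \<eta> * F s (\<xi> a) + y b \<eta> * F s (\<xi> b)"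
      by (subst e) (simp add: lin_simps[OF linF[OF s]])
    have x1\<eta>: "s (x1 \<Otimes> \<eta>) = y a \<eta> * s (x1 \<Otimes> \<xi> a) + y b \<eta> * s (x1 \<Otimes> \<xi> b)"
      by (subst e) (simp add: tensor_simps lin_simps[OF ls])
    have x1\<zeta>: "s (x1 \<Otimes> \<zeta>) = s (x0 \<Otimes> \<zeta>) - l * s (ub \<Otimes> \<zeta>) + m * s (ua \<Otimes> \<zeta>)" for \<zeta>
      unfolding x1_def by (simp add: tensor_simps lin_simps[OF ls])
    show "F s \<eta> = s (x1 \<Otimes> \<eta>) + y a \<eta> * \<alpha> ?A + y b \<eta> * \<alpha> ?D"
      unfolding F\<eta> x1\<eta> fa fb unfolding x1\<zeta> r by (simp add: algebra_simps)
  qed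
  show ?thesis
  proof (cases "\<forall>a. \<alpha> a = 0")
    case True
    then show ?thesis using formula x1 unfolding localF_def by auto
  next
    case False
    then have two: "(2::'a) = 0" using \<alpha>(2) by blast
    have twox: "z + z = 0" for z :: 'a using two by (metis mult_2 mult_zero_left)
    have \<alpha>add: "\<alpha> (c + d) = \<alpha> c + \<alpha> d" and \<alpha>sq: "\<alpha> (c * c * d) = c * \<alpha> d" for c d
      using \<alpha>(1) by (auto simp: rootlin_def)
    have "F s \<eta> = s (x1 \<Otimes> \<eta>) + \<alpha> (s (J \<eta> \<Otimes> \<eta>))" if s: "s \<in> Ann T" and \<eta>: "\<eta> \<in> X" for s \<eta>
    proof -
      let ?A = "- s (ub \<Otimes> \<xi> a)" and ?D = "s (ua \<Otimes> \<xi> b)"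
      have ls: "lin s" using AnnD(1)[OF s] .
      have "s (J \<eta> \<Otimes> \<eta>) = y b \<eta> * s (ua \<Otimes> \<eta>) - y a \<eta> * s (ub \<Otimes> \<eta>)"
        by (simp add: J_def tensor_simps lin_simps[OF ls])
      also have "s (ua \<Otimes> \<eta>) = y a \<eta> * s (ua \<Otimes> \<xi> a) + y b \<eta> * ?D"
        by (subst exps[OF s \<eta>]) (simp add: tensor_simps lin_simps[OF ls])
      also have "s (ub \<Otimes> \<eta>) = y a \<eta> * s (ub \<Otimes> \<xi> a) - y b \<eta> * s (ua \<Otimes> \<xi> a)"
        by (subst exps[OF s \<eta>]) (simp add: tensor_simps lin_simps[OF ls] rel[OF s \<eta>])
      finally have "s (J \<eta> \<Otimes> \<eta>) = y a \<eta> * y a \<eta> * ?A + y b \<eta> * y b \<eta> * ?D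
          + (y a \<eta> * y b \<eta> * s (ua \<Otimes> \<xi> a) + y a \<eta> * y b \<eta> * s (ua \<Otimes> \<xi> a))"
        by (simp add: algebra_simps)
      then have E: "s (J \<eta> \<Otimes> \<eta>) = y a \<eta> * y a \<eta> * ?A + y b \<eta> * y b \<eta> * ?D" unfolding twox by simp
      have "\<alpha> (s (J \<eta> \<Otimes> \<eta>)) = y a \<eta> * \<alpha> ?A + y b \<eta> * \<alpha> ?D" unfolding E by (simp only: \<alpha>add \<alpha>sq)
      then show ?thesis using formula[OF s \<eta>] by (simp only: add.assoc)
    qed
    then have "formC p X T F x1 J \<alpha>" unfolding formC_def using x1 J JU \<alpha>(1) False by blast
    then show ?thesis using two unfolding typeC_def by blast
  qed
qed

text \<open>At most one tensor \<open>\<tau>\<close> is left, and its rank decides: rank zero or one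
  leads to \<open>one_column\<close> or a trivial \<open>T\<close>, rank two to symmetric
  matrices.\<close>

lemma base_case:
  assumes db: "db I X \<xi> y" and card: "card I = 2" and dim: "dimle T 1"
  shows "localF p X T F \<or> \<not> homogF X T F \<and> type1F p X T \<or> typeC p X T F"
proof (cases "\<forall>t\<in>T. t = 0")
  case True
  then show ?thesis using local_if_T_trivial[OF db] card by simp
next
  case False
  then obtain \<tau> where \<tau>: "\<tau> \<in> T" "\<tau> \<noteq> 0" by blast
  have T\<tau>: "\<exists>c. t = c \<star> \<tau>" if t: "t \<in> T" for t
    using dimle_spanned[OF dim T, of "{0::nat}" "\<lambda>_. \<tau>" t] \<tau> indf_single[OF \<tau>(2), of "0::nat"] t by auto
  obtain a b where I: "I = {a, b}" and ab: "a \<noteq> b" using card by (meson card_2_iff)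
  have ya: "lin (y a)" and yb: "lin (y b)" using db_lin[OF db] I by auto
  have \<xi>a: "\<xi> a \<in> X" and \<xi>b: "\<xi> b \<in> X" using db_mem[OF db] I by auto
  define ua where "ua = contr \<tau> (y a)"
  define ub where "ub = contr \<tau> (y b)"
  have U: "ua \<in> UU p" "ub \<in> UU p"
    unfolding ua_def ub_def using contr_UU[of \<tau> p X] \<tau> TW ya yb by auto
  have \<tau>eq: "\<tau> = ua \<Otimes> \<xi> a + ub \<Otimes> \<xi> b"
    using db_decompose[OF db, of \<tau> p] \<tau> TW ab I by (auto simp: ua_def ub_def)
  show ?thesis
  proof (cases "indep2 ua ub")
    case True
    then show ?thesis using base_rank_two[OF ab _ \<tau>(1) T\<tau>] db I unfolding ua_def ub_def by blast
  next
    case False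
    have "\<exists>u\<in>UU p. u \<noteq> 0 \<and> (\<exists>\<eta>\<in>X. \<tau> = u \<Otimes> \<eta>)"
    proof (cases "ua = 0")
      case True
      then have "\<tau> = ub \<Otimes> \<xi> b" using \<tau>eq by simp
      moreover from this have "ub \<noteq> 0" using \<tau>(2) by auto
      ultimately show ?thesis using U(2) \<xi>b by blast
    next
      case nz: False
      obtain c where c: "ub = c \<star> ua" using not_indep2[OF False nz] .
      have "\<tau> = ua \<Otimes> (\<xi> a + c \<star> \<xi> b)" unfolding \<tau>eq c by (simp add: tensor_simps)
      moreover have "\<xi> a + c \<star> \<xi> b \<in> X" using \<xi>a \<xi>b sub_add[OF X] sub_scl[OF X] by blast
      ultimately show ?thesis using nz U(1) by blast
    qed
    then obtain u \<eta> where u: "u \<in> UU p" "u \<noteq> 0" and \<eta>: "\<eta> \<in> X" "\<tau> = u \<Otimes> \<eta>" by blast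
    have "\<exists>\<eta>\<in>X. t = u \<Otimes> \<eta>" if tT: "t \<in> T" for t
    proof -
      obtain c where "t = c \<star> \<tau>" using T\<tau>[OF tT] by blast
      then have "t = u \<Otimes> (c \<star> \<eta>)" by (simp add: \<eta>(2) tensor_simps)
      then show ?thesis using sub_scl[OF X \<eta>(1)] by blast
    qed
    then show ?thesis using one_column[OF db _ u] card by auto
  qed
qed

text \<open>Scaling \<open>s\<close> by \<open>c * c\<close> multiplies the additional term by
  \<open>c\<close>, whereas homogeneity demands \<open>c * c\<close>; a scalar other than 0 and 1
  makes the term vanish.\<close>

lemma homog_typeC_local:
  assumes hom: "homogF X T F" and C: "typeC p X T F" and c01: "\<exists>c::'a. c \<noteq> 0 \<and> c \<noteq> 1"
  shows "localF p X T F"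
proof -
  obtain x J \<alpha> where f: "formC p X T F x J \<alpha>" using C unfolding typeC_def by blast
  then have x: "x \<in> UU p" and Fs: "\<And>s \<xi>. s \<in> Ann T \<Longrightarrow> \<xi> \<in> X \<Longrightarrow> F s \<xi> = s (x \<Otimes> \<xi>) + \<alpha> (s (J \<xi> \<Otimes> \<xi>))"
    and \<alpha>: "\<And>a c. \<alpha> (c * c * a) = c * \<alpha> a" by (auto simp: formC_def rootlin_def)
  obtain c :: 'a where c: "c \<noteq> 0" "c \<noteq> 1" using c01 by blast
  have "\<alpha> (s (J \<xi> \<Otimes> \<xi>)) = 0" if s: "s \<in> Ann T" and \<xi>: "\<xi> \<in> X" for s \<xi>
  proof -
    have "F ((c * c) \<star> s) \<xi> = c * c * F s \<xi>" using hom s \<xi> by (simp add: homogF_def)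
    then have "c * \<alpha> (s (J \<xi> \<Otimes> \<xi>)) = c * (c * \<alpha> (s (J \<xi> \<Otimes> \<xi>)))"
      using Fs[OF s \<xi>] Fs[OF sub_scl[OF sub_Ann s, of "c * c"] \<xi>] \<alpha>[of c "s (J \<xi> \<Otimes> \<xi>)"]
      by (simp add: algebra_simps)
    then have "\<alpha> (s (J \<xi> \<Otimes> \<xi>)) = c * \<alpha> (s (J \<xi> \<Otimes> \<xi>))" using c(1) by simp
    then show ?thesis using c(2) by (metis mult_cancel_right1)
  qed
  then show ?thesis using x Fs unfolding localF_def by auto
qed

end

subsection \<open>Gluing along three hyperplanes\<close>

lemma add_line_mono: "A \<subseteq> {u + c \<star> v | u c. u \<in> A}" and add_line_mem: "sub A \<Longrightarrow> v \<in> {u + c \<star> v | u c. u \<in> A}"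
proof -
  show "A \<subseteq> {u + c \<star> v | u c. u \<in> A}"
  proof
    fix u assume "u \<in> A"
    moreover have "u = u + 0 \<star> v" by simp
    ultimately show "u \<in> {u + c \<star> v | u c. u \<in> A}" by blast
  qed
  assume "sub A"
  then have "0 \<in> A" by (rule sub_0)
  moreover have "v = 0 + 1 \<star> v" by simp
  ultimately show "v \<in> {u + c \<star> v | u c. u \<in> A}" by blast
qed

text \<open>Two independent contractions mean that contraction with \<open>z\<close> has rank at
  least two on \<open>T\<close>; its kernel is reached by two single drops.\<close>

lemma dimle_Tker2:
  assumes T: "sub T" and z: "lin z" and t: "t1 \<in> T" "t2 \<in> T" "indep2 (contr t1 z) (contr t2 z)"
    and d: "dimle T (Suc (Suc d))"
  shows "dimle (Tker T z) d"
proof -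
  let ?T1 = "{u + c \<star> t1 | u c. u \<in> Tker T z}"
  have S0: "sub (Tker T z)" using sub_Tker[OF T z] .
  have S1: "sub ?T1" using sub_add_line[OF S0] .
  have T1T: "?T1 \<subseteq> T" using sub_add[OF T] sub_scl[OF T t(1)] by (auto simp: Tker_def)
  have "t2 \<notin> ?T1"
  proof
    assume "t2 \<in> ?T1"
    then obtain u c where u: "t2 = u + c \<star> t1" "contr u z = 0" by (auto simp: Tker_def)
    then have "contr t2 z = c \<star> contr t1 z" by (simp add: contr_simps[OF z])
    then show False using t(3) by (simp add: indep2_iff)
  qed
  from dimle_drop[OF d S1 T1T t(2) this] have "dimle ?T1 (Suc d)" .
  moreover have "t1 \<notin> Tker T z" using indep2_nonzero(1)[OF t(3)] by (simp add: Tker_def)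
  ultimately show ?thesis using dimle_drop[OF _ S0 add_line_mono add_line_mem[OF S0]] by blast
qed

lemma dimle_Tker1:
  assumes T: "sub T" and z: "lin z" and t: "t \<in> T" "contr t z \<noteq> 0" and d: "dimle T (Suc d)"
  shows "dimle (Tker T z) d"
  by (rule dimle_drop[OF d sub_Tker[OF T z] _ t(1)]) (use t(2) in \<open>auto simp: Tker_def\<close>)

definition Tkers :: "(nat \<times> nat \<Rightarrow> 'a::field) set \<Rightarrow> nat set \<Rightarrow> (nat \<Rightarrow> (nat \<Rightarrow> 'a) \<Rightarrow> 'a) \<Rightarrow> (nat \<times> nat \<Rightarrow> 'a) set" where
  "Tkers T B y = {t \<in> T. \<forall>b\<in>B. contr t (y b) = 0}"

text \<open>Each index of \<open>B\<close> comes with two tensors of \<open>T\<close> detected by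
  \<open>y b\<close> and invisible to the other functionals of \<open>B\<close>. They survive the
  restrictions along those, so every restriction costs two dimensions, in any order.\<close>

definition chain :: "(nat \<times> nat \<Rightarrow> 'a::field) set \<Rightarrow> nat set \<Rightarrow> (nat \<Rightarrow> (nat \<Rightarrow> 'a) \<Rightarrow> 'a) \<Rightarrow>
    (nat \<Rightarrow> nat \<times> nat \<Rightarrow> 'a) \<Rightarrow> (nat \<Rightarrow> nat \<times> nat \<Rightarrow> 'a) \<Rightarrow> bool" where
  "chain T B y t1 t2 \<longleftrightarrow> (\<forall>b\<in>B. lin (y b) \<and> t1 b \<in> T \<and> t2 b \<in> T \<and> indep2 (contr (t1 b) (y b)) (contr (t2 b) (y b)) \<and>
     (\<forall>b'\<in>B-{b}. contr (t1 b) (y b') = 0 \<and> contr (t2 b) (y b') = 0))"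

lemma chain_insert:
  assumes "chain T (insert b0 B) y t1 t2" "b0 \<notin> B"
  shows "chain (Tker T (y b0)) B y t1 t2" "Tkers (Tker T (y b0)) B y = Tkers T (insert b0 B) y"
  using assms by (auto simp: chain_def Tker_def Tkers_def)

lemma chain_dimle:
  assumes "finite B" "sub T" "chain T B y t1 t2" "dimle T (d + 2 * card B)"
  shows "dimle (Tkers T B y) d"
  using assms
proof (induction B arbitrary: T rule: finite_induct)
  case empty
  then show ?case by (simp add: Tkers_def)
next
  case (insert b0 B)
  have b0: "lin (y b0)" "t1 b0 \<in> T" "t2 b0 \<in> T" "indep2 (contr (t1 b0) (y b0)) (contr (t2 b0) (y b0))"
    using insert.prems(2) by (auto simp: chain_def)
  have "dimle T (Suc (Suc (d + 2 * card B)))" using insert.prems(3) insert.hyps by simp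
  from dimle_Tker2[OF insert.prems(1) b0 this] have "dimle (Tker T (y b0)) (d + 2 * card B)" .
  from insert.IH[OF sub_Tker[OF insert.prems(1) b0(1)] chain_insert(1)[OF insert.prems(2) insert.hyps(2)] this]
  show ?case using chain_insert(2)[OF insert.prems(2) insert.hyps(2)] by simp
qed

text \<open>If restricting along \<open>B\<close> drops the dimension by exactly two at each step, then the chain elements
  span \<open>T\<close> modulo the restriction.\<close>

lemma chain_spans:
  assumes "finite B" "sub T" "chain T B y t1 t2" "dimle T (Suc d + 2 * card B)" "\<not> dimle (Tkers T B y) d"
    and s: "lin s" "\<forall>t\<in>Tkers T B y. s t = 0" "\<forall>b\<in>B. s (t1 b) = 0 \<and> s (t2 b) = 0" and t: "t \<in> T"
  shows "s t = 0"
  using assms(1-5) s(2,3) t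
proof (induction B arbitrary: T t rule: finite_induct)
  case empty
  then show ?case by (simp add: Tkers_def)
next
  case (insert b0 B)
  let ?T' = "Tker T (y b0)"
  let ?T1 = "{u + c \<star> t1 b0 | u c. u \<in> ?T'}"
  let ?T2 = "{u + c \<star> t2 b0 | u c. u \<in> ?T1}"
  note ch = chain_insert[OF insert.prems(2) insert.hyps(2)]
  have b0: "lin (y b0)" "t1 b0 \<in> T" "t2 b0 \<in> T" "indep2 (contr (t1 b0) (y b0)) (contr (t2 b0) (y b0))"
    using insert.prems(2) by (auto simp: chain_def)
  have S': "sub ?T'" using sub_Tker[OF insert.prems(1) b0(1)] .
  have S1: "sub ?T1" using sub_add_line[OF S'] .
  have S2: "sub ?T2" using sub_add_line[OF S1] .
  have T'T: "?T' \<subseteq> T" by (auto simp: Tker_def)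
  have T1T: "?T1 \<subseteq> T" using sub_add[OF insert.prems(1)] sub_scl[OF insert.prems(1) b0(2)] T'T by blast
  have T2T: "?T2 \<subseteq> T" using sub_add[OF insert.prems(1)] sub_scl[OF insert.prems(1) b0(3)] T1T by blast
  have dT: "dimle T (Suc (Suc (Suc (d + 2 * card B))))" using insert.prems(3) insert.hyps by simp
  have n1: "t1 b0 \<notin> ?T'" using indep2_nonzero(1)[OF b0(4)] by (simp add: Tker_def)
  have n2: "t2 b0 \<notin> ?T1"
  proof
    assume "t2 b0 \<in> ?T1"
    then obtain u c where u: "t2 b0 = u + c \<star> t1 b0" "contr u (y b0) = 0" by (auto simp: Tker_def)
    then have "contr (t2 b0) (y b0) = c \<star> contr (t1 b0) (y b0)" by (simp add: contr_simps[OF b0(1)])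
    then show False using b0(4) by (simp add: indep2_iff)
  qed
  \<comment> \<open>Otherwise \<open>t\<close>, \<open>t2 b0\<close> and \<open>t1 b0\<close> give
    three drops where only two are available, against the lower bound on
    \<open>Tkers T (insert b0 B) y\<close>.\<close>
  have "t \<in> ?T2"
  proof (rule ccontr)
    assume "t \<notin> ?T2"
    from dimle_drop[OF dT S2 T2T insert.prems(7) this]
    have "dimle ?T2 (Suc (Suc (d + 2 * card B)))" .
    from dimle_drop[OF this S1 add_line_mono add_line_mem[OF S1] n2]
    have "dimle ?T1 (Suc (d + 2 * card B))" .
    from dimle_drop[OF this S' add_line_mono add_line_mem[OF S'] n1]
    have "dimle ?T' (d + 2 * card B)" .
    from chain_dimle[OF insert.hyps(1) S' ch(1) this] show False using insert.prems(4) ch(2) by simp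
  qed
  then obtain u c c' where u: "u \<in> ?T'" "t = u + c \<star> t1 b0 + c' \<star> t2 b0" by blast
  have "s u = 0"
  proof (rule insert.IH[OF S' ch(1)])
    have "dimle T (Suc (Suc (Suc d + 2 * card B)))" using dT by simp
    from dimle_Tker2[OF insert.prems(1) b0 this] show "dimle ?T' (Suc d + 2 * card B)" .
  qed (use insert.prems(4,5,6) ch(2) u(1) in auto)
  moreover have "s (u + c \<star> t1 b0 + c' \<star> t2 b0) = s u + c * s (t1 b0) + c' * s (t2 b0)"
    by (simp only: lin_add[OF s(1)] lin_scl[OF s(1)])
  ultimately have "s (u + c \<star> t1 b0 + c' \<star> t2 b0) = 0" using insert.prems(6) by simp
  then show ?case by (simp only: u(2))
qed

context rcs
begin

text \<open>Differences of the three multipliers give tensors in \<open>T\<close>. If two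
  multipliers act alike, two hyperplanes already glue, since together they span \<open>X\<close>. If
  the differences \<open>a\<close>, \<open>b\<close> are independent, the tensors number
  \<open>2 * card I - 3\<close> and span \<open>T\<close>; then \<open>Ann T\<close> contains an
  explicit functional at which the three formulas violate range restriction.\<close>

lemma local_if_three_local:
  assumes db: "db I X \<xi> y" and k: "k1 \<in> I" "k2 \<in> I" "k3 \<in> I" "k1 \<noteq> k2" "k1 \<noteq> k3" "k2 \<noteq> k3"
    and dim: "dimle T (2 * card I - 3)"
    and loc: "localF p (kerin X (y k1)) T F" "localF p (kerin X (y k2)) T F" "localF p (kerin X (y k3)) T F"
  shows "localF p X T F"
proof -
  obtain x1 where x1: "x1 \<in> UU p" "\<forall>s\<in>Ann T. \<forall>\<eta>\<in>kerin X (y k1). F s \<eta> = s (x1 \<Otimes> \<eta>)"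
    using loc(1) unfolding localF_def by blast
  obtain x2 where x2: "x2 \<in> UU p" "\<forall>s\<in>Ann T. \<forall>\<eta>\<in>kerin X (y k2). F s \<eta> = s (x2 \<Otimes> \<eta>)"
    using loc(2) unfolding localF_def by blast
  obtain x3 where x3: "x3 \<in> UU p" "\<forall>s\<in>Ann T. \<forall>\<eta>\<in>kerin X (y k3). F s \<eta> = s (x3 \<Otimes> \<eta>)"
    using loc(3) unfolding localF_def by blast
  note xU = x1(1) x2(1) x3(1)
  have F1: "F s \<eta> = s (x1 \<Otimes> \<eta>)" if "s \<in> Ann T" "\<eta> \<in> kerin X (y k1)" for s \<eta> using x1(2) that by blast
  have F2: "F s \<eta> = s (x2 \<Otimes> \<eta>)" if "s \<in> Ann T" "\<eta> \<in> kerin X (y k2)" for s \<eta> using x2(2) that by blast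
  have F3: "F s \<eta> = s (x3 \<Otimes> \<eta>)" if "s \<in> Ann T" "\<eta> \<in> kerin X (y k3)" for s \<eta> using x3(2) that by blast
  have \<xi>ker: "\<xi> b \<in> kerin X (y k)" if "b \<in> I" "k \<in> I" "b \<noteq> k" for b k
    using that db_mem[OF db] db_dual[OF db] by (simp add: kerin_def)
  have eqT: "(x - x') \<Otimes> \<eta> \<in> T" if h: "\<And>s. s \<in> Ann T \<Longrightarrow> s (x \<Otimes> \<eta>) = s (x' \<Otimes> \<eta>)" for x x' \<eta>
  proof (rule mem_if_Ann_vanishes[OF T])
    fix s assume s: "s \<in> Ann T"
    show "s ((x - x') \<Otimes> \<eta>) = 0" using h[OF s] by (simp add: tensor_simps lin_diff[OF AnnD(1)[OF s]])
  qed
  have eqker: "(x - x') \<Otimes> \<eta> \<in> T"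
    if "\<And>s. s \<in> Ann T \<Longrightarrow> F s \<eta> = s (x \<Otimes> \<eta>)" "\<And>s. s \<in> Ann T \<Longrightarrow> F s \<eta> = s (x' \<Otimes> \<eta>)" for x x' \<eta>
  proof (rule eqT)
    fix s assume s: "s \<in> Ann T"
    show "s (x \<Otimes> \<eta>) = s (x' \<Otimes> \<eta>)" using that(1)[OF s] that(2)[OF s] by simp
  qed
  have glue: "localF p X T F"
    if x: "x \<in> UU p" and i: "i \<in> I" "j \<in> I" "i \<noteq> j"
      and Fi: "\<And>s \<eta>. s \<in> Ann T \<Longrightarrow> \<eta> \<in> kerin X (y i) \<Longrightarrow> F s \<eta> = s (x \<Otimes> \<eta>)"
      and Fj: "\<And>s \<eta>. s \<in> Ann T \<Longrightarrow> \<eta> \<in> kerin X (y j) \<Longrightarrow> F s \<eta> = s (x \<Otimes> \<eta>)" for x i j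
    unfolding localF_def
  proof (intro bexI[OF _ x] ballI)
    fix s \<eta> assume s: "s \<in> Ann T" and \<eta>: "\<eta> \<in> X"
    let ?\<eta>' = "\<eta> - y i \<eta> \<star> \<xi> i"
    have 1: "?\<eta>' \<in> kerin X (y i)" using \<eta> db_mem[OF db i(1)] sub_diff[OF X] sub_scl[OF X] db_lin[OF db i(1)] db_dual[OF db i(1) i(1)]
      by (simp add: kerin_def lin_diff[of "y i"] lin_scl[of "y i"])
    have "\<xi> i \<in> kerin X (y j)" using \<xi>ker i by simp
    then have 2: "F s (\<xi> i) = s (x \<Otimes> \<xi> i)" by (rule Fj[OF s])
    have "F s (?\<eta>' + y i \<eta> \<star> \<xi> i) = s (x \<Otimes> (?\<eta>' + y i \<eta> \<star> \<xi> i))"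
      unfolding lin_add[OF linF[OF s]] lin_scl[OF linF[OF s]] Fi[OF s 1] 2
      by (simp only: tensor_simps lin_add[OF AnnD(1)[OF s]] lin_scl[OF AnnD(1)[OF s]])
    then show "F s \<eta> = s (x \<Otimes> \<eta>)" by simp
  qed
  define a where "a = x1 - x2"
  define b where "b = x1 - x3"
  have a_in: "a \<Otimes> \<xi> l \<in> T" if "l \<in> I" "l \<noteq> k1" "l \<noteq> k2" for l
    unfolding a_def by (rule eqker[OF F1[OF _ \<xi>ker] F2[OF _ \<xi>ker]]) (use that k in auto)
  have b_in: "b \<Otimes> \<xi> l \<in> T" if "l \<in> I" "l \<noteq> k1" "l \<noteq> k3" for l
    unfolding b_def by (rule eqker[OF F1[OF _ \<xi>ker] F3[OF _ \<xi>ker]]) (use that k in auto)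
  have "(x2 - x3) \<Otimes> \<xi> k1 \<in> T"
    by (rule eqker[OF F2[OF _ \<xi>ker] F3[OF _ \<xi>ker]]) (use k in auto)
  moreover have "x2 - x3 = b - a" by (simp add: a_def b_def)
  ultimately have c_in: "(b - a) \<Otimes> \<xi> k1 \<in> T" by simp
  show ?thesis
  proof (cases "indep2 a b")
    case False
    show ?thesis
    proof (cases "a = 0")
      case True
      then have "x2 = x1" by (simp add: a_def)
      then show ?thesis using glue[OF xU(1) k(1,2,4) F1] F2 by blast
    next
      case nz: False
      obtain c where c: "b = c \<star> a" using not_indep2[OF False nz] .
      show ?thesis
      proof (cases "c = 0 \<or> c = 1")
        case True
        then have "x3 = x1 \<or> x3 = x2" using c by (auto simp: a_def b_def)
        then show ?thesis using glue[OF xU(1) k(1,3,5) F1] glue[OF xU(2) k(2,3,6) F2] F3 by blast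
      next
        case c01: False
        have sc: "w \<in> T" if "d \<star> w \<in> T" "d \<noteq> 0" for d w
          using sub_scl[OF T that(1), of "inverse d"] that(2) by simp
        \<comment> \<open>With \<open>b = c \<star> a\<close> and \<open>c\<close> different from 0
          and 1, the missing tensors \<open>a \<Otimes> \<xi> k1\<close> and
          \<open>a \<Otimes> \<xi> k2\<close> are obtained, so \<open>x1\<close> and
          \<open>x2\<close> act alike.\<close>
        have "c \<star> a \<Otimes> \<xi> k2 \<in> T" using b_in[OF k(2)] k c by (simp add: tensor_simps)
        then have 2: "a \<Otimes> \<xi> k2 \<in> T" using sc c01 by blast
        have "(c - 1) \<star> a \<Otimes> \<xi> k1 \<in> T" using c_in c by (simp add: tensor_simps fs.scale_left_diff_distrib)
        then have 1: "a \<Otimes> \<xi> k1 \<in> T" using sc[of "c - 1"] c01 by simp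
        have al: "a \<Otimes> \<xi> l \<in> T" if "l \<in> I" for l using a_in[OF that] 1 2 by blast
        have "s (x1 \<Otimes> \<eta>) = s (x2 \<Otimes> \<eta>)" if s: "s \<in> Ann T" and \<eta>: "\<eta> \<in> X" for s \<eta>
        proof -
          have "s (a \<Otimes> \<eta>) = (\<Sum>i\<in>I. y i \<eta> * s (a \<Otimes> \<xi> i))"
            by (rule db_expand_lin[OF db lin_row[OF AnnD(1)[OF s]] \<eta>])
          then have "s (a \<Otimes> \<eta>) = 0" using AnnD(2)[OF s al] by simp
          then show ?thesis by (simp add: a_def tensor_simps lin_diff[OF AnnD(1)[OF s]])
        qed
        note eq12 = this
        have "F s \<eta> = s (x1 \<Otimes> \<eta>)" if "s \<in> Ann T" "\<eta> \<in> kerin X (y k2)" for s \<eta>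
          using F2[OF that] eq12[OF that(1), of \<eta>] that(2) by (simp add: kerin_def)
        then show ?thesis using glue[OF xU(1) k(1,2,4) F1] by blast
      qed
    qed
  next
    case ind: True
    have aU: "a \<in> UU p" and bU: "b \<in> UU p" unfolding a_def b_def using xU sub_diff[OF sub_UU] by blast+
    obtain j1 j2 x \<phi> where j: "j1 \<in> {..<p}" "j2 \<in> {..<p}" "j1 \<noteq> j2" and dbU: "db {..<p} (UU p) x \<phi>"
      and x: "x j1 = a" "x j2 = b"
      using db_two_vec[OF db_UU aU bU ind] by metis
    have lin1: "lin (\<phi> j1)" and lin2: "lin (\<phi> j2)" using db_lin[OF dbU] j by auto
    have \<phi>: "\<phi> j1 a = 1" "\<phi> j1 b = 0" "\<phi> j2 a = 0" "\<phi> j2 b = 1"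
      using db_dual[OF dbU] j x by (metis, metis, metis, metis)
    have ly: "lin (y i)" if "i \<in> I" for i using db_lin[OF db that] .
    define B where "B = I - {k1, k2, k3}"
    have fin: "finite I" using db_finite[OF db] .
    have "card I = card B + 3"
      using card_Diff_subset[of "{k1,k2,k3}" I] k fin card_mono[of I "{k1,k2,k3}"] by (simp add: B_def)
    then have dim': "dimle T (Suc 2 + 2 * card B)" using dim by (simp add: numeral_eq_Suc)
    have ch: "chain T B y (\<lambda>l. a \<Otimes> \<xi> l) (\<lambda>l. b \<Otimes> \<xi> l)"
      unfolding chain_def B_def using a_in b_in ind ly db_dual[OF db] by (auto simp: contr_tensor)
    \<comment> \<open>The three tensors outside the chain; with the \<open>2 * card B\<close> chain
      tensors they exhaust the bound.\<close>
    define t where "t = (\<lambda>_::nat. 0)(0 := a \<Otimes> \<xi> k3, 1 := b \<Otimes> \<xi> k2, 2 := (b - a) \<Otimes> \<xi> k1)"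
    have tB: "t i \<in> Tkers T B y" if "i \<in> {0,1,2}" for i
      using that a_in[OF k(3)] b_in[OF k(2)] c_in k ly db_dual[OF db] by (auto simp: t_def Tkers_def B_def contr_tensor)
    have indt: "indf {0,1,2} t"
    proof (rule indfI)
      fix c and j :: nat assume c: "(\<Sum>j\<in>{0,1,2}. c j \<star> t j) = 0" and j: "j \<in> {0,1,2}"
      have e: "c 0 \<star> a \<Otimes> \<xi> k3 + c 1 \<star> b \<Otimes> \<xi> k2 + c 2 \<star> (b - a) \<Otimes> \<xi> k1 = 0"
        using c by (simp add: t_def add.assoc)
      have ba: "b - a \<noteq> 0" using indep2D[OF ind, of "-1" 1] by (auto simp: fs.scale_minus_left)
      have "c 0 = 0" using arg_cong[OF e, of "\<lambda>w. contr w (y k3)"] indep2_nonzero(1)[OF ind] k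
        by (simp add: contr_simps[OF ly[OF k(3)]] db_dual[OF db])
      moreover have "c 1 = 0" using arg_cong[OF e, of "\<lambda>w. contr w (y k2)"] indep2_nonzero(2)[OF ind] k
        by (simp add: contr_simps[OF ly[OF k(2)]] db_dual[OF db])
      moreover have "c 2 = 0" using arg_cong[OF e, of "\<lambda>w. contr w (y k1)"] ba k
        by (simp add: contr_simps[OF ly[OF k(1)]] db_dual[OF db])
      ultimately show "c j = 0" using j by auto
    qed
    have subB: "sub (Tkers T B y)"
      unfolding sub_def Tkers_def using sub_0[OF T] sub_add[OF T] sub_scl[OF T] ly
      by (auto simp: B_def contr_0 contr_add contr_scl)
    have fin3: "finite {0,1,2::nat}" and card3: "card {0,1,2::nat} = 3" by auto
    have dB: "dimle (Tkers T B y) 3" using chain_dimle[OF _ T ch, of 3] dim' fin by (simp add: B_def)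
    have ndB: "\<not> dimle (Tkers T B y) 2"
      using dimleD[of "Tkers T B y" 2, OF _ fin3 tB indt] card3 by auto
    \<comment> \<open>Designed to vanish on the chain and on the three tensors but to take the value
      1 at \<open>a \<Otimes> \<xi> k1\<close>. The row
      \<open>\<xi> k1 - \<xi> k2 - \<xi> k3\<close> kills both of its columns.\<close>
    define s where "s = rk1 (\<phi> j1) (y k1 + y k2) + rk1 (\<phi> j2) (y k1 + y k3)"
    have l12: "lin (y k1 + y k2)" "lin (y k1 + y k3)" using ly k by auto
    have ls: "lin s" unfolding s_def by (intro lin_plus lin_rk1 lin1 lin2 l12)
    have sten: "s (u \<Otimes> \<eta>) = (y k1 \<eta> + y k2 \<eta>) * \<phi> j1 u + (y k1 \<eta> + y k3 \<eta>) * \<phi> j2 u" for u \<eta>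
      unfolding s_def by (simp add: rk1_tensor[OF lin1 l12(1)] rk1_tensor[OF lin2 l12(2)])
    have "s w = 0" if w: "w \<in> T" for w
    proof (rule chain_spans[OF _ T ch dim' ndB ls _ _ w])
      show "finite B" using fin by (simp add: B_def)
      show "\<forall>b'\<in>B. s (a \<Otimes> \<xi> b') = 0 \<and> s (b \<Otimes> \<xi> b') = 0"
        unfolding sten B_def using k db_dual[OF db] by auto
      have st: "s (t i) = 0" if "i \<in> {0,1,2}" for i
        using that k by (auto simp: t_def sten \<phi> db_dual[OF db] lin_diff[OF lin1] lin_diff[OF lin2])
      show "\<forall>t'\<in>Tkers T B y. s t' = 0"
      proof
        fix t' assume "t' \<in> Tkers T B y"
        then obtain c where "t' = (\<Sum>j\<in>{0,1,2}. c j \<star> t j)"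
          using dimle_spanned[OF dB subB fin3 tB indt card3] by blast
        then have "s t' = (\<Sum>j\<in>{0,1,2}. c j * s (t j))" by (simp only: lin_sum[OF ls] lin_scl[OF ls])
        then show "s t' = 0" using st by (simp add: sum.neutral)
      qed
    qed
    then have s: "s \<in> Ann T" using ls by (simp add: Ann_def)
    let ?\<eta> = "\<xi> k1 - \<xi> k2 - \<xi> k3"
    have \<eta>: "?\<eta> \<in> X" using db_mem[OF db] k sub_diff[OF X] by blast
    have s\<eta>: "s (u \<Otimes> ?\<eta>) = 0" for u
      unfolding sten using k by (simp add: lin_simps[OF ly[OF k(1)]] lin_simps[OF ly[OF k(2)]] lin_simps[OF ly[OF k(3)]] db_dual[OF db])
    \<comment> \<open>Both \<open>F s\<close> and \<open>s (x1 \<Otimes> _)\<close> vanish at this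
      row, but at \<open>\<xi> k1\<close> the first one is computed with \<open>x2\<close>; the
      discrepancy is \<open>s (a \<Otimes> \<xi> k1)\<close>.\<close>
    have "F s ?\<eta> = 0" by (rule rc[OF s \<eta>]) (rule s\<eta>)
    moreover have "F s (\<xi> k1) = s (x2 \<Otimes> \<xi> k1)" using F2[OF s \<xi>ker] k by simp
    moreover have "F s (\<xi> k2) = s (x1 \<Otimes> \<xi> k2)" using F1[OF s \<xi>ker] k by simp
    moreover have "F s (\<xi> k3) = s (x1 \<Otimes> \<xi> k3)" using F1[OF s \<xi>ker] k by simp
    ultimately have e1: "s (x2 \<Otimes> \<xi> k1) = s (x1 \<Otimes> \<xi> k2) + s (x1 \<Otimes> \<xi> k3)"
      by (simp add: lin_simps[OF linF[OF s]] algebra_simps)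
    have "s (x1 \<Otimes> ?\<eta>) = 0" by (rule s\<eta>)
    then have e2: "s (x1 \<Otimes> \<xi> k1) = s (x1 \<Otimes> \<xi> k2) + s (x1 \<Otimes> \<xi> k3)"
      by (simp add: tensor_simps lin_simps[OF ls] algebra_simps)
    have "s (a \<Otimes> \<xi> k1) = 0" using e1 e2 by (simp add: a_def tensor_simps lin_simps[OF ls])
    then have False unfolding sten \<phi> using k by (simp add: db_dual[OF db])
    then show ?thesis ..
  qed
qed

end

section \<open>The exceptional form on one hyperplane and on several\<close>

context rcs
begin

text \<open>The annihilator of \<open>T\<close> enlarged by the line of \<open>a\<close> consists of
  the \<open>s \<in> Ann T\<close> with \<open>s a = 0\<close>.\<close>

lemma mem_mod_line:
  assumes van: "\<forall>s\<in>Ann T. s a = 0 \<longrightarrow> s b = 0"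
  shows "\<exists>k. b - k \<star> a \<in> T"
proof -
  let ?S = "{u + c \<star> a | u c. u \<in> T}"
  have "b \<in> ?S"
  proof (rule mem_if_Ann_vanishes[OF sub_add_line[OF T]])
    fix s assume s: "s \<in> Ann ?S"
    have "s \<in> Ann T" using s add_line_mono[of T a] by (auto simp: Ann_def)
    moreover have "s a = 0" using AnnD(2)[OF s add_line_mem[OF T]] .
    ultimately show "s b = 0" using van by blast
  qed
  then obtain u c where "u \<in> T" "b = u + c \<star> a" by blast
  then have "b - c \<star> a \<in> T" by simp
  then show ?thesis by blast
qed

text \<open>Additivity of \<open>F s\<close> at \<open>\<xi> + \<eta>\<close> shows that
  \<open>\<alpha>\<close> vanishes at the value of \<open>s\<close> on this tensor. As
  \<open>s\<close> may be scaled freely, a nonzero value would make \<open>\<alpha>\<close> zero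
  everywhere.\<close>

lemma formC_sym:
  assumes C: "formC p X T F x J \<alpha>" and \<xi>: "\<xi> \<in> X" and \<eta>: "\<eta> \<in> X"
  shows "J \<eta> \<Otimes> \<xi> + J \<xi> \<Otimes> \<eta> \<in> T"
proof (rule mem_if_Ann_vanishes[OF T])
  have J: "linm J" and \<alpha>add: "\<And>a b. \<alpha> (a + b) = \<alpha> a + \<alpha> b" and \<alpha>nz: "\<exists>a. \<alpha> a \<noteq> 0"
    and Fs: "\<And>s \<xi>. s \<in> Ann T \<Longrightarrow> \<xi> \<in> X \<Longrightarrow> F s \<xi> = s (x \<Otimes> \<xi>) + \<alpha> (s (J \<xi> \<Otimes> \<xi>))"
    using C by (auto simp: formC_def rootlin_def)
  let ?w = "J \<eta> \<Otimes> \<xi> + J \<xi> \<Otimes> \<eta>"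
  have z: "\<alpha> (s ?w) = 0" if s: "s \<in> Ann T" for s
  proof -
    have ls: "lin s" using AnnD(1)[OF s] .
    have "\<xi> + \<eta> \<in> X" using sub_add[OF X \<xi> \<eta>] .
    from Fs[OF s this] have "F s \<xi> + F s \<eta> = s (x \<Otimes> \<xi>) + s (x \<Otimes> \<eta>) + \<alpha> (s (J (\<xi> + \<eta>) \<Otimes> (\<xi> + \<eta>)))"
      by (simp add: lin_add[OF linF[OF s]] tensor_simps lin_add[OF ls])
    moreover have "s (J (\<xi> + \<eta>) \<Otimes> (\<xi> + \<eta>)) = s (J \<xi> \<Otimes> \<xi>) + s (J \<eta> \<Otimes> \<eta>) + s ?w"
      by (simp add: linm_add[OF J] tensor_simps lin_add[OF ls] algebra_simps)
    ultimately show ?thesis using Fs[OF s \<xi>] Fs[OF s \<eta>] by (simp add: \<alpha>add)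
  qed
  fix s assume s: "s \<in> Ann T"
  show "s ?w = 0"
  proof (rule ccontr)
    assume nz: "s ?w \<noteq> 0"
    have "\<alpha> a = 0" for a
      using z[OF sub_scl[OF sub_Ann s], of "a / s ?w"] nz by simp
    then show False using \<alpha>nz by blast
  qed
qed

text \<open>With \<open>J = 0\<close> on \<open>X\<close> the additional term disappears. With
  \<open>J \<eta> = f \<eta> \<star> u\<close> the symmetry relation puts
  \<open>u \<Otimes> \<eta>\<close> into \<open>T\<close> whenever \<open>f \<eta> = 0\<close>; then
  either all \<open>u \<Otimes> \<eta>\<close> lie in \<open>T\<close>, and the map is local, or
  exactly those do, which is Type 1.\<close>

lemma formC_rank:
  assumes C: "formC p X T F x J \<alpha>" and nl: "\<not> localF p X T F" and n1: "\<not> type1F p X T"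
  shows "\<exists>\<xi>\<in>X. J \<xi> \<noteq> 0" "\<And>\<xi>. \<xi> \<in> X \<Longrightarrow> J \<xi> \<noteq> 0 \<Longrightarrow> \<exists>\<eta>\<in>X. indep2 (J \<xi>) (J \<eta>)"
proof -
  have J: "linm J" and x: "x \<in> UU p" and JU: "\<And>\<xi>. \<xi> \<in> X \<Longrightarrow> J \<xi> \<in> UU p"
    and \<alpha>add: "\<And>a b. \<alpha> (a + b) = \<alpha> a + \<alpha> b"
    and Fs: "\<And>s \<xi>. s \<in> Ann T \<Longrightarrow> \<xi> \<in> X \<Longrightarrow> F s \<xi> = s (x \<Otimes> \<xi>) + \<alpha> (s (J \<xi> \<Otimes> \<xi>))"
    using C by (auto simp: formC_def rootlin_def)
  have \<alpha>0: "\<alpha> 0 = 0" using \<alpha>add[of 0 0] by (metis add.right_neutral add_left_cancel)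
  have loc: False if h: "\<And>s \<xi>. s \<in> Ann T \<Longrightarrow> \<xi> \<in> X \<Longrightarrow> s (J \<xi> \<Otimes> \<xi>) = 0"
  proof -
    have "F s \<xi> = s (x \<Otimes> \<xi>)" if "s \<in> Ann T" "\<xi> \<in> X" for s \<xi>
      using Fs[OF that] h[OF that] \<alpha>0 by simp
    then show False using nl x unfolding localF_def by blast
  qed
  show "\<exists>\<xi>\<in>X. J \<xi> \<noteq> 0"
  proof (rule ccontr)
    assume "\<not> (\<exists>\<xi>\<in>X. J \<xi> \<noteq> 0)"
    then show False using loc by (metis AnnD(1) lin_0 tensor_zero_left)
  qed
  fix \<xi>0 assume \<xi>0: "\<xi>0 \<in> X" "J \<xi>0 \<noteq> 0"
  show "\<exists>\<eta>\<in>X. indep2 (J \<xi>0) (J \<eta>)"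
  proof (rule ccontr)
    assume no: "\<not> (\<exists>\<eta>\<in>X. indep2 (J \<xi>0) (J \<eta>))"
    define u where "u = J \<xi>0"
    obtain \<phi> where \<phi>: "lin \<phi>" "\<phi> u = 1" using lin_ex_nonzero[of u] \<xi>0(2) u_def by metis
    define f where "f \<eta> = \<phi> (J \<eta>)" for \<eta>
    have f: "lin f" by (rule linI) (simp_all add: f_def linm_add[OF J] linm_scl[OF J] lin_add[OF \<phi>(1)] lin_scl[OF \<phi>(1)])
    have Jf: "J \<eta> = f \<eta> \<star> u" if \<eta>: "\<eta> \<in> X" for \<eta>
    proof -
      have "\<not> indep2 u (J \<eta>)" "u \<noteq> 0" using no \<eta> \<xi>0 by (auto simp: u_def)
      then obtain c where "J \<eta> = c \<star> u" using not_indep2 by blast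
      then show ?thesis by (simp add: f_def lin_scl[OF \<phi>(1)] \<phi>(2))
    qed
    have f0: "f \<xi>0 = 1" using \<phi>(2) by (simp add: f_def u_def)
    have ker: "u \<Otimes> \<eta> \<in> T" if \<eta>: "\<eta> \<in> X" "f \<eta> = 0" for \<eta>
      using formC_sym[OF C \<eta>(1) \<xi>0(1)] Jf[OF \<eta>(1)] \<eta>(2) by (simp add: u_def)
    have all: "u \<Otimes> \<eta> \<in> T" if u0: "u \<Otimes> \<xi>0 \<in> T" and \<eta>: "\<eta> \<in> X" for \<eta>
    proof -
      have "\<eta> - f \<eta> \<star> \<xi>0 \<in> X" using \<eta> \<xi>0(1) sub_diff[OF X] sub_scl[OF X] by blast
      then have "u \<Otimes> (\<eta> - f \<eta> \<star> \<xi>0) \<in> T" by (rule ker) (simp add: lin_simps[OF f] f0)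
      from sub_add[OF T this sub_scl[OF T u0, of "f \<eta>"]] show ?thesis by (simp add: tensor_simps)
    qed
    show False
    proof (cases "u \<Otimes> \<xi>0 \<in> T")
      case True
      have "s (J \<xi> \<Otimes> \<xi>) = 0" if s: "s \<in> Ann T" and \<xi>: "\<xi> \<in> X" for s \<xi>
        using AnnD(2)[OF s all[OF True \<xi>]] by (simp add: Jf[OF \<xi>] tensor_simps lin_scl[OF AnnD(1)[OF s]])
      then show False using loc by blast
    next
      case False
      have "u \<Otimes> \<eta> \<in> T \<longleftrightarrow> f \<eta> = 0" if \<eta>: "\<eta> \<in> X" for \<eta>
      proof
        assume u\<eta>: "u \<Otimes> \<eta> \<in> T"
        show "f \<eta> = 0"
        proof (rule ccontr)
          assume nz: "f \<eta> \<noteq> 0"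
          have "\<xi>0 - inverse (f \<eta>) \<star> \<eta> \<in> X" using \<eta> \<xi>0(1) sub_diff[OF X] sub_scl[OF X] by blast
          then have "u \<Otimes> (\<xi>0 - inverse (f \<eta>) \<star> \<eta>) \<in> T" by (rule ker) (simp add: lin_simps[OF f] f0 nz)
          from sub_add[OF T this sub_scl[OF T u\<eta>, of "inverse (f \<eta>)"]] show False using False by (simp add: tensor_simps)
        qed
      qed (rule ker[OF \<eta>])
      then have "type1F p X T"
        unfolding type1F_def using f f0 \<xi>0(1) JU[OF \<xi>0(1)] u_def
        by (intro bexI[of _ u] exI[of _ f] conjI bexI[of _ \<xi>0]) auto
      then show False using n1 by blast
    qed
  qed
qed

text \<open>Dimension count: the symmetric tensors built from \<open>\<xi>0\<close> and a second
  vector \<open>\<eta>1\<close> already account for the whole bound, which leaves no room for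
  \<open>x0 \<Otimes> \<xi>0\<close>.\<close>

lemma formC_no_rank_one:
  assumes C: "formC p X T F x J \<alpha>" and nl: "\<not> localF p X T F" and n1: "\<not> type1F p X T"
    and db: "db I X \<xi> y" and dim: "dimle T (2 * card I - 3)" and \<xi>0: "\<xi>0 \<in> X" and x0: "x0 \<Otimes> \<xi>0 \<in> T"
  shows "x0 = 0 \<or> J \<xi>0 = 0"
proof (rule ccontr)
  assume "\<not> (x0 = 0 \<or> J \<xi>0 = 0)"
  then have nz: "x0 \<noteq> 0" "J \<xi>0 \<noteq> 0" by auto
  have J: "linm J" using C by (simp add: formC_def)
  obtain \<eta>1 where \<eta>1: "\<eta>1 \<in> X" "indep2 (J \<xi>0) (J \<eta>1)" using formC_rank(2)[OF C nl n1 \<xi>0 nz(2)] by blast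
  have "indep2 \<xi>0 \<eta>1"
    unfolding indep2_def
  proof (intro allI impI)
    fix a b assume "a \<star> \<xi>0 + b \<star> \<eta>1 = 0"
    then have "J (a \<star> \<xi>0 + b \<star> \<eta>1) = 0" using linm_0[OF J] by simp
    then show "a = 0 \<and> b = 0" using indep2D[OF \<eta>1(2)] by (simp add: linm_add[OF J] linm_scl[OF J])
  qed
  then obtain k0 k1 \<xi>' y' where k: "k0 \<in> I" "k1 \<in> I" "k0 \<noteq> k1" and db': "db I X \<xi>' y'"
    and \<xi>': "\<xi>' k0 = \<xi>0" "\<xi>' k1 = \<eta>1"
    using db_two_vec[OF db \<xi>0 \<eta>1(1)] by metis
  have ly: "lin (y' i)" if "i \<in> I" for i using db_lin[OF db' that] .
  define B where "B = I - {k0, k1}"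
  have fin: "finite I" using db_finite[OF db'] .
  have "card I = card B + 2"
    using card_Diff_subset[of "{k0,k1}" I] k fin card_mono[of I "{k0,k1}"] by (simp add: B_def)
  then have dim': "dimle T (Suc 0 + 2 * card B)" using dim by (simp add: numeral_eq_Suc)
  define \<tau> where "\<tau> \<eta> b = J \<eta> \<Otimes> \<xi>' b + J (\<xi>' b) \<Otimes> \<eta>" for \<eta> b
  have \<tau>T: "\<tau> \<eta> b \<in> T" if "\<eta> \<in> X" "b \<in> I" for \<eta> b
    unfolding \<tau>_def using formC_sym[OF C db_mem[OF db' that(2)] that(1)] .
  have d0: "y' b \<xi>0 = (if b = k0 then 1 else 0)" "y' b \<eta>1 = (if b = k1 then 1 else 0)" if "b \<in> I" for b
    using db_dual[OF db' that k(1)] db_dual[OF db' that k(2)] \<xi>' by auto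
  have ch: "chain T B y' (\<tau> \<xi>0) (\<tau> \<eta>1)"
    unfolding chain_def B_def
    using \<tau>T[OF \<xi>0] \<tau>T[OF \<eta>1(1)] ly \<eta>1(2) d0 db_dual[OF db']
    by (auto simp: \<tau>_def contr_add contr_tensor)
  have dB: "dimle (Tkers T B y') (Suc 0)" using chain_dimle[OF _ T ch, of "Suc 0"] dim' fin by (simp add: B_def)
  \<comment> \<open>Beyond the chain one dimension is left, but it would have to contain
    \<open>\<tau> \<xi>0 k1\<close>, which \<open>y' k1\<close> detects, and the line
    \<open>?L\<close>, which it does not.\<close>
  let ?L = "range (\<lambda>c. c \<star> x0 \<Otimes> \<xi>0)"
  have xT: "x0 \<Otimes> \<xi>0 \<in> Tkers T B y'" using x0 ly d0 by (auto simp: Tkers_def B_def contr_tensor)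
  have tT: "\<tau> \<xi>0 k1 \<in> Tkers T B y'"
    using \<tau>T[OF \<xi>0 k(2)] ly d0 \<xi>' k by (auto simp: Tkers_def B_def \<tau>_def contr_add contr_tensor)
  have "?L \<subseteq> Tkers T B y'" using xT sub_scl[OF T] ly by (auto simp: Tkers_def B_def contr_scl)
  moreover have "\<tau> \<xi>0 k1 \<notin> ?L"
  proof
    assume "\<tau> \<xi>0 k1 \<in> ?L"
    then obtain c where "\<tau> \<xi>0 k1 = c \<star> x0 \<Otimes> \<xi>0" by blast
    then have "contr (\<tau> \<xi>0 k1) (y' k1) = contr (c \<star> x0 \<Otimes> \<xi>0) (y' k1)" by simp
    then show False using nz d0[OF k(2)] \<xi>' k by (simp add: \<tau>_def contr_simps[OF ly[OF k(2)]])
  qed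
  ultimately have "dimle ?L 0" using dimle_drop[OF dB sub_line _ tT] by blast
  moreover have "x0 \<Otimes> \<xi>0 \<in> ?L" by (auto intro: image_eqI[of _ _ 1])
  ultimately have "x0 \<Otimes> \<xi>0 = 0" by (rule dimle_0)
  then show False using nz linm_0[OF J] by (auto simp: tensor_eq_0)
qed

text \<open>The part of the exceptional form on \<open>ker z\<close> that survives when the map there is neither a right
  multiplication nor of Type 1.\<close>

definition goodC :: "((nat \<Rightarrow> 'a) \<Rightarrow> 'a) \<Rightarrow> (nat \<Rightarrow> 'a) \<Rightarrow> ((nat \<Rightarrow> 'a) \<Rightarrow> nat \<Rightarrow> 'a) \<Rightarrow> ('a \<Rightarrow> 'a) \<Rightarrow> bool" where
  "goodC z x J \<alpha> \<longleftrightarrow> formC p (kerin X z) T F x J \<alpha> \<and>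
     (\<forall>\<xi>\<in>kerin X z. \<forall>\<eta>\<in>kerin X z. J \<eta> \<Otimes> \<xi> + J \<xi> \<Otimes> \<eta> \<in> T) \<and>
     (\<exists>\<xi>\<in>kerin X z. \<exists>\<eta>\<in>kerin X z. indep2 (J \<xi>) (J \<eta>)) \<and>
     (\<forall>\<xi>\<in>kerin X z. \<forall>x0. x0 \<Otimes> \<xi> \<in> T \<longrightarrow> x0 = 0 \<or> J \<xi> = 0)"

lemma goodC_form:
  assumes "goodC z x J \<alpha>"
  shows "x \<in> UU p" "linm J" "\<And>\<xi>. \<xi> \<in> kerin X z \<Longrightarrow> J \<xi> \<in> UU p"
    "\<And>a b. \<alpha> (a + b) = \<alpha> a + \<alpha> b" "\<And>a c. \<alpha> (c * c * a) = c * \<alpha> a" "\<exists>a. \<alpha> a \<noteq> 0"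
    "\<And>s \<xi>. s \<in> Ann T \<Longrightarrow> \<xi> \<in> kerin X z \<Longrightarrow> F s \<xi> = s (x \<Otimes> \<xi>) + \<alpha> (s (J \<xi> \<Otimes> \<xi>))"
  using assms by (auto simp: goodC_def formC_def rootlin_def)

lemma goodC_props:
  assumes "goodC z x J \<alpha>"
  shows "\<And>\<xi> \<eta>. \<xi> \<in> kerin X z \<Longrightarrow> \<eta> \<in> kerin X z \<Longrightarrow> J \<eta> \<Otimes> \<xi> + J \<xi> \<Otimes> \<eta> \<in> T"
    "\<exists>\<xi>\<in>kerin X z. \<exists>\<eta>\<in>kerin X z. indep2 (J \<xi>) (J \<eta>)"
    "\<And>\<xi> x0. \<xi> \<in> kerin X z \<Longrightarrow> x0 \<Otimes> \<xi> \<in> T \<Longrightarrow> x0 = 0 \<or> J \<xi> = 0"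
  using assms by (auto simp: goodC_def)

text \<open>\<open>J\<close> and \<open>\<alpha>\<close> may exchange a scalar without changing the
  form; this is used to give all hyperplanes the same \<open>\<alpha>\<close>.\<close>

lemma goodC_rescale:
  assumes g: "goodC z x J \<alpha>" and k: "k \<noteq> 0"
  shows "goodC z x (\<lambda>\<xi>. inverse k \<star> J \<xi>) (\<lambda>a. \<alpha> (k * a))"
proof -
  note G = goodC_form[OF g] and P = goodC_props[OF g]
  have sym: "(inverse k \<star> J \<eta>) \<Otimes> \<xi> + (inverse k \<star> J \<xi>) \<Otimes> \<eta> = inverse k \<star> (J \<eta> \<Otimes> \<xi> + J \<xi> \<Otimes> \<eta>)" for \<xi> \<eta>
    by (simp add: tensor_simps fs.scale_right_distrib)
  have "linm (\<lambda>\<xi>. inverse k \<star> J \<xi>)"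
    by (simp add: linm_def linm_add[OF G(2)] linm_scl[OF G(2)] fs.scale_right_distrib fs.scale_left_commute)
  moreover have "\<exists>a. \<alpha> (k * a) \<noteq> 0"
  proof -
    obtain a where "\<alpha> a \<noteq> 0" using G(6) by blast
    then have "\<alpha> (k * (inverse k * a)) \<noteq> 0" using k by (simp add: mult.assoc[symmetric])
    then show ?thesis by blast
  qed
  moreover have "rootlin (\<lambda>a. \<alpha> (k * a))"
    unfolding rootlin_def using G(4,5) by (metis distrib_left mult.left_commute)
  moreover have "F s \<xi> = s (x \<Otimes> \<xi>) + \<alpha> (k * s ((inverse k \<star> J \<xi>) \<Otimes> \<xi>))" if "s \<in> Ann T" "\<xi> \<in> kerin X z" for s \<xi>
    using G(7)[OF that] k by (simp add: tensor_simps lin_scl[OF AnnD(1)[OF that(1)]] mult.assoc[symmetric])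
  ultimately have "formC p (kerin X z) T F x (\<lambda>\<xi>. inverse k \<star> J \<xi>) (\<lambda>a. \<alpha> (k * a))"
    unfolding formC_def using G(1,3) sub_scl[OF sub_UU] by blast
  moreover have "\<exists>\<xi>\<in>kerin X z. \<exists>\<eta>\<in>kerin X z. indep2 (inverse k \<star> J \<xi>) (inverse k \<star> J \<eta>)"
  proof -
    obtain \<xi> \<eta> where \<xi>\<eta>: "\<xi> \<in> kerin X z" "\<eta> \<in> kerin X z" "indep2 (J \<xi>) (J \<eta>)" using P(2) by blast
    have "indep2 (inverse k \<star> J \<xi>) (inverse k \<star> J \<eta>)"
      unfolding indep2_def using indep2D[OF \<xi>\<eta>(3)] k by fastforce
    then show ?thesis using \<xi>\<eta> by blast
  qed
  ultimately show ?thesis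
    unfolding goodC_def sym using P(1,3) sub_scl[OF T] by auto
qed

text \<open>Both forms describe \<open>F\<close> on the common part of the hyperplanes, where no
  nonzero \<open>x0 \<Otimes> \<xi>\<close> lies in \<open>T\<close> unless \<open>J\<close>
  vanishes at \<open>\<xi>\<close>. So equal values of all \<open>s\<close> become equal vectors.
  The factor \<open>k\<close> is the same for all \<open>\<eta>\<close> because the nonzero
  \<open>\<alpha>2\<close> determines it.\<close>

lemma goodC_pair:
  assumes c01: "\<exists>c::'a. c \<noteq> 0 \<and> c \<noteq> 1" and db: "db I X \<xi> y" and ij: "i \<in> I" "j \<in> I" "i \<noteq> j"
    and g1: "goodC (y i) x1 J1 \<alpha>1" and g2: "goodC (y j) x2 J2 \<alpha>2"
  shows "x1 = x2 \<and> (\<exists>k. k \<noteq> 0 \<and> (\<forall>a. \<alpha>1 a = \<alpha>2 (k * a)) \<and> (\<forall>\<eta>\<in>X. y i \<eta> = 0 \<longrightarrow> y j \<eta> = 0 \<longrightarrow> J2 \<eta> = k \<star> J1 \<eta>))"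
proof -
  note G1 = goodC_form[OF g1] and G2 = goodC_form[OF g2]
  note P1 = goodC_props[OF g1] and P2 = goodC_props[OF g2]
  have \<alpha>0: "\<alpha>1 0 = 0" "\<alpha>2 0 = 0"
    using G1(5)[of 0 0] G2(5)[of 0 0] by simp_all
  obtain c :: 'a where c: "c \<noteq> 0" "c \<noteq> 1" using c01 by blast
  have lj: "lin (y j)" and li: "lin (y i)" using db_lin[OF db] ij by auto
  have \<xi>j: "\<xi> j \<in> kerin X (y i)" using db_mem[OF db ij(2)] db_dual[OF db ij(1,2)] ij(3) by (simp add: kerin_def)
  \<comment> \<open>If \<open>J1\<close> vanished on the common part, it would have rank at most one
    on \<open>ker (y i)\<close>.\<close>
  obtain \<zeta> where \<zeta>: "\<zeta> \<in> X" "y i \<zeta> = 0" "y j \<zeta> = 0" "J1 \<zeta> \<noteq> 0"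
  proof (rule ccontr)
    assume "\<not> thesis"
    then have z: "J1 \<eta> = 0" if "\<eta> \<in> X" "y i \<eta> = 0" "y j \<eta> = 0" for \<eta>
      using that \<open>\<And>\<zeta>. \<zeta> \<in> X \<Longrightarrow> y i \<zeta> = 0 \<Longrightarrow> y j \<zeta> = 0 \<Longrightarrow> J1 \<zeta> \<noteq> 0 \<Longrightarrow> thesis\<close> by blast
    have J1: "J1 \<eta> = y j \<eta> \<star> J1 (\<xi> j)" if \<eta>: "\<eta> \<in> kerin X (y i)" for \<eta>
    proof -
      have "J1 (\<eta> - y j \<eta> \<star> \<xi> j) = 0"
      proof (rule z)
        show "\<eta> - y j \<eta> \<star> \<xi> j \<in> X" using \<eta> \<xi>j sub_diff[OF X] sub_scl[OF X] by (simp add: kerin_def)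
        show "y i (\<eta> - y j \<eta> \<star> \<xi> j) = 0" using \<eta> \<xi>j by (simp add: kerin_def lin_simps[OF li])
        show "y j (\<eta> - y j \<eta> \<star> \<xi> j) = 0" using db_dual[OF db ij(2,2)] by (simp add: lin_simps[OF lj])
      qed
      moreover have "J1 \<eta> = J1 (\<eta> - y j \<eta> \<star> \<xi> j) + y j \<eta> \<star> J1 (\<xi> j)"
        using linm_add[OF G1(2), of "\<eta> - y j \<eta> \<star> \<xi> j" "y j \<eta> \<star> \<xi> j"] linm_scl[OF G1(2)] by simp
      ultimately show ?thesis by simp
    qed
    obtain \<eta> \<eta>' where \<eta>: "\<eta> \<in> kerin X (y i)" "\<eta>' \<in> kerin X (y i)" "indep2 (J1 \<eta>) (J1 \<eta>')" using P1(2) by blast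
    have "y j \<eta>' \<star> J1 \<eta> + (- y j \<eta>) \<star> J1 \<eta>' = 0"
      unfolding J1[OF \<eta>(1)] J1[OF \<eta>(2)] by (simp add: fun_eq_iff)
    from indep2D[OF \<eta>(3) this] have "y j \<eta> = 0" by simp
    then have "J1 \<eta> = 0" using J1[OF \<eta>(1)] by simp
    then show False using indep2_nonzero(1)[OF \<eta>(3)] by simp
  qed
  have kers: "\<eta> \<in> kerin X (y i)" "\<eta> \<in> kerin X (y j)" if "\<eta> \<in> X" "y i \<eta> = 0" "y j \<eta> = 0" for \<eta>
    using that by (auto simp: kerin_def)
  have x12: "x1 = x2"
  proof (rule ccontr)
    assume ne: "x1 \<noteq> x2"
    have "(x1 - x2) \<Otimes> \<zeta> \<in> T"
    proof (rule mem_if_Ann_vanishes[OF T])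
      fix s assume s: "s \<in> Ann T"
      have s': "(c * c) \<star> s \<in> Ann T" using sub_scl[OF sub_Ann s] .
      \<comment> \<open>This combination cancels the term with \<open>\<alpha>1\<close> and isolates
        the right multiplication.\<close>
      have "F ((c * c) \<star> s) \<zeta> - c * F s \<zeta> = (c * c - c) * s (x1 \<Otimes> \<zeta>)"
        using G1(7)[OF s kers(1)[OF \<zeta>(1-3)]] G1(7)[OF s' kers(1)[OF \<zeta>(1-3)]] G1(5)[of c "s (J1 \<zeta> \<Otimes> \<zeta>)"]
        by (simp add: algebra_simps)
      moreover have "F ((c * c) \<star> s) \<zeta> - c * F s \<zeta> = (c * c - c) * s (x2 \<Otimes> \<zeta>)"
        using G2(7)[OF s kers(2)[OF \<zeta>(1-3)]] G2(7)[OF s' kers(2)[OF \<zeta>(1-3)]] G2(5)[of c "s (J2 \<zeta> \<Otimes> \<zeta>)"]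
        by (simp add: algebra_simps)
      ultimately have "(c * c - c) * s (x1 \<Otimes> \<zeta>) = (c * c - c) * s (x2 \<Otimes> \<zeta>)" by (rule trans[OF sym])
      moreover have "c * c - c \<noteq> 0" using c by simp
      ultimately have "s (x1 \<Otimes> \<zeta>) = s (x2 \<Otimes> \<zeta>)" by simp
      then show "s ((x1 - x2) \<Otimes> \<zeta>) = 0" by (simp add: tensor_simps lin_diff[OF AnnD(1)[OF s]])
    qed
    from P1(3)[OF kers(1)[OF \<zeta>(1-3)] this] show False using ne \<zeta>(4) by simp
  qed
  have eq: "\<alpha>1 (s (J1 \<eta> \<Otimes> \<eta>)) = \<alpha>2 (s (J2 \<eta> \<Otimes> \<eta>))" if s: "s \<in> Ann T" and \<eta>: "\<eta> \<in> X" "y i \<eta> = 0" "y j \<eta> = 0" for s \<eta>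
    using G1(7)[OF s kers(1)[OF \<eta>]] G2(7)[OF s kers(2)[OF \<eta>]] x12 by simp
  have notT: "J1 \<eta> \<Otimes> \<eta> \<notin> T" if "\<eta> \<in> X" "y i \<eta> = 0" "y j \<eta> = 0" "J1 \<eta> \<noteq> 0" for \<eta>
    using P1(3)[OF kers(1)[OF that(1-3)]] that(4) by blast
  have zero_of: "J2 \<eta> \<Otimes> \<eta> \<in> T \<Longrightarrow> J2 \<eta> = 0" if "\<eta> \<in> X" "y i \<eta> = 0" "y j \<eta> = 0" for \<eta>
    using P2(3)[OF kers(2)[OF that]] by blast
  have J1zero: "J2 \<eta> = 0" if \<eta>: "\<eta> \<in> X" "y i \<eta> = 0" "y j \<eta> = 0" and z: "J1 \<eta> = 0" for \<eta>
  proof (rule zero_of[OF \<eta>], rule mem_if_Ann_vanishes[OF T])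
    fix s assume s: "s \<in> Ann T"
    show "s (J2 \<eta> \<Otimes> \<eta>) = 0"
    proof (rule ccontr)
      assume nz: "s (J2 \<eta> \<Otimes> \<eta>) \<noteq> 0"
      have "\<alpha>2 a = 0" for a
        using eq[OF sub_scl[OF sub_Ann s] \<eta>, of "a / s (J2 \<eta> \<Otimes> \<eta>)"] nz z lin_0[OF AnnD(1)[OF s]] by (simp add: \<alpha>0)
      then show False using G2(6) by blast
    qed
  qed
  have ex: "\<exists>k. k \<noteq> 0 \<and> (\<forall>a. \<alpha>1 a = \<alpha>2 (k * a)) \<and> J2 \<eta> = k \<star> J1 \<eta>"
    if \<eta>: "\<eta> \<in> X" "y i \<eta> = 0" "y j \<eta> = 0" "J1 \<eta> \<noteq> 0" for \<eta>
  proof -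
    have van: "s (J2 \<eta> \<Otimes> \<eta>) = 0" if s: "s \<in> Ann T" and z: "s (J1 \<eta> \<Otimes> \<eta>) = 0" for s
    proof (rule ccontr)
      assume nz: "s (J2 \<eta> \<Otimes> \<eta>) \<noteq> 0"
      have "\<alpha>2 a = 0" for a
        using eq[OF sub_scl[OF sub_Ann s] \<eta>(1-3), of "a / s (J2 \<eta> \<Otimes> \<eta>)"] nz z by (simp add: \<alpha>0)
      then show False using G2(6) by blast
    qed
    obtain k where k: "J2 \<eta> \<Otimes> \<eta> - k \<star> J1 \<eta> \<Otimes> \<eta> \<in> T" using mem_mod_line[of "J1 \<eta> \<Otimes> \<eta>" "J2 \<eta> \<Otimes> \<eta>"] van by blast
    then have mem: "(J2 \<eta> - k \<star> J1 \<eta>) \<Otimes> \<eta> \<in> T" by (simp add: tensor_simps)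
    have J2: "J2 \<eta> = k \<star> J1 \<eta>" using P1(3)[OF kers(1)[OF \<eta>(1-3)] mem] \<eta>(4) by simp
    obtain s where s: "s \<in> Ann T" "s (J1 \<eta> \<Otimes> \<eta>) = 1" using Ann_separates[OF T notT[OF \<eta>]] by blast
    have \<alpha>: "\<alpha>1 a = \<alpha>2 (k * a)" for a
    proof -
      have "\<alpha>1 ((a \<star> s) (J1 \<eta> \<Otimes> \<eta>)) = \<alpha>2 ((a \<star> s) (J2 \<eta> \<Otimes> \<eta>))" by (rule eq[OF sub_scl[OF sub_Ann s(1)] \<eta>(1-3)])
      then show ?thesis by (simp add: J2 tensor_simps lin_scl[OF AnnD(1)[OF s(1)]] s(2) mult.commute)
    qed
    have "k \<noteq> 0" using \<alpha> G1(6) \<alpha>0 by fastforce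
    then show ?thesis using \<alpha> J2 by blast
  qed
  obtain k where k: "k \<noteq> 0" "\<And>a. \<alpha>1 a = \<alpha>2 (k * a)" using ex[OF \<zeta>] by blast
  have "J2 \<eta> = k \<star> J1 \<eta>" if \<eta>: "\<eta> \<in> X" "y i \<eta> = 0" "y j \<eta> = 0" for \<eta>
  proof (cases "J1 \<eta> = 0")
    case True
    then show ?thesis using J1zero[OF \<eta>] by simp
  next
    case False
    obtain k' where k': "\<And>a. \<alpha>1 a = \<alpha>2 (k' * a)" "J2 \<eta> = k' \<star> J1 \<eta>" using ex[OF \<eta> False] by blast
    \<comment> \<open>Two different factors would make \<open>\<alpha>2\<close> vanish at all
      multiples of \<open>k' - k\<close>, that is everywhere.\<close>
    have "k' = k"
    proof (rule ccontr)
      assume ne: "k' \<noteq> k"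
      have "\<alpha>2 a = 0" for a
      proof -
        let ?b = "a / (k' - k)"
        have "k' * ?b = k * ?b + a" using ne by (simp add: field_simps)
        then have "\<alpha>2 (k' * ?b) = \<alpha>2 (k * ?b) + \<alpha>2 a" using G2(4) by metis
        then show ?thesis using k(2)[of ?b] k'(1)[of ?b] by simp
      qed
      then show False using G2(6) by blast
    qed
    then show ?thesis using k'(2) by simp
  qed
  then show ?thesis using x12 k by blast
qed

text \<open>After rescaling, the three forms share \<open>x\<close> and \<open>\<alpha>\<close> and
  agree on intersections. \<open>J\<close> is assembled from the first two. The third one is needed
  for the mixed term of \<open>\<xi> k1\<close> and \<open>\<xi> k2\<close>, which lie together in
  neither of the first two hyperplanes.\<close>

lemma typeC_glue:
  assumes two: "(2::'a) = 0" and c01: "\<exists>c::'a. c \<noteq> 0 \<and> c \<noteq> 1" and db: "db I X \<xi> y"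
    and k: "k1 \<in> I" "k2 \<in> I" "k3 \<in> I" "k1 \<noteq> k2" "k1 \<noteq> k3" "k2 \<noteq> k3"
    and g: "goodC (y k1) x1 J1 \<alpha>1" "goodC (y k2) x2 J2 \<alpha>2" "goodC (y k3) x3 J3 \<alpha>3"
  shows "typeC p X T F"
proof -
  obtain a where a: "a \<noteq> 0" "\<And>b. \<alpha>1 b = \<alpha>2 (a * b)" and x12: "x1 = x2"
    and J12: "\<And>\<eta>. \<eta> \<in> X \<Longrightarrow> y k1 \<eta> = 0 \<Longrightarrow> y k2 \<eta> = 0 \<Longrightarrow> J2 \<eta> = a \<star> J1 \<eta>"
    using goodC_pair[OF c01 db k(1,2,4) g(1,2)] by blast
  obtain a' where a': "a' \<noteq> 0" "\<And>b. \<alpha>1 b = \<alpha>3 (a' * b)" and x13: "x1 = x3"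
    and J13: "\<And>\<eta>. \<eta> \<in> X \<Longrightarrow> y k1 \<eta> = 0 \<Longrightarrow> y k3 \<eta> = 0 \<Longrightarrow> J3 \<eta> = a' \<star> J1 \<eta>"
    using goodC_pair[OF c01 db k(1,3,5) g(1,3)] by blast
  define L2 where "L2 \<eta> = inverse a \<star> J2 \<eta>" for \<eta>
  define L3 where "L3 \<eta> = inverse a' \<star> J3 \<eta>" for \<eta>
  define x where "x = x1"
  define \<alpha> where "\<alpha> = \<alpha>1"
  have g1: "goodC (y k1) x J1 \<alpha>" using g(1) by (simp add: x_def \<alpha>_def)
  have g2: "goodC (y k2) x L2 \<alpha>"
  proof -
    have "(\<lambda>b. \<alpha>2 (a * b)) = \<alpha>1" using a(2) by (simp add: fun_eq_iff)
    then show ?thesis using goodC_rescale[OF g(2) a(1)] by (simp add: x_def x12 \<alpha>_def L2_def[abs_def])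
  qed
  have g3: "goodC (y k3) x L3 \<alpha>"
  proof -
    have "(\<lambda>b. \<alpha>3 (a' * b)) = \<alpha>1" using a'(2) by (simp add: fun_eq_iff)
    then show ?thesis using goodC_rescale[OF g(3) a'(1)] by (simp add: x_def x13 \<alpha>_def L3_def[abs_def])
  qed
  note G1 = goodC_form[OF g1] and G2 = goodC_form[OF g2] and G3 = goodC_form[OF g3]
  have L12: "L2 \<eta> = J1 \<eta>" if "\<eta> \<in> X" "y k1 \<eta> = 0" "y k2 \<eta> = 0" for \<eta>
    unfolding L2_def J12[OF that] using a(1) by simp
  have L13: "L3 \<eta> = J1 \<eta>" if "\<eta> \<in> X" "y k1 \<eta> = 0" "y k3 \<eta> = 0" for \<eta>
    unfolding L3_def J13[OF that] using a'(1) by simp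
  have L23: "L3 \<eta> = L2 \<eta>" if \<eta>: "\<eta> \<in> X" "y k2 \<eta> = 0" "y k3 \<eta> = 0" for \<eta>
  proof -
    obtain d where d: "\<And>b. \<alpha> b = \<alpha> (d * b)" "L3 \<eta> = d \<star> L2 \<eta>"
      using goodC_pair[OF c01 db k(2,3,6) g2 g3] \<eta> by blast
    \<comment> \<open>Both forms now carry the same \<open>\<alpha>\<close>, which determines the
      factor.\<close>
    have "d = 1"
    proof (rule ccontr)
      assume ne: "d \<noteq> 1"
      have "\<alpha> b = 0" for b
      proof -
        let ?b = "b / (d - 1)"
        have "d * ?b = ?b + b" using ne by (simp add: field_simps)
        then have "\<alpha> (d * ?b) = \<alpha> ?b + \<alpha> b" using G1(4) by metis
        then show ?thesis using d(1)[of ?b] by simp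
      qed
      then show False using G1(6) by blast
    qed
    then show ?thesis using d(2) by simp
  qed
  have ly: "lin (y k1)" "lin (y k2)" "lin (y k3)" using db_lin[OF db] k by auto
  have \<xi>X: "\<xi> k1 \<in> X" "\<xi> k2 \<in> X" using db_mem[OF db] k by auto
  have dual: "y k1 (\<xi> k1) = 1" "y k2 (\<xi> k1) = 0" "y k3 (\<xi> k1) = 0" "y k1 (\<xi> k2) = 0" "y k2 (\<xi> k2) = 1" "y k3 (\<xi> k2) = 0"
    using db_dual[OF db] k by auto
  \<comment> \<open>The first hyperplane and the vector \<open>\<xi> k1\<close>, which lies in the
    other two, generate \<open>X\<close>.\<close>
  define J where "J \<eta> = J1 (\<eta> - y k1 \<eta> \<star> \<xi> k1) + y k1 \<eta> \<star> L2 (\<xi> k1)" for \<eta>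
  have J: "linm J"
  proof -
    have 1: "u + v - y k1 (u + v) \<star> \<xi> k1 = (u - y k1 u \<star> \<xi> k1) + (v - y k1 v \<star> \<xi> k1)" for u v
      by (simp add: fun_eq_iff lin_add[OF ly(1)] algebra_simps)
    have 2: "c \<star> u - y k1 (c \<star> u) \<star> \<xi> k1 = c \<star> (u - y k1 u \<star> \<xi> k1)" for c u
      by (simp add: fun_eq_iff lin_scl[OF ly(1)] algebra_simps)
    show ?thesis
      unfolding linm_def
    proof (intro conjI allI)
      show "J (u + v) = J u + J v" for u v
        unfolding J_def 1 unfolding linm_add[OF G1(2)] lin_add[OF ly(1)]
        by (simp add: fs.scale_left_distrib)
      show "J (c \<star> u) = c \<star> J u" for c u
        unfolding J_def 2 unfolding linm_scl[OF G1(2)] lin_scl[OF ly(1)]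
        by (simp add: fs.scale_right_distrib)
    qed
  qed
  have JJ1: "J \<eta> = J1 \<eta>" if "y k1 \<eta> = 0" for \<eta> using that by (simp add: J_def)
  have proj: "\<eta> - y k1 \<eta> \<star> \<xi> k1 \<in> X" "y k1 (\<eta> - y k1 \<eta> \<star> \<xi> k1) = 0" if "\<eta> \<in> X" for \<eta>
    using that \<xi>X sub_diff[OF X] sub_scl[OF X] dual by (auto simp: lin_simps[OF ly(1)])
  have JL2: "J \<eta> = L2 \<eta>" if \<eta>: "\<eta> \<in> X" "y k2 \<eta> = 0" for \<eta>
  proof -
    have "L2 (\<eta> - y k1 \<eta> \<star> \<xi> k1) = J1 (\<eta> - y k1 \<eta> \<star> \<xi> k1)"
      using proj[OF \<eta>(1)] \<eta>(2) dual by (intro L12) (simp_all add: lin_simps[OF ly(2)])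
    moreover have "L2 \<eta> = L2 (\<eta> - y k1 \<eta> \<star> \<xi> k1) + y k1 \<eta> \<star> L2 (\<xi> k1)"
      using linm_add[OF G2(2), of "\<eta> - y k1 \<eta> \<star> \<xi> k1" "y k1 \<eta> \<star> \<xi> k1"] linm_scl[OF G2(2)] by simp
    ultimately show ?thesis by (simp add: J_def)
  qed
  have JL3: "J \<eta> = L3 \<eta>" if \<eta>: "\<eta> \<in> X" "y k3 \<eta> = 0" for \<eta>
  proof -
    have "L3 (\<eta> - y k1 \<eta> \<star> \<xi> k1) = J1 (\<eta> - y k1 \<eta> \<star> \<xi> k1)"
      using proj[OF \<eta>(1)] \<eta>(2) dual by (intro L13) (simp_all add: lin_simps[OF ly(3)])
    moreover have "L3 (\<xi> k1) = L2 (\<xi> k1)" using \<xi>X dual by (intro L23) auto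
    moreover have "L3 \<eta> = L3 (\<eta> - y k1 \<eta> \<star> \<xi> k1) + y k1 \<eta> \<star> L3 (\<xi> k1)"
      using linm_add[OF G3(2), of "\<eta> - y k1 \<eta> \<star> \<xi> k1" "y k1 \<eta> \<star> \<xi> k1"] linm_scl[OF G3(2)] by simp
    ultimately show ?thesis by (simp add: J_def)
  qed
  have JU: "J \<eta> \<in> UU p" if "\<eta> \<in> X" for \<eta>
    unfolding J_def using proj[OF that] \<xi>X dual
    by (intro sub_add[OF sub_UU] sub_scl[OF sub_UU] G1(3) G2(3)) (simp_all add: kerin_def)
  have sym2: "J \<eta> \<Otimes> \<zeta> + J \<zeta> \<Otimes> \<eta> \<in> T" if "\<eta> \<in> X" "\<zeta> \<in> X" "y k2 \<eta> = 0" "y k2 \<zeta> = 0" for \<eta> \<zeta>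
    using goodC_props(1)[OF g2, of \<zeta> \<eta>] that JL2 by (simp add: kerin_def)
  have sym3: "J \<eta> \<Otimes> \<zeta> + J \<zeta> \<Otimes> \<eta> \<in> T" if "\<eta> \<in> X" "\<zeta> \<in> X" "y k3 \<eta> = 0" "y k3 \<zeta> = 0" for \<eta> \<zeta>
    using goodC_props(1)[OF g3, of \<zeta> \<eta>] that JL3 by (simp add: kerin_def)
  have F: "F s \<eta> = s (x \<Otimes> \<eta>) + \<alpha> (s (J \<eta> \<Otimes> \<eta>))" if s: "s \<in> Ann T" and \<eta>: "\<eta> \<in> X" for s \<eta>
  proof -
    have ls: "lin s" using AnnD(1)[OF s] .
    let ?c = "y k1 \<eta>"
    define \<eta>1 where "\<eta>1 = \<eta> - ?c \<star> \<xi> k1"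
    define \<eta>2 where "\<eta>2 = \<eta>1 - y k2 \<eta>1 \<star> \<xi> k2"
    have \<eta>eq: "\<eta> = \<eta>1 + ?c \<star> \<xi> k1" by (simp add: \<eta>1_def)
    have \<eta>1eq: "\<eta>1 = \<eta>2 + y k2 \<eta>1 \<star> \<xi> k2" by (simp add: \<eta>2_def)
    have \<eta>1: "\<eta>1 \<in> X" "y k1 \<eta>1 = 0" unfolding \<eta>1_def using proj[OF \<eta>] by auto
    have \<eta>2: "\<eta>2 \<in> X" "y k2 \<eta>2 = 0"
      unfolding \<eta>2_def using \<eta>1(1) \<xi>X sub_diff[OF X] sub_scl[OF X] dual by (auto simp: lin_simps[OF ly(2)])
    have e2: "s (J \<eta>2 \<Otimes> \<xi> k1) + s (J (\<xi> k1) \<Otimes> \<eta>2) = 0"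
      using AnnD(2)[OF s sym2[OF \<eta>2(1) \<xi>X(1) \<eta>2(2)]] dual by (simp add: lin_add[OF ls])
    have e3: "s (J (\<xi> k2) \<Otimes> \<xi> k1) + s (J (\<xi> k1) \<Otimes> \<xi> k2) = 0"
      using AnnD(2)[OF s sym3[OF \<xi>X(2,1)]] dual by (simp add: lin_add[OF ls])
    have J\<eta>1: "J \<eta>1 = J \<eta>2 + y k2 \<eta>1 \<star> J (\<xi> k2)" by (subst \<eta>1eq) (simp only: linm_add[OF J] linm_scl[OF J])
    have t\<eta>1: "s (J (\<xi> k1) \<Otimes> \<eta>1) = s (J (\<xi> k1) \<Otimes> \<eta>2) + y k2 \<eta>1 * s (J (\<xi> k1) \<Otimes> \<xi> k2)"
      by (subst \<eta>1eq) (simp only: tensor_simps lin_add[OF ls] lin_scl[OF ls])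
    have "s (J \<eta>1 \<Otimes> \<xi> k1) + s (J (\<xi> k1) \<Otimes> \<eta>1)
        = (s (J \<eta>2 \<Otimes> \<xi> k1) + s (J (\<xi> k1) \<Otimes> \<eta>2)) + y k2 \<eta>1 * (s (J (\<xi> k2) \<Otimes> \<xi> k1) + s (J (\<xi> k1) \<Otimes> \<xi> k2))"
      unfolding J\<eta>1 t\<eta>1 by (simp add: tensor_simps lin_simps[OF ls] algebra_simps)
    then have cross: "s (J \<eta>1 \<Otimes> \<xi> k1) + s (J (\<xi> k1) \<Otimes> \<eta>1) = 0" unfolding e2 e3 by simp
    have "s (J \<eta> \<Otimes> \<eta>) = s (J (\<eta>1 + ?c \<star> \<xi> k1) \<Otimes> (\<eta>1 + ?c \<star> \<xi> k1))" using \<eta>eq by simp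
    also have "\<dots> = s (J \<eta>1 \<Otimes> \<eta>1) + ?c * ?c * s (J (\<xi> k1) \<Otimes> \<xi> k1) + ?c * (s (J \<eta>1 \<Otimes> \<xi> k1) + s (J (\<xi> k1) \<Otimes> \<eta>1))"
      by (simp add: linm_add[OF J] linm_scl[OF J] tensor_simps lin_simps[OF ls] algebra_simps)
    finally have "s (J \<eta> \<Otimes> \<eta>) = s (J \<eta>1 \<Otimes> \<eta>1) + ?c * ?c * s (J (\<xi> k1) \<Otimes> \<xi> k1)" unfolding cross by simp
    then have \<alpha>eq: "\<alpha> (s (J \<eta> \<Otimes> \<eta>)) = \<alpha> (s (J \<eta>1 \<Otimes> \<eta>1)) + ?c * \<alpha> (s (J (\<xi> k1) \<Otimes> \<xi> k1))"
      by (simp only: G1(4,5))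
    have F1: "F s \<eta>1 = s (x \<Otimes> \<eta>1) + \<alpha> (s (J \<eta>1 \<Otimes> \<eta>1))"
      using G1(7)[OF s, of \<eta>1] \<eta>1 JJ1 by (simp add: kerin_def)
    have F2: "F s (\<xi> k1) = s (x \<Otimes> \<xi> k1) + \<alpha> (s (J (\<xi> k1) \<Otimes> \<xi> k1))"
      using G2(7)[OF s, of "\<xi> k1"] \<xi>X JL2 dual by (simp add: kerin_def)
    have "F s \<eta> = F s \<eta>1 + ?c * F s (\<xi> k1)"
      using lin_add[OF linF[OF s], of \<eta>1 "?c \<star> \<xi> k1"] \<eta>eq by (simp add: lin_scl[OF linF[OF s]])
    moreover have "s (x \<Otimes> \<eta>) = s (x \<Otimes> \<eta>1) + ?c * s (x \<Otimes> \<xi> k1)"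
      by (subst \<eta>eq) (simp add: tensor_simps lin_simps[OF ls])
    ultimately show ?thesis unfolding F1 F2 \<alpha>eq by (simp add: algebra_simps)
  qed
  have "rootlin \<alpha>" using G1(4,5) by (simp add: rootlin_def)
  then have "formC p X T F x J \<alpha>" unfolding formC_def using G1(1,6) J JU F by blast
  then show ?thesis using two unfolding typeC_def by blast
qed

end

subsection \<open>Two distinct planes of rank-one tensors\<close>

text \<open>The kernel of \<open>a1\<close>, \<open>b1\<close> has codimension two and the smaller
  one at most two, so they are equal: \<open>a1\<close>, \<open>b1\<close> are combinations of
  \<open>a2\<close>, \<open>b2\<close>, and independence makes the coefficient matrix
  invertible.\<close>

lemma codim_two_incl:
  assumes X: "sub X" and l: "lin a1" "lin b1" "lin a2" "lin b2" and ind: "indX X a1 b1"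
    and inc: "\<And>\<xi>. \<xi> \<in> X \<Longrightarrow> a2 \<xi> = 0 \<Longrightarrow> b2 \<xi> = 0 \<Longrightarrow> a1 \<xi> = 0 \<and> b1 \<xi> = 0"
    and \<zeta>: "\<zeta> \<in> X" "a1 \<zeta> = 0" "b1 \<zeta> = 0"
  shows "a2 \<zeta> = 0 \<and> b2 \<zeta> = 0"
proof -
  obtain \<alpha> \<beta> where 1: "\<And>\<xi>. \<xi> \<in> X \<Longrightarrow> a1 \<xi> = \<alpha> * a2 \<xi> + \<beta> * b2 \<xi>"
    using lin_proportional2[OF X l(1,3,4)] inc by metis
  obtain \<gamma> \<delta> where 2: "\<And>\<xi>. \<xi> \<in> X \<Longrightarrow> b1 \<xi> = \<gamma> * a2 \<xi> + \<delta> * b2 \<xi>"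
    using lin_proportional2[OF X l(2,3,4)] inc by metis
  let ?d = "\<alpha> * \<delta> - \<beta> * \<gamma>"
  have d: "?d \<noteq> 0"
  proof
    assume d0: "?d = 0"
    have eq: "\<alpha> * \<delta> = \<beta> * \<gamma>" using d0 by simp
    have "\<delta> * a1 \<xi> + (- \<beta>) * b1 \<xi> = 0" if "\<xi> \<in> X" for \<xi>
    proof -
      have "\<delta> * a1 \<xi> + (- \<beta>) * b1 \<xi> = ?d * a2 \<xi>" unfolding 1[OF that] 2[OF that] by (simp add: algebra_simps)
      then show ?thesis using d0 by simp
    qed
    from indXD[OF ind this] have "\<delta> = 0" "\<beta> = 0" by auto
    have "\<gamma> * a1 \<xi> + (- \<alpha>) * b1 \<xi> = 0" if "\<xi> \<in> X" for \<xi>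
    proof -
      have "\<gamma> * a1 \<xi> + (- \<alpha>) * b1 \<xi> = - ?d * b2 \<xi>" unfolding 1[OF that] 2[OF that] by (simp add: algebra_simps)
      then show ?thesis using d0 by simp
    qed
    from indXD[OF ind this] have "\<gamma> = 0" "\<alpha> = 0" by auto
    then have "1 * a1 \<xi> + 0 * b1 \<xi> = 0" if "\<xi> \<in> X" for \<xi> using 1[OF that] \<open>\<beta> = 0\<close> by simp
    from indXD[OF ind this] show False by simp
  qed
  have "?d * a2 \<zeta> = \<delta> * a1 \<zeta> - \<beta> * b1 \<zeta>" "?d * b2 \<zeta> = \<alpha> * b1 \<zeta> - \<gamma> * a1 \<zeta>"
    unfolding 1[OF \<zeta>(1)] 2[OF \<zeta>(1)] by (simp_all add: algebra_simps)
  then have "?d * a2 \<zeta> = 0" "?d * b2 \<zeta> = 0" using \<zeta> by simp_all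
  then show ?thesis using d by simp
qed

lemma db_two_fun:
  assumes db: "db I X \<xi> y" and X: "sub X" and l: "lin a" "lin b" and ind: "indX X a b"
  obtains k1 k2 \<xi>' y' where "k1 \<in> I" "k2 \<in> I" "k1 \<noteq> k2" "db I X \<xi>' y'" "y' k1 = a" "y' k2 = b"
proof -
  have "\<exists>\<eta>\<in>X. a \<eta> \<noteq> 0" using indXD[OF ind, of 1 0] by auto
  then obtain k1 where k1: "k1 \<in> I" "a (\<xi> k1) \<noteq> 0" using db_ex_nonzero[OF db l(1)] by blast
  obtain \<xi>1 where db1: "db I X \<xi>1 (y(k1 := a))" using db_fun_exchange[OF db X k1(1) l(1) k1(2)] .
  have "\<exists>k2\<in>I - {k1}. b (\<xi>1 k2) \<noteq> 0"
  proof (rule ccontr)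
    assume no: "\<not> (\<exists>k2\<in>I - {k1}. b (\<xi>1 k2) \<noteq> 0)"
    have "b (\<xi>1 k1) * a \<eta> + (-1) * b \<eta> = 0" if \<eta>: "\<eta> \<in> X" for \<eta>
    proof -
      have "b \<eta> = (b (\<xi>1 k1) \<star> a) \<eta>"
      proof (rule db_eq_lin[OF db1 l(2) _ _ \<eta>])
        show "lin (b (\<xi>1 k1) \<star> a)" using l(1) by blast
        fix i assume i: "i \<in> I"
        show "b (\<xi>1 i) = (b (\<xi>1 k1) \<star> a) (\<xi>1 i)"
          using no i db_dual[OF db1 k1(1) i] by (cases "i = k1") auto
      qed
      then show ?thesis by simp
    qed
    from indXD[OF ind this] show False by simp
  qed
  then obtain k2 where k2: "k2 \<in> I" "k2 \<noteq> k1" "b (\<xi>1 k2) \<noteq> 0" by blast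
  obtain \<xi>2 where "db I X \<xi>2 ((y(k1 := a))(k2 := b))" using db_fun_exchange[OF db1 X k2(1) l(2) k2(3)] .
  then show thesis using that[of k1 k2 \<xi>2 "(y(k1 := a))(k2 := b)"] k1 k2 by simp
qed

text \<open>The maps \<open>(v\<^sub>1, v\<^sub>2) \<mapsto> \<lambda> v\<^sub>1 + \<mu> v\<^sub>2\<close> with \<open>\<lambda>\<close>, \<open>\<mu>\<close> depending on the argument, on a subspace of
  dimension at least three of \<open>P\<^sub>1 \<times> P\<^sub>2\<close>, where \<open>P\<^sub>1\<close>, \<open>P\<^sub>2\<close> are distinct planes with bases
  \<open>w\<^sub>1, a\<close> and \<open>w\<^sub>2, b\<close>: additivity forces \<open>\<lambda>\<close> and \<open>\<mu>\<close> to be constant.\<close>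

lemma two_planes_shift:
  fixes v2 :: "'a::field"
  assumes "v3 = v2 + g" "v3 = l * ((- c + 1) * w) + m * (W + (u + K) * b)" "v2 = l * (- c * w) + m * (W + u * b)"
  shows "m * (K * b) = g - l * w"
proof -
  have "l * (- c * w) + m * (W + u * b) + g = l * ((- c + 1) * w) + m * (W + (u + K) * b)"
    using assms by simp
  then show ?thesis by (simp add: algebra_simps)
qed

text \<open>The coordinates are those of \<open>v1 = p w1 + q a\<close> and
  \<open>v2 = r w2 + u b\<close>, and \<open>rel\<close> is the linear condition cutting out the
  subspace. The test vector \<open>\<xi>2\<close> will see only \<open>p\<close>, and
  \<open>\<xi>1\<close> only \<open>r\<close>, so the two scalars are
  \<open>f p q r u \<xi>2 / p\<close> and \<open>f p q r u \<xi>1 / r\<close>; their constancy is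
  first shown where \<open>p\<close> and \<open>r\<close> are nonzero.\<close>

lemma two_planes_core:
  fixes f :: "'a::field \<Rightarrow> 'a \<Rightarrow> 'a \<Rightarrow> 'a \<Rightarrow> (nat \<Rightarrow> 'a) \<Rightarrow> 'a"
  defines "rel A B C D p q r u \<equiv> A * p + B * q + C * r + D * u = 0"
  assumes c01: "\<exists>c::'a. c \<noteq> 0 \<and> c \<noteq> 1"
    and add: "\<And>p q r u p' q' r' u' \<xi>. rel A B C D p q r u \<Longrightarrow> rel A B C D p' q' r' u' \<Longrightarrow> \<xi> \<in> X \<Longrightarrow>
        f (p + p') (q + q') (r + r') (u + u') \<xi> = f p q r u \<xi> + f p' q' r' u' \<xi>"
    and comb: "\<And>p q r u \<xi>. rel A B C D p q r u \<Longrightarrow> p \<noteq> 0 \<Longrightarrow> r \<noteq> 0 \<Longrightarrow> \<xi> \<in> X \<Longrightarrow>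
        f p q r u \<xi> = f p q r u \<xi>2 / p * (p * w1 \<xi> + q * a \<xi>) + f p q r u \<xi>1 / r * (r * w2 \<xi> + u * b \<xi>)"
    and \<xi>12: "\<xi>1 \<in> X" "\<xi>2 \<in> X"
    and z2: "\<And>q r u. rel A B C D 0 q r u \<Longrightarrow> f 0 q r u \<xi>2 = 0"
    and z1: "\<And>p q u. rel A B C D p q 0 u \<Longrightarrow> f p q 0 u \<xi>1 = 0"
    and a: "\<exists>\<xi>\<in>X. a \<xi> \<noteq> 0" and b: "\<exists>\<xi>\<in>X. b \<xi> \<noteq> 0"
    and nd: "A = 0 \<and> B = 0 \<longleftrightarrow> C = 0 \<and> D = 0"
  shows "\<exists>l m. \<forall>p q r u. rel A B C D p q r u \<longrightarrow> (\<forall>\<xi>\<in>X. f p q r u \<xi> = l * (p * w1 \<xi> + q * a \<xi>) + m * (r * w2 \<xi> + u * b \<xi>))"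
proof -
  let ?R = "rel A B C D"
  have Radd: "?R (p + p') (q + q') (r + r') (u + u')" if "?R p q r u" "?R p' q' r' u'" for p q r u p' q' r' u'
  proof -
    have "A * (p + p') + B * (q + q') + C * (r + r') + D * (u + u')
      = (A * p + B * q + C * r + D * u) + (A * p' + B * q' + C * r' + D * u')" by (simp add: algebra_simps)
    then show ?thesis using that by (simp add: rel_def)
  qed
  have Rscl: "?R (c * p) (c * q) (c * r) (c * u)" if "?R p q r u" for c p q r u
  proof -
    have "A * (c * p) + B * (c * q) + C * (c * r) + D * (c * u) = c * (A * p + B * q + C * r + D * u)"
      by (simp add: algebra_simps)
    then show ?thesis using that by (simp add: rel_def)
  qed
  have Rneg: "?R (- p) (- q) (- r) (- u)" if "?R p q r u" for p q r u
    using Rscl[OF that, of "-1"] by simp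
  have fdiff: "f p q r u \<xi> = f p' q' r' u' \<xi> + f (p - p') (q - q') (r - r') (u - u') \<xi>"
    if "?R p q r u" "?R p' q' r' u'" "\<xi> \<in> X" for p q r u p' q' r' u' \<xi>
    using add[OF that(2) Radd[OF that(1) Rneg[OF that(2)]] that(3)] by simp
  have dep2: "f p q r u \<xi>2 = f p q' r' u' \<xi>2" if "?R p q r u" "?R p q' r' u'" for p q r u q' r' u'
    using fdiff[OF that \<xi>12(2)] z2 Radd[OF that(1) Rneg[OF that(2)]] by simp
  have dep1: "f p q r u \<xi>1 = f p' q' r u' \<xi>1" if "?R p q r u" "?R p' q' r u'" for p q r u p' q' u'
    using fdiff[OF that \<xi>12(1)] z1 Radd[OF that(1) Rneg[OF that(2)]] by simp
  \<comment> \<open>Moving along a direction with \<open>p = r = 0\<close> changes neither scalar,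
    so the increment of \<open>f\<close> exhibits both.\<close>
  have shift: "f p' q' 0 u' \<xi> = f p q r u \<xi>2 / p * (q' * a \<xi>) + f p q r u \<xi>1 / r * (u' * b \<xi>)"
    if s: "?R p q r u" "p \<noteq> 0" "r \<noteq> 0" and s': "?R p' q' 0 u'" "p' = 0" and \<xi>: "\<xi> \<in> X" for p q r u p' q' u' \<xi>
  proof -
    have R': "?R p (q + q') r (u + u')" using Radd[OF s(1) s'(1)] s'(2) by simp
    have "f p (q + q') r (u + u') \<xi> = f p q r u \<xi> + f p' q' 0 u' \<xi>"
      using add[OF s(1) s'(1) \<xi>] s'(2) by simp
    moreover have "f p (q + q') r (u + u') \<xi>2 = f p q r u \<xi>2" by (rule dep2[OF R' s(1)])
    moreover have "f p (q + q') r (u + u') \<xi>1 = f p q r u \<xi>1" by (rule dep1[OF R' s(1)])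
    ultimately show ?thesis
      using comb[OF R' s(2,3) \<xi>] comb[OF s \<xi>] by (simp add: algebra_simps)
  qed
  obtain \<xi>a where \<xi>a: "\<xi>a \<in> X" "a \<xi>a \<noteq> 0" using a by blast
  obtain \<xi>b where \<xi>b: "\<xi>b \<in> X" "b \<xi>b \<noteq> 0" using b by blast
  obtain c :: 'a where c: "c \<noteq> 0" "c \<noteq> 1" using c01 by blast
  \<comment> \<open>If \<open>B = 0\<close>, the direction of \<open>q\<close> alone is admissible
    and reads off the first scalar.\<close>
  have lB: "\<exists>l. \<forall>p q r u. ?R p q r u \<longrightarrow> p \<noteq> 0 \<longrightarrow> r \<noteq> 0 \<longrightarrow> f p q r u \<xi>2 / p = l" if "B = 0"
  proof -
    have R1: "?R 0 1 0 0" using that by (simp add: rel_def)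
    have "f p q r u \<xi>2 / p = f 0 1 0 0 \<xi>a / a \<xi>a" if "?R p q r u" "p \<noteq> 0" "r \<noteq> 0" for p q r u
      using shift[OF that R1 refl \<xi>a(1)] \<xi>a(2) by (simp add: field_simps)
    then show ?thesis by blast
  qed
  have mD: "\<exists>m. \<forall>p q r u. ?R p q r u \<longrightarrow> p \<noteq> 0 \<longrightarrow> r \<noteq> 0 \<longrightarrow> f p q r u \<xi>1 / r = m" if "D = 0"
  proof -
    have R1: "?R 0 0 0 1" using that by (simp add: rel_def)
    have "f p q r u \<xi>1 / r = f 0 0 0 1 \<xi>b / b \<xi>b" if "?R p q r u" "p \<noteq> 0" "r \<noteq> 0" for p q r u
      using shift[OF that R1 refl \<xi>b(1)] \<xi>b(2) by (simp add: field_simps)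
    then show ?thesis by blast
  qed
  have "\<exists>l m. \<forall>p q r u. ?R p q r u \<longrightarrow> p \<noteq> 0 \<longrightarrow> r \<noteq> 0 \<longrightarrow> f p q r u \<xi>2 / p = l \<and> f p q r u \<xi>1 / r = m"
  proof (cases "B = 0"; cases "D = 0")
    assume "B = 0" "D = 0"
    then show ?thesis using lB mD by metis
  next
    assume B: "B = 0" and D: "D \<noteq> 0"
    obtain l where l: "\<And>p q r u. ?R p q r u \<Longrightarrow> p \<noteq> 0 \<Longrightarrow> r \<noteq> 0 \<Longrightarrow> f p q r u \<xi>2 / p = l" using lB[OF B] by blast
    have A: "A \<noteq> 0" using nd B D by blast
    have R1: "?R 1 0 0 (- A / D)" using D by (simp add: rel_def)
    define m where "m = (f 1 0 0 (- A / D) \<xi>b - l * w1 \<xi>b) / (- A / D * b \<xi>b)"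
    have "f p q r u \<xi>1 / r = m" if s: "?R p q r u" "p \<noteq> 0" "r \<noteq> 0" for p q r u
    proof -
      \<comment> \<open>The first coordinates \<open>- c\<close> and \<open>1 - c\<close> are both
        nonzero and are combined with the same \<open>r\<close>. The two points differ by the fixed
        admissible vector \<open>(1, 0, 0, - A / D)\<close>, at which the second scalar is read
        off.\<close>
      have c1: "- c \<noteq> 0" "- c + 1 \<noteq> 0" using c by auto
      define u1 where "u1 = (A * c - C * r) / D"
      have R2: "?R (- c) 0 r u1" using D by (simp add: rel_def u1_def)
      have R3: "?R (- c + 1) (0 + 0) (r + 0) (u1 + - A / D)" using Radd[OF R2 R1] .
      have "f (- c + 1) (0 + 0) (r + 0) (u1 + - A / D) \<xi>b = f (- c) 0 r u1 \<xi>b + f 1 0 0 (- A / D) \<xi>b"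
        by (rule add[OF R2 R1 \<xi>b(1)])
      moreover have "f (- c + 1) (0 + 0) (r + 0) (u1 + - A / D) \<xi>b
        = l * ((- c + 1) * w1 \<xi>b) + f p q r u \<xi>1 / r * (r * w2 \<xi>b + (u1 + - A / D) * b \<xi>b)"
      proof -
        have r0: "r + 0 \<noteq> 0" using s by simp
        have d1: "f (- c + 1) (0 + 0) (r + 0) (u1 + - A / D) \<xi>1 = f p q r u \<xi>1"
          using dep1[of "- c + 1" 0 r "u1 + - A / D" p q u] R3 s by simp
        show ?thesis using comb[OF R3 c1(2) r0 \<xi>b(1)] unfolding l[OF R3 c1(2) r0] d1 by simp
      qed
      moreover have "f (- c) 0 r u1 \<xi>b = l * (- c * w1 \<xi>b) + f p q r u \<xi>1 / r * (r * w2 \<xi>b + u1 * b \<xi>b)"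
        using comb[OF R2 c1(1) s(3) \<xi>b(1)] unfolding l[OF R2 c1(1) s(3)] dep1[OF R2 s(1)] by simp
      ultimately have "f p q r u \<xi>1 / r * (- A / D * b \<xi>b) = f 1 0 0 (- A / D) \<xi>b - l * w1 \<xi>b"
        by (rule two_planes_shift)
      moreover have "- A / D * b \<xi>b \<noteq> 0" using A D \<xi>b(2) by simp
      ultimately show ?thesis unfolding m_def by (rule eq_divide_imp[rotated])
    qed
    then show ?thesis using l by (rule_tac exI[of _ l], rule_tac exI[of _ m]) simp
  next
    assume B: "B \<noteq> 0" and D: "D = 0"
    obtain m where m: "\<And>p q r u. ?R p q r u \<Longrightarrow> p \<noteq> 0 \<Longrightarrow> r \<noteq> 0 \<Longrightarrow> f p q r u \<xi>1 / r = m" using mD[OF D] by blast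
    have C: "C \<noteq> 0" using nd B D by blast
    have R1: "?R 0 (- C / B) 1 0" using B by (simp add: rel_def)
    define l where "l = (f 0 (- C / B) 1 0 \<xi>a - m * w2 \<xi>a) / (- C / B * a \<xi>a)"
    have "f p q r u \<xi>2 / p = l" if s: "?R p q r u" "p \<noteq> 0" "r \<noteq> 0" for p q r u
    proof -
      have c1: "- c \<noteq> 0" "- c + 1 \<noteq> 0" using c by auto
      define q1 where "q1 = (C * c - A * p) / B"
      have R2: "?R p q1 (- c) 0" using B by (simp add: rel_def q1_def)
      have R3: "?R (p + 0) (q1 + - C / B) (- c + 1) (0 + 0)" using Radd[OF R2 R1] .
      have "f (p + 0) (q1 + - C / B) (- c + 1) (0 + 0) \<xi>a = f p q1 (- c) 0 \<xi>a + f 0 (- C / B) 1 0 \<xi>a"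
        by (rule add[OF R2 R1 \<xi>a(1)])
      moreover have "f (p + 0) (q1 + - C / B) (- c + 1) (0 + 0) \<xi>a
        = m * ((- c + 1) * w2 \<xi>a) + f p q r u \<xi>2 / p * (p * w1 \<xi>a + (q1 + - C / B) * a \<xi>a)"
      proof -
        have p0: "p + 0 \<noteq> 0" using s by simp
        have d1: "f (p + 0) (q1 + - C / B) (- c + 1) (0 + 0) \<xi>2 = f p q r u \<xi>2"
          using dep2[of p "q1 + - C / B" "- c + 1" 0 q r u] R3 s by simp
        show ?thesis using comb[OF R3 p0 c1(2) \<xi>a(1)] unfolding m[OF R3 p0 c1(2)] d1 by simp
      qed
      moreover have "f p q1 (- c) 0 \<xi>a = m * (- c * w2 \<xi>a) + f p q r u \<xi>2 / p * (p * w1 \<xi>a + q1 * a \<xi>a)"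
        using comb[OF R2 s(2) c1(1) \<xi>a(1)] unfolding m[OF R2 s(2) c1(1)] dep2[OF R2 s(1)] by simp
      ultimately have "f p q r u \<xi>2 / p * (- C / B * a \<xi>a) = f 0 (- C / B) 1 0 \<xi>a - m * w2 \<xi>a"
        by (rule two_planes_shift)
      moreover have "- C / B * a \<xi>a \<noteq> 0" using C B \<xi>a(2) by simp
      ultimately show ?thesis unfolding l_def by (rule eq_divide_imp[rotated])
    qed
    then show ?thesis using m by (rule_tac exI[of _ l], rule_tac exI[of _ m]) simp
  next
    assume B: "B \<noteq> 0" and D: "D \<noteq> 0"
    have R1: "?R 0 1 0 (- B / D)" using D by (simp add: rel_def)
    have sh: "f 0 1 0 (- B / D) \<xi> = f p q r u \<xi>2 / p * a \<xi> + f p q r u \<xi>1 / r * (- B / D * b \<xi>)"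
      if "?R p q r u" "p \<noteq> 0" "r \<noteq> 0" "\<xi> \<in> X" for p q r u \<xi>
      using shift[OF that(1-3) R1 refl that(4)] by (simp only: mult_1)
    define u0 where "u0 = - (A + C) / D"
    have R0: "?R 1 0 1 u0" using D by (simp add: rel_def u0_def)
    show ?thesis
    proof (rule exI[of _ "f 1 0 1 u0 \<xi>2"], rule exI[of _ "f 1 0 1 u0 \<xi>1"], intro allI impI)
      fix p q r u assume s: "?R p q r u" "p \<noteq> 0" "r \<noteq> 0"
      define l1 where "l1 = f p q r u \<xi>2 / p"
      define m1 where "m1 = f p q r u \<xi>1 / r"
      define l0 where "l0 = f 1 0 1 u0 \<xi>2"
      define m0 where "m0 = f 1 0 1 u0 \<xi>1"
      \<comment> \<open>The intermediate point shares \<open>p\<close> with the given point and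
        \<open>r\<close> with the reference point, so it takes one scalar from each; comparing in
        two stages separates them.\<close>
      define u2 where "u2 = - (A * p + C) / D"
      have R2: "?R p 0 1 u2" using D by (simp add: rel_def u2_def)
      have l2: "f p 0 1 u2 \<xi>2 / p = l1" unfolding l1_def using dep2[OF R2 s(1)] by simp
      have m2: "f p 0 1 u2 \<xi>1 / 1 = m0" unfolding div_by_1 m0_def using dep1[OF R2 R0] by simp
      have e1: "l1 * a \<xi> + m1 * (- B / D * b \<xi>) = l0 * a \<xi> + m0 * (- B / D * b \<xi>)" if "\<xi> \<in> X" for \<xi>
        using sh[OF s that] sh[OF R0 one_neq_zero one_neq_zero that]
        unfolding l0_def m0_def l1_def m1_def div_by_1 by (rule trans[OF sym])
      have e2: "l1 * a \<xi> + m0 * (- B / D * b \<xi>) = l0 * a \<xi> + m0 * (- B / D * b \<xi>)" if "\<xi> \<in> X" for \<xi>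
        using sh[OF R2 s(2) one_neq_zero that] sh[OF R0 one_neq_zero one_neq_zero that]
        unfolding l2 m2 unfolding l0_def[symmetric] m0_def[symmetric] div_by_1 by (rule trans[OF sym])
      have l: "l1 = l0" using e2[OF \<xi>a(1)] \<xi>a(2) by simp
      moreover have "m1 = m0"
      proof -
        have nz: "- B / D * b \<xi>b \<noteq> 0" using B D \<xi>b(2) by simp
        have "m1 * (- B / D * b \<xi>b) = m0 * (- B / D * b \<xi>b)" using e1[OF \<xi>b(1)] unfolding l by (rule add_left_imp_eq)
        then show ?thesis by (simp only: mult_right_cancel[OF nz])
      qed
      ultimately show "f p q r u \<xi>2 / p = f 1 0 1 u0 \<xi>2 \<and> f p q r u \<xi>1 / r = f 1 0 1 u0 \<xi>1"
        unfolding l1_def m1_def l0_def m0_def by blast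
    qed
  qed
  then obtain l m where lm: "\<And>p q r u. ?R p q r u \<Longrightarrow> p \<noteq> 0 \<Longrightarrow> r \<noteq> 0 \<Longrightarrow> f p q r u \<xi>2 / p = l \<and> f p q r u \<xi>1 / r = m"
    by blast
  have main: "f p q r u \<xi> = l * (p * w1 \<xi> + q * a \<xi>) + m * (r * w2 \<xi> + u * b \<xi>)"
    if "?R p q r u" "p \<noteq> 0" "r \<noteq> 0" "\<xi> \<in> X" for p q r u \<xi>
    using comb[OF that] lm[OF that(1-3)] by simp
  have "\<exists>q0 r0 u0. ?R 1 q0 r0 u0 \<and> r0 \<noteq> 0"
  proof (cases "B = 0 \<and> D = 0")
    case True
    show ?thesis
    proof (cases "C = 0")
      case True
      then show ?thesis using nd \<open>B = 0 \<and> D = 0\<close> by (rule_tac exI[of _ 0], rule_tac exI[of _ 1]) (simp add: rel_def)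
    next
      case False
      then have "A \<noteq> 0" using nd True by blast
      then show ?thesis using False True by (rule_tac exI[of _ 0], rule_tac exI[of _ "- A / C"]) (simp add: rel_def)
    qed
  next
    case False
    then consider "B \<noteq> 0" | "D \<noteq> 0" by blast
    then show ?thesis
    proof cases
      case 1
      then show ?thesis by (rule_tac exI[of _ "- (A + C) / B"], rule_tac exI[of _ 1], rule_tac exI[of _ 0]) (simp add: rel_def)
    next
      case 2
      then show ?thesis by (rule_tac exI[of _ 0], rule_tac exI[of _ 1], rule_tac exI[of _ "- (A + C) / D"]) (simp add: rel_def)
    qed
  qed
  then obtain q0 r0 u0 where R0: "?R 1 q0 r0 u0" "r0 \<noteq> 0" by blast
  have "f p q r u \<xi> = l * (p * w1 \<xi> + q * a \<xi>) + m * (r * w2 \<xi> + u * b \<xi>)" if s: "?R p q r u" and \<xi>: "\<xi> \<in> X" for p q r u \<xi>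
  proof (cases "p \<noteq> 0 \<and> r \<noteq> 0")
    case True
    then show ?thesis using main[OF s _ _ \<xi>] by blast
  next
    case False
    \<comment> \<open>Arguments with \<open>p = 0\<close> or \<open>r = 0\<close> are differences of
      two covered ones. Keeping both coordinates nonzero may require the scalar
      \<open>c\<close>.\<close>
    have "\<exists>d. d \<noteq> 0 \<and> p + d \<noteq> 0 \<and> r + d * r0 \<noteq> 0"
    proof -
      consider "p = 0" "r = 0" | "p = 0" "r \<noteq> 0" | "p \<noteq> 0" "r = 0" using False by blast
      then show ?thesis
      proof cases
        case 1
        then show ?thesis using R0(2) by (intro exI[of _ 1]) simp
      next
        case 2
        show ?thesis
        proof (cases "r + r0 = 0")
          case True
          then have "r + c * r0 = (c - 1) * r0" by (simp add: algebra_simps eq_neg_iff_add_eq_0[symmetric])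
          then show ?thesis using 2 c R0(2) by (intro exI[of _ c]) simp
        qed (use 2 in \<open>auto intro!: exI[of _ 1]\<close>)
      next
        case 3
        show ?thesis
        proof (cases "p + 1 = 0")
          case True
          then have "p + c = c - 1" by (simp add: eq_neg_iff_add_eq_0[symmetric])
          then show ?thesis using 3 c R0(2) by (intro exI[of _ c]) simp
        qed (use 3 R0(2) in \<open>auto intro!: exI[of _ 1]\<close>)
      qed
    qed
    then obtain d where d: "d \<noteq> 0" "p + d \<noteq> 0" "r + d * r0 \<noteq> 0" by blast
    have R1: "?R d (d * q0) (d * r0) (d * u0)" using Rscl[OF R0(1), of d] by simp
    have "f (p + d) (q + d * q0) (r + d * r0) (u + d * u0) \<xi> = f p q r u \<xi> + f d (d * q0) (d * r0) (d * u0) \<xi>"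
      by (rule add[OF s R1 \<xi>])
    then show ?thesis
      using main[OF Radd[OF s R1] d(2,3) \<xi>] main[OF R1 d(1) _ \<xi>] d(1) R0(2) by (simp add: algebra_simps)
  qed
  then show ?thesis by blast
qed

text \<open>A change of basis in the plane of \<open>a\<close> and \<open>b\<close>, adapted to the
  test vector.\<close>

lemma plane_basis:
  fixes X :: "(nat \<Rightarrow> 'a::field) set"
  assumes X: "sub X" and l: "lin a" "lin b" and ind: "indX X a b" and \<xi>2: "\<not> (a \<xi>2 = 0 \<and> b \<xi>2 = 0)"
  obtains w a0 where "lin w" "lin a0" "w \<xi>2 = 1" "a0 \<xi>2 = 0" "\<exists>\<xi>\<in>X. a0 \<xi> \<noteq> 0"
    "\<forall>\<xi>. a \<xi> = 0 \<longrightarrow> b \<xi> = 0 \<longrightarrow> w \<xi> = 0 \<and> a0 \<xi> = 0"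
    "\<forall>\<xi>. w \<xi> = 0 \<longrightarrow> a0 \<xi> = 0 \<longrightarrow> a \<xi> = 0 \<and> b \<xi> = 0"
proof (cases "a \<xi>2 = 0")
  case True
  then have b2: "b \<xi>2 \<noteq> 0" using \<xi>2 by blast
  have "\<exists>\<xi>\<in>X. a \<xi> \<noteq> 0" using indXD[OF ind, of 1 0] by auto
  moreover have lw: "lin (inverse (b \<xi>2) \<star> b)" using l by blast
  ultimately show thesis
    by (intro that[OF lw l(1)]) (use True b2 in simp_all)
next
  case False
  let ?w = "inverse (a \<xi>2) \<star> a"
  let ?a0 = "b - b \<xi>2 \<star> ?w"
  have "\<exists>\<xi>\<in>X. ?a0 \<xi> \<noteq> 0"
  proof (rule ccontr)
    assume "\<not> ?thesis"
    then have "(- b \<xi>2 * inverse (a \<xi>2)) * a \<xi> + 1 * b \<xi> = 0" if "\<xi> \<in> X" for \<xi> using that by (auto simp: algebra_simps)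
    from indXD[OF ind this] show False by simp
  qed
  moreover have lw: "lin ?w" and la: "lin ?a0" using l by blast+
  ultimately show thesis
    by (intro that[OF lw la]) (use False in simp_all)
qed

lemma plane_expand:
  fixes X :: "(nat \<Rightarrow> 'a::field) set"
  assumes X: "sub X" and l: "lin w" "lin a0" and \<xi>2: "\<xi>2 \<in> X" "w \<xi>2 = 1" "a0 \<xi>2 = 0"
    and v: "lin v" "\<And>\<xi>. \<xi> \<in> X \<Longrightarrow> w \<xi> = 0 \<Longrightarrow> a0 \<xi> = 0 \<Longrightarrow> v \<xi> = 0"
  obtains q where "\<forall>\<xi>\<in>X. v \<xi> = v \<xi>2 * w \<xi> + q * a0 \<xi>"
proof -
  obtain c q where cq: "\<And>\<xi>. \<xi> \<in> X \<Longrightarrow> v \<xi> = c * w \<xi> + q * a0 \<xi>"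
    using lin_proportional2[OF X v(1) l v(2)] by metis
  then have "c = v \<xi>2" using \<xi>2 by simp
  then show thesis using that cq by blast
qed

lemma lin_combination_ex:
  fixes X :: "(nat \<Rightarrow> 'a::field) set"
  assumes X: "sub X" and f: "lin f" and y: "lin y1" "lin y2"
    and van: "\<forall>\<xi>\<in>X. y1 \<xi> = 0 \<longrightarrow> y2 \<xi> = 0 \<longrightarrow> f \<xi> = 0"
  shows "\<exists>a b. \<forall>\<xi>\<in>X. f \<xi> = a * y1 \<xi> + b * y2 \<xi>"
proof (rule lin_proportional2[OF X f y])
  show "f \<xi> = 0" if "\<xi> \<in> X" "y1 \<xi> = 0" "y2 \<xi> = 0" for \<xi> using van that by blast
  show ?thesis if "\<And>\<xi>. \<xi> \<in> X \<Longrightarrow> f \<xi> = a * y1 \<xi> + b * y2 \<xi>" for a b using that by blast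
qed

context rcs
begin

text \<open>The tensors \<open>x1 \<Otimes> \<eta>\<close> and \<open>x2 \<Otimes> \<zeta>\<close>
  in \<open>T\<close> form two spaces of dimension \<open>card I - 2\<close>, with zero intersection
  because \<open>x1\<close>, \<open>x2\<close> are independent. Together they fall short of the
  bound by one, so at most one further generator exists.\<close>

lemma two_planes_span:
  assumes db: "db I X \<xi> y" and card: "3 \<le> card I" and dim: "dimle T (2 * card I - 3)"
    and ix: "indep2 x1 x2" and l: "lin a1" "lin b1" "lin a2" "lin b2" and ind: "indX X a1 b1" "indX X a2 b2"
    and \<Phi>1: "\<And>\<xi>. \<xi> \<in> X \<Longrightarrow> x1 \<Otimes> \<xi> \<in> T \<longleftrightarrow> a1 \<xi> = 0 \<and> b1 \<xi> = 0"
    and \<Phi>2: "\<And>\<xi>. \<xi> \<in> X \<Longrightarrow> x2 \<Otimes> \<xi> \<in> T \<longleftrightarrow> a2 \<xi> = 0 \<and> b2 \<xi> = 0"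
  shows "\<exists>\<tau>\<in>T. \<forall>t\<in>T. \<exists>c. \<exists>\<eta>\<in>X. \<exists>\<zeta>\<in>X. x1 \<Otimes> \<eta> \<in> T \<and> x2 \<Otimes> \<zeta> \<in> T \<and> t = x1 \<Otimes> \<eta> + x2 \<Otimes> \<zeta> + c \<star> \<tau>"
proof -
  define Y where "Y = {x1 \<Otimes> \<eta> + x2 \<Otimes> \<zeta> | \<eta> \<zeta>. \<eta> \<in> X \<and> \<zeta> \<in> X \<and> x1 \<Otimes> \<eta> \<in> T \<and> x2 \<Otimes> \<zeta> \<in> T}"
  have YT: "Y \<subseteq> T" using sub_add[OF T] by (auto simp: Y_def)
  have Y: "sub Y"
    unfolding sub_def
  proof (intro conjI ballI allI)
    have "0 = x1 \<Otimes> 0 + x2 \<Otimes> 0" "0 \<in> X" "x1 \<Otimes> 0 \<in> T" "x2 \<Otimes> 0 \<in> T" using sub_0[OF X] sub_0[OF T] by simp_all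
    then show "0 \<in> Y" unfolding Y_def by blast
  next
    fix u v assume "u \<in> Y" "v \<in> Y"
    then obtain \<eta> \<zeta> \<eta>' \<zeta>' where *: "u = x1 \<Otimes> \<eta> + x2 \<Otimes> \<zeta>" "v = x1 \<Otimes> \<eta>' + x2 \<Otimes> \<zeta>'" "\<eta> \<in> X" "\<zeta> \<in> X" "\<eta>' \<in> X" "\<zeta>' \<in> X"
      "x1 \<Otimes> \<eta> \<in> T" "x2 \<Otimes> \<zeta> \<in> T" "x1 \<Otimes> \<eta>' \<in> T" "x2 \<Otimes> \<zeta>' \<in> T" unfolding Y_def by blast
    have "u + v = x1 \<Otimes> (\<eta> + \<eta>') + x2 \<Otimes> (\<zeta> + \<zeta>')" by (simp add: * tensor_simps algebra_simps)
    moreover have "x1 \<Otimes> (\<eta> + \<eta>') \<in> T" "x2 \<Otimes> (\<zeta> + \<zeta>') \<in> T"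
      unfolding tensor_add_right using * sub_add[OF T] by blast+
    ultimately show "u + v \<in> Y" unfolding Y_def using * sub_add[OF X] by blast
  next
    fix c u assume "u \<in> Y"
    then obtain \<eta> \<zeta> where *: "u = x1 \<Otimes> \<eta> + x2 \<Otimes> \<zeta>" "\<eta> \<in> X" "\<zeta> \<in> X"
      "x1 \<Otimes> \<eta> \<in> T" "x2 \<Otimes> \<zeta> \<in> T" unfolding Y_def by blast
    have "c \<star> u = x1 \<Otimes> (c \<star> \<eta>) + x2 \<Otimes> (c \<star> \<zeta>)" by (simp add: * tensor_simps fs.scale_right_distrib)
    moreover have "x1 \<Otimes> (c \<star> \<eta>) \<in> T" "x2 \<Otimes> (c \<star> \<zeta>) \<in> T"
      unfolding tensor_scl_right using * sub_scl[OF T] by blast+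
    ultimately show "c \<star> u \<in> Y" unfolding Y_def using * sub_scl[OF X] by blast
  qed
  have nY: "\<not> dimle Y (2 * card I - 5)"
  proof
    assume dY: "dimle Y (2 * card I - 5)"
    obtain k1 k2 e z where k: "k1 \<in> I" "k2 \<in> I" "k1 \<noteq> k2" and dbe: "db I X e z" and z: "z k1 = a1" "z k2 = b1"
      using db_two_fun[OF db X l(1,2) ind(1)] by metis
    obtain k1' k2' e' z' where k': "k1' \<in> I" "k2' \<in> I" "k1' \<noteq> k2'" and dbe': "db I X e' z'" and z': "z' k1' = a2" "z' k2' = b2"
      using db_two_fun[OF db X l(3,4) ind(2)] by metis
    define B where "B = I - {k1, k2}"
    define B' where "B' = I - {k1', k2'}"
    have fin: "finite B" "finite B'" using db_finite[OF db] by (auto simp: B_def B'_def)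
    have cB: "card B = card I - 2" "card B' = card I - 2"
      unfolding B_def B'_def using k k' db_finite[OF db] by (simp_all add: card_Diff_subset)
    define t where "t = case_sum (\<lambda>b. x1 \<Otimes> e b) (\<lambda>b. x2 \<Otimes> e' b)"
    have eB: "x1 \<Otimes> e b \<in> T" if "b \<in> B" for b
      using that \<Phi>1[OF db_mem[OF dbe, of b]] db_dual[OF dbe, of k1 b] db_dual[OF dbe, of k2 b] k z by (auto simp: B_def)
    have eB': "x2 \<Otimes> e' b \<in> T" if "b \<in> B'" for b
      using that \<Phi>2[OF db_mem[OF dbe', of b]] db_dual[OF dbe', of k1' b] db_dual[OF dbe', of k2' b] k' z' by (auto simp: B'_def)
    have tY: "t j \<in> Y" if jm: "j \<in> B <+> B'" for j
    proof -
      consider b where "b \<in> B" "j = Inl b" | b where "b \<in> B'" "j = Inr b" using jm by blast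
      then show ?thesis
      proof cases
        case 1
        have "t j = x1 \<Otimes> e b + x2 \<Otimes> 0" "0 \<in> X" "x2 \<Otimes> 0 \<in> T" using sub_0[OF X] sub_0[OF T] by (auto simp: t_def 1)
        moreover have "e b \<in> X" using db_mem[OF dbe, of b] 1(1) by (simp add: B_def)
        ultimately show ?thesis unfolding Y_def using eB[OF 1(1)] by blast
      next
        case 2
        have "t j = x1 \<Otimes> 0 + x2 \<Otimes> e' b" "0 \<in> X" "x1 \<Otimes> 0 \<in> T" using sub_0[OF X] sub_0[OF T] by (auto simp: t_def 2)
        moreover have "e' b \<in> X" using db_mem[OF dbe', of b] 2(1) by (simp add: B'_def)
        ultimately show ?thesis unfolding Y_def using eB'[OF 2(1)] by blast
      qed
    qed
    have indt: "indf (B <+> B') t"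
    proof (rule indfI)
      fix c j assume c: "(\<Sum>j\<in>B <+> B'. c j \<star> t j) = 0" and j: "j \<in> B <+> B'"
      define u where "u = (\<Sum>b\<in>B. c (Inl b) \<star> e b)"
      define u' where "u' = (\<Sum>b\<in>B'. c (Inr b) \<star> e' b)"
      have "(\<Sum>j\<in>B <+> B'. c j \<star> t j) = (\<Sum>b\<in>B. c (Inl b) \<star> t (Inl b)) + (\<Sum>b\<in>B'. c (Inr b) \<star> t (Inr b))"
        using sum.Plus[OF fin, of "\<lambda>j. c j \<star> t j"] by (simp add: o_def)
      also have "\<dots> = x1 \<Otimes> u + x2 \<Otimes> u'"
        by (simp add: t_def u_def u'_def tensor_sum_right tensor_scl_right)
      finally have e0: "x1 \<Otimes> u + x2 \<Otimes> u' = 0" using c by simp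
      have zu: "v u = 0 \<and> v u' = 0" if v: "lin v" for v
      proof -
        have "v u \<star> x1 + v u' \<star> x2 = contr (x1 \<Otimes> u + x2 \<Otimes> u') v" by (simp add: contr_simps[OF v])
        then have "v u \<star> x1 + v u' \<star> x2 = 0" using e0 contr_0[OF v] by simp
        then show ?thesis by (rule indep2D[OF ix])
      qed
      consider b where "b \<in> B" "j = Inl b" | b where "b \<in> B'" "j = Inr b" using j by blast
      then show "c j = 0"
      proof cases
        case 1
        have bI: "b \<in> I" using 1 by (simp add: B_def)
        have "z b u = (\<Sum>b'\<in>B. if b = b' then c (Inl b') else 0)"
          unfolding u_def lin_sum[OF db_lin[OF dbe bI]] lin_scl[OF db_lin[OF dbe bI]]
          using db_dual[OF dbe bI] by (intro sum.cong) (auto simp: B_def)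
        then show ?thesis using zu[OF db_lin[OF dbe bI]] fin 1 by simp
      next
        case 2
        have bI: "b \<in> I" using 2 by (simp add: B'_def)
        have "z' b u' = (\<Sum>b'\<in>B'. if b = b' then c (Inr b') else 0)"
          unfolding u'_def lin_sum[OF db_lin[OF dbe' bI]] lin_scl[OF db_lin[OF dbe' bI]]
          using db_dual[OF dbe' bI] by (intro sum.cong) (auto simp: B'_def)
        then show ?thesis using zu[OF db_lin[OF dbe' bI]] fin 2 by simp
      qed
    qed
    have "card (B <+> B') \<le> 2 * card I - 5"
      by (rule dimleD[OF dY _ tY indt]) (use fin in auto)
    then show False using card_Plus[OF fin] cB card by simp
  qed
  have conv: "\<exists>c. \<exists>\<eta>\<in>X. \<exists>\<zeta>\<in>X. x1 \<Otimes> \<eta> \<in> T \<and> x2 \<Otimes> \<zeta> \<in> T \<and> t = x1 \<Otimes> \<eta> + x2 \<Otimes> \<zeta> + c \<star> \<tau>"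
    if "t \<in> {u + c \<star> \<tau> | u c. u \<in> Y}" for t \<tau>
    using that unfolding Y_def by blast
  show ?thesis
  proof (cases "T \<subseteq> Y")
    case True
    then have "t \<in> {u + c \<star> 0 | u c. u \<in> Y}" if "t \<in> T" for t using that by auto
    then show ?thesis using conv[of _ 0] sub_0[OF T] by blast
  next
    case False
    then obtain \<tau> where \<tau>: "\<tau> \<in> T" "\<tau> \<notin> Y" by blast
    let ?Y1 = "{u + c \<star> \<tau> | u c. u \<in> Y}"
    have Y1T: "?Y1 \<subseteq> T" using YT sub_add[OF T] sub_scl[OF T \<tau>(1)] by blast
    have "t \<in> ?Y1" if t: "t \<in> T" for t
    proof (rule ccontr)
      assume nt: "t \<notin> ?Y1"
      have "2 * card I - 3 = Suc (Suc (2 * card I - 5))" using card by simp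
      then have "dimle T (Suc (Suc (2 * card I - 5)))" using dim by simp
      from dimle_drop[OF this sub_add_line[OF Y] Y1T t nt] have "dimle ?Y1 (Suc (2 * card I - 5))" .
      from dimle_drop[OF this Y add_line_mono add_line_mem[OF Y] \<tau>(2)] show False using nY by blast
    qed
    then show ?thesis using conv \<tau>(1) by blast
  qed
qed

text \<open>\<open>T\<close> is generated by two families of rank-one tensors and one
  \<open>\<tau>\<close>, so the columns of \<open>s \<in> Ann T\<close> vary independently in the
  spaces \<open>P k\<close> up to a single relation coming from \<open>\<tau>\<close>. If a column
  other than those of \<open>x1\<close>, \<open>x2\<close> enters that relation, it can absorb it;
  otherwise only these two are constrained, which is the situation of
  \<open>two_planes_core\<close>.\<close>

lemma two_planes:
  assumes c01: "\<exists>c::'a. c \<noteq> 0 \<and> c \<noteq> 1"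
    and db: "db I X \<xi> y" and card: "3 \<le> card I" and dim: "dimle T (2 * card I - 3)"
    and xU: "x1 \<in> UU p" "x2 \<in> UU p" and l: "lin a1" "lin b1" "lin a2" "lin b2" and ind: "indX X a1 b1" "indX X a2 b2"
    and \<Phi>1: "\<And>\<xi>. \<xi> \<in> X \<Longrightarrow> x1 \<Otimes> \<xi> \<in> T \<longleftrightarrow> a1 \<xi> = 0 \<and> b1 \<xi> = 0"
    and \<Phi>2: "\<And>\<xi>. \<xi> \<in> X \<Longrightarrow> x2 \<Otimes> \<xi> \<in> T \<longleftrightarrow> a2 \<xi> = 0 \<and> b2 \<xi> = 0"
    and \<xi>1: "\<xi>1 \<in> X" "x1 \<Otimes> \<xi>1 \<in> T" "x2 \<Otimes> \<xi>1 \<notin> T"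
  shows "localF p X T F"
proof -
  have x1nz: "x1 \<noteq> 0"
  proof
    assume "x1 = 0"
    then have "1 * a1 \<eta> + 0 * b1 \<eta> = 0" if "\<eta> \<in> X" for \<eta> using \<Phi>1[OF that] sub_0[OF T] by simp
    from indXD[OF ind(1) this] show False by simp
  qed
  have ix: "indep2 x1 x2"
  proof (rule ccontr)
    assume "\<not> indep2 x1 x2"
    then obtain c where "x2 = c \<star> x1" using not_indep2[OF _ x1nz] by blast
    then show False using \<xi>1(2,3) sub_scl[OF T] by (simp add: tensor_scl_left)
  qed
  obtain \<tau> where \<tau>: "\<tau> \<in> T" and Tspan: "\<And>t. t \<in> T \<Longrightarrow>
      \<exists>c. \<exists>\<eta>\<in>X. \<exists>\<zeta>\<in>X. x1 \<Otimes> \<eta> \<in> T \<and> x2 \<Otimes> \<zeta> \<in> T \<and> t = x1 \<Otimes> \<eta> + x2 \<Otimes> \<zeta> + c \<star> \<tau>"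
    using two_planes_span[OF db card dim ix l ind \<Phi>1 \<Phi>2] by blast
  obtain j1 j2 x \<phi> where j: "j1 \<in> {..<p}" "j2 \<in> {..<p}" "j1 \<noteq> j2" and dbU: "db {..<p} (UU p) x \<phi>"
    and x: "x j1 = x1" "x j2 = x2"
    using db_two_vec[OF db_UU xU ix] by metis
  have lin\<phi>: "lin (\<phi> k)" if "k < p" for k using db_lin[OF dbU] that by simp
  have xkU: "x k \<in> UU p" if "k < p" for k using db_mem[OF dbU] that by simp
  have \<phi>x1: "\<phi> k x1 = (if k = j1 then 1 else 0)" and \<phi>x2: "\<phi> k x2 = (if k = j2 then 1 else 0)" if "k < p" for k
    using db_dual[OF dbU, of k j1] db_dual[OF dbU, of k j2] that j x by auto
  have ly: "lin (y i)" if "i \<in> I" for i using db_lin[OF db that] .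
  \<comment> \<open>The contribution of column \<open>k\<close> to the value at
    \<open>\<tau>\<close>.\<close>
  define \<theta> where "\<theta> k v = rk1 (\<phi> k) v \<tau>" for k v
  have \<theta>add: "\<theta> k (v + w) = \<theta> k v + \<theta> k w" and \<theta>scl: "\<theta> k (c \<star> v) = c * \<theta> k v" if "k < p" for k v w c
    unfolding \<theta>_def rk1_fun_add[OF lin\<phi>[OF that]] rk1_fun_scl[OF lin\<phi>[OF that]] by simp_all
  define P where "P k = {v. lin v \<and> (k = j1 \<longrightarrow> (\<forall>\<eta>\<in>X. x1 \<Otimes> \<eta> \<in> T \<longrightarrow> v \<eta> = 0)) \<and>
      (k = j2 \<longrightarrow> (\<forall>\<eta>\<in>X. x2 \<Otimes> \<eta> \<in> T \<longrightarrow> v \<eta> = 0))}" for k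
  have subP: "sub (P k)" for k by (auto simp: P_def sub_def)
  have Plin: "lin v" if "v \<in> P k" for v k using that by (simp add: P_def)
  have mem: "s \<in> Ann T" if "lin s" "\<And>\<eta>. \<eta> \<in> X \<Longrightarrow> x1 \<Otimes> \<eta> \<in> T \<Longrightarrow> s (x1 \<Otimes> \<eta>) = 0"
      "\<And>\<eta>. \<eta> \<in> X \<Longrightarrow> x2 \<Otimes> \<eta> \<in> T \<Longrightarrow> s (x2 \<Otimes> \<eta>) = 0" "s \<tau> = 0" for s
  proof (rule AnnI[OF that(1)])
    fix t assume "t \<in> T"
    then obtain c \<eta> \<zeta> where "\<eta> \<in> X" "\<zeta> \<in> X" "x1 \<Otimes> \<eta> \<in> T" "x2 \<Otimes> \<zeta> \<in> T" "t = x1 \<Otimes> \<eta> + x2 \<Otimes> \<zeta> + c \<star> \<tau>"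
      using Tspan by blast
    then show "s t = 0" using that by (simp add: lin_add[OF that(1)] lin_scl[OF that(1)])
  qed
  have rkten: "rk1 (\<phi> k) v (u \<Otimes> \<eta>) = v \<eta> * \<phi> k u" if "k < p" "lin v" for k v u \<eta>
    using rk1_tensor[OF lin\<phi>[OF that(1)] that(2)] .
  have rk12: "rk1 (\<phi> k) v (x1 \<Otimes> \<eta>) = 0" "rk1 (\<phi> k) v (x2 \<Otimes> \<zeta>) = 0"
    if "k < p" "v \<in> P k" "\<eta> \<in> X" "x1 \<Otimes> \<eta> \<in> T" "\<zeta> \<in> X" "x2 \<Otimes> \<zeta> \<in> T" for k v \<eta> \<zeta>
    using rkten[OF that(1) Plin[OF that(2)]] \<phi>x1[OF that(1)] \<phi>x2[OF that(1)] that by (auto simp: P_def)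
  have mem1: "rk1 (\<phi> k) v \<in> Ann T" if "k < p" "v \<in> P k" "\<theta> k v = 0" for k v
    by (rule mem) (use lin_rk1[OF lin\<phi>[OF that(1)] Plin[OF that(2)]] rk12[OF that(1,2)] that(3) sub_0[OF X] sub_0[OF T]
        in \<open>auto simp: \<theta>_def\<close>)
  have mem2: "rk1 (\<phi> k) v + rk1 (\<phi> m) w \<in> Ann T" if "k < p" "v \<in> P k" "m < p" "w \<in> P m" "\<theta> k v + \<theta> m w = 0" for k v m w
    by (rule mem) (use lin_rk1[OF lin\<phi>[OF that(1)] Plin[OF that(2)]] lin_rk1[OF lin\<phi>[OF that(3)] Plin[OF that(4)]]
        rk12[OF that(1,2)] rk12[OF that(3,4)] that(5) sub_0[OF X] sub_0[OF T] in \<open>auto simp: \<theta>_def\<close>)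
  have row: "(\<lambda>\<eta>. s (x k \<Otimes> \<eta>)) \<in> P k" if "s \<in> Ann T" for s k
    using lin_row[OF AnnD(1)[OF that]] AnnD(2)[OF that] x by (auto simp: P_def)
  have s\<tau>: "(\<Sum>k<p. \<theta> k (\<lambda>\<eta>. s (x k \<Otimes> \<eta>))) = 0" if s: "s \<in> Ann T" for s
  proof -
    have r: "lin (\<lambda>\<eta>. s (x k \<Otimes> \<eta>))" for k using Plin[OF row[OF s]] .
    have ll: "lin (\<Sum>k<p. rk1 (\<phi> k) (\<lambda>\<eta>. s (x k \<Otimes> \<eta>)))" using lin_rk1[OF lin\<phi> r] by (intro lin_setsum) auto
    have "s \<tau> = (\<Sum>k<p. rk1 (\<phi> k) (\<lambda>\<eta>. s (x k \<Otimes> \<eta>))) \<tau>"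
    proof (rule WW_lin_eqI[OF db _ AnnD(1)[OF s] ll])
      show "\<tau> \<in> WW p X" using \<tau> TW by blast
      fix u \<eta> :: "nat \<Rightarrow> 'a" assume "u \<in> UU p"
      then show "s (u \<Otimes> \<eta>) = (\<Sum>k<p. rk1 (\<phi> k) (\<lambda>\<eta>. s (x k \<Otimes> \<eta>))) (u \<Otimes> \<eta>)"
        unfolding sum_fun_apply using Ann_expand[OF dbU AnnD(1)[OF s]] rkten[OF _ r] by (simp add: mult.commute)
    qed
    then show ?thesis using AnnD(2)[OF s \<tau>] by (simp add: \<theta>_def sum_fun_apply)
  qed
  show ?thesis
  proof (cases "\<exists>k v. k < p \<and> k \<noteq> j1 \<and> k \<noteq> j2 \<and> lin v \<and> \<theta> k v \<noteq> 0")
    case True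
    then obtain k v0 where k: "k < p" "k \<noteq> j1" "k \<noteq> j2" and v0: "lin v0" "\<theta> k v0 \<noteq> 0" by blast
    have Pk: "v \<in> P k \<longleftrightarrow> lin v" for v using k by (simp add: P_def)
    define w0 where "w0 = inverse (\<theta> k v0) \<star> v0"
    have w0: "lin w0" using v0(1) by (auto simp: w0_def)
    have \<theta>w0: "\<theta> k w0 = 1" using v0(2) by (simp add: w0_def \<theta>scl[OF k(1)])
    have "\<exists>\<eta>\<in>X. w0 \<eta> \<noteq> 0"
    proof (rule ccontr)
      assume "\<not> ?thesis"
      moreover have "col \<tau> i \<in> X" for i using \<tau> TW by (auto simp: WW_def)
      ultimately have "contr \<tau> w0 = 0" by (simp add: contr_def fun_eq_iff)
      then show False using \<theta>w0 by (simp add: \<theta>_def rk1_def lin_0[OF lin\<phi>[OF k(1)]])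
    qed
    then obtain i0 where i0: "i0 \<in> I" "w0 (\<xi> i0) \<noteq> 0" using db_ex_nonzero[OF db w0] by blast
    obtain \<xi>0 where db0: "db I X \<xi>0 (y(i0 := w0))" using db_fun_exchange[OF db X i0(1) w0 i0(2)] .
    have "2 \<le> card (I - {i0})" using card i0(1) db_finite[OF db] by simp
    then obtain i1 i2 where i12: "i1 \<in> I" "i2 \<in> I" "i1 \<noteq> i0" "i2 \<noteq> i0" "i1 \<noteq> i2"
      by (metis Diff_iff Diff_empty card_le_Suc0_iff_eq db db_finite finite_Diff insert_iff not_less_eq_eq numeral_2_eq_2)
    \<comment> \<open>The entries of column \<open>k\<close> that need no compensation elsewhere. As
      \<open>3 \<le> card I\<close>, two of them are independent on \<open>X\<close>.\<close>
    define H where "H = {v. lin v \<and> \<theta> k v = 0}"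
    have \<theta>0: "\<theta> k 0 = 0" using \<theta>scl[OF k(1), of 0 0] by simp
    have subH: "sub H" unfolding sub_def H_def using \<theta>add[OF k(1)] \<theta>scl[OF k(1)] \<theta>0 by auto
    define h1 where "h1 = y i1 - \<theta> k (y i1) \<star> w0"
    define h2 where "h2 = y i2 - \<theta> k (y i2) \<star> w0"
    have hH: "v - \<theta> k v \<star> w0 \<in> H" if "lin v" for v
    proof -
      have "\<theta> k (v - \<theta> k v \<star> w0) = \<theta> k (v + (- \<theta> k v) \<star> w0)" by (simp add: fs.scale_minus_left)
      also have "\<dots> = 0" unfolding \<theta>add[OF k(1)] \<theta>scl[OF k(1)] \<theta>w0 by simp
      finally show ?thesis using that w0 by (auto simp: H_def)
    qed
    have h12: "h1 \<in> H" "h2 \<in> H" unfolding h1_def h2_def using hH ly i12 by blast+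
    have indh: "indX X h1 h2"
      unfolding indX_def
    proof (intro allI impI)
      fix a b assume h: "\<forall>\<eta>\<in>X. a * h1 \<eta> + b * h2 \<eta> = 0"
      have d: "h1 (\<xi>0 i1) = 1" "h2 (\<xi>0 i1) = 0" "h1 (\<xi>0 i2) = 0" "h2 (\<xi>0 i2) = 1"
        using db_dual[OF db0 i12(1) i12(1)] db_dual[OF db0 i12(2) i12(1)] db_dual[OF db0 i12(1) i12(2)]
          db_dual[OF db0 i12(2) i12(2)] db_dual[OF db0 i0(1) i12(1)] db_dual[OF db0 i0(1) i12(2)] i12
        by (auto simp: h1_def h2_def)
      show "a = 0 \<and> b = 0"
        using bspec[OF h db_mem[OF db0 i12(1)]] bspec[OF h db_mem[OF db0 i12(2)]] by (simp add: d)
    qed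
    have Hmem: "rk1 (\<phi> k) v \<in> Ann T" if "v \<in> H" for v using mem1[OF k(1)] that Pk by (simp add: H_def)
    have Hlin: "lin v" if "v \<in> H" for v using that by (simp add: H_def)
    have "\<forall>v\<in>H. \<exists>c. \<forall>\<eta>\<in>X. F (rk1 (\<phi> k) v) \<eta> = c * v \<eta>"
      using F_rank1[OF Hmem lin\<phi>[OF k(1)] Hlin] by blast
    moreover have "\<forall>v\<in>H. \<forall>w\<in>H. \<forall>\<eta>\<in>X. F (rk1 (\<phi> k) (v + w)) \<eta> = F (rk1 (\<phi> k) v) \<eta> + F (rk1 (\<phi> k) w) \<eta>"
      unfolding rk1_fun_add[OF lin\<phi>[OF k(1)]] using addF Hmem by blast
    ultimately obtain c where c: "\<forall>v\<in>H. \<forall>\<eta>\<in>X. F (rk1 (\<phi> k) v) \<eta> = c * v \<eta>"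
      using additive_scalar[OF subH _ _ h12 indh, of "\<lambda>v. F (rk1 (\<phi> k) v)"] by blast
    \<comment> \<open>After subtraction of the multiplier of column \<open>k\<close>, the map
      vanishes on \<open>H\<close>.\<close>
    define G where "G s \<eta> = F s \<eta> - s ((c \<star> x k) \<Otimes> \<eta>)" for s \<eta>
    have cx: "c \<star> x k \<in> UU p" using sub_scl[OF sub_UU xkU[OF k(1)]] .
    interpret G: rcs p X T G unfolding G_def[abs_def] by (rule subtract[OF cx])
    have GH: "G (rk1 (\<phi> k) v) \<eta> = 0" if "v \<in> H" "\<eta> \<in> X" for v \<eta>
      unfolding G_def using c that db_dual[OF dbU, of k k] k(1)
      by (simp add: rkten[OF k(1) Hlin[OF that(1)]] lin_scl[OF lin\<phi>[OF k(1)]])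
    \<comment> \<open>An arbitrary entry \<open>v\<close> of column \<open>m\<close>, compensated in
      column \<open>k\<close> so that \<open>\<tau>\<close> is killed.\<close>
    define e where "e m v = rk1 (\<phi> m) v + rk1 (\<phi> k) ((- \<theta> m v) \<star> w0)" for m v
    have lw: "lin (d \<star> w0)" for d using w0 by blast
    have e: "e m v \<in> Ann T" if "m < p" "v \<in> P m" for m v
    proof -
      have "\<theta> m v + \<theta> k ((- \<theta> m v) \<star> w0) = 0" unfolding \<theta>scl[OF k(1)] \<theta>w0 by simp
      then show ?thesis unfolding e_def using mem2[OF that k(1)] lw Pk by blast
    qed
    have eten: "e m v (u \<Otimes> \<eta>) = v \<eta> * \<phi> m u - \<theta> m v * w0 \<eta> * \<phi> k u" if "m < p" "lin v" for m v u \<eta>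
      unfolding e_def plus_fun_apply rkten[OF that] rkten[OF k(1) lw] by simp
    \<comment> \<open>At a row with \<open>v \<eta> = 0\<close> only the compensation is left;
      adding an element of \<open>H\<close> removes it, and range restriction applies.\<close>
    have Ge1: "G (e m v) \<eta> = 0" if m: "m < p" and v: "v \<in> P m" and \<eta>: "\<eta> \<in> X" "v \<eta> = 0" and h: "h \<in> H" "h \<eta> \<noteq> 0" for m v \<eta> h
    proof -
      let ?h = "(\<theta> m v * w0 \<eta> / h \<eta>) \<star> h"
      have hH': "?h \<in> H" using sub_scl[OF subH h(1)] .
      have "G (e m v + rk1 (\<phi> k) ?h) \<eta> = 0"
      proof (rule G.rc[OF sub_add[OF sub_Ann e[OF m v] Hmem[OF hH']] \<eta>(1)])
        fix u
        show "(e m v + rk1 (\<phi> k) ?h) (u \<Otimes> \<eta>) = 0"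
          using h(2) \<eta>(2) by (simp add: eten[OF m Plin[OF v]] rkten[OF k(1) Hlin[OF hH']])
      qed
      then show ?thesis using G.addF[OF e[OF m v] Hmem[OF hH'] \<eta>(1)] GH[OF hH' \<eta>(1)] by simp
    qed
    have Ge: "G (e m v) \<eta> = 0" if m: "m < p" and v: "v \<in> P m" and \<eta>: "\<eta> \<in> X" "v \<eta> = 0" for m v \<eta>
    proof (cases "\<exists>h\<in>H. h \<eta> \<noteq> 0")
      case True
      then show ?thesis using Ge1[OF m v \<eta>] by blast
    next
      case none: False
      \<comment> \<open>If all of \<open>H\<close> vanishes at \<open>\<eta>\<close>, the previous
        case is used at some \<open>\<zeta>\<close> and at \<open>\<eta> + \<zeta>\<close>.\<close>
      have "\<exists>\<zeta>\<in>X. v \<zeta> = 0 \<and> (\<exists>h\<in>H. h \<zeta> \<noteq> 0)"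
      proof (rule ccontr)
        assume no: "\<not> ?thesis"
        obtain c1 where c1: "\<And>\<zeta>. \<zeta> \<in> X \<Longrightarrow> h1 \<zeta> = c1 * v \<zeta>"
          using lin_proportional[OF X Hlin[OF h12(1)] Plin[OF v]] no h12(1) by metis
        obtain c2 where c2: "\<And>\<zeta>. \<zeta> \<in> X \<Longrightarrow> h2 \<zeta> = c2 * v \<zeta>"
          using lin_proportional[OF X Hlin[OF h12(2)] Plin[OF v]] no h12(2) by metis
        have "c2 * h1 \<zeta> + (- c1) * h2 \<zeta> = 0" if "\<zeta> \<in> X" for \<zeta> unfolding c1[OF that] c2[OF that] by simp
        from indXD[OF indh this] have "c1 = 0" by simp
        then have "1 * h1 \<zeta> + 0 * h2 \<zeta> = 0" if "\<zeta> \<in> X" for \<zeta> using c1[OF that] by simp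
        from indXD[OF indh this] show False by simp
      qed
      then obtain \<zeta> h where \<zeta>: "\<zeta> \<in> X" "v \<zeta> = 0" and h: "h \<in> H" "h \<zeta> \<noteq> 0" by blast
      have \<eta>\<zeta>: "\<eta> + \<zeta> \<in> X" using sub_add[OF X \<eta>(1) \<zeta>(1)] .
      have "h \<eta> = 0" using none h(1) by blast
      then have "G (e m v) (\<eta> + \<zeta>) = 0"
        using Ge1[OF m v \<eta>\<zeta> _ h(1)] h(2) \<eta>(2) \<zeta>(2) by (simp add: lin_add[OF Hlin[OF h(1)]] lin_add[OF Plin[OF v]])
      moreover have "G (e m v) \<zeta> = 0" using Ge1[OF m v \<zeta> h] .
      ultimately show ?thesis by (simp add: lin_add[OF G.linF[OF e[OF m v]]])
    qed
    have eadd: "e m (v + w) = e m v + e m w" if "m < p" for m v w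
      unfolding e_def \<theta>add[OF that] rk1_fun_add[OF lin\<phi>[OF that]] rk1_fun_scl[OF lin\<phi>[OF k(1)]]
      by (simp add: fun_eq_iff algebra_simps)
    have "\<exists>d. \<forall>v\<in>P m. \<forall>\<eta>\<in>X. G (e m v) \<eta> = d * v \<eta>" if m: "m < p" for m
    proof -
      have g1: "\<forall>v\<in>P m. \<exists>c. \<forall>\<eta>\<in>X. G (e m v) \<eta> = c * v \<eta>"
        using lin_proportional[OF X G.linF[OF e[OF m]] Plin] Ge[OF m] by metis
      have g2: "\<forall>v\<in>P m. \<forall>w\<in>P m. \<forall>\<eta>\<in>X. G (e m (v + w)) \<eta> = G (e m v) \<eta> + G (e m w) \<eta>"
        unfolding eadd[OF m] using G.addF e[OF m] by blast
      obtain v w where vw: "v \<in> P m" "w \<in> P m" "indX X v w"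
      proof (cases "m = j1")
        case True
        then show thesis using that[of a1 b1] l ind j(3) \<Phi>1 by (simp add: P_def)
      next
        case m1: False
        show thesis
        proof (cases "m = j2")
          case True
          then show thesis using that[of a2 b2] l ind j(3) \<Phi>2 by (simp add: P_def)
        next
          case False
          then show thesis using that[of "y i1" "y i2"] m1 ly i12 indX_db[OF db i12(1,2,5)] by (simp add: P_def)
        qed
      qed
      show ?thesis using additive_scalar[OF subP g1 g2 vw] .
    qed
    then obtain d where d: "\<And>m. m < p \<Longrightarrow> \<forall>v\<in>P m. \<forall>\<eta>\<in>X. G (e m v) \<eta> = d m * v \<eta>" by metis
    let ?N = "{..<p} - {k}"
    define x' where "x' = (\<Sum>m\<in>?N. d m \<star> x m)"
    have x'U: "x' \<in> UU p" unfolding x'_def by (intro sub_sum sub_scl sub_UU xkU) auto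
    have Gs: "G s \<eta> = s (x' \<Otimes> \<eta>)" if s: "s \<in> Ann T" and \<eta>: "\<eta> \<in> X" for s \<eta>
    proof -
      define r where "r m = (\<lambda>\<eta>. s (x m \<Otimes> \<eta>))" for m
      have rP: "r m \<in> P m" for m unfolding r_def using row[OF s] .
      define q where "q = (\<Sum>m\<in>?N. \<theta> m (r m))"
      define h0 where "h0 = r k + q \<star> w0"
      have "(\<Sum>m<p. \<theta> m (r m)) = \<theta> k (r k) + q"
        unfolding q_def using k(1) by (subst sum.remove[of _ k]) auto
      then have "\<theta> k h0 = 0" using s\<tau>[OF s] by (simp add: h0_def \<theta>add[OF k(1)] \<theta>scl[OF k(1)] \<theta>w0 r_def)
      moreover have "lin h0" unfolding h0_def using Plin[OF rP] w0 by blast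
      ultimately have h0: "h0 \<in> H" by (simp add: H_def)
      have eN: "(\<Sum>m\<in>?N. e m (r m)) \<in> Ann T" by (intro sub_sum sub_Ann e rP) auto
      have "s (u \<Otimes> \<eta>) = ((\<Sum>m\<in>?N. e m (r m)) + rk1 (\<phi> k) h0) (u \<Otimes> \<eta>)" if u: "u \<in> UU p" for u
      proof -
        have "(\<Sum>m\<in>?N. e m (r m)) (u \<Otimes> \<eta>) = (\<Sum>m\<in>?N. r m \<eta> * \<phi> m u) - q * w0 \<eta> * \<phi> k u"
          unfolding sum_fun_apply q_def sum_distrib_right sum_subtractf[symmetric]
          by (rule sum.cong) (simp_all add: eten Plin[OF rP])
        moreover have "rk1 (\<phi> k) h0 (u \<Otimes> \<eta>) = r k \<eta> * \<phi> k u + q * w0 \<eta> * \<phi> k u"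
          by (subst rkten[OF k(1) Hlin[OF h0]]) (simp add: h0_def algebra_simps)
        moreover have "s (u \<Otimes> \<eta>) = r k \<eta> * \<phi> k u + (\<Sum>m\<in>?N. r m \<eta> * \<phi> m u)"
          unfolding Ann_expand[OF dbU AnnD(1)[OF s] u] using k(1)
          by (subst sum.remove[of _ k]) (auto simp: r_def mult.commute)
        ultimately show ?thesis by simp
      qed
      then have "G s \<eta> = G ((\<Sum>m\<in>?N. e m (r m)) + rk1 (\<phi> k) h0) \<eta>"
        by (intro G.F_cong[OF s _ \<eta>] sub_add[OF sub_Ann eN Hmem[OF h0]])
      also have "\<dots> = (\<Sum>m\<in>?N. G (e m (r m)) \<eta>)"
        using G.addF[OF eN Hmem[OF h0] \<eta>] GH[OF h0 \<eta>] G.F_sum[of ?N "\<lambda>m. e m (r m)" \<eta>] e rP \<eta> by simp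
      also have "\<dots> = (\<Sum>m\<in>?N. d m * r m \<eta>)"
        using d rP \<eta> by (intro sum.cong) auto
      also have "\<dots> = s (x' \<Otimes> \<eta>)"
        unfolding x'_def tensor_sum_left tensor_scl_left lin_sum[OF AnnD(1)[OF s]] lin_scl[OF AnnD(1)[OF s]] r_def ..
      finally show ?thesis .
    qed
    have "F s \<eta> = s ((c \<star> x k + x') \<Otimes> \<eta>)" if s: "s \<in> Ann T" and \<eta>: "\<eta> \<in> X" for s \<eta>
      using Gs[OF s \<eta>] by (simp add: G_def tensor_simps lin_add[OF AnnD(1)[OF s]] algebra_simps)
    then show ?thesis unfolding localF_def using sub_add[OF sub_UU cx x'U] by blast
  next
    case False
    then have np: "\<theta> k v = 0" if "k < p" "k \<noteq> j1" "k \<noteq> j2" "lin v" for k v using that by blast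
    have jp: "j1 < p" "j2 < p" using j by auto
    have free: "\<forall>k\<in>{..<p} - {j1, j2}. \<forall>t\<in>T. \<forall>v. lin v \<longrightarrow> \<phi> k (contr t v) = 0"
    proof (intro ballI allI impI)
      fix k t and v :: "(nat \<Rightarrow> 'a) \<Rightarrow> 'a"
      assume k: "k \<in> {..<p} - {j1, j2}" and t: "t \<in> T" and v: "lin v"
      obtain c \<eta> \<zeta> where te: "t = x1 \<Otimes> \<eta> + x2 \<Otimes> \<zeta> + c \<star> \<tau>" using Tspan[OF t] by blast
      have kp: "k < p" using k by simp
      have "\<phi> k (contr \<tau> v) = 0" using np[of k v] k v by (simp add: \<theta>_def rk1_def)
      then show "\<phi> k (contr t v) = 0"
        using k \<phi>x1[OF kp] \<phi>x2[OF kp] unfolding te contr_simps[OF v] lin_add[OF lin\<phi>[OF kp]] lin_scl[OF lin\<phi>[OF kp]] by simp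
    qed
    have R: "{j1, j2} \<subseteq> {..<p}" using j by simp
    have card2: "2 \<le> card I" using card by simp
    obtain x0 where x0: "x0 \<in> UU p"
      and Fs0: "\<forall>s\<in>Ann T. (\<Sum>r\<in>{j1,j2}. rk1 (\<phi> r) (\<lambda>\<xi>. s (x r \<Otimes> \<xi>))) \<in> Ann T \<and>
         (\<forall>\<xi>\<in>X. F s \<xi> = s (x0 \<Otimes> \<xi>) + F (\<Sum>r\<in>{j1,j2}. rk1 (\<phi> r) (\<lambda>\<xi>. s (x r \<Otimes> \<xi>))) \<xi>)"
      using split_columns[OF db card2 dbU R free] by blast
    \<comment> \<open>The first kernel is not contained in the second because of
      \<open>\<xi>1\<close>; by codimension the second is not contained in the first either.\<close>
    have "\<exists>\<zeta>\<in>X. a2 \<zeta> = 0 \<and> b2 \<zeta> = 0 \<and> \<not> (a1 \<zeta> = 0 \<and> b1 \<zeta> = 0)"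
      using codim_two_incl[OF X l ind(1), of \<xi>1] \<Phi>1[OF \<xi>1(1)] \<Phi>2[OF \<xi>1(1)] \<xi>1 by metis
    then obtain \<xi>2 where \<xi>2: "\<xi>2 \<in> X" "a2 \<xi>2 = 0" "b2 \<xi>2 = 0" "\<not> (a1 \<xi>2 = 0 \<and> b1 \<xi>2 = 0)" by blast
    have \<xi>1': "a1 \<xi>1 = 0" "b1 \<xi>1 = 0" "\<not> (a2 \<xi>1 = 0 \<and> b2 \<xi>1 = 0)" using \<Phi>1[OF \<xi>1(1)] \<Phi>2[OF \<xi>1(1)] \<xi>1 by auto
    obtain w1 a where w1: "lin w1" "lin a" "w1 \<xi>2 = 1" "a \<xi>2 = 0" "\<exists>\<xi>\<in>X. a \<xi> \<noteq> 0"
      "\<forall>\<xi>. a1 \<xi> = 0 \<longrightarrow> b1 \<xi> = 0 \<longrightarrow> w1 \<xi> = 0 \<and> a \<xi> = 0"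
      "\<forall>\<xi>. w1 \<xi> = 0 \<longrightarrow> a \<xi> = 0 \<longrightarrow> a1 \<xi> = 0 \<and> b1 \<xi> = 0"
      using plane_basis[OF X l(1,2) ind(1) \<xi>2(4)] by blast
    obtain w2 b where w2: "lin w2" "lin b" "w2 \<xi>1 = 1" "b \<xi>1 = 0" "\<exists>\<xi>\<in>X. b \<xi> \<noteq> 0"
      "\<forall>\<xi>. a2 \<xi> = 0 \<longrightarrow> b2 \<xi> = 0 \<longrightarrow> w2 \<xi> = 0 \<and> b \<xi> = 0"
      "\<forall>\<xi>. w2 \<xi> = 0 \<longrightarrow> b \<xi> = 0 \<longrightarrow> a2 \<xi> = 0 \<and> b2 \<xi> = 0"
      using plane_basis[OF X l(3,4) ind(2) \<xi>1'(3)] by blast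
    have z: "w1 \<xi>1 = 0" "a \<xi>1 = 0" "w2 \<xi>2 = 0" "b \<xi>2 = 0" using w1(6) w2(6) \<xi>1' \<xi>2 by auto
    have PP: "w1 \<in> P j1" "a \<in> P j1" "w2 \<in> P j2" "b \<in> P j2"
      unfolding P_def using w1 w2 \<Phi>1 \<Phi>2 j(3) by auto
    define S where "S p' q r u = rk1 (\<phi> j1) (p' \<star> w1 + q \<star> a) + rk1 (\<phi> j2) (r \<star> w2 + u \<star> b)" for p' q r u
    have lc: "lin (p' \<star> w1 + q \<star> a)" "lin (p' \<star> w2 + q \<star> b)" for p' q using w1 w2 by blast+
    have Sten: "S p' q r u (v \<Otimes> \<eta>) = (p' * w1 \<eta> + q * a \<eta>) * \<phi> j1 v + (r * w2 \<eta> + u * b \<eta>) * \<phi> j2 v" for p' q r u v \<eta>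
      unfolding S_def by (simp add: rkten[OF jp(1) lc(1)] rkten[OF jp(2) lc(2)])
    define A where "A = \<theta> j1 w1"
    define B where "B = \<theta> j1 a"
    define C where "C = \<theta> j2 w2"
    define D where "D = \<theta> j2 b"
    have S\<tau>: "S p' q r u \<tau> = A * p' + B * q + C * r + D * u" for p' q r u
      unfolding S_def A_def B_def C_def D_def
      using \<theta>add[OF jp(1), of "p' \<star> w1" "q \<star> a"] \<theta>add[OF jp(2), of "r \<star> w2" "u \<star> b"]
      by (simp add: \<theta>_def[symmetric] \<theta>scl[OF jp(1)] \<theta>scl[OF jp(2)] mult.commute)
    have S: "S p' q r u \<in> Ann T" if "A * p' + B * q + C * r + D * u = 0" for p' q r u
      unfolding S_def
    proof (rule mem2[OF jp(1) _ jp(2)])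
      show "p' \<star> w1 + q \<star> a \<in> P j1" "r \<star> w2 + u \<star> b \<in> P j2" using PP sub_add[OF subP] sub_scl[OF subP] by blast+
      show "\<theta> j1 (p' \<star> w1 + q \<star> a) + \<theta> j2 (r \<star> w2 + u \<star> b) = 0"
        using that by (simp add: \<theta>add[OF jp(1)] \<theta>scl[OF jp(1)] \<theta>add[OF jp(2)] \<theta>scl[OF jp(2)] A_def B_def C_def D_def algebra_simps)
    qed
    have Sadd: "S (p' + p'') (q + q') (r + r') (u + u') = S p' q r u + S p'' q' r' u'" for p' q r u p'' q' r' u'
      unfolding S_def rk1_fun_add[OF lin\<phi>[OF jp(1)]] rk1_fun_add[OF lin\<phi>[OF jp(2)]] rk1_fun_scl[OF lin\<phi>[OF jp(1)]] rk1_fun_scl[OF lin\<phi>[OF jp(2)]]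
      by (simp add: fun_eq_iff algebra_simps)
    \<comment> \<open>As no other column sees \<open>\<tau>\<close>, it has the form
      \<open>x1 \<Otimes> \<eta>0 + x2 \<Otimes> \<eta>1\<close>.\<close>
    define \<eta>0 where "\<eta>0 = (\<Sum>i\<in>I. \<phi> j1 (contr \<tau> (y i)) \<star> \<xi> i)"
    define \<eta>1 where "\<eta>1 = (\<Sum>i\<in>I. \<phi> j2 (contr \<tau> (y i)) \<star> \<xi> i)"
    have \<eta>01: "\<eta>0 \<in> X" "\<eta>1 \<in> X" unfolding \<eta>0_def \<eta>1_def by (intro sub_sum[OF X] sub_scl[OF X] db_mem[OF db]; assumption)+
    have \<tau>W: "\<tau> \<in> WW p X" using \<tau> TW by blast
    have \<tau>eq: "\<tau> = x1 \<Otimes> \<eta>0 + x2 \<Otimes> \<eta>1"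
    proof -
      have "contr \<tau> (y i) = \<phi> j1 (contr \<tau> (y i)) \<star> x1 + \<phi> j2 (contr \<tau> (y i)) \<star> x2" if i: "i \<in> I" for i
      proof -
        have "contr \<tau> (y i) = (\<Sum>k<p. \<phi> k (contr \<tau> (y i)) \<star> x k)"
          by (rule db_expand[OF dbU contr_UU[OF \<tau>W ly[OF i]]])
        also have "\<dots> = (\<Sum>k\<in>{j1,j2}. \<phi> k (contr \<tau> (y i)) \<star> x k)"
        proof (rule sum.mono_neutral_right)
          show "\<forall>k\<in>{..<p} - {j1, j2}. \<phi> k (contr \<tau> (y i)) \<star> x k = 0"
            using np[OF _ _ _ ly[OF i]] by (auto simp: \<theta>_def rk1_def)
        qed (use R in auto)
        finally show ?thesis using j(3) x by simp
      qed
      then have "\<tau> = (\<Sum>i\<in>I. (\<phi> j1 (contr \<tau> (y i)) \<star> x1 + \<phi> j2 (contr \<tau> (y i)) \<star> x2) \<Otimes> \<xi> i)"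
        using db_decompose[OF db \<tau>W] by simp
      then show ?thesis by (simp add: \<eta>0_def \<eta>1_def tensor_simps tensor_sum_right sum.distrib)
    qed
    have \<theta>\<eta>: "\<theta> j1 v = v \<eta>0" "\<theta> j2 v = v \<eta>1" if v: "lin v" for v
      unfolding \<theta>_def rk1_def \<tau>eq contr_simps[OF v]
      by (simp_all add: lin_add[OF lin\<phi>[OF jp(1)]] lin_scl[OF lin\<phi>[OF jp(1)]] lin_add[OF lin\<phi>[OF jp(2)]] lin_scl[OF lin\<phi>[OF jp(2)]]
        \<phi>x1[OF jp(1)] \<phi>x1[OF jp(2)] \<phi>x2[OF jp(1)] \<phi>x2[OF jp(2)] j(3) j(3)[symmetric])
    \<comment> \<open>If one summand of \<open>\<tau>\<close> lies in \<open>T\<close>, so does the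
      other.\<close>
    have nd: "A = 0 \<and> B = 0 \<longleftrightarrow> C = 0 \<and> D = 0"
    proof
      assume "A = 0 \<and> B = 0"
      then have "w1 \<eta>0 = 0" "a \<eta>0 = 0" by (simp_all add: A_def B_def \<theta>\<eta> w1)
      then have "x1 \<Otimes> \<eta>0 \<in> T" using w1(7) \<Phi>1[OF \<eta>01(1)] by blast
      from sub_diff[OF T \<tau> this] have "x2 \<Otimes> \<eta>1 \<in> T" by (simp add: \<tau>eq)
      then have "w2 \<eta>1 = 0" "b \<eta>1 = 0" using w2(6) \<Phi>2[OF \<eta>01(2)] by blast+
      then show "C = 0 \<and> D = 0" by (simp add: C_def D_def \<theta>\<eta> w2)
    next
      assume "C = 0 \<and> D = 0"
      then have "w2 \<eta>1 = 0" "b \<eta>1 = 0" by (simp_all add: C_def D_def \<theta>\<eta> w2)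
      then have "x2 \<Otimes> \<eta>1 \<in> T" using w2(7) \<Phi>2[OF \<eta>01(2)] by blast
      from sub_diff[OF T \<tau> this] have "x1 \<Otimes> \<eta>0 \<in> T" by (simp add: \<tau>eq)
      then have "w1 \<eta>0 = 0" "a \<eta>0 = 0" using w1(6) \<Phi>1[OF \<eta>01(1)] by blast+
      then show "A = 0 \<and> B = 0" by (simp add: A_def B_def \<theta>\<eta> w1)
    qed
    have "\<exists>lc mc. \<forall>p' q r u. A * p' + B * q + C * r + D * u = 0 \<longrightarrow>
        (\<forall>\<eta>\<in>X. F (S p' q r u) \<eta> = lc * (p' * w1 \<eta> + q * a \<eta>) + mc * (r * w2 \<eta> + u * b \<eta>))"
    proof (rule two_planes_core[OF c01, where ?\<xi>1.0 = \<xi>1 and ?\<xi>2.0 = \<xi>2])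
      fix p' q r u p'' q' r' u' \<eta>
      assume "A * p' + B * q + C * r + D * u = 0" "A * p'' + B * q' + C * r' + D * u' = 0" "\<eta> \<in> X"
      then show "F (S (p' + p'') (q + q') (r + r') (u + u')) \<eta> = F (S p' q r u) \<eta> + F (S p'' q' r' u') \<eta>"
        unfolding Sadd using addF S by blast
    next
      fix p' q r u \<eta>
      assume rel: "A * p' + B * q + C * r + D * u = 0" and nz: "p' \<noteq> 0" "r \<noteq> 0" and \<eta>: "\<eta> \<in> X"
      have "F (S p' q r u) \<zeta> = 0" if "\<zeta> \<in> X" "(p' \<star> w1 + q \<star> a) \<zeta> = 0" "(r \<star> w2 + u \<star> b) \<zeta> = 0" for \<zeta>
        by (rule rc[OF S[OF rel] that(1)]) (use that in \<open>simp add: Sten\<close>)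
      then have van: "\<forall>\<zeta>\<in>X. (p' \<star> w1 + q \<star> a) \<zeta> = 0 \<longrightarrow> (r \<star> w2 + u \<star> b) \<zeta> = 0 \<longrightarrow> F (S p' q r u) \<zeta> = 0" by blast
      obtain \<alpha> \<beta> where ab0: "\<forall>\<zeta>\<in>X. F (S p' q r u) \<zeta> = \<alpha> * (p' \<star> w1 + q \<star> a) \<zeta> + \<beta> * (r \<star> w2 + u \<star> b) \<zeta>"
        using lin_combination_ex[OF X linF[OF S[OF rel]] lc(1) lc(2) van] by blast
      have ab: "F (S p' q r u) \<zeta> = \<alpha> * (p' * w1 \<zeta> + q * a \<zeta>) + \<beta> * (r * w2 \<zeta> + u * b \<zeta>)" if "\<zeta> \<in> X" for \<zeta>
        using ab0 that by simp
      have "F (S p' q r u) \<xi>2 = \<alpha> * p'" "F (S p' q r u) \<xi>1 = \<beta> * r"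
        using ab[OF \<xi>2(1)] ab[OF \<xi>1(1)] z w1 w2 by simp_all
      then have "\<alpha> = F (S p' q r u) \<xi>2 / p'" "\<beta> = F (S p' q r u) \<xi>1 / r" using nz by simp_all
      then show "F (S p' q r u) \<eta> = F (S p' q r u) \<xi>2 / p' * (p' * w1 \<eta> + q * a \<eta>) + F (S p' q r u) \<xi>1 / r * (r * w2 \<eta> + u * b \<eta>)"
        using ab[OF \<eta>] by simp
    next
      fix q r u assume rel: "A * 0 + B * q + C * r + D * u = 0"
      show "F (S 0 q r u) \<xi>2 = 0" by (rule rc[OF S[OF rel] \<xi>2(1)]) (simp add: Sten w1 z)
    next
      fix p' q u assume rel: "A * p' + B * q + C * 0 + D * u = 0"
      show "F (S p' q 0 u) \<xi>1 = 0" by (rule rc[OF S[OF rel] \<xi>1(1)]) (simp add: Sten w2 z)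
    qed (use \<xi>1 \<xi>2 w1 w2 nd in auto)
    then obtain lc mc where lm: "\<And>p' q r u \<eta>. A * p' + B * q + C * r + D * u = 0 \<Longrightarrow> \<eta> \<in> X \<Longrightarrow>
        F (S p' q r u) \<eta> = lc * (p' * w1 \<eta> + q * a \<eta>) + mc * (r * w2 \<eta> + u * b \<eta>)" by blast
    define x' where "x' = x0 + lc \<star> x1 + mc \<star> x2"
    have x': "x' \<in> UU p" unfolding x'_def using x0 xU sub_add[OF sub_UU] sub_scl[OF sub_UU] by blast
    have "F s \<eta> = s (x' \<Otimes> \<eta>)" if s: "s \<in> Ann T" and \<eta>: "\<eta> \<in> X" for s \<eta>
    proof -
      let ?s' = "\<Sum>r\<in>{j1,j2}. rk1 (\<phi> r) (\<lambda>\<xi>. s (x r \<Otimes> \<xi>))"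
      have s': "?s' \<in> Ann T" and Fs': "F s \<eta> = s (x0 \<Otimes> \<eta>) + F ?s' \<eta>" using Fs0 s \<eta> by blast+
      have r: "lin (\<lambda>\<eta>. s (x1 \<Otimes> \<eta>))" "lin (\<lambda>\<eta>. s (x2 \<Otimes> \<eta>))" using lin_row[OF AnnD(1)[OF s]] by auto
      have v1: "s (x1 \<Otimes> \<zeta>) = 0" if "\<zeta> \<in> X" "w1 \<zeta> = 0" "a \<zeta> = 0" for \<zeta>
        using AnnD(2)[OF s] \<Phi>1[OF that(1)] w1(7) that by blast
      have v2: "s (x2 \<Otimes> \<zeta>) = 0" if "\<zeta> \<in> X" "w2 \<zeta> = 0" "b \<zeta> = 0" for \<zeta>
        using AnnD(2)[OF s] \<Phi>2[OF that(1)] w2(7) that by blast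
      obtain q where q: "\<forall>\<zeta>\<in>X. s (x1 \<Otimes> \<zeta>) = s (x1 \<Otimes> \<xi>2) * w1 \<zeta> + q * a \<zeta>"
        using plane_expand[OF X w1(1,2) \<xi>2(1) w1(3,4) r(1) v1] by blast
      obtain u where u: "\<forall>\<zeta>\<in>X. s (x2 \<Otimes> \<zeta>) = s (x2 \<Otimes> \<xi>1) * w2 \<zeta> + u * b \<zeta>"
        using plane_expand[OF X w2(1,2) \<xi>1(1) w2(3,4) r(2) v2] by blast
      let ?S = "S (s (x1 \<Otimes> \<xi>2)) q (s (x2 \<Otimes> \<xi>1)) u"
      have s'ten: "?s' (v \<Otimes> \<zeta>) = ?S (v \<Otimes> \<zeta>)" if "\<zeta> \<in> X" for v \<zeta>
        using q u that j(3) by (simp add: Sten x rkten[OF jp(1) r(1)] rkten[OF jp(2) r(2)])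
      have lS: "lin ?S" unfolding S_def by (intro lin_plus lin_rk1 lin\<phi> jp lc)
      have "?s' \<tau> = ?S \<tau>" by (rule WW_lin_eqI[OF db \<tau>W AnnD(1)[OF s'] lS s'ten])
      then have rel: "A * s (x1 \<Otimes> \<xi>2) + B * q + C * s (x2 \<Otimes> \<xi>1) + D * u = 0" using AnnD(2)[OF s' \<tau>] S\<tau> by simp
      have "F ?s' \<eta> = F ?S \<eta>" by (rule F_cong[OF s' S[OF rel] \<eta> s'ten[OF \<eta>]])
      then have "F ?s' \<eta> = lc * s (x1 \<Otimes> \<eta>) + mc * s (x2 \<Otimes> \<eta>)" using lm[OF rel \<eta>] q u \<eta> by simp
      then show ?thesis using Fs' by (simp add: x'_def tensor_simps lin_add[OF AnnD(1)[OF s]] lin_scl[OF AnnD(1)[OF s]])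
    qed
    then show ?thesis unfolding localF_def using x' by blast
  qed
qed

end

subsection \<open>Bad dual bases\<close>

text \<open>With \<open>|L| + 2\<close> points on the projective line through two functionals, at most one of them is
  lost for each vector to be avoided.\<close>

lemma lin_avoid:
  fixes N :: "('i \<Rightarrow> 'a::field) set" and L :: "'a set"
  assumes "finite N" "0 \<notin> N" "finite L" "0 \<notin> L" "card N \<le> card L + 1"
  shows "\<exists>z. lin z \<and> (\<forall>\<eta>\<in>N. z \<eta> \<noteq> 0)"
  using assms(1,2,5)
proof (induction N rule: finite_induct)
  case empty
  show ?case using lin_zero by blast
next
  case (insert \<eta> N)
  obtain z where z: "lin z" "\<And>\<zeta>. \<zeta> \<in> N \<Longrightarrow> z \<zeta> \<noteq> 0" using insert by auto
  have "\<eta> \<noteq> 0" using insert.prems by auto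
  then obtain w where w: "lin w" "w \<eta> = 1" using lin_ex_nonzero by blast
  show ?case
  proof (cases "z \<eta> = 0")
    case False
    then show ?thesis using z by blast
  next
    case z0: True
    show ?thesis
    proof (cases "\<forall>\<zeta>\<in>N. w \<zeta> \<noteq> 0")
      case True
      then show ?thesis using w by (intro exI[of _ w]) auto
    next
      case False
      then obtain \<zeta>0 where \<zeta>0: "\<zeta>0 \<in> N" "w \<zeta>0 = 0" by blast
      let ?b = "(\<lambda>\<zeta>. - z \<zeta> / w \<zeta>) ` (N - {\<zeta>0})"
      have "card ?b \<le> card (N - {\<zeta>0})" using insert.hyps by (intro card_image_le) auto
      also have "\<dots> < card N" using insert.hyps \<zeta>0 by (intro psubset_card_mono) auto
      also have "\<dots> \<le> card L" using insert.prems insert.hyps by simp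
      finally have "\<not> L \<subseteq> ?b" using card_mono[of ?b L] insert.hyps by auto
      then obtain c where c: "c \<in> L" "c \<notin> ?b" by blast
      have "z \<zeta> + c * w \<zeta> \<noteq> 0" if \<zeta>: "\<zeta> \<in> N" for \<zeta>
      proof (cases "w \<zeta> = 0")
        case True
        then show ?thesis using z(2)[OF \<zeta>] by simp
      next
        case nz: False
        show ?thesis
        proof
          assume "z \<zeta> + c * w \<zeta> = 0"
          then have "c = - z \<zeta> / w \<zeta>" using nz by (simp add: field_simps add_eq_0_iff)
          then show False using c(2) \<zeta> nz \<zeta>0(2) by blast
        qed
      qed
      moreover have "z \<eta> + c * w \<eta> \<noteq> 0" using z0 w(2) c(1) assms(4) by auto
      moreover have "lin (z + c \<star> w)" using z(1) w(1) by (intro lin_plus lin_star)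
      ultimately have "lin (z + c \<star> w)" "\<forall>\<zeta>\<in>insert \<eta> N. (z + c \<star> w) \<zeta> \<noteq> 0" by auto
      then show ?thesis by blast
    qed
  qed
qed

text \<open>The functionals are replaced one at a time. Each new one must also be nonzero at the
  current \<open>\<xi>1 k\<close> for the exchange to work; this is the one extra vector granted by
  \<open>lin_avoid\<close>.\<close>

lemma db_avoid:
  fixes N :: "(nat \<Rightarrow> 'a::field) set" and L :: "'a set"
  assumes db: "db I X \<xi> y" and X: "sub X"
    and N: "finite N" "0 \<notin> N" and L: "finite L" "0 \<notin> L" "card N \<le> card L"
  obtains \<xi>' y' where "db I X \<xi>' y'" "\<forall>i\<in>I. \<forall>\<eta>\<in>N. y' i \<eta> \<noteq> 0"
proof -
  have "\<exists>\<xi>' y'. db I X \<xi>' y' \<and> (\<forall>i\<in>J. \<forall>\<eta>\<in>N. y' i \<eta> \<noteq> 0)" if "J \<subseteq> I" for J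
  proof -
    have "finite J" using that db_finite[OF db] finite_subset by blast
    then show ?thesis using that
    proof (induction J rule: finite_induct)
      case empty
      then show ?case using db by blast
    next
      case (insert k J)
      then obtain \<xi>1 y1 where db1: "db I X \<xi>1 y1" and g: "\<forall>i\<in>J. \<forall>\<eta>\<in>N. y1 i \<eta> \<noteq> 0" by blast
      have k: "k \<in> I" using insert.prems by simp
      have "card (insert (\<xi>1 k) N) \<le> card L + 1" using card_insert_le_m1[of "Suc (card L)" N "\<xi>1 k"] L(3) by simp
      then obtain z where z: "lin z" "\<forall>\<eta>\<in>insert (\<xi>1 k) N. z \<eta> \<noteq> 0"
        using lin_avoid[of "insert (\<xi>1 k) N" L] N L db_nonzero[OF db1 k] by auto
      obtain \<xi>2 where db2: "db I X \<xi>2 (y1(k := z))" using db_fun_exchange[OF db1 X k z(1)] z(2) by blast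
      have "\<forall>i\<in>insert k J. \<forall>\<eta>\<in>N. (y1(k := z)) i \<eta> \<noteq> 0" using g z(2) by auto
      then show ?case using db2 by blast
    qed
  qed
  then show thesis using that by blast
qed

text \<open>Greedy exchange: functionals with \<open>Q\<close> enter the dual basis as long as one
  of them is nonzero at a vector not yet used. Either three are placed, or all of them vanish at the
  vectors that remain.\<close>

lemma three_or_vanish:
  assumes db: "db I X \<xi> y" and X: "sub X" and card: "3 \<le> card I"
  shows "(\<exists>\<xi>' y' k1 k2 k3. db I X \<xi>' y' \<and> k1 \<in> I \<and> k2 \<in> I \<and> k3 \<in> I \<and> k1 \<noteq> k2 \<and> k1 \<noteq> k3 \<and> k2 \<noteq> k3 \<and>
      Q (y' k1) \<and> Q (y' k2) \<and> Q (y' k3)) \<or>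
    (\<exists>\<xi>' y' k1 k2. db I X \<xi>' y' \<and> k1 \<in> I \<and> k2 \<in> I \<and> k1 \<noteq> k2 \<and>
      (\<forall>z. lin z \<longrightarrow> Q z \<longrightarrow> (\<forall>i\<in>I - {k1, k2}. z (\<xi>' i) = 0)))"
proof -
  have fin: "finite I" using db_finite[OF db] .
  have ex2: "\<exists>k2. k2 \<in> I \<and> k2 \<noteq> k1" for k1
  proof (rule ccontr)
    assume "\<not> ?thesis"
    then have "I \<subseteq> {k1}" by blast
    then show False using card card_mono[of "{k1}" I] by simp
  qed
  show ?thesis
  proof (cases "\<exists>z1 k1. lin z1 \<and> Q z1 \<and> k1 \<in> I \<and> z1 (\<xi> k1) \<noteq> 0")
    case False
    obtain k1 where "k1 \<in> I" using card by fastforce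
    then show ?thesis using False db ex2[of k1] by (intro disjI2) blast
  next
    case True
    then obtain z1 k1 where z1: "lin z1" "Q z1" "k1 \<in> I" "z1 (\<xi> k1) \<noteq> 0" by blast
    obtain \<xi>1 where db1: "db I X \<xi>1 (y(k1 := z1))" using db_fun_exchange[OF db X z1(3,1,4)] .
    show ?thesis
    proof (cases "\<exists>z2 k2. lin z2 \<and> Q z2 \<and> k2 \<in> I - {k1} \<and> z2 (\<xi>1 k2) \<noteq> 0")
      case False
      obtain k2 where "k2 \<in> I" "k2 \<noteq> k1" using ex2 by blast
      then show ?thesis using False db1 z1(3) by (intro disjI2) blast
    next
      case True
      then obtain z2 k2 where z2: "lin z2" "Q z2" "k2 \<in> I" "k2 \<noteq> k1" "z2 (\<xi>1 k2) \<noteq> 0" by blast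
      obtain \<xi>2 where db2: "db I X \<xi>2 ((y(k1 := z1))(k2 := z2))" using db_fun_exchange[OF db1 X z2(3,1,5)] .
      show ?thesis
      proof (cases "\<exists>z3 k3. lin z3 \<and> Q z3 \<and> k3 \<in> I - {k1, k2} \<and> z3 (\<xi>2 k3) \<noteq> 0")
        case False
        then show ?thesis using db2 z1(3) z2(3,4) by (intro disjI2) blast
      next
        case True
        then obtain z3 k3 where z3: "lin z3" "Q z3" "k3 \<in> I" "k3 \<noteq> k1" "k3 \<noteq> k2" "z3 (\<xi>2 k3) \<noteq> 0" by blast
        obtain \<xi>3 where db3: "db I X \<xi>3 (((y(k1 := z1))(k2 := z2))(k3 := z3))"
          using db_fun_exchange[OF db2 X z3(3,1,6)] .
        define Y where "Y = ((y(k1 := z1))(k2 := z2))(k3 := z3)"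
        have "Y k1 = z1" "Y k2 = z2" "Y k3 = z3" using z2 z3 by (simp_all add: Y_def)
        then show ?thesis using db3[folded Y_def] z1 z2 z3 by metis
      qed
    qed
  qed
qed

lemma three_or_hyperplane:
  assumes db: "db I X \<xi> y" and X: "sub X" and card: "3 \<le> card I"
    and no3: "\<And>\<xi>' y' k1 k2 k3. db I X \<xi>' y' \<Longrightarrow> k1 \<in> I \<Longrightarrow> k2 \<in> I \<Longrightarrow> k3 \<in> I \<Longrightarrow> k1 \<noteq> k2 \<Longrightarrow> k1 \<noteq> k3 \<Longrightarrow> k2 \<noteq> k3 \<Longrightarrow>
      Q (y' k1) \<Longrightarrow> Q (y' k2) \<Longrightarrow> Q (y' k3) \<Longrightarrow> False"
  shows "\<exists>\<eta>\<in>X. \<eta> \<noteq> 0 \<and> (\<forall>z. lin z \<longrightarrow> Q z \<longrightarrow> z \<eta> = 0)"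
proof -
  obtain \<xi>' y' k1 k2 where db': "db I X \<xi>' y'" and k: "k1 \<in> I" "k2 \<in> I"
    and Q: "\<forall>z. lin z \<longrightarrow> Q z \<longrightarrow> (\<forall>i\<in>I - {k1, k2}. z (\<xi>' i) = 0)"
    using three_or_vanish[OF db X card, of Q] no3 by blast
  have "\<not> I \<subseteq> {k1, k2}" using card card_mono[of "{k1, k2}" I] card_insert_le_m1[of 2 "{k2}" k1] by auto
  then obtain i where i: "i \<in> I - {k1, k2}" by blast
  then show ?thesis using Q db_mem[OF db'] db_nonzero[OF db'] by blast
qed

context rcs
begin

text \<open>For each \<open>i\<close> the contractions with \<open>y i\<close> lie on a line,
  spanned by \<open>u i\<close>. So \<open>T\<close> lies in the span of the tensors
  \<open>u i \<Otimes> \<xi> i\<close>, and equals it if its dimension is not below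
  \<open>card I\<close>.\<close>

lemma bad_basis:
  assumes db: "db I X \<xi> y" and bad: "\<And>i t1 t2. i \<in> I \<Longrightarrow> t1 \<in> T \<Longrightarrow> t2 \<in> T \<Longrightarrow> \<not> indep2 (contr t1 (y i)) (contr t2 (y i))"
  shows "\<exists>u. (\<forall>i\<in>I. u i \<in> UU p) \<and> (\<forall>t\<in>T. \<forall>i\<in>I. \<exists>c. contr t (y i) = c \<star> u i) \<and> dimle T (card I) \<and>
    (\<not> dimle T (card I - 1) \<longrightarrow> (\<forall>i\<in>I. u i \<noteq> 0 \<and> u i \<Otimes> \<xi> i \<in> T))"
proof -
  have ly: "lin (y i)" if "i \<in> I" for i using db_lin[OF db that] .
  have fin: "finite I" using db_finite[OF db] .
  have "\<exists>u\<in>UU p. \<forall>t\<in>T. \<exists>c. contr t (y i) = c \<star> u" if i: "i \<in> I" for i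
  proof (cases "\<forall>t\<in>T. contr t (y i) = 0")
    case True
    then show ?thesis using sub_0[OF sub_UU] by (intro bexI[of _ 0]) auto
  next
    case False
    then obtain t0 where t0: "t0 \<in> T" "contr t0 (y i) \<noteq> 0" by blast
    have "\<exists>c. contr t (y i) = c \<star> contr t0 (y i)" if "t \<in> T" for t
      using not_indep2[OF bad[OF i t0(1) that] t0(2)] by blast
    moreover have "contr t0 (y i) \<in> UU p" using contr_UU[OF _ ly[OF i]] TW t0(1) by blast
    ultimately show ?thesis by blast
  qed
  then obtain u where u: "\<And>i. i \<in> I \<Longrightarrow> u i \<in> UU p" "\<And>i t. i \<in> I \<Longrightarrow> t \<in> T \<Longrightarrow> \<exists>c. contr t (y i) = c \<star> u i"
    by metis
  have sp: "\<exists>c. t = (\<Sum>i\<in>I. c i \<star> u i \<Otimes> \<xi> i)" if t: "t \<in> T" for t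
  proof -
    obtain c where c: "\<And>i. i \<in> I \<Longrightarrow> contr t (y i) = c i \<star> u i" using u(2)[OF _ t] by metis
    have "t = (\<Sum>i\<in>I. contr t (y i) \<Otimes> \<xi> i)" using db_decompose[OF db] t TW by blast
    also have "\<dots> = (\<Sum>i\<in>I. c i \<star> u i \<Otimes> \<xi> i)" by (rule sum.cong) (simp_all add: c tensor_scl_left)
    finally show ?thesis by blast
  qed
  have dT: "dimle T (card I)" by (rule dimle_span[OF fin sp])
  have full: "u i \<noteq> 0 \<and> u i \<Otimes> \<xi> i \<in> T" if nd: "\<not> dimle T (card I - 1)" and i: "i \<in> I" for i
  proof
    have cI: "card I = Suc (card I - 1)" using i fin card_gt_0_iff[of I] by auto
    show "u i \<noteq> 0"
    proof
      assume z: "u i = 0"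
      have "\<exists>c. t = (\<Sum>j\<in>I-{i}. c j \<star> u j \<Otimes> \<xi> j)" if t: "t \<in> T" for t
      proof -
        obtain c where "t = (\<Sum>j\<in>I. c j \<star> u j \<Otimes> \<xi> j)" using sp[OF t] by blast
        also have "\<dots> = (\<Sum>j\<in>I-{i}. c j \<star> u j \<Otimes> \<xi> j)" using z sum.remove[OF fin i, of "\<lambda>j. c j \<star> u j \<Otimes> \<xi> j"] by simp
        finally show ?thesis by blast
      qed
      then have "dimle T (card (I - {i}))" using dimle_span[of "I - {i}" T "\<lambda>j. u j \<Otimes> \<xi> j"] fin by blast
      then show False using nd i fin by simp
    qed
    let ?S = "{(\<Sum>j\<in>I. c j \<star> u j \<Otimes> \<xi> j) | c. True}"
    have dS: "dimle ?S (Suc (card I - 1))"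
      unfolding cI[symmetric] by (rule dimle_span[OF fin, of _ "\<lambda>j. u j \<Otimes> \<xi> j"]) blast
    have TS: "T \<subseteq> ?S" using sp by blast
    have mS: "u i \<Otimes> \<xi> i \<in> ?S"
    proof -
      have "(\<Sum>j\<in>I. (if j = i then 1 else 0) \<star> u j \<Otimes> \<xi> j) = (\<Sum>j\<in>I. if j = i then u j \<Otimes> \<xi> j else 0)"
        by (rule sum.cong) auto
      then have "u i \<Otimes> \<xi> i = (\<Sum>j\<in>I. (if j = i then 1 else 0) \<star> u j \<Otimes> \<xi> j)" using fin i by simp
      then show ?thesis by (intro CollectI exI[of _ "\<lambda>j. if j = i then 1 else 0"] conjI TrueI)
    qed
    show "u i \<Otimes> \<xi> i \<in> T"
    proof (rule ccontr)
      assume "u i \<Otimes> \<xi> i \<notin> T"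
      from dimle_drop[OF dS T TS mS this] show False using nd by blast
    qed
  qed
  show ?thesis using u dT full by blast
qed

text \<open>Here \<open>T\<close> consists of all \<open>u \<Otimes> \<eta>\<close> for one vector
  \<open>u\<close>, whereas the alternative to locality in \<open>one_column\<close> provides some
  \<open>u \<Otimes> \<eta>\<close> outside \<open>T\<close>.\<close>

lemma parallel_columns:
  assumes db: "db I X \<xi> y" and card: "2 \<le> card I"
    and u: "\<And>i. i \<in> I \<Longrightarrow> u i \<in> UU p" "\<And>t i. t \<in> T \<Longrightarrow> i \<in> I \<Longrightarrow> \<exists>c. contr t (y i) = c \<star> u i"
    and unz: "\<And>i. i \<in> I \<Longrightarrow> u i \<noteq> 0" and uT: "\<And>i. i \<in> I \<Longrightarrow> u i \<Otimes> \<xi> i \<in> T"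
    and par: "\<And>i j. i \<in> I \<Longrightarrow> j \<in> I \<Longrightarrow> \<not> indep2 (u i) (u j)"
  shows "localF p X T F"
proof -
  obtain i where i: "i \<in> I" using card by fastforce
  have "\<exists>d. u j = d \<star> u i \<and> d \<noteq> 0" if j: "j \<in> I" for j
  proof -
    obtain d where d: "u j = d \<star> u i" using not_indep2[OF par[OF i j] unz[OF i]] .
    moreover have "d \<noteq> 0" using unz[OF j] d by auto
    ultimately show ?thesis by blast
  qed
  then obtain d where d: "\<And>j. j \<in> I \<Longrightarrow> u j = d j \<star> u i" "\<And>j. j \<in> I \<Longrightarrow> d j \<noteq> 0" by metis
  have mem: "u i \<Otimes> \<eta> \<in> T" if \<eta>: "\<eta> \<in> X" for \<eta>
  proof -
    have "u i \<Otimes> \<xi> j \<in> T" if j: "j \<in> I" for j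
      using sub_scl[OF T uT[OF j], of "inverse (d j)"] d[OF j] by (simp add: tensor_scl_left)
    then have "(\<Sum>j\<in>I. y j \<eta> \<star> u i \<Otimes> \<xi> j) \<in> T" by (intro sub_sum[OF T] sub_scl[OF T])
    moreover have "u i \<Otimes> \<eta> = (\<Sum>j\<in>I. y j \<eta> \<star> u i \<Otimes> \<xi> j)"
      by (subst db_expand[OF db \<eta>]) (simp add: tensor_sum_right tensor_scl_right)
    ultimately show ?thesis by simp
  qed
  have "\<exists>\<eta>\<in>X. t = u i \<Otimes> \<eta>" if t: "t \<in> T" for t
  proof -
    obtain c where c: "\<And>j. j \<in> I \<Longrightarrow> contr t (y j) = c j \<star> u j" using u(2)[OF t] by metis
    have "t = (\<Sum>j\<in>I. contr t (y j) \<Otimes> \<xi> j)" using db_decompose[OF db] t TW by blast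
    also have "\<dots> = (\<Sum>j\<in>I. u i \<Otimes> ((c j * d j) \<star> \<xi> j))"
      using c d(1) by (intro sum.cong) (simp_all add: tensor_scl_left tensor_scl_right)
    also have "\<dots> = u i \<Otimes> (\<Sum>j\<in>I. (c j * d j) \<star> \<xi> j)" by (simp add: tensor_sum_right)
    finally have "t = u i \<Otimes> (\<Sum>j\<in>I. (c j * d j) \<star> \<xi> j)" .
    moreover have "(\<Sum>j\<in>I. (c j * d j) \<star> \<xi> j) \<in> X"
      by (rule sub_sum[OF X]) (rule sub_scl[OF X db_mem[OF db]])
    ultimately show ?thesis by blast
  qed
  then show ?thesis using one_column[OF db card u(1)[OF i] unz[OF i]] mem by blast
qed

end

subsection \<open>The induction for fields with more than two elements\<close>

context rcs
begin

lemma restrict_db: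
  assumes db: "db I X \<xi> y" and z: "lin z" "\<exists>\<eta>\<in>X. z \<eta> \<noteq> 0"
  shows "\<exists>k\<in>I. \<exists>\<xi>'. db I X \<xi>' (y(k := z)) \<and> db (I - {k}) (kerin X z) \<xi>' (y(k := z))"
proof -
  obtain k where k: "k \<in> I" "z (\<xi> k) \<noteq> 0" using db_ex_nonzero[OF db z(1)] z(2) by blast
  obtain \<xi>' where db': "db I X \<xi>' (y(k := z))" using db_fun_exchange[OF db X k(1) z(1) k(2)] by blast
  from db_kerin[OF db' k(1)] have "db (I - {k}) (kerin X z) \<xi>' (y(k := z))" by simp
  then show ?thesis using db' k(1) by blast
qed

text \<open>A lift of \<open>c \<star> s'\<close> and the \<open>c\<close>-fold lift of
  \<open>s'\<close> agree on rows in \<open>ker z\<close>.\<close>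

lemma homogF_restrict:
  assumes hom: "homogF X T F" and z: "lin z"
    and G: "\<forall>s'\<in>Ann (Tker T z). \<exists>s\<in>Ann T. (\<forall>t\<in>WW p (kerin X z). s t = s' t) \<and> (\<forall>\<xi>\<in>kerin X z. G s' \<xi> = F s \<xi>)"
  shows "homogF (kerin X z) (Tker T z) G"
  unfolding homogF_def
proof (intro allI ballI)
  fix c s' \<xi> assume s': "s' \<in> Ann (Tker T z)" and \<xi>: "\<xi> \<in> kerin X z"
  have K: "sub (kerin X z)" by (rule sub_kerin[OF X z])
  have \<xi>X: "\<xi> \<in> X" using \<xi> by (simp add: kerin_def)
  obtain s where s: "s \<in> Ann T" "\<forall>t\<in>WW p (kerin X z). s t = s' t" "G s' \<xi> = F s \<xi>" using G s' \<xi> by blast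
  have "c \<star> s' \<in> Ann (Tker T z)" by (rule sub_scl[OF sub_Ann s'])
  then obtain r where r: "r \<in> Ann T" "\<forall>t\<in>WW p (kerin X z). r t = (c \<star> s') t" "G (c \<star> s') \<xi> = F r \<xi>" using G \<xi> by blast
  have "F r \<xi> = F (c \<star> s) \<xi>"
  proof (rule F_cong[OF r(1) sub_scl[OF sub_Ann s(1)] \<xi>X])
    fix x :: "nat \<Rightarrow> 'a" assume "x \<in> UU p"
    then have "x \<Otimes> \<xi> \<in> WW p (kerin X z)" by (rule tensor_WW[OF _ \<xi> K])
    then show "r (x \<Otimes> \<xi>) = (c \<star> s) (x \<Otimes> \<xi>)" using s(2) r(2) by (simp add: scl_apply)
  qed
  also have "\<dots> = c * F s \<xi>" using hom s(1) \<xi>X unfolding homogF_def by blast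
  finally show "G (c \<star> s') \<xi> = c * G s' \<xi>" using r(3) s(3) by simp
qed

lemma restrict_homogF:
  assumes z: "lin z"
  shows "\<exists>G. rcs p (kerin X z) (Tker T z) G \<and> (\<forall>s\<in>Ann T. \<forall>\<xi>\<in>kerin X z. G s \<xi> = F s \<xi>) \<and>
    (homogF X T F \<longrightarrow> homogF (kerin X z) (Tker T z) G)"
proof -
  obtain G where G: "rcs p (kerin X z) (Tker T z) G"
    and eq: "\<And>s \<xi>. s \<in> Ann T \<Longrightarrow> \<xi> \<in> kerin X z \<Longrightarrow> G s \<xi> = F s \<xi>"
    and lift: "\<And>s'. s' \<in> Ann (Tker T z) \<Longrightarrow>
      \<exists>s\<in>Ann T. (\<forall>t\<in>WW p (kerin X z). s t = s' t) \<and> (\<forall>\<xi>\<in>kerin X z. G s' \<xi> = F s \<xi>)"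
    using restrict[OF z] by blast
  have "homogF X T F \<longrightarrow> homogF (kerin X z) (Tker T z) G"
    using homogF_restrict[OF _ z] lift by blast
  then show ?thesis using G eq by blast
qed

lemma localF_restrict:
  assumes "\<forall>s\<in>Ann T. \<forall>\<xi>\<in>kerin X z. G s \<xi> = F s \<xi>" "localF p (kerin X z) (Tker T z) G"
  shows "localF p (kerin X z) T F"
proof -
  obtain x where "x \<in> UU p" "\<forall>s\<in>Ann (Tker T z). \<forall>\<xi>\<in>kerin X z. G s \<xi> = s (x \<Otimes> \<xi>)"
    using assms(2) unfolding localF_def by blast
  moreover have "s \<in> Ann (Tker T z)" if "s \<in> Ann T" for s using that Ann_Tker by blast
  ultimately have "\<forall>s\<in>Ann T. \<forall>\<xi>\<in>kerin X z. F s \<xi> = s (x \<Otimes> \<xi>)" using assms(1) by simp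
  then show ?thesis using \<open>x \<in> UU p\<close> unfolding localF_def by blast
qed

lemma tensor_Tker: "lin z \<Longrightarrow> \<xi> \<in> kerin X z \<Longrightarrow> x \<Otimes> \<xi> \<in> Tker T z \<longleftrightarrow> x \<Otimes> \<xi> \<in> T"
  by (simp add: Tker_def kerin_def contr_tensor)

text \<open>When locality and Type 1 are ruled out on the hyperplane, \<open>formC_rank\<close> and
  \<open>formC_no_rank_one\<close> supply the properties collected in \<open>goodC\<close>;
  inhomogeneity comes from \<open>homog_typeC_local\<close>.\<close>

lemma restrict_trichotomy:
  assumes z: "lin z" and c01: "\<exists>c::'a. c \<noteq> 0 \<and> c \<noteq> 1"
    and IH: "\<And>G. rcs p (kerin X z) (Tker T z) G \<Longrightarrow> localF p (kerin X z) (Tker T z) G \<or>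
      \<not> homogF (kerin X z) (Tker T z) G \<and> type1F p (kerin X z) (Tker T z) \<or> typeC p (kerin X z) (Tker T z) G"
    and db: "db I' (kerin X z) \<xi>' y'" and dim: "dimle (Tker T z) (2 * card I' - 3)"
  shows "localF p (kerin X z) T F \<or> \<not> homogF X T F \<and> type1F p (kerin X z) T \<or>
    \<not> homogF X T F \<and> (2::'a) = 0 \<and> (\<exists>x J \<alpha>. goodC z x J \<alpha>)"
proof -
  obtain G where G: "rcs p (kerin X z) (Tker T z) G" and eq: "\<forall>s\<in>Ann T. \<forall>\<xi>\<in>kerin X z. G s \<xi> = F s \<xi>"
    and hom: "homogF X T F \<longrightarrow> homogF (kerin X z) (Tker T z) G"
    using restrict_homogF[OF z] by blast
  interpret G: rcs p "kerin X z" "Tker T z" G by fact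
  have t1: "type1F p (kerin X z) (Tker T z) \<longleftrightarrow> type1F p (kerin X z) T"
    using tensor_Tker[OF z] unfolding type1F_def by (simp cong: ball_cong)
  show ?thesis
  proof (cases "localF p (kerin X z) (Tker T z) G")
    case True
    then show ?thesis using localF_restrict[OF eq] by blast
  next
    case nl: False
    show ?thesis
    proof (cases "\<not> homogF (kerin X z) (Tker T z) G \<and> type1F p (kerin X z) (Tker T z)")
      case True
      then show ?thesis using hom t1 by blast
    next
      case n1: False
      have C: "typeC p (kerin X z) (Tker T z) G" using IH[OF G] nl n1 by blast
      have nhG: "\<not> homogF (kerin X z) (Tker T z) G" using G.homog_typeC_local[OF _ C c01] nl by blast
      then have nt: "\<not> type1F p (kerin X z) (Tker T z)" using n1 by blast
      obtain x J \<alpha> where two: "(2::'a) = 0" and f: "formC p (kerin X z) (Tker T z) G x J \<alpha>"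
        using C unfolding typeC_def by blast
      have "formC p (kerin X z) T F x J \<alpha>"
        using f eq Ann_Tker unfolding formC_def by (simp add: subset_iff)
      moreover have "J \<eta> \<Otimes> \<xi> + J \<xi> \<Otimes> \<eta> \<in> T" if "\<xi> \<in> kerin X z" "\<eta> \<in> kerin X z" for \<xi> \<eta>
        using G.formC_sym[OF f that] by (simp add: Tker_def)
      moreover have "\<exists>\<xi>\<in>kerin X z. \<exists>\<eta>\<in>kerin X z. indep2 (J \<xi>) (J \<eta>)"
        using G.formC_rank[OF f nl nt] by blast
      moreover have "x0 = 0 \<or> J \<xi> = 0" if \<xi>: "\<xi> \<in> kerin X z" and x0: "x0 \<Otimes> \<xi> \<in> T" for \<xi> x0
        using G.formC_no_rank_one[OF f nl nt db dim \<xi>, of x0] tensor_Tker[OF z \<xi>] x0 by blast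
      ultimately have "goodC z x J \<alpha>" unfolding goodC_def by blast
      then show ?thesis using two nhG hom by blast
    qed
  qed
qed

text \<open>\<open>e\<close> is the bound demanded on hyperplanes. If \<open>T\<close> is within
  \<open>e + 1\<close>, one nonzero contraction would already be good, so badness forces
  \<open>T = 0\<close>. Otherwise \<open>bad_basis\<close> gives \<open>e + 1 < card I\<close>,
  which leaves only very small dimensions for the values of \<open>e\<close> in use.\<close>

lemma all_bad:
  assumes db: "db I X \<xi> y" and card: "3 \<le> card I"
    and N: "finite N" "0 \<notin> N" and L: "finite L" "(0::'a) \<notin> L" "card N \<le> card L"
    and dim: "dimle T (Suc (Suc e))"
    and bad: "\<And>z. lin z \<Longrightarrow> \<forall>\<eta>\<in>N. z \<eta> \<noteq> 0 \<Longrightarrow> \<exists>\<eta>\<in>X. z \<eta> \<noteq> 0 \<Longrightarrow> \<not> dimle (Tker T z) e"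
  shows "localF p X T F \<or> (\<exists>\<xi>' y' u. db I X \<xi>' y' \<and> (\<forall>i\<in>I. \<forall>\<eta>\<in>N. y' i \<eta> \<noteq> 0) \<and> Suc e < card I \<and>
    (\<forall>i\<in>I. u i \<in> UU p) \<and> (\<forall>t\<in>T. \<forall>i\<in>I. \<exists>c. contr t (y' i) = c \<star> u i) \<and>
    (card I = Suc (Suc e) \<longrightarrow> (\<forall>i\<in>I. u i \<noteq> 0 \<and> u i \<Otimes> \<xi>' i \<in> T)))"
proof -
  obtain \<xi>' y' where db': "db I X \<xi>' y'" and av: "\<forall>i\<in>I. \<forall>\<eta>\<in>N. y' i \<eta> \<noteq> 0"
    using db_avoid[OF db X N L] by blast
  have nd: "\<not> dimle (Tker T (y' i)) e" if i: "i \<in> I" for i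
  proof (rule bad)
    show "lin (y' i)" using db_lin[OF db' i] .
    show "\<forall>\<eta>\<in>N. y' i \<eta> \<noteq> 0" using av i by blast
    have "y' i (\<xi>' i) \<noteq> 0" using db_dual[OF db' i i] by simp
    then show "\<exists>\<eta>\<in>X. y' i \<eta> \<noteq> 0" using db_mem[OF db' i] by blast
  qed
  show ?thesis
  proof (cases "dimle T (Suc e)")
    case True
    have z: "contr t (y' i) = 0" if "t \<in> T" "i \<in> I" for t i
      using dimle_Tker1[OF T db_lin[OF db' that(2)] that(1) _ True] nd[OF that(2)] by blast
    have "t = 0" if t: "t \<in> T" for t
    proof -
      have "t = (\<Sum>i\<in>I. contr t (y' i) \<Otimes> \<xi>' i)" using db_decompose[OF db'] t TW by blast
      also have "\<dots> = (\<Sum>i\<in>I. 0)" using z[OF t] by (intro sum.cong) simp_all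
      finally show ?thesis by simp
    qed
    then show ?thesis using local_if_T_trivial[OF db] card by simp
  next
    case nT: False
    have "\<not> indep2 (contr t1 (y' i)) (contr t2 (y' i))" if "i \<in> I" "t1 \<in> T" "t2 \<in> T" for i t1 t2
      using dimle_Tker2[OF T db_lin[OF db' that(1)] that(2,3) _ dim] nd[OF that(1)] by blast
    from bad_basis[OF db' this] obtain u where u: "\<forall>i\<in>I. u i \<in> UU p"
      "\<forall>t\<in>T. \<forall>i\<in>I. \<exists>c. contr t (y' i) = c \<star> u i" and dI: "dimle T (card I)"
      and full: "\<not> dimle T (card I - 1) \<longrightarrow> (\<forall>i\<in>I. u i \<noteq> 0 \<and> u i \<Otimes> \<xi>' i \<in> T)" by blast
    have "Suc e < card I" using dimle_mono[OF dI order_refl] nT by (meson not_le)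
    moreover have "\<forall>i\<in>I. u i \<noteq> 0 \<and> u i \<Otimes> \<xi>' i \<in> T" if "card I = Suc (Suc e)" using full nT that by simp
    ultimately show ?thesis using db' av u by blast
  qed
qed

text \<open>If a row outside \<open>ker z\<close> also gave a tensor in \<open>T\<close>, the rows
  with \<open>x \<Otimes> \<xi> \<in> T\<close> would form a hyperplane of \<open>X\<close>, which
  is Type 1 on \<open>X\<close> itself.\<close>

lemma type1_plane:
  assumes t1: "type1F p (kerin X z) T" and n1: "\<not> type1F p X T" and z: "lin z" "\<exists>\<eta>\<in>X. z \<eta> \<noteq> 0"
  shows "\<exists>x\<in>UU p. \<exists>z'. lin z' \<and> indX X z z' \<and> (\<forall>\<xi>\<in>X. x \<Otimes> \<xi> \<in> T \<longleftrightarrow> z \<xi> = 0 \<and> z' \<xi> = 0)"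
proof -
  obtain x z' \<xi>1 where x: "x \<in> UU p" and z': "lin z'" and \<xi>1: "\<xi>1 \<in> X" "z \<xi>1 = 0" "z' \<xi>1 \<noteq> 0"
    and \<Phi>: "\<And>\<xi>. \<xi> \<in> X \<Longrightarrow> z \<xi> = 0 \<Longrightarrow> x \<Otimes> \<xi> \<in> T \<longleftrightarrow> z' \<xi> = 0"
    using t1 unfolding type1F_def kerin_def by blast
  have "indX X z z'"
    unfolding indX_def
  proof (intro allI impI)
    fix a b assume ab: "\<forall>\<xi>\<in>X. a * z \<xi> + b * z' \<xi> = 0"
    from bspec[OF ab \<xi>1(1)] have b: "b = 0" using \<xi>1(2,3) by simp
    obtain \<eta> where "\<eta> \<in> X" "z \<eta> \<noteq> 0" using z(2) by blast
    then show "a = 0 \<and> b = 0" using bspec[OF ab, of \<eta>] b by simp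
  qed
  moreover have "z \<eta> = 0" if \<eta>: "\<eta> \<in> X" and x\<eta>: "x \<Otimes> \<eta> \<in> T" for \<eta>
  proof (rule ccontr)
    assume nz: "z \<eta> \<noteq> 0"
    \<comment> \<open>\<open>z'\<close> corrected so as to vanish at \<open>\<eta>\<close> too; its
      kernel is the hyperplane in question.\<close>
    define w where "w = z' - (z' \<eta> / z \<eta>) \<star> z"
    have w: "lin w" unfolding w_def using z' z(1) by (intro lin_minus lin_star)
    have wa: "w \<xi> = z' \<xi> - z' \<eta> / z \<eta> * z \<xi>" for \<xi> by (simp add: w_def scl_apply)
    have "x \<Otimes> \<xi> \<in> T \<longleftrightarrow> w \<xi> = 0" if \<xi>: "\<xi> \<in> X" for \<xi>
    proof -
      define r where "r = (z \<xi> / z \<eta>) \<star> \<eta>"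
      have r: "r \<in> X" "x \<Otimes> r \<in> T" unfolding r_def
        using sub_scl[OF X \<eta>] sub_scl[OF T x\<eta>] by (simp_all add: tensor_scl_right)
      have z0: "z (\<xi> - r) = 0" using nz by (simp add: r_def lin_diff[OF z(1)] lin_scl[OF z(1)])
      have "x \<Otimes> \<xi> \<in> T \<longleftrightarrow> x \<Otimes> (\<xi> - r) \<in> T"
        using sub_diff[OF T _ r(2), of "x \<Otimes> \<xi>"] sub_add[OF T _ r(2), of "x \<Otimes> (\<xi> - r)"] by (auto simp: tensor_diff_right)
      also have "\<dots> \<longleftrightarrow> z' (\<xi> - r) = 0" using \<Phi>[OF sub_diff[OF X \<xi> r(1)] z0] .
      also have "z' (\<xi> - r) = w \<xi>" by (simp add: wa r_def lin_diff[OF z'] lin_scl[OF z'])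
      finally show ?thesis .
    qed
    moreover have "w \<xi>1 \<noteq> 0" using \<xi>1 by (simp add: wa)
    ultimately have "type1F p X T" unfolding type1F_def using x w \<xi>1(1) by blast
    then show False using n1 by blast
  qed
  ultimately show ?thesis using x z' \<Phi> by blast
qed

text \<open>By \<open>two_planes\<close>, each codimension-two kernel arising from
  \<open>type1_plane\<close> contains the first one, as otherwise the map would be local. So every
  such \<open>z\<close> vanishes on that kernel, which is nonzero in dimension at least
  three.\<close>

lemma type1_hyperplane:
  assumes c01: "\<exists>c::'a. c \<noteq> 0 \<and> c \<noteq> 1" and db: "db I X \<xi> y" and card: "3 \<le> card I"
    and dim: "dimle T (2 * card I - 3)" and nl: "\<not> localF p X T F" and n1: "\<not> type1F p X T"
  shows "\<exists>\<eta>\<in>X. \<eta> \<noteq> 0 \<and> (\<forall>z. lin z \<longrightarrow> (\<exists>\<zeta>\<in>X. z \<zeta> \<noteq> 0) \<longrightarrow> type1F p (kerin X z) T \<longrightarrow> z \<eta> = 0)"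
proof (cases "\<exists>z. lin z \<and> (\<exists>\<zeta>\<in>X. z \<zeta> \<noteq> 0) \<and> type1F p (kerin X z) T")
  case False
  obtain i where "i \<in> I" using card by fastforce
  then show ?thesis using False db_mem[OF db] db_nonzero[OF db] by blast
next
  case True
  then obtain z where z: "lin z" "\<exists>\<zeta>\<in>X. z \<zeta> \<noteq> 0" and t1: "type1F p (kerin X z) T" by blast
  obtain x z' where x: "x \<in> UU p" and z': "lin z'" and ind: "indX X z z'"
    and \<Phi>: "\<And>\<xi>. \<xi> \<in> X \<Longrightarrow> x \<Otimes> \<xi> \<in> T \<longleftrightarrow> z \<xi> = 0 \<and> z' \<xi> = 0"
    using type1_plane[OF t1 n1 z] by blast
  obtain k1 k2 \<xi>' y' where db': "db I X \<xi>' y'" and k: "k1 \<in> I" "k2 \<in> I" "k1 \<noteq> k2"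
    and y': "y' k1 = z" "y' k2 = z'" using db_two_fun[OF db X z(1) z' ind] by metis
  have "\<not> I \<subseteq> {k1, k2}" using card card_mono[of "{k1, k2}" I] card_insert_le_m1[of 2 "{k2}" k1] by auto
  then obtain k3 where k3: "k3 \<in> I" "k3 \<noteq> k1" "k3 \<noteq> k2" by blast
  have \<eta>: "\<xi>' k3 \<in> X" "\<xi>' k3 \<noteq> 0" using db_mem[OF db' k3(1)] db_nonzero[OF db' k3(1)] by blast+
  have z0: "z (\<xi>' k3) = 0" "z' (\<xi>' k3) = 0"
    using db_dual[OF db' k(1) k3(1)] db_dual[OF db' k(2) k3(1)] k3(2,3) y' by auto
  have "w (\<xi>' k3) = 0" if w: "lin w" "\<exists>\<zeta>\<in>X. w \<zeta> \<noteq> 0" and tw: "type1F p (kerin X w) T" for w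
  proof -
    obtain x2 w' where x2: "x2 \<in> UU p" and w': "lin w'" and ind2: "indX X w w'"
      and \<Phi>2: "\<And>\<xi>. \<xi> \<in> X \<Longrightarrow> x2 \<Otimes> \<xi> \<in> T \<longleftrightarrow> w \<xi> = 0 \<and> w' \<xi> = 0"
      using type1_plane[OF tw n1 w] by blast
    have "x2 \<Otimes> \<xi>' k3 \<in> T"
      using two_planes[OF c01 db card dim x x2 z(1) z' w(1) w' ind ind2 \<Phi> \<Phi>2 \<eta>(1)] nl \<Phi>[OF \<eta>(1)] z0 by blast
    then show ?thesis using \<Phi>2[OF \<eta>(1)] by blast
  qed
  then show ?thesis using \<eta> by blast
qed

text \<open>If \<open>u k\<close> were parallel to \<open>u i\<close>, the rows with
  \<open>u i \<Otimes> \<eta> \<in> T\<close> would be those with \<open>y j \<eta> = 0\<close>,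
  which is Type 1. So \<open>u i\<close> is independent of both other vectors, and contracting with
  \<open>y j\<close> and \<open>y k\<close> forces both coordinates of such an \<open>\<eta>\<close>
  to vanish.\<close>

lemma third_column:
  assumes db: "db {i, j, k} X \<xi> y" and d: "i \<noteq> j" "i \<noteq> k" "j \<noteq> k"
    and u: "\<forall>l\<in>{i, j, k}. u l \<in> UU p" "\<forall>t\<in>T. \<forall>l\<in>{i, j, k}. \<exists>c. contr t (y l) = c \<star> u l"
    and full: "\<forall>l\<in>{i, j, k}. u l \<noteq> 0 \<and> u l \<Otimes> \<xi> l \<in> T"
    and ij: "indep2 (u i) (u j)" and n1: "\<not> type1F p X T"
  shows "\<forall>\<eta>\<in>X. u i \<Otimes> \<eta> \<in> T \<longleftrightarrow> y j \<eta> = 0 \<and> y k \<eta> = 0"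
proof -
  have ly: "lin (y l)" if "l \<in> {i, j, k}" for l using db_lin[OF db that] .
  have van: "y l \<eta> = 0" if l: "l \<in> {i, j, k}" and m: "u i \<Otimes> \<eta> \<in> T" and il: "indep2 (u i) (u l)" for l \<eta>
  proof -
    obtain c where "contr (u i \<Otimes> \<eta>) (y l) = c \<star> u l" using u(2) m l by blast
    then have "y l \<eta> \<star> u i + (- c) \<star> u l = 0" using ly[OF l] by (simp add: contr_tensor)
    then show ?thesis using indep2D[OF il] by blast
  qed
  have dec: "u i \<Otimes> \<eta> = y i \<eta> \<star> u i \<Otimes> \<xi> i + (y j \<eta> \<star> u i \<Otimes> \<xi> j + y k \<eta> \<star> u i \<Otimes> \<xi> k)" if "\<eta> \<in> X" for \<eta>
  proof -
    have "u i \<Otimes> \<eta> = u i \<Otimes> (\<Sum>l\<in>{i, j, k}. y l \<eta> \<star> \<xi> l)" by (rule arg_cong[OF db_expand[OF db that]])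
    then show ?thesis using d by (simp add: tensor_add_right tensor_scl_right)
  qed
  have ui: "c \<star> u i \<Otimes> \<xi> i \<in> T" for c using full sub_scl[OF T] by blast
  have ik: "indep2 (u i) (u k)"
  proof (rule ccontr)
    assume nik: "\<not> indep2 (u i) (u k)"
    obtain c where c: "u k = c \<star> u i" using not_indep2[OF nik] full by blast
    then have "c \<noteq> 0" using full by auto
    then have "u i \<Otimes> \<xi> k = inverse c \<star> u k \<Otimes> \<xi> k" using c by (simp add: tensor_scl_left)
    then have uk: "u i \<Otimes> \<xi> k \<in> T" using full sub_scl[OF T] by simp
    have "u i \<Otimes> \<eta> \<in> T \<longleftrightarrow> y j \<eta> = 0" if \<eta>: "\<eta> \<in> X" for \<eta>
    proof
      assume "y j \<eta> = 0"
      then show "u i \<Otimes> \<eta> \<in> T" unfolding dec[OF \<eta>] using sub_add[OF T ui sub_scl[OF T uk]] by simp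
    qed (use van ij in blast)
    moreover have "y j (\<xi> j) \<noteq> 0" "\<xi> j \<in> X" using db_dual[OF db, of j j] db_mem[OF db, of j] by simp_all
    ultimately have "type1F p X T" unfolding type1F_def using u(1) ly by blast
    then show False using n1 by blast
  qed
  show ?thesis
  proof (intro ballI iffI conjI)
    fix \<eta> assume \<eta>: "\<eta> \<in> X" and "y j \<eta> = 0 \<and> y k \<eta> = 0"
    then show "u i \<Otimes> \<eta> \<in> T" unfolding dec[OF \<eta>] using ui by simp
  qed (use van ij ik in blast)+
qed

end

lemma card_three:
  assumes "card I = 3" "i \<in> I" "j \<in> I" "i \<noteq> j"
  obtains k where "I = {i, j, k}" "i \<noteq> k" "j \<noteq> k"
proof -
  have fin: "finite I" using assms(1) card.infinite by fastforce
  have "card (I - {i, j}) = 1" using assms fin by (simp add: card_Diff_subset)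
  then obtain k where k: "I - {i, j} = {k}" using card_1_singletonE by blast
  then have "I = {i, j, k}" using assms by blast
  moreover have "i \<noteq> k" "j \<noteq> k" using k by blast+
  ultimately show thesis using that by blast
qed

context rcs
begin

text \<open>Badness leaves dimension three with \<open>T\<close> spanned by three tensors
  \<open>u l \<Otimes> \<xi>' l\<close>, not all \<open>u l\<close> being parallel. A homogeneous
  map is then excluded inside the pencil of \<open>y' i\<close> and \<open>y' j\<close>, any other
  map by \<open>two_planes\<close> applied to \<open>u i\<close> and \<open>u j\<close>.\<close>

lemma local_if_all_bad:
  assumes c01: "\<exists>c::'a. c \<noteq> 0 \<and> c \<noteq> 1" and db: "db I X \<xi> y" and card: "card I = n + 3"
    and dim: "dimle T (2 * n + 3)" and hn: "homogF X T F \<or> \<not> type1F p X T"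
    and N: "finite N" "0 \<notin> N" and L: "finite L" "(0::'a) \<notin> L" "card N \<le> card L" and \<eta>: "\<eta> \<in> N"
    and bad: "\<And>z. lin z \<Longrightarrow> \<forall>\<eta>\<in>N. z \<eta> \<noteq> 0 \<Longrightarrow> \<exists>\<eta>\<in>X. z \<eta> \<noteq> 0 \<Longrightarrow> \<not> dimle (Tker T z) (2 * n + 1)"
    and hb: "\<And>z. homogF X T F \<Longrightarrow> lin z \<Longrightarrow> \<exists>\<eta>\<in>X. z \<eta> \<noteq> 0 \<Longrightarrow> z \<eta> \<noteq> 0 \<Longrightarrow> \<not> dimle (Tker T z) (2 * n + 1)"
  shows "localF p X T F"
proof (rule ccontr)
  assume nl: "\<not> localF p X T F"
  have card3: "3 \<le> card I" using card by simp
  have dim': "dimle T (Suc (Suc (2 * n + 1)))" using dim by (simp add: numeral_3_eq_3)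
  have "2 * card I - 3 = 2 * n + 3" using card by simp
  then have dimI: "dimle T (2 * card I - 3)" using dim by (simp only:)
  have "\<exists>\<xi>' y' u. db I X \<xi>' y' \<and> (\<forall>i\<in>I. \<forall>\<eta>\<in>N. y' i \<eta> \<noteq> 0) \<and> Suc (2 * n + 1) < card I \<and>
    (\<forall>i\<in>I. u i \<in> UU p) \<and> (\<forall>t\<in>T. \<forall>i\<in>I. \<exists>c. contr t (y' i) = c \<star> u i) \<and>
    (card I = Suc (Suc (2 * n + 1)) \<longrightarrow> (\<forall>i\<in>I. u i \<noteq> 0 \<and> u i \<Otimes> \<xi>' i \<in> T))"
    using all_bad[OF db card3 N L dim' bad] nl by blast
  then obtain \<xi>' y' u where db': "db I X \<xi>' y'" and av: "\<forall>i\<in>I. \<forall>\<eta>\<in>N. y' i \<eta> \<noteq> 0"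
    and c: "Suc (2 * n + 1) < card I"
    and u: "\<forall>i\<in>I. u i \<in> UU p" "\<forall>t\<in>T. \<forall>i\<in>I. \<exists>c. contr t (y' i) = c \<star> u i"
    and full0: "card I = Suc (Suc (2 * n + 1)) \<longrightarrow> (\<forall>i\<in>I. u i \<noteq> 0 \<and> u i \<Otimes> \<xi>' i \<in> T)" by blast
  have n0: "n = 0" and I3: "card I = 3" using c card by simp_all
  have full: "\<forall>i\<in>I. u i \<noteq> 0 \<and> u i \<Otimes> \<xi>' i \<in> T" using full0 n0 I3 by simp
  have "\<exists>i\<in>I. \<exists>j\<in>I. indep2 (u i) (u j)"
    using parallel_columns[OF db', of u] card3 u full nl by force
  then obtain i j where i: "i \<in> I" and j: "j \<in> I" and ij: "indep2 (u i) (u j)" by blast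
  have nij: "i \<noteq> j" using ij by (auto simp: indep2_iff dest: spec[of _ 1])
  show False
  proof (cases "homogF X T F")
    case hom: True
    \<comment> \<open>For \<open>d \<noteq> 0\<close> the combination has two independent
      contractions, so it is good and vanishes at \<open>\<eta>\<close>. Two values of
      \<open>d\<close> give \<open>y' j \<eta> = 0\<close>, against the choice of the basis.\<close>
    have z0: "y' i \<eta> + d * y' j \<eta> = 0" if d: "d \<noteq> 0" for d
    proof (rule ccontr)
      assume nz: "y' i \<eta> + d * y' j \<eta> \<noteq> 0"
      let ?z = "y' i + d \<star> y' j"
      have z: "lin ?z" using db_lin[OF db'] i j by (intro lin_plus lin_star)
      have dual: "?z (\<xi>' i) = 1" "?z (\<xi>' j) = d"
        using db_dual[OF db'] i j nij by (simp_all add: scl_apply)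
      have "\<not> dimle (Tker T ?z) (2 * n + 1)"
      proof (rule hb[OF hom z])
        show "\<exists>\<eta>\<in>X. ?z \<eta> \<noteq> 0" using dual(1) db_mem[OF db' i] by (intro bexI[of _ "\<xi>' i"]) simp_all
      qed (use nz in \<open>simp add: scl_apply\<close>)
      moreover have "indep2 (contr (u i \<Otimes> \<xi>' i) ?z) (contr (u j \<Otimes> \<xi>' j) ?z)"
        unfolding contr_tensor[OF z] dual indep2_def
      proof (intro allI impI)
        fix a b assume "a \<star> 1 \<star> u i + b \<star> d \<star> u j = 0"
        then have "a \<star> u i + (b * d) \<star> u j = 0" by simp
        from indep2D[OF ij this] show "a = 0 \<and> b = 0" using d by simp
      qed
      ultimately show False using dimle_Tker2[OF T z _ _ _ dim'] full i j by blast
    qed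
    obtain c :: 'a where c: "c \<noteq> 0" "c \<noteq> 1" using c01 by blast
    have "(c - 1) * y' j \<eta> = (y' i \<eta> + c * y' j \<eta>) - (y' i \<eta> + 1 * y' j \<eta>)" by (simp add: algebra_simps)
    also have "\<dots> = 0" using z0[of 1] z0[OF c(1)] by simp
    finally have "(c - 1) * y' j \<eta> = 0" .
    then have "y' j \<eta> = 0" using c by simp
    then show False using av j \<eta> by blast
  next
    case False
    then have n1: "\<not> type1F p X T" using hn by blast
    obtain k where I: "I = {i, j, k}" and k: "i \<noteq> k" "j \<noteq> k" using card_three[OF I3 i j nij] .
    have I': "I = {j, i, k}" using I by blast
    note A = db' u full
    have \<Phi>i: "\<forall>\<eta>\<in>X. u i \<Otimes> \<eta> \<in> T \<longleftrightarrow> y' j \<eta> = 0 \<and> y' k \<eta> = 0"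
      by (rule third_column[OF A(1)[unfolded I] _ _ _ A(2-4)[unfolded I]]) (use nij k ij n1 in auto)
    have \<Phi>j: "\<forall>\<eta>\<in>X. u j \<Otimes> \<eta> \<in> T \<longleftrightarrow> y' i \<eta> = 0 \<and> y' k \<eta> = 0"
      by (rule third_column[OF A(1)[unfolded I'] _ _ _ A(2-4)[unfolded I']])
        (use nij k indep2_sym[OF ij] n1 in auto)
    have kI: "k \<in> I" using I by simp
    have l: "lin (y' i)" "lin (y' j)" "lin (y' k)" using db_lin[OF db'] i j kI by blast+
    have "u j \<Otimes> \<xi>' i \<notin> T" using \<Phi>j db_mem[OF db' i] db_dual[OF db' i i] by simp
    then have "localF p X T F"
      using two_planes[OF c01 db' card3 dimI _ _ l(2,3) l(1,3) indX_db[OF db' j kI k(2)] indX_db[OF db' i kI k(1)],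
        of "u i" "u j" "\<xi>' i"] u(1) i j \<Phi>i \<Phi>j full db_mem[OF db' i] by blast
    then show False using nl by blast
  qed
qed

lemma trichotomy_step:
  assumes c01: "\<exists>c::'a. c \<noteq> 0 \<and> c \<noteq> 1" and db: "db I X \<xi> y" and card: "card I = n + 3" and dim: "dimle T (2 * n + 3)"
    and IH: "\<And>X' T' G I' \<xi>' y'. rcs p X' T' G \<Longrightarrow> db I' X' \<xi>' (y' :: nat \<Rightarrow> (nat \<Rightarrow> 'a) \<Rightarrow> 'a) \<Longrightarrow> card I' = n + 2 \<Longrightarrow>
      dimle T' (2 * n + 1) \<Longrightarrow> localF p X' T' G \<or> \<not> homogF X' T' G \<and> type1F p X' T' \<or> typeC p X' T' G"
  shows "localF p X T F \<or> \<not> homogF X T F \<and> type1F p X T \<or> typeC p X T F"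
proof (rule ccontr)
  assume "\<not> ?thesis"
  then have nl: "\<not> localF p X T F" and hn: "homogF X T F \<or> \<not> type1F p X T" and nC: "\<not> typeC p X T F" by blast+
  have card3: "3 \<le> card I" using card by simp
  have "2 * card I - 3 = 2 * n + 3" using card by simp
  then have dimI: "dimle T (2 * card I - 3)" using dim by (simp only:)
  have good: "localF p (kerin X z) T F \<or> \<not> homogF X T F \<and> type1F p (kerin X z) T \<or>
    \<not> homogF X T F \<and> (2::'a) = 0 \<and> (\<exists>x J \<alpha>. goodC z x J \<alpha>)"
    if z: "lin z" "\<exists>\<eta>\<in>X. z \<eta> \<noteq> 0" and d: "dimle (Tker T z) (2 * n + 1)" for z
  proof -
    obtain k \<xi>' where k: "k \<in> I" and db': "db (I - {k}) (kerin X z) \<xi>' (y(k := z))"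
      using restrict_db[OF db z] by blast
    have c: "card (I - {k}) = n + 2" using card k by simp
    then have d': "dimle (Tker T z) (2 * card (I - {k}) - 3)" using d by simp
    show ?thesis by (rule restrict_trichotomy[OF z(1) c01 _ db' d']) (rule IH[OF _ db' c d])
  qed
  obtain \<eta>1 where \<eta>1: "\<eta>1 \<in> X" "\<eta>1 \<noteq> 0" "\<forall>z. lin z \<longrightarrow> localF p (kerin X z) T F \<longrightarrow> z \<eta>1 = 0"
    using three_or_hyperplane[OF db X card3, of "\<lambda>z. localF p (kerin X z) T F"]
      local_if_three_local[OF _ _ _ _ _ _ _ dimI] nl by blast
  obtain \<eta>2 where \<eta>2: "\<eta>2 \<in> X" "\<eta>2 \<noteq> 0" "\<forall>z. lin z \<longrightarrow> (2::'a) = 0 \<and> (\<exists>x J \<alpha>. goodC z x J \<alpha>) \<longrightarrow> z \<eta>2 = 0"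
    using three_or_hyperplane[OF db X card3, of "\<lambda>z. (2::'a) = 0 \<and> (\<exists>x J \<alpha>. goodC z x J \<alpha>)"]
      typeC_glue[OF _ c01] nC by blast
  obtain \<eta>3 where \<eta>3: "\<eta>3 \<in> X" "\<eta>3 \<noteq> 0"
    "\<forall>z. lin z \<longrightarrow> (\<exists>\<zeta>\<in>X. z \<zeta> \<noteq> 0) \<longrightarrow> \<not> homogF X T F \<and> type1F p (kerin X z) T \<longrightarrow> z \<eta>3 = 0"
  \<comment> \<open>For a homogeneous map the condition on \<open>\<eta>3\<close> is vacuous and
    \<open>\<eta>1\<close> can serve again.\<close>
  proof (cases "homogF X T F")
    case True
    then show ?thesis using that \<eta>1 by blast
  next
    case False
    then show ?thesis using type1_hyperplane[OF c01 db card3 dimI nl] hn that by blast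
  qed
  obtain c :: 'a where c: "c \<noteq> 0" "c \<noteq> 1" using c01 by blast
  \<comment> \<open>The exceptional form occurs only for \<open>2 = 0\<close>, so
    \<open>\<eta>2\<close> is dropped otherwise. \<open>L\<close> supplies enough nonzero scalars:
    \<open>c + 1\<close> is the third one in characteristic 2, and \<open>- 1\<close> differs from 1
    in all other cases.\<close>
  define N where "N = (if (2::'a) = 0 then {\<eta>1, \<eta>2, \<eta>3} else {\<eta>1, \<eta>3})"
  define L where "L = (if (2::'a) = 0 then {1, c, c + 1} else {1, - 1})"
  have N: "finite N" "0 \<notin> N" "\<eta>1 \<in> N" using \<eta>1 \<eta>2 \<eta>3 by (auto simp: N_def)
  have L: "finite L" "0 \<notin> L" "card N \<le> card L"
  proof -
    show "finite L" by (simp add: L_def)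
    have m1: "(1::'a) = - 1 \<longleftrightarrow> (2::'a) = 0" by (metis add.right_inverse add_diff_cancel_left' diff_0 one_add_one)
    have c1: "c + 1 \<noteq> 0" if "(2::'a) = 0"
      using that m1 c(2) by (metis add_eq_0_iff2)
    then show "0 \<notin> L" using c by (auto simp: L_def)
    show "card N \<le> card L"
    proof (cases "(2::'a) = 0")
      case True
      then have "card L = 3" using c by (simp add: L_def)
      moreover have "card {\<eta>1, \<eta>2, \<eta>3} \<le> 3"
        using card_insert_le_m1[of 3 "{\<eta>2, \<eta>3}" \<eta>1] card_insert_le_m1[of 2 "{\<eta>3}" \<eta>2] by simp
      ultimately show ?thesis using True by (simp add: N_def)
    next
      case False
      then have "card L = 2" using m1 by (simp add: L_def)
      then show ?thesis using False card_insert_le_m1[of 2 "{\<eta>3}" \<eta>1] by (simp add: N_def)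
    qed
  qed
  have "localF p X T F"
  proof (rule local_if_all_bad[OF c01 db card dim hn N(1,2) L N(3)])
    fix z :: "(nat \<Rightarrow> 'a) \<Rightarrow> 'a" assume z: "lin z" "\<exists>\<eta>\<in>X. z \<eta> \<noteq> 0"
    { assume "\<forall>\<eta>\<in>N. z \<eta> \<noteq> 0"
      then show "\<not> dimle (Tker T z) (2 * n + 1)" using good[OF z] z \<eta>1(3) \<eta>2(3) \<eta>3(3) unfolding N_def
        by (metis insertCI) }
    { assume "homogF X T F" "z \<eta>1 \<noteq> 0"
      then show "\<not> dimle (Tker T z) (2 * n + 1)" using good[OF z] z(1) \<eta>1(3) by blast }
  qed
  then show False using nl by blast
qed

end

text \<open>The parameter \<open>n\<close> is \<open>m - 2\<close>, so \<open>2 * n + 1\<close> is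
  the bound \<open>2 m - 3\<close>.\<close>

theorem rcs_trichotomy:
  fixes X :: "(nat \<Rightarrow> 'a::field) set"
  assumes c01: "\<exists>c::'a. c \<noteq> 0 \<and> c \<noteq> 1"
  shows "rcs p X T F \<Longrightarrow> db I X \<xi> y \<Longrightarrow> card I = n + 2 \<Longrightarrow> dimle T (2 * n + 1) \<Longrightarrow>
    localF p X T F \<or> \<not> homogF X T F \<and> type1F p X T \<or> typeC p X T F"
proof (induction n arbitrary: X T F I \<xi> y)
  case 0
  then show ?case using rcs.base_case[of p X T F I \<xi> y] by simp
next
  case (Suc n)
  show ?case
    by (rule rcs.trichotomy_step[OF Suc.prems(1) c01 Suc.prems(2), of n])
      (use Suc.prems Suc.IH in \<open>simp_all add: numeral_3_eq_3\<close>)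
qed

subsection \<open>The field with two elements\<close>

text \<open>A plane over two elements has just three nonzero vectors.\<close>

lemma two_dimensional_span:
  fixes T :: "('i \<Rightarrow> 'a::field) set"
  assumes two: "\<forall>c::'a. c = 0 \<or> c = 1" and T: "sub T" and dim: "dimle T 2"
    and t: "t1 \<in> T" "t2 \<in> T" "t1 \<noteq> 0" "t2 \<noteq> 0" "t1 \<noteq> t2" and w: "w \<in> T"
  shows "w = 0 \<or> w = t1 \<or> w = t2 \<or> w = t1 + t2"
proof -
  let ?f = "\<lambda>j::nat. if j = 0 then t1 else t2"
  have "indf {0, 1} ?f"
  proof (rule indfI)
    fix c and j :: nat assume "(\<Sum>j\<in>{0, 1}. c j \<star> ?f j) = 0" and j: "j \<in> {0, 1}"
    then have c: "c 0 \<star> t1 + c 1 \<star> t2 = 0" by simp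
    have m: "(- 1 :: 'a) = 1" using two by (metis neg_equal_0_iff_equal zero_neq_one)
    consider "c 0 = 0" "c 1 = 0" | "c 0 = 0" "c 1 = 1" | "c 0 = 1" "c 1 = 0" | "c 0 = 1" "c 1 = 1" using two by blast
    then have "c 0 = 0 \<and> c 1 = 0"
    proof cases
      case 4
      then have "t1 = (- 1) \<star> t2" using c by (simp add: eq_neg_iff_add_eq_0)
      then show ?thesis using t m by simp
    qed (use c t in simp_all)
    then show "c j = 0" using j by auto
  qed
  then obtain c where "w = (\<Sum>j\<in>{0, 1}. c j \<star> ?f j)"
    using t(1,2) by (rule_tac dimle_spanned[OF dim T _ _ _ _ w, of "{0, 1}" ?f]) auto
  then have w: "w = c 0 \<star> t1 + c 1 \<star> t2" by simp
  consider "c 0 = 0" "c 1 = 0" | "c 0 = 0" "c 1 = 1" | "c 0 = 1" "c 1 = 0" | "c 0 = 1" "c 1 = 1" using two by blast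
  then show ?thesis by cases (simp_all add: w)
qed

context rcs
begin

text \<open>The only scalars are 0 and 1. This excludes the Type 1 alternative of
  \<open>one_column\<close>.\<close>

lemma homogF_two:
  assumes "\<forall>c::'a. c = 0 \<or> c = 1"
  shows "homogF X T F"
  unfolding homogF_def
proof (intro allI ballI)
  fix c s \<xi> assume "s \<in> Ann T" "\<xi> \<in> X"
  then show "F (c \<star> s) \<xi> = c * F s \<xi>" using assms[rule_format, of c] F_0 by auto
qed

lemma local_kerin_if_trivial:
  assumes db: "db I X \<xi> y" and card: "3 \<le> card I" and z: "lin z" "\<exists>\<eta>\<in>X. z \<eta> \<noteq> 0"
    and triv: "\<And>t. t \<in> T \<Longrightarrow> contr t z = 0 \<Longrightarrow> t = 0"
  shows "localF p (kerin X z) T F"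
proof -
  obtain G where G: "rcs p (kerin X z) (Tker T z) G" and eq: "\<forall>s\<in>Ann T. \<forall>\<xi>\<in>kerin X z. G s \<xi> = F s \<xi>"
    using restrict_homogF[OF z(1)] by blast
  obtain k \<xi>' where k: "k \<in> I" and db': "db (I - {k}) (kerin X z) \<xi>' (y(k := z))"
    using restrict_db[OF db z] by blast
  have "localF p (kerin X z) (Tker T z) G"
    by (rule rcs.local_if_T_trivial[OF G db']) (use k card triv in \<open>auto simp: Tker_def\<close>)
  then show ?thesis by (rule localF_restrict[OF eq])
qed

text \<open>In dimension three a tensor killed by \<open>z\<close> and \<open>z'\<close> is some
  \<open>u \<Otimes> \<zeta>\<close> with \<open>\<zeta>\<close> spanning their common kernel. If
  \<open>z\<close> had a nonzero contraction on \<open>T\<close>, only 0 and \<open>t\<close> would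
  survive on \<open>ker z\<close>, and \<open>one_column\<close> would make the restriction local;
  likewise for \<open>z'\<close>. So all of \<open>T\<close> lies over \<open>\<zeta>\<close>, and a
  functional nonzero at \<open>\<eta>\<close> and \<open>\<zeta>\<close> has a local
  restriction.\<close>

lemma no_common_kernel:
  assumes two: "\<forall>c::'a. c = 0 \<or> c = 1" and db: "db I X \<xi> y" and card: "card I = 3" and dim: "dimle T 2"
    and \<eta>: "\<eta> \<in> X" "\<eta> \<noteq> 0" and nl: "\<And>z. lin z \<Longrightarrow> z \<eta> \<noteq> 0 \<Longrightarrow> \<not> localF p (kerin X z) T F"
    and z: "lin z" "z \<eta> \<noteq> 0" and z': "lin z'" "z' \<eta> \<noteq> 0" and ind: "indX X z z'"
    and t: "t \<in> T" "t \<noteq> 0" "contr t z = 0" "contr t z' = 0"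
  shows False
proof -
  obtain k1 k2 \<xi>' y' where db': "db I X \<xi>' y'" and k: "k1 \<in> I" "k2 \<in> I" "k1 \<noteq> k2"
    and y': "y' k1 = z" "y' k2 = z'" using db_two_fun[OF db X z(1) z'(1) ind] by metis
  obtain k3 where I: "I = {k1, k2, k3}" and k3: "k1 \<noteq> k3" "k2 \<noteq> k3" using card_three[OF card k] .
  have k3I: "k3 \<in> I" using I by simp
  define \<zeta> where "\<zeta> = \<xi>' k3"
  have \<zeta>: "\<zeta> \<in> X" "\<zeta> \<noteq> 0" "z \<zeta> = 0" "z' \<zeta> = 0"
    using db_mem[OF db' k3I] db_nonzero[OF db' k3I] db_dual[OF db' k(1) k3I] db_dual[OF db' k(2) k3I] k3 y'
    by (simp_all add: \<zeta>_def)
  have dec: "w = contr w (y' k3) \<Otimes> \<zeta>" if w: "w \<in> T" "contr w z = 0" "contr w z' = 0" for w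
  proof -
    have "w \<in> WW p X" using w(1) TW by blast
    from db_decompose[OF db' this, unfolded I] show ?thesis using k(3) k3 w y' by (simp add: \<zeta>_def)
  qed
  define u where "u = contr t (y' k3)"
  have tu: "t = u \<Otimes> \<zeta>" unfolding u_def by (rule dec[OF t(1,3,4)])
  have "t \<in> WW p X" using t(1) TW by blast
  then have "u \<in> UU p" unfolding u_def by (rule contr_UU[OF _ db_lin[OF db' k3I]])
  moreover have "u \<noteq> 0" using tu t(2) tensor_zero_left[of \<zeta>] by metis
  ultimately have u: "u \<in> UU p" "u \<noteq> 0" by blast+
  have full: "contr w x = 0" if x: "lin x" "x \<eta> \<noteq> 0" "x \<zeta> = 0" and w: "w \<in> T" for x w
  proof (rule ccontr)
    assume nz: "contr w x \<noteq> 0"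
    have tx: "contr t x = 0" using tu x(1,3) by (simp add: contr_tensor)
    have only: "v = 0 \<or> v = t" if v: "v \<in> T" "contr v x = 0" for v
    proof (rule ccontr)
      assume "\<not> ?thesis"
      then have "w = 0 \<or> w = v \<or> w = t \<or> w = v + t"
        using two_dimensional_span[OF two T dim v(1) t(1) _ t(2) _ w] by blast
      then show False using nz v(2) tx contr_add[OF x(1), of v t] contr_0[OF x(1)] by auto
    qed
    obtain G where G: "rcs p (kerin X x) (Tker T x) G" and eq: "\<forall>s\<in>Ann T. \<forall>\<xi>\<in>kerin X x. G s \<xi> = F s \<xi>"
      using restrict_homogF[OF x(1)] by blast
    obtain k \<xi>'' where "k \<in> I" and db'': "db (I - {k}) (kerin X x) \<xi>'' (y(k := x))"
      using restrict_db[OF db x(1)] \<eta>(1) x(2) by blast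
    then have c: "2 \<le> card (I - {k})" using card by simp
    have "\<exists>\<eta>\<in>kerin X x. v = u \<Otimes> \<eta>" if v: "v \<in> Tker T x" for v
    proof -
      have "v = 0 \<or> v = t" using only v by (simp add: Tker_def)
      moreover have "0 \<in> kerin X x" "\<zeta> \<in> kerin X x" using sub_0[OF sub_kerin[OF X x(1)]] \<zeta> x(3) by (simp_all add: kerin_def)
      moreover have "0 = u \<Otimes> 0" by simp
      ultimately show ?thesis using tu by metis
    qed
    from rcs.one_column[OF G db'' c u this] have "localF p (kerin X x) (Tker T x) G"
      using rcs.homogF_two[OF G two] by blast
    then show False using nl[OF x(1,2)] localF_restrict[OF eq] by blast
  qed
  \<comment> \<open>One functional can avoid two vectors even if 1 is the only nonzero
    scalar.\<close>
  obtain x where x: "lin x" "\<forall>\<eta>'\<in>{\<eta>, \<zeta>}. x \<eta>' \<noteq> 0"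
    using lin_avoid[of "{\<eta>, \<zeta>}" "{1}"] \<eta>(2) \<zeta>(2) card_insert_le_m1[of 2 "{\<zeta>}" \<eta>] by auto
  have "localF p (kerin X x) T F"
  proof (rule local_kerin_if_trivial[OF db _ x(1)])
    fix w assume w: "w \<in> T" "contr w x = 0"
    have d: "w = contr w (y' k3) \<Otimes> \<zeta>" using dec[OF w(1)] full[OF z \<zeta>(3) w(1)] full[OF z' \<zeta>(4) w(1)] by blast
    have "contr (contr w (y' k3) \<Otimes> \<zeta>) x = 0" using w(2) d by simp
    then have "contr w (y' k3) = 0" using x by (simp add: contr_tensor)
    then show "w = 0" using d by simp
  qed (use card x \<eta> in auto)
  then show False using nl x by simp
qed

text \<open>Adding to \<open>y a\<close> the four combinations of \<open>y b\<close> and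
  \<open>y c\<close> gives four functionals that are nonzero at \<open>\<xi> a\<close>. Each kills a
  nonzero tensor of \<open>T\<close>, no two the same one, but \<open>T\<close> has at most three
  nonzero elements.\<close>

lemma local_two_three:
  assumes two: "\<forall>c::'a. c = 0 \<or> c = 1" and db: "db I X \<xi> y" and card: "card I = 3" and dim: "dimle T 2"
    and a: "a \<in> I" and nl: "\<And>z. lin z \<Longrightarrow> z (\<xi> a) \<noteq> 0 \<Longrightarrow> \<not> localF p (kerin X z) T F"
  shows False
proof -
  have "\<not> I \<subseteq> {a}" using card card_mono[of "{a}" I] by auto
  then obtain b where b: "b \<in> I" "a \<noteq> b" by blast
  obtain c where I: "I = {a, b, c}" and c: "a \<noteq> c" "b \<noteq> c" using card_three[OF card a b] .
  have cI: "c \<in> I" using I by simp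
  have \<eta>: "\<xi> a \<in> X" "\<xi> a \<noteq> 0" using db_mem[OF db a] db_nonzero[OF db a] .
  have dual: "y a (\<xi> a) = 1" "y a (\<xi> b) = 0" "y a (\<xi> c) = 0" "y b (\<xi> a) = 0" "y b (\<xi> b) = 1" "y b (\<xi> c) = 0"
    "y c (\<xi> a) = 0" "y c (\<xi> b) = 0" "y c (\<xi> c) = 1"
    using db_dual[OF db] a b cI c by auto
  have ly: "lin (y a)" "lin (y b)" "lin (y c)" using db_lin[OF db] a b(1) cI by blast+
  have mem: "\<xi> a \<in> X" "\<xi> b \<in> X" "\<xi> c \<in> X" using db_mem[OF db] a b(1) cI by blast+
  have ex: "\<exists>t\<in>T. t \<noteq> 0 \<and> contr t z = 0" if z: "lin z" "z (\<xi> a) \<noteq> 0" for z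
    using local_kerin_if_trivial[OF db _ z(1)] nl[OF z] card \<eta>(1) z(2) by force
  note nc = no_common_kernel[OF two db card dim \<eta> nl]
  define z1 z2 z3 z4 where "z1 = y a" and "z2 = y a + y b" and "z3 = y a + y c" and "z4 = y a + y b + y c"
  note zd = z1_def z2_def z3_def z4_def
  have l: "lin z1" "lin z2" "lin z3" "lin z4" unfolding zd by (intro lin_plus ly)+
  have za: "z1 (\<xi> a) \<noteq> 0" "z2 (\<xi> a) \<noteq> 0" "z3 (\<xi> a) \<noteq> 0" "z4 (\<xi> a) \<noteq> 0" using dual by (simp_all add: zd)
  have iX: "indX X z z'" if za: "z (\<xi> a) = 1" "z' (\<xi> a) = 1" and zz: "\<exists>e\<in>X. z e = 0 \<and> z' e = 1 \<or> z e = 1 \<and> z' e = 0"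
    for z z' :: "(nat \<Rightarrow> 'a) \<Rightarrow> 'a"
    unfolding indX_def
  proof (intro allI impI)
    fix r s assume rs: "\<forall>\<xi>\<in>X. r * z \<xi> + s * z' \<xi> = 0"
    obtain e where e: "e \<in> X" "z e = 0 \<and> z' e = 1 \<or> z e = 1 \<and> z' e = 0" using zz by blast
    show "r = 0 \<and> s = 0" using bspec[OF rs mem(1)] bspec[OF rs e(1)] e(2) za by auto
  qed
  have i12: "indX X z1 z2" by (rule iX) (use dual mem in \<open>auto simp: zd intro!: bexI[of _ "\<xi> b"]\<close>)
  have i13: "indX X z1 z3" by (rule iX) (use dual mem in \<open>auto simp: zd intro!: bexI[of _ "\<xi> c"]\<close>)
  have i23: "indX X z2 z3" by (rule iX) (use dual mem in \<open>auto simp: zd intro!: bexI[of _ "\<xi> b"]\<close>)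
  have i14: "indX X z1 z4" by (rule iX) (use dual mem in \<open>auto simp: zd intro!: bexI[of _ "\<xi> b"]\<close>)
  have i24: "indX X z2 z4" by (rule iX) (use dual mem in \<open>auto simp: zd intro!: bexI[of _ "\<xi> c"]\<close>)
  have i34: "indX X z3 z4" by (rule iX) (use dual mem in \<open>auto simp: zd intro!: bexI[of _ "\<xi> b"]\<close>)
  obtain t1 where t1: "t1 \<in> T" "t1 \<noteq> 0" "contr t1 z1 = 0" using ex[OF l(1) za(1)] by blast
  obtain t2 where t2: "t2 \<in> T" "t2 \<noteq> 0" "contr t2 z2 = 0" using ex[OF l(2) za(2)] by blast
  obtain t3 where t3: "t3 \<in> T" "t3 \<noteq> 0" "contr t3 z3 = 0" using ex[OF l(3) za(3)] by blast
  obtain t4 where t4: "t4 \<in> T" "t4 \<noteq> 0" "contr t4 z4 = 0" using ex[OF l(4) za(4)] by blast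
  have n12: "t1 \<noteq> t2" using nc[OF _ _ l(1) za(1) l(2) za(2) i12 t1] t2 by blast
  have n13: "t1 \<noteq> t3" using nc[OF _ _ l(1) za(1) l(3) za(3) i13 t1] t3 by blast
  have n14: "t1 \<noteq> t4" using nc[OF _ _ l(1) za(1) l(4) za(4) i14 t1] t4 by blast
  have n23: "t2 \<noteq> t3" using nc[OF _ _ l(2) za(2) l(3) za(3) i23 t2] t3 by blast
  have n24: "t2 \<noteq> t4" using nc[OF _ _ l(2) za(2) l(4) za(4) i24 t2] t4 by blast
  have n34: "t3 \<noteq> t4" using nc[OF _ _ l(3) za(3) l(4) za(4) i34 t3] t4 by blast
  have "t3 = t1 + t2" "t4 = t1 + t2"
    using two_dimensional_span[OF two T dim t1(1) t2(1) t1(2) t2(2) n12] t3 t4 n13 n14 n23 n24 by blast+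
  then show False using n34 by simp
qed

text \<open>The bound \<open>2 * n + 2\<close> is \<open>2 m - 4\<close>. Dimension three is
  \<open>local_two_three\<close>; beyond it, avoiding one vector leaves only dimension four by
  \<open>all_bad\<close>. There a second vector \<open>\<xi>' b\<close>, at which all functionals
  with local restriction vanish, is compared with the first.\<close>

lemma local_two_step:
  assumes two: "\<forall>c::'a. c = 0 \<or> c = 1" and db: "db I X \<xi> y" and card: "card I = n + 3" and dim: "dimle T (2 * n + 2)"
    and IH: "\<And>X' T' G I' \<xi>' y'. rcs p X' T' G \<Longrightarrow> db I' X' \<xi>' (y' :: nat \<Rightarrow> (nat \<Rightarrow> 'a) \<Rightarrow> 'a) \<Longrightarrow> card I' = n + 2 \<Longrightarrow>
      dimle T' (2 * n) \<Longrightarrow> localF p X' T' G"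
  shows "localF p X T F"
proof (rule ccontr)
  assume nl: "\<not> localF p X T F"
  have card3: "3 \<le> card I" using card by simp
  have "2 * card I - 3 = 2 * n + 3" using card by simp
  then have dimI: "dimle T (2 * card I - 3)" using dimle_mono[OF dim, of T "2 * n + 3"] by simp
  have good: "localF p (kerin X z) T F"
    if z: "lin z" "\<exists>\<eta>\<in>X. z \<eta> \<noteq> 0" and d: "dimle (Tker T z) (2 * n)" for z
  proof -
    obtain G where G: "rcs p (kerin X z) (Tker T z) G" and eq: "\<forall>s\<in>Ann T. \<forall>\<xi>\<in>kerin X z. G s \<xi> = F s \<xi>"
      using restrict_homogF[OF z(1)] by blast
    obtain k \<xi>' where k: "k \<in> I" and db': "db (I - {k}) (kerin X z) \<xi>' (y(k := z))"
      using restrict_db[OF db z] by blast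
    have c: "card (I - {k}) = n + 2" using card k by simp
    show ?thesis by (rule localF_restrict[OF eq IH[OF G db' c d]])
  qed
  obtain \<xi>' y' k1 k2 where db': "db I X \<xi>' y'" and k: "k1 \<in> I" "k2 \<in> I" "k1 \<noteq> k2"
    and van: "\<forall>z. lin z \<longrightarrow> localF p (kerin X z) T F \<longrightarrow> (\<forall>i\<in>I - {k1, k2}. z (\<xi>' i) = 0)"
    using three_or_vanish[OF db X card3, of "\<lambda>z. localF p (kerin X z) T F"]
      local_if_three_local[OF _ _ _ _ _ _ _ dimI] nl by blast
  have "card (I - {k1, k2}) = n + 1" using card k db_finite[OF db] by (simp add: card_Diff_subset)
  then have "I - {k1, k2} \<noteq> {}" by (metis card.empty add_is_0 one_neq_zero)
  then obtain a where a: "a \<in> I - {k1, k2}" by blast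
  have dim': "dimle T (Suc (Suc (2 * n)))" using dim by simp
  show False
  proof (cases "n = 0")
    case True
    show False by (rule local_two_three[OF two db' _ _ _]) (use True card dim a van in \<open>auto simp: numeral_2_eq_2\<close>)
  next
    case n: False
    have N: "finite {\<xi>' a}" "0 \<notin> {\<xi>' a}" "finite {1::'a}" "(0::'a) \<notin> {1}" "card {\<xi>' a} \<le> card {1::'a}"
      using db_nonzero[OF db', of a] a by auto
    have bad: "\<not> dimle (Tker T z) (2 * n)" if "lin z" "\<forall>\<eta>\<in>{\<xi>' a}. z \<eta> \<noteq> 0" "\<exists>\<eta>\<in>X. z \<eta> \<noteq> 0" for z
      using good[OF that(1,3)] van that(1,2) a by blast
    obtain \<xi>2 y2 u where db2: "db I X \<xi>2 y2" and av: "\<forall>i\<in>I. \<forall>\<eta>\<in>{\<xi>' a}. y2 i \<eta> \<noteq> 0"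
      and c: "Suc (2 * n) < card I"
      and u: "\<forall>i\<in>I. u i \<in> UU p" "\<forall>t\<in>T. \<forall>i\<in>I. \<exists>c. contr t (y2 i) = c \<star> u i"
      and full0: "card I = Suc (Suc (2 * n)) \<longrightarrow> (\<forall>i\<in>I. u i \<noteq> 0 \<and> u i \<Otimes> \<xi>2 i \<in> T)"
      using all_bad[OF db card3 N dim' bad] nl by blast
    have n1: "n = 1" and I4: "card I = 4" using c card n by simp_all
    have full: "\<forall>i\<in>I. u i \<noteq> 0 \<and> u i \<Otimes> \<xi>2 i \<in> T" using full0 n1 I4 by simp
    have "\<exists>i\<in>I. \<exists>j\<in>I. indep2 (u i) (u j)"
      using parallel_columns[OF db2, of u] card3 u full nl by force
    then obtain i j where ij: "i \<in> I" "j \<in> I" "indep2 (u i) (u j)" by blast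
    have y1: "y2 l (\<xi>' a) = 1" if "l \<in> I" for l using av that two by blast
    have "\<not> I - {k1, k2} \<subseteq> {a}"
      using card_mono[of "{a}" "I - {k1, k2}"] \<open>card (I - {k1, k2}) = n + 1\<close> n1 by auto
    then obtain b where b: "b \<in> I - {k1, k2}" "b \<noteq> a" by blast
    \<comment> \<open>Distinct nonzero vectors are independent here, so \<open>y2 l + y2 m\<close>
      is good and vanishes at \<open>\<xi>' b\<close>; over two elements this equates the two
      coordinates.\<close>
    have eqv: "y2 l (\<xi>' b) = y2 m (\<xi>' b)" if l: "l \<in> I" "m \<in> I" and ne: "u l \<noteq> u m" for l m
    proof -
      have lm: "l \<noteq> m" using ne by blast
      have ind: "indep2 (u l) (u m)"
        unfolding indep2_iff
      proof (intro conjI allI)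
        show "u l \<noteq> 0" using full l by blast
        fix c show "u m \<noteq> c \<star> u l" using two[rule_format, of c] ne full l by auto
      qed
      let ?z = "y2 l + y2 m"
      have z: "lin ?z" using db_lin[OF db2] l by (intro lin_plus)
      have dual: "?z (\<xi>2 l) = 1" "?z (\<xi>2 m) = 1" using db_dual[OF db2] l lm by simp_all
      have "indep2 (contr (u l \<Otimes> \<xi>2 l) ?z) (contr (u m \<Otimes> \<xi>2 m) ?z)"
        unfolding contr_tensor[OF z] dual using ind by simp
      then have "dimle (Tker T ?z) (2 * n)" using dimle_Tker2[OF T z _ _ _ dim'] full l by blast
      moreover have "\<exists>\<eta>\<in>X. ?z \<eta> \<noteq> 0" using dual(1) db_mem[OF db2 l(1)] by (intro bexI[of _ "\<xi>2 l"]) simp_all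
      ultimately have "?z (\<xi>' b) = 0" using good[OF z] van z b(1) by blast
      then have e: "y2 l (\<xi>' b) + y2 m (\<xi>' b) = 0" by simp
      show ?thesis using e two[rule_format, of "y2 l (\<xi>' b)"] two[rule_format, of "y2 m (\<xi>' b)"] by auto
    qed
    \<comment> \<open>Every \<open>u l\<close> differs from \<open>u i\<close> or from
      \<open>u j\<close>, so all coordinates of \<open>\<xi>' b\<close> are equal. Since those of
      \<open>\<xi>' a\<close> are all 1, \<open>\<xi>' b\<close> is a multiple of
      \<open>\<xi>' a\<close>.\<close>
    have "u i \<noteq> u j" using ij(3) by (auto simp: indep2_iff dest: spec[of _ 1])
    then have con: "y2 l (\<xi>' b) = y2 i (\<xi>' b)" if "l \<in> I" for l
      using eqv[OF that ij(1)] eqv[OF that ij(2)] eqv[OF ij(1,2)] by metis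
    have "\<xi>' b = (\<Sum>l\<in>I. y2 l (\<xi>' b) \<star> \<xi>2 l)" by (rule db_expand[OF db2]) (use db_mem[OF db'] b in blast)
    also have "\<dots> = (\<Sum>l\<in>I. y2 i (\<xi>' b) \<star> (y2 l (\<xi>' a) \<star> \<xi>2 l))"
      by (intro sum.cong refl) (use con y1 in simp)
    also have "\<dots> = y2 i (\<xi>' b) \<star> (\<Sum>l\<in>I. y2 l (\<xi>' a) \<star> \<xi>2 l)" by (rule fs.scale_sum_right[symmetric])
    also have "(\<Sum>l\<in>I. y2 l (\<xi>' a) \<star> \<xi>2 l) = \<xi>' a" by (rule db_expand[OF db2, symmetric]) (use db_mem[OF db'] a in blast)
    finally have "\<xi>' b = y2 i (\<xi>' b) \<star> \<xi>' a" .
    then have "y' b (\<xi>' b) = y2 i (\<xi>' b) * y' b (\<xi>' a)" using lin_scl[OF db_lin[OF db', of b]] b(1) by (metis DiffD1)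
    then show False using db_dual[OF db', of b b] db_dual[OF db', of b a] a b by auto
  qed
qed

end

text \<open>Again \<open>n\<close> is \<open>m - 2\<close>, and the induction starts from
  \<open>T = 0\<close>.\<close>

theorem rcs_local_two:
  fixes X :: "(nat \<Rightarrow> 'a::field) set"
  assumes two: "\<forall>c::'a. c = 0 \<or> c = 1"
  shows "rcs p X T F \<Longrightarrow> db I X \<xi> y \<Longrightarrow> card I = n + 2 \<Longrightarrow> dimle T (2 * n) \<Longrightarrow> localF p X T F"
proof (induction n arbitrary: X T F I \<xi> y)
  case 0
  show ?case by (rule rcs.local_if_T_trivial[OF 0(1,2)]) (use 0 dimle_0 in auto)
next
  case (Suc n)
  show ?case
    by (rule rcs.local_two_step[OF Suc.prems(1) two Suc.prems(2), of n])
      (use Suc.prems Suc.IH in simp_all)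
qed

subsection \<open>Matrices\<close>

definition ev :: "nat \<Rightarrow> nat \<Rightarrow> 'a::field" where
  "ev j = (\<lambda>i. if j = i then 1 else 0)"

text \<open>The pairing of matrices with tensors, whose index pair is transposed;
  \<open>mat_of\<close> recovers the matrix from its functional.\<close>

definition mfun :: "nat \<Rightarrow> nat \<Rightarrow> 'a::field mat \<Rightarrow> (nat \<times> nat \<Rightarrow> 'a) \<Rightarrow> 'a" where
  "mfun n p M t = (\<Sum>j<p. \<Sum>i<n. M $$ (i, j) * t (j, i))"

text \<open>A matrix padded by zeros to a function, so that the linear algebra of function spaces
  applies to sets of matrices.\<close>

definition fmat :: "nat \<Rightarrow> nat \<Rightarrow> 'a::field mat \<Rightarrow> nat \<times> nat \<Rightarrow> 'a" where
  "fmat n p M = (\<lambda>(j, i). if i < n \<and> j < p then M $$ (i, j) else 0)"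

definition mat_of :: "nat \<Rightarrow> nat \<Rightarrow> ((nat \<times> nat \<Rightarrow> 'a::field) \<Rightarrow> 'a) \<Rightarrow> 'a mat" where
  "mat_of n p s = mat n p (\<lambda>(i, j). s (ev j \<Otimes> ev i))"

definition perp :: "nat \<Rightarrow> nat \<Rightarrow> 'a::field mat set \<Rightarrow> (nat \<times> nat \<Rightarrow> 'a) set" where
  "perp n p S = {t \<in> WW p (UU n). \<forall>M\<in>S. mfun n p M t = 0}"

lemma db_ev: "db {..<p} (UU p) (ev :: nat \<Rightarrow> nat \<Rightarrow> 'a::field) (\<lambda>j u. u j)"
  using db_UU[of p] by (simp add: ev_def[abs_def])

lemma ev_UU: "j < p \<Longrightarrow> ev j \<in> UU p"
  by (auto simp: ev_def UU_def)

lemma WW_UU: "t \<in> WW p (UU n) \<longleftrightarrow> (\<forall>j i. p \<le> j \<or> n \<le> i \<longrightarrow> t (j, i) = 0)"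
  by (auto simp: WW_def UU_def col_def fun_eq_iff)

lemma WW_expand:
  assumes "t \<in> WW p (UU n)"
  shows "t = (\<Sum>j<p. \<Sum>i<n. t (j, i) \<star> (ev j \<Otimes> ev i))"
proof
  fix ba :: "nat \<times> nat"
  obtain b a where ba: "ba = (b, a)" by fastforce
  have "(\<Sum>j<p. \<Sum>i<n. t (j, i) * (ev j b * ev i a)) = t (b, a)"
  proof -
    have "(\<Sum>i<n. t (j, i) * (ev j b * ev i a)) = (if b = j then t (b, a) else 0)" for j
    proof -
      have "(\<Sum>i<n. t (j, i) * (ev j b * ev i a)) = (\<Sum>i<n. if i = a then t (j, a) * ev j b else 0)"
        by (rule sum.cong) (auto simp: ev_def)
      then show ?thesis using assms by (auto simp: WW_UU ev_def)
    qed
    then show ?thesis using assms by (auto simp: WW_UU)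
  qed
  then show "t ba = (\<Sum>j<p. \<Sum>i<n. t (j, i) \<star> (ev j \<Otimes> ev i)) ba"
    by (simp add: sum_fun_apply scl_apply tensor_def ba)
qed

lemma lin_WW_expand:
  assumes "lin s" "t \<in> WW p (UU n)"
  shows "s t = (\<Sum>j<p. \<Sum>i<n. t (j, i) * s (ev j \<Otimes> ev i))"
  by (subst WW_expand[OF assms(2)]) (simp add: lin_sum[OF assms(1)] lin_scl[OF assms(1)])

lemma lin_mfun: "lin (mfun n p M)"
  by (rule linI) (simp_all add: mfun_def scl_apply algebra_simps sum.distrib sum_distrib_left)

lemma mfun_smult: "A \<in> carrier_mat n p \<Longrightarrow> mfun n p (c \<cdot>\<^sub>m A) = c \<star> mfun n p A"
  by (rule ext) (simp add: mfun_def scl_apply sum_distrib_left mult.assoc)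

lemma mfun_tensor: "mfun n p M (x \<Otimes> \<xi>) = (\<Sum>i<n. \<xi> i * (\<Sum>j<p. M $$ (i, j) * x j))"
  unfolding mfun_def tensor_def
  by (subst sum.swap) (simp add: sum_distrib_left mult_ac)

lemma mfun_ev: "i < n \<Longrightarrow> j < p \<Longrightarrow> mfun n p M (ev j \<Otimes> ev i) = M $$ (i, j)"
proof -
  assume i: "i < n" and j: "j < p"
  have "(\<Sum>b<p. M $$ (a, b) * ev j b) = M $$ (a, j)" for a
  proof -
    have "(\<Sum>b<p. M $$ (a, b) * ev j b) = (\<Sum>b<p. if b = j then M $$ (a, j) else 0)"
      by (rule sum.cong) (auto simp: ev_def)
    then show ?thesis using j by simp
  qed
  then have "mfun n p M (ev j \<Otimes> ev i) = (\<Sum>a<n. if a = i then M $$ (i, j) else 0)"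
    unfolding mfun_tensor by (intro sum.cong) (auto simp: ev_def)
  then show ?thesis using i by simp
qed

lemma mat_of_carrier [simp]: "mat_of n p s \<in> carrier_mat n p"
  and mat_of_index: "i < n \<Longrightarrow> j < p \<Longrightarrow> mat_of n p s $$ (i, j) = s (ev j \<Otimes> ev i)"
  by (simp_all add: mat_of_def)

lemma mat_of_mfun: "M \<in> carrier_mat n p \<Longrightarrow> mat_of n p (mfun n p M) = M"
  by (rule eq_matI) (auto simp: mat_of_index mfun_ev mat_of_def)

lemma mfun_mat_of: "lin s \<Longrightarrow> t \<in> WW p (UU n) \<Longrightarrow> mfun n p (mat_of n p s) t = s t"
  unfolding lin_WW_expand mfun_def by (intro sum.cong) (auto simp: mat_of_index)

lemma mat_of_add: "mat_of n p (s + s') = mat_of n p s + mat_of n p s'"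
  and mat_of_scl: "mat_of n p (c \<star> s) = c \<cdot>\<^sub>m mat_of n p s"
  by (rule eq_matI; simp add: mat_of_def scl_apply)+

lemma fmat_WW: "fmat n p M \<in> WW p (UU n)"
  by (simp add: WW_UU fmat_def)

lemma fmat_add: "A \<in> carrier_mat n p \<Longrightarrow> B \<in> carrier_mat n p \<Longrightarrow> fmat n p (A + B) = fmat n p A + fmat n p B"
  and fmat_smult: "A \<in> carrier_mat n p \<Longrightarrow> fmat n p (c \<cdot>\<^sub>m A) = c \<star> fmat n p A"
  and fmat_zero: "fmat n p (0\<^sub>m n p) = 0"
  by (auto simp: fmat_def fun_eq_iff scl_apply)

lemma fmat_inject: "A \<in> carrier_mat n p \<Longrightarrow> B \<in> carrier_mat n p \<Longrightarrow> fmat n p A = fmat n p B \<Longrightarrow> A = B"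
  by (rule eq_matI) (auto simp: fmat_def fun_eq_iff split: if_splits)

text \<open>The entries of the tensor are the values of \<open>\<phi>\<close> at the matrix
  units.\<close>

lemma lin_represented:
  assumes "lin \<phi>"
  shows "\<exists>t\<in>WW p (UU n). \<forall>M. mfun n p M t = \<phi> (fmat n p M)"
proof -
  define t where "t = (\<lambda>(j, i). if i < n \<and> j < p then \<phi> (ev j \<Otimes> ev i) else 0)"
  have "t \<in> WW p (UU n)" by (simp add: WW_UU t_def)
  moreover have "mfun n p M t = \<phi> (fmat n p M)" for M
    unfolding lin_WW_expand[OF assms fmat_WW] mfun_def
    by (intro sum.cong) (auto simp: t_def fmat_def)
  ultimately show ?thesis by blast
qed

lemma sub_perp: "sub (perp n p S)"
proof -
  have "sub (WW p (UU n) :: (nat \<times> nat \<Rightarrow> 'a::field) set)" by (rule sub_WW[OF sub_UU])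
  then show ?thesis unfolding sub_def perp_def
    by (auto simp: lin_0[OF lin_mfun] lin_add[OF lin_mfun] lin_scl[OF lin_mfun])
qed

lemma mfun_Ann: "M \<in> S \<Longrightarrow> mfun n p M \<in> Ann (perp n p S)"
  by (rule AnnI[OF lin_mfun]) (simp add: perp_def)

text \<open>\<open>S\<close> is its own double annihilator: a functional separating a matrix from
  \<open>S\<close> is represented by a tensor of \<open>perp n p S\<close>, at which
  \<open>s\<close> would have to vanish.\<close>

lemma mat_of_mem:
  assumes S: "mat_subspace n p S" and s: "s \<in> Ann (perp n p S)"
  shows "mat_of n p s \<in> S"
proof (rule ccontr)
  assume n: "mat_of n p s \<notin> S"
  have SC: "S \<subseteq> carrier_mat n p" using S by (simp add: mat_subspace_def)
  let ?A = "fmat n p ` S"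
  have "sub ?A"
    unfolding sub_def
  proof (intro conjI ballI allI)
    have "fmat n p (0\<^sub>m n p) \<in> ?A" using S unfolding mat_subspace_def by blast
    then show "0 \<in> ?A" by (simp only: fmat_zero)
  next
    fix u v assume "u \<in> ?A" "v \<in> ?A"
    then obtain A B where AB: "A \<in> S" "B \<in> S" "u = fmat n p A" "v = fmat n p B" by blast
    have "u + v = fmat n p (A + B)" unfolding AB(3,4)
      by (rule fmat_add[symmetric]) (use AB(1,2) SC in blast)+
    moreover have "A + B \<in> S" using S AB unfolding mat_subspace_def by blast
    ultimately show "u + v \<in> ?A" by blast
  next
    fix c u assume "u \<in> ?A"
    then obtain A where A: "A \<in> S" "u = fmat n p A" by blast
    have "c \<star> u = fmat n p (c \<cdot>\<^sub>m A)" unfolding A(2)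
      by (rule fmat_smult[symmetric]) (use A(1) SC in blast)
    moreover have "c \<cdot>\<^sub>m A \<in> S" using S A unfolding mat_subspace_def by blast
    ultimately show "c \<star> u \<in> ?A" by blast
  qed
  moreover have "fmat n p (mat_of n p s) \<notin> ?A"
  proof
    assume "fmat n p (mat_of n p s) \<in> ?A"
    then obtain M where M: "M \<in> S" "fmat n p (mat_of n p s) = fmat n p M" by blast
    have "mat_of n p s = M" by (rule fmat_inject[OF mat_of_carrier _ M(2)]) (use M(1) SC in blast)
    then show False using n M(1) by blast
  qed
  ultimately obtain \<phi> where \<phi>: "\<phi> \<in> Ann ?A" "\<phi> (fmat n p (mat_of n p s)) = 1" by (rule Ann_separates)
  obtain t where t: "t \<in> WW p (UU n)" "\<forall>M. mfun n p M t = \<phi> (fmat n p M)"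
    using lin_represented[OF AnnD(1)[OF \<phi>(1)], of p n] by (rule bexE)
  have "t \<in> perp n p S" unfolding perp_def using t AnnD(2)[OF \<phi>(1)] by simp
  then have "s t = 0" by (rule AnnD(2)[OF s])
  moreover have "s t = 1" using mfun_mat_of[OF AnnD(1)[OF s] t(1)] t(2) \<phi>(2) by simp
  ultimately show False by simp
qed

lemma dimle_WW: "dimle (WW p (UU n) :: (nat \<times> nat \<Rightarrow> 'a::field) set) (n * p)"
proof -
  have "\<exists>c. w = (\<Sum>k\<in>{..<p} \<times> {..<n}. c k \<star> (ev (fst k) \<Otimes> ev (snd k)))"
    if "w \<in> WW p (UU n)" for w :: "nat \<times> nat \<Rightarrow> 'a"
    using WW_expand[OF that] by (intro exI[of _ w]) (simp add: sum.cartesian_product case_prod_unfold)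
  from dimle_span[OF _ this] show ?thesis by (simp add: card_cartesian_product mult.commute)
qed

text \<open>Each \<open>g k\<close> lies outside the span of the others, so
  \<open>Ann_separates\<close> applies.\<close>

lemma dual_family:
  fixes g :: "'k \<Rightarrow> 'i \<Rightarrow> 'a::field"
  assumes J: "finite J" and g: "indf J g"
  shows "\<exists>\<phi>. \<forall>k\<in>J. lin (\<phi> k) \<and> (\<forall>l\<in>J. \<phi> k (g l) = (if k = l then 1 else 0))"
proof -
  have "\<exists>\<phi>. lin \<phi> \<and> (\<forall>l\<in>J. \<phi> (g l) = (if k = l then 1 else 0))" if k: "k \<in> J" for k
  proof -
    let ?S = "{(\<Sum>l\<in>J-{k}. c l \<star> g l) | c. True}"
    have "g k \<notin> ?S"
    proof
      assume "g k \<in> ?S"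
      then obtain c where c: "g k = (\<Sum>l\<in>J-{k}. c l \<star> g l)" by blast
      have "(\<Sum>l\<in>J. (c(k := - 1)) l \<star> g l) = (- 1) \<star> g k + (\<Sum>l\<in>J-{k}. (c(k := - 1)) l \<star> g l)"
        using sum.remove[OF J k, of "\<lambda>l. (c(k := - 1)) l \<star> g l"] by simp
      also have "(\<Sum>l\<in>J-{k}. (c(k := - 1)) l \<star> g l) = g k" unfolding c by (rule sum.cong) auto
      also have "(- 1) \<star> g k + g k = 0" by (simp add: fun_eq_iff scl_apply)
      finally have "(\<Sum>l\<in>J. (c(k := - 1)) l \<star> g l) = 0" .
      from indfD[OF g this k] show False by simp
    qed
    then obtain \<phi> where \<phi>: "\<phi> \<in> Ann ?S" "\<phi> (g k) = 1" by (rule Ann_separates[OF sub_spanned])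
    have "\<phi> (g l) = 0" if l: "l \<in> J" "k \<noteq> l" for l
    proof -
      have "(\<Sum>m\<in>J-{k}. (if m = l then 1 else 0) \<star> g m) = (\<Sum>m\<in>J-{k}. if m = l then g m else 0)"
        by (rule sum.cong) auto
      then have "g l = (\<Sum>m\<in>J-{k}. (if m = l then 1 else 0) \<star> g m)" using l J by simp
      then have "g l \<in> ?S" by (intro CollectI exI[of _ "\<lambda>m. if m = l then 1 else 0"] conjI TrueI)
      then show ?thesis by (rule AnnD(2)[OF \<phi>(1)])
    qed
    then show ?thesis using AnnD(1)[OF \<phi>(1)] \<phi>(2) by (intro exI[of _ \<phi>]) auto
  qed
  then show ?thesis by metis
qed

lemma lin_comb_mat_fmat:
  assumes "set Ms \<subseteq> carrier_mat n p"
  shows "lin_comb_mat n p c Ms \<in> carrier_mat n p \<and>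
    fmat n p (lin_comb_mat n p c Ms) = (\<Sum>i<length Ms. c i \<star> fmat n p (Ms ! i))"
proof -
  let ?f = "\<lambda>i acc. c i \<cdot>\<^sub>m (Ms ! i) + acc"
  have "foldr ?f is (0\<^sub>m n p) \<in> carrier_mat n p \<and>
    fmat n p (foldr ?f is (0\<^sub>m n p)) = sum_list (map (\<lambda>i. c i \<star> fmat n p (Ms ! i)) is)"
    if "set is \<subseteq> {..<length Ms}" for "is"
    using that
  proof (induction "is")
    case Nil
    then show ?case by (simp add: fmat_zero)
  next
    case (Cons a "is")
    have a: "Ms ! a \<in> carrier_mat n p" using Cons.prems assms by (simp add: subset_iff)
    have IH: "foldr ?f is (0\<^sub>m n p) \<in> carrier_mat n p"
      "fmat n p (foldr ?f is (0\<^sub>m n p)) = sum_list (map (\<lambda>i. c i \<star> fmat n p (Ms ! i)) is)"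
      using Cons.IH Cons.prems by (meson order_trans set_subset_Cons)+
    have ca: "c a \<cdot>\<^sub>m (Ms ! a) \<in> carrier_mat n p" using a by simp
    show ?case unfolding foldr.simps list.map sum_list.Cons comp_apply fmat_add[OF ca IH(1)] fmat_smult[OF a] IH(2)
      by (intro conjI refl add_carrier_mat IH(1))
  qed
  from this[of "[0..<length Ms]"] show ?thesis
    unfolding lin_comb_mat_def by (simp add: interv_sum_list_conv_sum_set_nat atLeast0LessThan)
qed

lemma mat_lin_indep_indf:
  assumes "mat_lin_indep n p Ms"
  shows "indf {..<length Ms} (\<lambda>i. fmat n p (Ms ! i))"
proof (rule indfI)
  fix c j assume c: "(\<Sum>i<length Ms. c i \<star> fmat n p (Ms ! i)) = 0" and j: "j \<in> {..<length Ms}"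
  have Ms: "set Ms \<subseteq> carrier_mat n p" using assms by (simp add: mat_lin_indep_def)
  have "lin_comb_mat n p c Ms = 0\<^sub>m n p"
    by (rule fmat_inject[of _ n p]) (use lin_comb_mat_fmat[OF Ms, of c] c in \<open>simp_all add: fmat_zero\<close>)
  then show "c j = 0" using assms j by (simp add: mat_lin_indep_def)
qed

text \<open>A longest independent list of \<open>S\<close> has a dual family of tensors. Joined to
  an independent family of \<open>perp n p S\<close> it stays independent, because pairing with the
  matrices of the list picks out its coefficients and kills the rest; and \<open>WW p (UU n)\<close>
  has dimension at most \<open>n * p\<close>.\<close>

lemma perp_dim:
  assumes S: "mat_subspace n p S"
  shows "mat_space_dim n p S \<le> n * p" "dimle (perp n p S) (n * p - mat_space_dim n p S)"
proof -
  let ?L = "{length Ms | Ms. set Ms \<subseteq> S \<and> mat_lin_indep n p Ms}"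
  have bound: "length Ms \<le> n * p" if "mat_lin_indep n p Ms" for Ms :: "'a mat list"
    using dimleD[OF dimle_WW finite_lessThan fmat_WW mat_lin_indep_indf[OF that]] by simp
  have "?L \<subseteq> {..n * p}" using bound by auto
  then have fin: "finite ?L" using finite_subset by blast
  have "mat_lin_indep n p ([] :: 'a mat list)" by (simp add: mat_lin_indep_def)
  then have "length ([] :: 'a mat list) \<in> ?L" by (metis (mono_tags, lifting) empty_set empty_subsetI mem_Collect_eq)
  then have "mat_space_dim n p S \<in> ?L" unfolding mat_space_dim_def using Max_in[OF fin] by blast
  then obtain Ms where Ms: "set Ms \<subseteq> S" "mat_lin_indep n p Ms" "mat_space_dim n p S = length Ms" by auto
  define d where "d = length Ms"
  obtain \<phi> where \<phi>: "\<forall>k\<in>{..<d}. lin (\<phi> k) \<and> (\<forall>l\<in>{..<d}. \<phi> k (fmat n p (Ms ! l)) = (if k = l then 1 else 0))"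
    using dual_family[OF finite_lessThan mat_lin_indep_indf[OF Ms(2)]] unfolding d_def by blast
  have "\<forall>k\<in>{..<d}. \<exists>\<tau>\<in>WW p (UU n). \<forall>l\<in>{..<d}. mfun n p (Ms ! l) \<tau> = (if k = l then 1 else 0)"
    using \<phi> lin_represented[of _ p n] by (metis (no_types, lifting))
  then obtain \<tau> where \<tau>: "\<forall>k\<in>{..<d}. \<tau> k \<in> WW p (UU n) \<and> (\<forall>l\<in>{..<d}. mfun n p (Ms ! l) (\<tau> k) = (if k = l then 1 else 0))"
    by metis
  show "mat_space_dim n p S \<le> n * p" using bound Ms(2,3) by simp
  show "dimle (perp n p S) (n * p - mat_space_dim n p S)"
  proof (rule dimleI)
    fix J :: "nat set" and t assume J: "finite J" and t: "\<And>j. j \<in> J \<Longrightarrow> t j \<in> perp n p S" and ind: "indf J t"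
    \<comment> \<open>The indices of the second family are shifted by \<open>d\<close> to keep the
      two apart.\<close>
    define f where "f x = (if x < d then \<tau> x else t (x - d))" for x
    let ?J = "{..<d} \<union> (\<lambda>j. j + d) ` J"
    have fW: "f x \<in> WW p (UU n)" if "x \<in> ?J" for x using that \<tau> t by (auto simp: f_def perp_def)
    have split: "(\<Sum>x\<in>?J. c x \<star> f x) = (\<Sum>k<d. c k \<star> \<tau> k) + (\<Sum>j\<in>J. c (j + d) \<star> t j)" for c
    proof -
      have "(\<Sum>x\<in>?J. c x \<star> f x) = (\<Sum>k<d. c k \<star> f k) + (\<Sum>x\<in>(\<lambda>j. j + d) ` J. c x \<star> f x)"
        by (rule sum.union_disjoint) (use J in auto)
      also have "(\<Sum>x\<in>(\<lambda>j. j + d) ` J. c x \<star> f x) = (\<Sum>j\<in>J. c (j + d) \<star> f (j + d))"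
        by (subst sum.reindex) (auto simp: inj_on_def)
      also have "(\<Sum>j\<in>J. c (j + d) \<star> f (j + d)) = (\<Sum>j\<in>J. c (j + d) \<star> t j)" by (rule sum.cong) (simp_all add: f_def)
      also have "(\<Sum>k<d. c k \<star> f k) = (\<Sum>k<d. c k \<star> \<tau> k)" by (rule sum.cong) (simp_all add: f_def)
      finally show ?thesis .
    qed
    have "indf ?J f"
    proof (rule indfI)
      fix c x assume "(\<Sum>x\<in>?J. c x \<star> f x) = 0" and x: "x \<in> ?J"
      then have c0: "(\<Sum>k<d. c k \<star> \<tau> k) + (\<Sum>j\<in>J. c (j + d) \<star> t j) = 0" by (simp only: split)
      have cl: "c l = 0" if l: "l < d" for l
      proof -
        note L = lin_mfun[of n p "Ms ! l"]
        have "Ms ! l \<in> S" using l Ms(1) by (auto simp: d_def)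
        then have "mfun n p (Ms ! l) (t j) = 0" if "j \<in> J" for j using t[OF that] by (simp add: perp_def)
        then have b: "mfun n p (Ms ! l) (\<Sum>j\<in>J. c (j + d) \<star> t j) = 0"
          by (simp add: lin_sum[OF L] lin_scl[OF L])
        have "mfun n p (Ms ! l) (\<Sum>k<d. c k \<star> \<tau> k) = (\<Sum>k<d. if k = l then c k else 0)"
          unfolding lin_sum[OF L] by (rule sum.cong) (use \<tau> l in \<open>auto simp: lin_scl[OF L]\<close>)
        also have "\<dots> = c l" using l by simp
        finally show ?thesis
          using b lin_add[OF L, of "\<Sum>k<d. c k \<star> \<tau> k" "\<Sum>j\<in>J. c (j + d) \<star> t j"] c0 lin_0[OF L] by simp
      qed
      then have "(\<Sum>k<d. c k \<star> \<tau> k) = 0" by simp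
      then have "(\<Sum>j\<in>J. c (j + d) \<star> t j) = 0" using c0 by simp
      then have "c (j + d) = 0" if "j \<in> J" for j using indfD[OF ind _ that, of "\<lambda>j. c (j + d)"] by blast
      then show "c x = 0" using x cl by auto
    qed
    from dimleD[OF dimle_WW _ fW this] have "card ?J \<le> n * p" using J by simp
    moreover have "card ?J = d + card J"
    proof -
      have "card ?J = card {..<d} + card ((\<lambda>j. j + d) ` J)" by (rule card_Un_disjoint) (use J in auto)
      then show ?thesis by (simp add: card_image inj_on_def)
    qed
    ultimately show "card J \<le> n * p - mat_space_dim n p S" using Ms(3) by (simp add: d_def)
  qed
qed

section \<open>From matrix maps to functionals on tensors and back\<close>

lemma mult_mat_vec_index: "M \<in> carrier_mat n p \<Longrightarrow> v \<in> carrier_vec p \<Longrightarrow> i < n \<Longrightarrow> (M *\<^sub>v v) $ i = (\<Sum>j<p. M $$ (i, j) * v $ j)"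
  by (simp add: scalar_prod_def atLeast0LessThan)

text \<open>If the row \<open>\<xi>\<close> kills the matrix \<open>M\<close> of \<open>s\<close>,
  it kills column \<open>k\<close> of \<open>F M\<close>, because range restriction writes that
  column as \<open>M x\<close>.\<close>

lemma rcs_column:
  fixes F :: "'a::field mat \<Rightarrow> 'a mat"
  assumes S: "mat_subspace n p S" and F: "F ` S \<subseteq> carrier_mat n q" and add: "additive_on S F" and rr: "range_restricting S F"
    and k: "k < q"
  shows "rcs p (UU n) (perp n p S) (\<lambda>s \<xi>. \<Sum>i<n. \<xi> i * F (mat_of n p s) $$ (i, k))"
proof
  show "sub (UU n :: (nat \<Rightarrow> 'a) set)" by (rule sub_UU)
  show "sub (perp n p S)" by (rule sub_perp)
  show "perp n p S \<subseteq> WW p (UU n)" by (auto simp: perp_def)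
  fix s assume s: "s \<in> Ann (perp n p S)"
  have M: "mat_of n p s \<in> S" by (rule mat_of_mem[OF S s])
  have FM: "F (mat_of n p s) \<in> carrier_mat n q" using M F by blast
  show "lin (\<lambda>\<xi>. \<Sum>i<n. \<xi> i * F (mat_of n p s) $$ (i, k))"
    by (rule linI) (simp_all add: scl_apply algebra_simps sum.distrib sum_distrib_left)
  { fix s' and \<xi> :: "nat \<Rightarrow> 'a" assume s': "s' \<in> Ann (perp n p S)"
    have M': "mat_of n p s' \<in> S" by (rule mat_of_mem[OF S s'])
    have FM': "F (mat_of n p s') \<in> carrier_mat n q" using M' F by blast
    have "F (mat_of n p (s + s')) = F (mat_of n p s) + F (mat_of n p s')"
      unfolding mat_of_add using add M M' by (simp add: additive_on_def)
    then show "(\<Sum>i<n. \<xi> i * F (mat_of n p (s + s')) $$ (i, k)) =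
        (\<Sum>i<n. \<xi> i * F (mat_of n p s) $$ (i, k)) + (\<Sum>i<n. \<xi> i * F (mat_of n p s') $$ (i, k))"
      using FM FM' k by (simp add: algebra_simps sum.distrib) }
  fix \<xi> :: "nat \<Rightarrow> 'a" assume \<xi>: "\<xi> \<in> UU n" and van: "\<And>x. x \<in> UU p \<Longrightarrow> s (x \<Otimes> \<xi>) = 0"
  have "F (mat_of n p s) *\<^sub>v unit_vec q k \<in> col_space (F (mat_of n p s))"
    using FM unfolding col_space_def by fastforce
  then have "F (mat_of n p s) *\<^sub>v unit_vec q k \<in> col_space (mat_of n p s)"
    using rr M unfolding range_restricting_def by blast
  then obtain x where x: "x \<in> carrier_vec p" "F (mat_of n p s) *\<^sub>v unit_vec q k = mat_of n p s *\<^sub>v x"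
    unfolding col_space_def by (auto simp: mat_of_def)
  define x' where "x' j = (if j < p then x $ j else 0)" for j
  have x': "x' \<in> UU p" by (simp add: UU_def x'_def)
  have "F (mat_of n p s) $$ (i, k) = (\<Sum>j<p. mat_of n p s $$ (i, j) * x' j)" if i: "i < n" for i
  proof -
    have "F (mat_of n p s) $$ (i, k) = (F (mat_of n p s) *\<^sub>v unit_vec q k) $ i"
      using FM i k by (simp add: scalar_prod_right_unit)
    also have "\<dots> = (\<Sum>j<p. mat_of n p s $$ (i, j) * x $ j)"
      unfolding x(2) by (rule mult_mat_vec_index[OF mat_of_carrier x(1) i])
    also have "\<dots> = (\<Sum>j<p. mat_of n p s $$ (i, j) * x' j)" by (rule sum.cong) (simp_all add: x'_def)
    finally show ?thesis .
  qed
  then have "(\<Sum>i<n. \<xi> i * F (mat_of n p s) $$ (i, k)) = mfun n p (mat_of n p s) (x' \<Otimes> \<xi>)"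
    unfolding mfun_tensor by (intro sum.cong) auto
  also have "\<dots> = s (x' \<Otimes> \<xi>)" by (rule mfun_mat_of[OF AnnD(1)[OF s] tensor_WW[OF x' \<xi> sub_UU]])
  also have "\<dots> = 0" by (rule van[OF x'])
  finally show "(\<Sum>i<n. \<xi> i * F (mat_of n p s) $$ (i, k)) = 0" .
qed

text \<open>The multipliers found for the single columns of \<open>F\<close> are the columns of
  \<open>P\<close>.\<close>

lemma right_mult_if_local:
  fixes F :: "'a::field mat \<Rightarrow> 'a mat"
  assumes S: "mat_subspace n p S" and F: "F ` S \<subseteq> carrier_mat n q"
    and loc: "\<And>k. k < q \<Longrightarrow> localF p (UU n) (perp n p S) (\<lambda>s \<xi>. \<Sum>i<n. \<xi> i * F (mat_of n p s) $$ (i, k))"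
  shows "\<exists>P\<in>carrier_mat p q. \<forall>M\<in>S. F M = M * P"
proof -
  have "\<forall>k\<in>{..<q}. \<exists>x\<in>UU p. \<forall>s\<in>Ann (perp n p S). \<forall>\<xi>\<in>UU n. (\<Sum>i<n. \<xi> i * F (mat_of n p s) $$ (i, k)) = s (x \<Otimes> \<xi>)"
    using loc unfolding localF_def by blast
  then obtain x where x: "\<forall>k\<in>{..<q}. \<forall>s\<in>Ann (perp n p S). \<forall>\<xi>\<in>UU n. (\<Sum>i<n. \<xi> i * F (mat_of n p s) $$ (i, k)) = s (x k \<Otimes> \<xi>)"
    by metis
  define P where "P = mat p q (\<lambda>(j, k). x k j)"
  have "F M = M * P" if M: "M \<in> S" for M
  proof (rule eq_matI)
    have MC: "M \<in> carrier_mat n p" using M S by (auto simp: mat_subspace_def)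
    have FM: "F M \<in> carrier_mat n q" using M F by blast
    show "dim_row (F M) = dim_row (M * P)" "dim_col (F M) = dim_col (M * P)" using MC FM by (simp_all add: P_def)
    fix i k assume "i < dim_row (M * P)" "k < dim_col (M * P)"
    then have i: "i < n" and k: "k < q" using MC by (simp_all add: P_def)
    have "(\<Sum>l<n. ev i l * F (mat_of n p (mfun n p M)) $$ (l, k)) = mfun n p M (x k \<Otimes> ev i)"
      using x k mfun_Ann[OF M] ev_UU[OF i] by blast
    moreover have "(\<Sum>l<n. ev i l * F M $$ (l, k)) = (\<Sum>l<n. if l = i then F M $$ (l, k) else 0)"
      by (rule sum.cong) (auto simp: ev_def)
    moreover have "mfun n p M (x k \<Otimes> ev i) = (\<Sum>l<n. if l = i then (\<Sum>j<p. M $$ (l, j) * x k j) else 0)"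
      unfolding mfun_tensor by (rule sum.cong) (auto simp: ev_def)
    ultimately have "F M $$ (i, k) = (\<Sum>j<p. M $$ (i, j) * x k j)" using i by (simp add: mat_of_mfun[OF MC])
    then show "F M $$ (i, k) = (M * P) $$ (i, k)"
      using MC i k by (simp add: P_def scalar_prod_def atLeast0LessThan)
  qed
  moreover have "P \<in> carrier_mat p q" by (simp add: P_def)
  ultimately show ?thesis by blast
qed

lemma right_mult_conv:
  fixes F :: "'a::field mat \<Rightarrow> 'a mat"
  assumes S: "mat_subspace n p S" and P: "P \<in> carrier_mat p q" and FM: "\<forall>M\<in>S. F M = M * P"
  shows "F ` S \<subseteq> carrier_mat n q" "linear_on S F" "range_restricting S F"
proof -
  have SC: "M \<in> carrier_mat n p" if "M \<in> S" for M using that S by (auto simp: mat_subspace_def)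
  have cl: "A + B \<in> S" "c \<cdot>\<^sub>m A \<in> S" if "A \<in> S" "B \<in> S" for A B c using that S by (auto simp: mat_subspace_def)
  show "F ` S \<subseteq> carrier_mat n q" using FM mult_carrier_mat[OF SC P] by auto
  show "linear_on S F" unfolding linear_on_def additive_on_def
    using FM cl add_mult_distrib_mat[OF SC SC P] mult_smult_assoc_mat[OF SC P] by auto
  show "range_restricting S F"
    unfolding range_restricting_def col_space_def
  proof (intro ballI subsetI)
    fix M v assume M: "M \<in> S" and "v \<in> {F M *\<^sub>v x | x. x \<in> carrier_vec (dim_col (F M))}"
    then obtain x where x: "x \<in> carrier_vec (dim_col (F M))" "v = F M *\<^sub>v x" by blast
    have "dim_col (F M) = q" using FM M P by simp
    then have xq: "x \<in> carrier_vec q" using x(1) by simp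
    then have "v = M *\<^sub>v (P *\<^sub>v x)" using x(2) FM M assoc_mult_mat_vec[OF SC[OF M] P xq] by simp
    moreover have "P *\<^sub>v x \<in> carrier_vec (dim_col M)" using P SC[OF M] xq by simp
    ultimately show "v \<in> {M *\<^sub>v x | x. x \<in> carrier_vec (dim_col M)}" by blast
  qed
qed

text \<open>For \<open>M \<in> S\<close> the functional
  \<open>\<xi> \<mapsto> mfun n p M (x \<Otimes> \<xi>)\<close> vanishes with \<open>z\<close>, so
  \<open>M x\<close> is a multiple of the coefficient vector \<open>yv\<close> of \<open>z\<close>.
  Some \<open>M0\<close> gives a nonzero multiple, and scaling it fills the line.\<close>

lemma type1_if_type1F:
  assumes S: "mat_subspace n p S" and t1: "type1F p (UU n) (perp n p S)"
  shows "type1 n p S"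
proof -
  obtain x z \<xi>0 where x: "x \<in> UU p" and z: "lin z" and \<xi>0: "\<xi>0 \<in> UU n" "z \<xi>0 \<noteq> 0"
    and \<Phi>: "\<forall>\<xi>\<in>UU n. x \<Otimes> \<xi> \<in> perp n p S \<longleftrightarrow> z \<xi> = 0" using t1 unfolding type1F_def by blast
  have SC: "M \<in> carrier_mat n p" if "M \<in> S" for M using that S by (auto simp: mat_subspace_def)
  define xv where "xv = vec p x"
  define yv where "yv = vec n (\<lambda>i. z (ev i))"
  have entry: "(M *\<^sub>v xv) $ i = mfun n p M (x \<Otimes> ev i)" if M: "M \<in> S" and i: "i < n" for M i
  proof -
    have "(M *\<^sub>v xv) $ i = (\<Sum>j<p. M $$ (i, j) * x j)"
      using mult_mat_vec_index[OF SC[OF M] _ i, of xv] by (simp add: xv_def)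
    also have "\<dots> = (\<Sum>l<n. if l = i then (\<Sum>j<p. M $$ (l, j) * x j) else 0)" using i by simp
    also have "\<dots> = mfun n p M (x \<Otimes> ev i)"
      unfolding mfun_tensor by (rule sum.cong) (auto simp: ev_def)
    finally show ?thesis .
  qed
  have multiple: "\<exists>c. \<forall>\<xi>\<in>UU n. mfun n p M (x \<Otimes> \<xi>) = c * z \<xi>" if M: "M \<in> S" for M
  proof -
    have l: "lin (\<lambda>\<xi>. mfun n p M (x \<Otimes> \<xi>))"
      by (rule linI) (simp_all add: tensor_add_right tensor_scl_right lin_add[OF lin_mfun] lin_scl[OF lin_mfun])
    have "mfun n p M (x \<Otimes> \<xi>) = 0" if "\<xi> \<in> UU n" "z \<xi> = 0" for \<xi>
      using \<Phi> that M unfolding perp_def by blast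
    from lin_proportional[OF sub_UU l z this] show ?thesis by metis
  qed
  have vec_eq: "M *\<^sub>v xv = c \<cdot>\<^sub>v yv" if M: "M \<in> S" and c: "\<forall>\<xi>\<in>UU n. mfun n p M (x \<Otimes> \<xi>) = c * z \<xi>" for M c
  proof (rule eq_vecI)
    show "dim_vec (M *\<^sub>v xv) = dim_vec (c \<cdot>\<^sub>v yv)" using SC[OF M] by (simp add: yv_def)
    fix i assume "i < dim_vec (c \<cdot>\<^sub>v yv)"
    then have i: "i < n" by (simp add: yv_def)
    show "(M *\<^sub>v xv) $ i = (c \<cdot>\<^sub>v yv) $ i" using entry[OF M i] bspec[OF c ev_UU[OF i]] i by (simp add: yv_def)
  qed
  have "x \<Otimes> \<xi>0 \<notin> perp n p S" using \<Phi> \<xi>0 by blast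
  then obtain M0 where M0: "M0 \<in> S" "mfun n p M0 (x \<Otimes> \<xi>0) \<noteq> 0"
    using tensor_WW[OF x \<xi>0(1) sub_UU] unfolding perp_def by blast
  obtain c0 where c0: "\<forall>\<xi>\<in>UU n. mfun n p M0 (x \<Otimes> \<xi>) = c0 * z \<xi>" using multiple[OF M0(1)] by blast
  have c0nz: "c0 \<noteq> 0" using M0(2) c0 \<xi>0(1) by auto
  have "yv \<noteq> 0\<^sub>v n"
  proof
    assume "yv = 0\<^sub>v n"
    then have "yv $ i = 0" if "i < n" for i using that by simp
    then have "z (ev i) = 0" if "i < n" for i using that by (simp add: yv_def)
    then have "z \<xi>0 = 0" using db_eq_lin[OF db_ev z lin_zero _ \<xi>0(1)] by simp
    then show False using \<xi>0(2) by simp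
  qed
  moreover have "{M *\<^sub>v xv | M. M \<in> S} = {c \<cdot>\<^sub>v yv | c. True}"
  proof (intro equalityI subsetI)
    fix v assume "v \<in> {M *\<^sub>v xv | M. M \<in> S}"
    then obtain M where M: "M \<in> S" "v = M *\<^sub>v xv" by blast
    obtain c where c: "\<forall>\<xi>\<in>UU n. mfun n p M (x \<Otimes> \<xi>) = c * z \<xi>" using multiple[OF M(1)] by blast
    show "v \<in> {c \<cdot>\<^sub>v yv | c. True}" unfolding M(2) vec_eq[OF M(1) c] by blast
  next
    fix v assume "v \<in> {c \<cdot>\<^sub>v yv | c. True}"
    then obtain c where c: "v = c \<cdot>\<^sub>v yv" by blast
    have M: "(c / c0) \<cdot>\<^sub>m M0 \<in> S" using S M0(1) unfolding mat_subspace_def by blast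
    have e: "\<forall>\<xi>\<in>UU n. mfun n p ((c / c0) \<cdot>\<^sub>m M0) (x \<Otimes> \<xi>) = c * z \<xi>"
      using c0 c0nz by (simp add: mfun_smult[OF SC[OF M0(1)]] scl_apply)
    have "v = (c / c0) \<cdot>\<^sub>m M0 *\<^sub>v xv" unfolding c by (rule vec_eq[OF M e, symmetric])
    then show "v \<in> {M *\<^sub>v xv | M. M \<in> S}" using M by blast
  qed
  moreover have "xv \<in> carrier_vec p" "yv \<in> carrier_vec n" by (simp_all add: xv_def yv_def)
  ultimately show ?thesis unfolding type1_def by blast
qed

text \<open>The normal forms of Types 2 and 3 refer to the first indices, so the chosen vectors are
  moved to the front.\<close>

lemma db_reorder:
  assumes db: "db I X \<xi> y" and ks: "distinct ks" "set ks \<subseteq> I" and card: "card I = n"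
  shows "\<exists>\<xi>' y'. db {..<n} X \<xi>' y' \<and> (\<forall>i<length ks. \<xi>' i = \<xi> (ks ! i)) \<and>
    (\<forall>i. length ks \<le> i \<longrightarrow> i < n \<longrightarrow> (\<exists>k\<in>I - set ks. \<xi>' i = \<xi> k)) \<and> length ks \<le> n"
proof -
  have fin: "finite I" using db_finite[OF db] .
  obtain xs where xs: "set xs = I - set ks" "distinct xs" using finite_distinct_list[of "I - set ks"] fin by blast
  let ?l = "ks @ xs"
  have d: "distinct ?l" and s: "set ?l = I" using ks xs by auto
  then have len: "length ?l = n" using card distinct_card by metis
  have b: "bij_betw ((!) ?l) {..<n} I" using bij_betw_nth[OF d] len s by simp
  have m: "?l ! i \<in> I" if "i < n" for i using that b by (auto simp: bij_betw_def)
  have e: "?l ! i = ?l ! j \<longleftrightarrow> i = j" if "i < n" "j < n" for i j using d that len nth_eq_iff_index_eq by metis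
  have "db {..<n} X (\<lambda>i. \<xi> (?l ! i)) (\<lambda>i. y (?l ! i))"
    unfolding db_def
  proof (intro conjI ballI)
    fix i j assume "i \<in> {..<n}" "j \<in> {..<n}"
    then show "y (?l ! i) (\<xi> (?l ! j)) = (if i = j then 1 else 0)" using db_dual[OF db m m, of i j] e by simp
  next
    fix \<eta> assume "\<eta> \<in> X"
    from db_expand[OF db this] have "\<eta> = (\<Sum>k\<in>I. y k \<eta> \<star> \<xi> k)" .
    also have "\<dots> = (\<Sum>i<n. y (?l ! i) \<eta> \<star> \<xi> (?l ! i))"
      using sum.reindex_bij_betw[OF b, of "\<lambda>k. y k \<eta> \<star> \<xi> k"] by (rule sym)
    finally show "\<eta> = (\<Sum>i<n. y (?l ! i) \<eta> \<star> \<xi> (?l ! i))" .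
  qed (use db_mem[OF db m] db_lin[OF db m] in auto)
  moreover have "\<forall>i<length ks. \<xi> (?l ! i) = \<xi> (ks ! i)" by (simp add: nth_append)
  moreover have "\<exists>k\<in>I - set ks. \<xi> (?l ! i) = \<xi> k" if "length ks \<le> i" "i < n" for i
  proof -
    have "i - length ks < length xs" using that len by simp
    then have "xs ! (i - length ks) \<in> I - set ks" using xs(1) nth_mem by blast
    moreover have "?l ! i = xs ! (i - length ks)" using that by (simp add: nth_append)
    ultimately show ?thesis by auto
  qed
  moreover have "length ks \<le> n" using len by simp
  ultimately show ?thesis by blast
qed

lemma db_three_vec:
  assumes db: "db I X \<xi> y" and x: "x1 \<in> X" "x2 \<in> X" "x3 \<in> X" and ind: "indep2 x1 x2"
    and x3: "\<forall>a b. x3 \<noteq> a \<star> x1 + b \<star> x2"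
  shows "\<exists>k1 k2 k3 \<xi>' y'. distinct [k1, k2, k3] \<and> set [k1, k2, k3] \<subseteq> I \<and> db I X \<xi>' y' \<and>
    \<xi>' k1 = x1 \<and> \<xi>' k2 = x2 \<and> \<xi>' k3 = x3"
proof -
  obtain k1 k2 \<xi>1 y1 where k: "k1 \<in> I" "k2 \<in> I" "k1 \<noteq> k2" and db1: "db I X \<xi>1 y1" and \<xi>1: "\<xi>1 k1 = x1" "\<xi>1 k2 = x2"
    using db_two_vec[OF db x(1,2) ind] .
  have "\<exists>k3\<in>I-{k1,k2}. y1 k3 x3 \<noteq> 0"
  proof (rule ccontr)
    assume n: "\<not> (\<exists>k3\<in>I-{k1,k2}. y1 k3 x3 \<noteq> 0)"
    have "(\<Sum>i\<in>I. y1 i x3 \<star> \<xi>1 i) = (\<Sum>i\<in>{k1,k2}. y1 i x3 \<star> \<xi>1 i)"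
      by (rule sum.mono_neutral_right) (use n k db_finite[OF db] in auto)
    then have "x3 = y1 k1 x3 \<star> x1 + y1 k2 x3 \<star> x2" using db_expand[OF db1 x(3)] k(3) \<xi>1 by simp
    then show False using x3 by blast
  qed
  then obtain k3 where k3: "k3 \<in> I" "k3 \<noteq> k1" "k3 \<noteq> k2" "y1 k3 x3 \<noteq> 0" by blast
  obtain y' where "db I X (\<xi>1(k3 := x3)) y'" using db_vec_exchange[OF db1 k3(1) x(3) k3(4)] .
  moreover have "(\<xi>1(k3 := x3)) k1 = x1" "(\<xi>1(k3 := x3)) k2 = x2" "(\<xi>1(k3 := x3)) k3 = x3" using k3 \<xi>1 by simp_all
  ultimately show ?thesis using k k3(1-3) by (metis distinct_length_2_or_more distinct_singleton empty_subsetI insert_subset list.simps(15) list.set(1))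
qed

text \<open>One equation is duality of the bases, the other the expansion of the unit
  vectors.\<close>

lemma db_matrix:
  assumes db: "db {..<n} (UU n) \<xi> y"
  defines "A \<equiv> mat n n (\<lambda>(i, k). \<xi> i k)" and "B \<equiv> mat n n (\<lambda>(k, i). y i (ev k))"
  shows "A * B = 1\<^sub>m n" "B * A = 1\<^sub>m n"
proof -
  show "A * B = 1\<^sub>m n"
  proof (rule eq_matI)
    fix i j assume "i < dim_row (1\<^sub>m n :: 'a mat)" "j < dim_col (1\<^sub>m n :: 'a mat)"
    then have i: "i < n" and j: "j < n" by simp_all
    have "y j (\<xi> i) = (\<Sum>k<n. \<xi> i k * y j (ev k))"
      using db_expand_lin[OF db_ev db_lin[OF db] db_mem[OF db]] i j by simp
    moreover have "y j (\<xi> i) = (if i = j then 1 else 0)" using db_dual[OF db, of j i] i j by auto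
    moreover have "(A * B) $$ (i, j) = (\<Sum>k<n. \<xi> i k * y j (ev k))"
      using i j by (simp add: A_def B_def scalar_prod_def atLeast0LessThan)
    ultimately show "(A * B) $$ (i, j) = 1\<^sub>m n $$ (i, j)" using i j by simp
  qed (simp_all add: A_def B_def)
  show "B * A = 1\<^sub>m n"
  proof (rule eq_matI)
    fix i j assume "i < dim_row (1\<^sub>m n :: 'a mat)" "j < dim_col (1\<^sub>m n :: 'a mat)"
    then have i: "i < n" and j: "j < n" by simp_all
    have "ev i j = (\<Sum>k<n. y k (ev i) \<star> \<xi> k) j" using db_expand[OF db ev_UU[OF i]] by metis
    then show "(B * A) $$ (i, j) = 1\<^sub>m n $$ (i, j)"
      using i j by (simp add: A_def B_def scalar_prod_def atLeast0LessThan sum_fun_apply scl_apply ev_def)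
  qed (simp_all add: A_def B_def)
qed

lemma change_of_basis:
  assumes M: "M \<in> carrier_mat n p" and i: "i < n" and j: "j < p"
  shows "(mat n n (\<lambda>(i, k). \<xi> i k) * M * mat p p (\<lambda>(k, j). x j k)) $$ (i, j) = mfun n p M (x j \<Otimes> \<xi> i)"
proof -
  have "(mat n n (\<lambda>(i, k). \<xi> i k) * M * mat p p (\<lambda>(k, j). x j k)) $$ (i, j) =
      (\<Sum>b<p. (\<Sum>a<n. \<xi> i a * M $$ (a, b)) * x j b)"
    using M i j by (simp add: scalar_prod_def atLeast0LessThan)
  also have "\<dots> = (\<Sum>b<p. \<Sum>a<n. \<xi> i a * (M $$ (a, b) * x j b))" by (simp add: sum_distrib_right mult.assoc)
  also have "\<dots> = mfun n p M (x j \<Otimes> \<xi> i)"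
    unfolding mfun_tensor by (subst sum.swap) (simp add: sum_distrib_left)
  finally show ?thesis .
qed

lemma lin_prescribed:
  assumes dbX: "db I X \<xi> y" and dbU: "db K U x \<phi>"
  shows "\<exists>s. lin s \<and> (\<forall>i\<in>I. \<forall>j\<in>K. s (x j \<Otimes> \<xi> i) = A i j)"
proof -
  define s where "s = (\<Sum>i\<in>I. \<Sum>j\<in>K. A i j \<star> rk1 (\<phi> j) (y i))"
  have "lin s" unfolding s_def
    by (intro lin_setsum lin_star lin_rk1) (use db_lin[OF dbX] db_lin[OF dbU] in auto)
  moreover have "s (x j \<Otimes> \<xi> i) = A i j" if i: "i \<in> I" and j: "j \<in> K" for i j
  proof -
    have "s (x j \<Otimes> \<xi> i) = (\<Sum>a\<in>I. \<Sum>b\<in>K. A a b * (y a (\<xi> i) * \<phi> b (x j)))"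
      unfolding s_def sum_fun_apply scl_apply
      by (intro sum.cong refl) (simp add: rk1_tensor db_lin[OF dbX] db_lin[OF dbU])
    also have "\<dots> = (\<Sum>a\<in>I. if a = i then A i j else 0)"
    proof (rule sum.cong[OF refl])
      fix a assume a: "a \<in> I"
      have "(\<Sum>b\<in>K. A a b * (y a (\<xi> i) * \<phi> b (x j))) = (\<Sum>b\<in>K. if b = j then A a j * y a (\<xi> i) else 0)"
        by (rule sum.cong) (use db_dual[OF dbU _ j] in auto)
      also have "\<dots> = A a j * y a (\<xi> i)" using j db_finite[OF dbU] by simp
      finally show "(\<Sum>b\<in>K. A a b * (y a (\<xi> i) * \<phi> b (x j))) = (if a = i then A i j else 0)"
        using db_dual[OF dbX a i] by simp
    qed
    also have "\<dots> = A i j" using i db_finite[OF dbX] by simp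
    finally show ?thesis .
  qed
  ultimately show ?thesis by blast
qed

text \<open>In the two bases \<open>M\<close> has the entries
  \<open>mfun n p M (x j \<Otimes> \<xi> i)\<close>. Equivalence to \<open>R\<close> thus reduces to
  two claims: these entries satisfy the conditions of \<open>R\<close>, and a functional with values
  prescribed by \<open>R\<close> annihilates \<open>perp n p S\<close>.\<close>

lemma equivalent_image:
  assumes S: "mat_subspace n p S" and dbX: "db {..<n} (UU n) \<xi> y" and dbU: "db {..<p} (UU p) x \<phi>"
    and RC: "R \<subseteq> carrier_mat n p"
    and into: "\<And>A M. M \<in> S \<Longrightarrow> A \<in> carrier_mat n p \<Longrightarrow> (\<And>i j. i < n \<Longrightarrow> j < p \<Longrightarrow> A $$ (i, j) = mfun n p M (x j \<Otimes> \<xi> i)) \<Longrightarrow> A \<in> R"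
    and onto: "\<And>A s. A \<in> R \<Longrightarrow> lin s \<Longrightarrow> (\<And>i j. i < n \<Longrightarrow> j < p \<Longrightarrow> s (x j \<Otimes> \<xi> i) = A $$ (i, j)) \<Longrightarrow> s \<in> Ann (perp n p S)"
  shows "\<exists>P Q Qi. P \<in> carrier_mat n n \<and> invertible_mat P \<and> Q \<in> carrier_mat p p \<and>
        Qi \<in> carrier_mat p p \<and> Q * Qi = 1\<^sub>m p \<and> Qi * Q = 1\<^sub>m p \<and> (\<lambda>M. P * M * Qi) ` S = R"
proof -
  define P where "P = mat n n (\<lambda>(i, k). \<xi> i k)"
  define P' where "P' = mat n n (\<lambda>(k, i). y i (ev k))"
  define A where "A = mat p p (\<lambda>(j, k). x j k)"
  define B where "B = mat p p (\<lambda>(k, j). \<phi> j (ev k))"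
  define Qi where "Qi = mat p p (\<lambda>(k, j). x j k)"
  have SC: "M \<in> carrier_mat n p" if "M \<in> S" for M using that S by (auto simp: mat_subspace_def)
  have PP: "P * P' = 1\<^sub>m n" "P' * P = 1\<^sub>m n" unfolding P_def P'_def by (rule db_matrix[OF dbX])+
  have PC: "P \<in> carrier_mat n n" "P' \<in> carrier_mat n n" by (simp_all add: P_def P'_def)
  have inv: "invertible_mat P"
    unfolding invertible_mat_def inverts_mat_def using PP PC by (intro conjI exI[of _ P']) auto
  have AB: "A * B = 1\<^sub>m p" "B * A = 1\<^sub>m p" unfolding A_def B_def by (rule db_matrix[OF dbU])+
  have ABC: "A \<in> carrier_mat p p" "B \<in> carrier_mat p p" by (simp_all add: A_def B_def)
  have Qi: "Qi = transpose_mat A" by (rule eq_matI) (simp_all add: Qi_def A_def)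
  have QQ: "transpose_mat B * Qi = 1\<^sub>m p" "Qi * transpose_mat B = 1\<^sub>m p"
    unfolding Qi transpose_mult[OF ABC, symmetric] transpose_mult[OF ABC(2,1), symmetric] AB by simp_all
  have QC: "Qi \<in> carrier_mat p p" "transpose_mat B \<in> carrier_mat p p" using ABC by (simp_all add: Qi)
  have entry: "(P * M * Qi) $$ (i, j) = mfun n p M (x j \<Otimes> \<xi> i)" if "M \<in> S" "i < n" "j < p" for M i j
    unfolding P_def Qi_def by (rule change_of_basis[OF SC[OF that(1)] that(2,3)])
  have C: "P * M * Qi \<in> carrier_mat n p" if "M \<in> S" for M using PC(1) SC[OF that] QC(1) by simp
  have "(\<lambda>M. P * M * Qi) ` S = R"
  proof (intro equalityI subsetI)
    fix N assume "N \<in> (\<lambda>M. P * M * Qi) ` S"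
    then obtain M where M: "M \<in> S" "N = P * M * Qi" by blast
    show "N \<in> R" unfolding M(2) by (rule into[OF M(1) C[OF M(1)] entry[OF M(1)]])
  next
    fix N assume N: "N \<in> R"
    obtain s where s: "lin s" "\<forall>i\<in>{..<n}. \<forall>j\<in>{..<p}. s (x j \<Otimes> \<xi> i) = N $$ (i, j)"
      using lin_prescribed[OF dbX dbU, of "\<lambda>i j. N $$ (i, j)"] by blast
    have sA: "s \<in> Ann (perp n p S)" by (rule onto[OF N s(1)]) (use s(2) in simp)
    have M: "mat_of n p s \<in> S" by (rule mat_of_mem[OF S sA])
    have "N = P * mat_of n p s * Qi"
    proof (rule eq_matI)
      fix i j assume "i < dim_row (P * mat_of n p s * Qi)" "j < dim_col (P * mat_of n p s * Qi)"
      then have i: "i < n" and j: "j < p" using C[OF M] by auto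
      have "x j \<Otimes> \<xi> i \<in> WW p (UU n)" by (rule tensor_WW[OF _ _ sub_UU]) (use db_mem[OF dbU] db_mem[OF dbX] i j in auto)
      then show "N $$ (i, j) = (P * mat_of n p s * Qi) $$ (i, j)"
        using entry[OF M i j] mfun_mat_of[OF s(1)] s(2) i j by simp
    qed (unfold carrier_matD[OF C[OF M]] carrier_matD[OF subsetD[OF RC N]], rule refl, rule refl)
    then show "N \<in> (\<lambda>M. P * M * Qi) ` S" using M by blast
  qed
  then show ?thesis using PC(1) inv QC QQ by blast
qed

section \<open>Types 2 and 3 from the exceptional form\<close>

lemma sub_Tkers: "sub T \<Longrightarrow> (\<And>b. b \<in> B \<Longrightarrow> lin (y b)) \<Longrightarrow> sub (Tkers T B y)"
  by (auto simp: sub_def Tkers_def contr_add contr_scl contr_0)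

context rcs
begin

text \<open>The symmetric tensors of \<open>formC_sym\<close> formed with \<open>\<xi> 0\<close> and
  \<open>\<xi> 1\<close> contract with \<open>y b\<close> to \<open>J (\<xi> 0)\<close> and
  \<open>J (\<xi> 1)\<close>.\<close>

lemma formC_chain:
  assumes C: "formC p X T F x0 J \<alpha>" and db: "db {..<n} X \<xi> y" and B: "B \<subseteq> {2..<n}"
    and ind: "indep2 (J (\<xi> 0)) (J (\<xi> 1))"
  shows "chain T B y (\<lambda>b. J (\<xi> b) \<Otimes> \<xi> 0 + J (\<xi> 0) \<Otimes> \<xi> b) (\<lambda>b. J (\<xi> b) \<Otimes> \<xi> 1 + J (\<xi> 1) \<Otimes> \<xi> b)"
  unfolding chain_def
proof (intro ballI)
  fix b assume b: "b \<in> B"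
  have bn: "2 \<le> b" "b < n" using b B by auto
  have mem: "\<xi> i \<in> X" if "i < n" for i using db_mem[OF db, of i] that by simp
  have con: "contr (J (\<xi> b) \<Otimes> \<xi> i + J (\<xi> i) \<Otimes> \<xi> b) (y b') = (if b' = b then J (\<xi> i) else 0)"
    if "b' \<in> B" "i < 2" for b' i
  proof -
    have b': "2 \<le> b'" "b' < n" using that B by auto
    have "lin (y b')" using db_lin[OF db, of b'] b' by simp
    then show ?thesis using db_dual[OF db, of b' i] db_dual[OF db, of b' b] b' bn that(2)
      by (simp add: contr_simps)
  qed
  show "lin (y b) \<and> J (\<xi> b) \<Otimes> \<xi> 0 + J (\<xi> 0) \<Otimes> \<xi> b \<in> T \<and> J (\<xi> b) \<Otimes> \<xi> 1 + J (\<xi> 1) \<Otimes> \<xi> b \<in> T \<and>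
    indep2 (contr (J (\<xi> b) \<Otimes> \<xi> 0 + J (\<xi> 0) \<Otimes> \<xi> b) (y b)) (contr (J (\<xi> b) \<Otimes> \<xi> 1 + J (\<xi> 1) \<Otimes> \<xi> b) (y b)) \<and>
    (\<forall>b'\<in>B-{b}. contr (J (\<xi> b) \<Otimes> \<xi> 0 + J (\<xi> 0) \<Otimes> \<xi> b) (y b') = 0 \<and> contr (J (\<xi> b) \<Otimes> \<xi> 1 + J (\<xi> 1) \<Otimes> \<xi> b) (y b') = 0)"
    using db_lin[OF db, of b] bn formC_sym[OF C mem mem, of 0 b] formC_sym[OF C mem mem, of 1 b] con[OF b, of 0] con[OF b, of 1]
      con[of _ 0] con[of _ 1] ind by auto
qed

text \<open>The chain over the indices from 2 on and one more symmetric tensor number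
  \<open>2 * (n - 2) + 1\<close>, which is the bound. So they span \<open>T\<close>, and it is
  enough that \<open>s\<close> kills them.\<close>

lemma formC_rank_two_span:
  assumes two: "(2::'a) = 0" and C: "formC p X T F x0 J \<alpha>" and db: "db {..<n} X \<xi> y" and n: "2 \<le> n"
    and dim: "dimle T (2 * n - 3)" and ind: "indep2 (J (\<xi> 0)) (J (\<xi> 1))"
    and J0: "\<And>i. 2 \<le> i \<Longrightarrow> i < n \<Longrightarrow> J (\<xi> i) = 0"
    and s: "lin s" "s (J (\<xi> 0) \<Otimes> \<xi> 1) = s (J (\<xi> 1) \<Otimes> \<xi> 0)"
      "\<And>i. 2 \<le> i \<Longrightarrow> i < n \<Longrightarrow> s (J (\<xi> 0) \<Otimes> \<xi> i) = 0 \<and> s (J (\<xi> 1) \<Otimes> \<xi> i) = 0"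
    and t: "t \<in> T"
  shows "s t = 0"
proof -
  let ?B = "{2..<n}"
  let ?\<tau> = "J (\<xi> 1) \<Otimes> \<xi> 0 + J (\<xi> 0) \<Otimes> \<xi> 1"
  note ch = formC_chain[OF C db order_refl ind]
  have c: "2 * n - 3 = Suc 0 + 2 * card ?B" using n by simp
  have ly: "lin (y i)" if "i < n" for i using db_lin[OF db, of i] that by simp
  have mem: "\<xi> i \<in> X" if "i < n" for i using db_mem[OF db, of i] that by simp
  have n1: "0 < n" "1 < n" using n by simp_all
  have \<tau>T: "?\<tau> \<in> T" by (rule formC_sym[OF C mem[OF n1(1)] mem[OF n1(2)]])
  have \<tau>K: "?\<tau> \<in> Tkers T ?B y"
    unfolding Tkers_def
  proof (intro CollectI conjI ballI \<tau>T)
    fix b assume b: "b \<in> {2..<n}"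
    then have "lin (y b)" using ly by simp
    then show "contr ?\<tau> (y b) = 0" using db_dual[OF db, of b 0] db_dual[OF db, of b 1] b n1 by (simp add: contr_simps)
  qed
  have "contr ?\<tau> (y 0) = J (\<xi> 1)"
    using db_dual[OF db, of 0 0] db_dual[OF db, of 0 1] n1 ly[OF n1(1)] by (simp add: contr_simps)
  then have \<tau>nz: "?\<tau> \<noteq> 0" using indep2_nonzero(2)[OF ind] contr_0[OF ly[OF n1(1)]] by metis
  have s\<tau>: "s ?\<tau> = 0"
  proof -
    have "s ?\<tau> = 2 * s (J (\<xi> 1) \<Otimes> \<xi> 0)" using s(2) by (simp add: lin_add[OF s(1)])
    then show ?thesis using two by simp
  qed
  have K1: "dimle (Tkers T ?B y) 1"
    by (rule chain_dimle[OF _ T ch]) (use dim c in simp_all)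
  have sK: "\<forall>t\<in>Tkers T ?B y. s t = 0"
  proof
    fix w assume w: "w \<in> Tkers T ?B y"
    obtain c where "w = (\<Sum>j\<in>{0::nat}. c j \<star> ?\<tau>)"
      by (rule dimle_spanned[OF K1 sub_Tkers[OF T] _ _ indf_single[OF \<tau>nz] _ w])
        (use \<tau>K ly in auto)
    then have "w = c 0 \<star> ?\<tau>" by simp
    then show "s w = 0" using s\<tau> lin_scl[OF s(1)] by simp
  qed
  have kill: "\<forall>b\<in>?B. s (J (\<xi> b) \<Otimes> \<xi> 0 + J (\<xi> 0) \<Otimes> \<xi> b) = 0 \<and> s (J (\<xi> b) \<Otimes> \<xi> 1 + J (\<xi> 1) \<Otimes> \<xi> b) = 0"
  proof
    fix b assume b: "b \<in> ?B"
    then have "J (\<xi> b) = 0" using J0 by simp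
    then show "s (J (\<xi> b) \<Otimes> \<xi> 0 + J (\<xi> 0) \<Otimes> \<xi> b) = 0 \<and> s (J (\<xi> b) \<Otimes> \<xi> 1 + J (\<xi> 1) \<Otimes> \<xi> b) = 0"
      using s(3)[of b] b by simp
  qed
  have "\<not> dimle (Tkers T ?B y) 0" using dimle_0 \<tau>K \<tau>nz by blast
  then show ?thesis using chain_spans[OF _ T ch _ _ s(1) sK kill t, of 0] dim c by simp
qed

text \<open>Once \<open>J\<close> has rank at least three, the three symmetric tensors among the
  first three vectors and the chain over the indices from 3 on again exhaust the bound. For
  \<open>n > 3\<close> the symmetric tensor of \<open>\<xi> 3\<close> and \<open>\<xi> 2\<close>
  would be one too many.\<close>

lemma formC_rank_three_span:
  assumes two: "(2::'a) = 0" and C: "formC p X T F x0 J \<alpha>" and db: "db {..<n} X \<xi> y" and n: "3 \<le> n"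
    and dim: "dimle T (2 * n - 3)" and dbU: "db {..<p} (UU p) x \<phi>" and p: "3 \<le> p"
    and Jx: "\<And>i. i < 3 \<Longrightarrow> J (\<xi> i) = x i"
  shows "n = 3 \<and> (\<forall>s. lin s \<longrightarrow> (\<forall>i<3. \<forall>j<3. s (x j \<Otimes> \<xi> i) = s (x i \<Otimes> \<xi> j)) \<longrightarrow> (\<forall>t\<in>T. s t = 0))"
proof -
  let ?B = "{3..<n}"
  define \<tau> where "\<tau> i j = J (\<xi> i) \<Otimes> \<xi> j + J (\<xi> j) \<Otimes> \<xi> i" for i j
  have mem: "\<xi> i \<in> X" if "i < n" for i using db_mem[OF db, of i] that by simp
  have ly: "lin (y i)" if "i < n" for i using db_lin[OF db, of i] that by simp
  have l\<phi>: "lin (\<phi> j)" if "j < p" for j using db_lin[OF dbU, of j] that by simp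
  have \<phi>x: "\<phi> j (x i) = (if j = i then 1 else 0)" if "i < 3" "j < 3" for i j
    using db_dual[OF dbU, of j i] that p by simp
  have J: "J (\<xi> 0) = x 0" "J (\<xi> 1) = x 1" "J (\<xi> 2) = x 2" using Jx by simp_all
  have ind: "indep2 (J (\<xi> 0)) (J (\<xi> 1))"
    unfolding indep2_def J
  proof (intro allI impI)
    fix a b assume e: "a \<star> x 0 + b \<star> x 1 = 0"
    have l: "lin (\<phi> 0)" "lin (\<phi> 1)" using l\<phi> p by simp_all
    have "\<phi> 0 (a \<star> x 0 + b \<star> x 1) = a" "\<phi> 1 (a \<star> x 0 + b \<star> x 1) = b"
      using \<phi>x[of 0 0] \<phi>x[of 1 0] \<phi>x[of 0 1] \<phi>x[of 1 1] by (simp_all add: lin_add[OF l(1)] lin_scl[OF l(1)] lin_add[OF l(2)] lin_scl[OF l(2)] del: One_nat_def)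
    then show "a = 0 \<and> b = 0" unfolding e using lin_0[OF l(1)] lin_0[OF l(2)] by simp
  qed
  have con: "contr (\<tau> i j) (y k) = (if k = j then J (\<xi> i) else 0) + (if k = i then J (\<xi> j) else 0)"
    if "i < n" "j < n" "k < n" for i j k
    using db_dual[OF db, of k i] db_dual[OF db, of k j] that ly[OF that(3)] by (simp add: \<tau>_def contr_simps)
  have \<tau>T: "\<tau> i j \<in> T" if "i < n" "j < n" for i j
    using formC_sym[OF C mem[OF that(2)] mem[OF that(1)]] by (simp add: \<tau>_def)
  have ch: "chain T ?B y (\<lambda>b. J (\<xi> b) \<Otimes> \<xi> 0 + J (\<xi> 0) \<Otimes> \<xi> b) (\<lambda>b. J (\<xi> b) \<Otimes> \<xi> 1 + J (\<xi> 1) \<Otimes> \<xi> b)"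
    by (rule formC_chain[OF C db _ ind]) auto
  define g where "g k = (if k = 0 then \<tau> 0 1 else if k = 1 then \<tau> 0 2 else \<tau> 1 2)" for k :: nat
  have gsum: "(\<Sum>k\<in>{0,1,2::nat}. c k \<star> g k) = c 0 \<star> \<tau> 0 1 + (c 1 \<star> \<tau> 0 2 + c 2 \<star> \<tau> 1 2)" for c by (simp add: g_def)
  have gind: "indf {0,1,2::nat} g"
  proof (rule indfI)
    fix c and j :: nat assume "(\<Sum>k\<in>{0,1,2}. c k \<star> g k) = 0" and j: "j \<in> {0,1,2}"
    then have e: "c 0 \<star> \<tau> 0 1 + (c 1 \<star> \<tau> 0 2 + c 2 \<star> \<tau> 1 2) = 0" by (simp only: gsum)
    have L: "lin (y 0)" "lin (y 1)" using ly n by simp_all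
    have "contr (c 0 \<star> \<tau> 0 1 + (c 1 \<star> \<tau> 0 2 + c 2 \<star> \<tau> 1 2)) (y 0) = c 0 \<star> x 1 + c 1 \<star> x 2"
      using con[of 0 1 0] con[of 0 2 0] con[of 1 2 0] n J by (simp add: contr_add[OF L(1)] contr_scl[OF L(1)])
    then have e0: "c 0 \<star> x 1 + c 1 \<star> x 2 = 0" unfolding e contr_0[OF L(1)] by (rule sym)
    have "contr (c 0 \<star> \<tau> 0 1 + (c 1 \<star> \<tau> 0 2 + c 2 \<star> \<tau> 1 2)) (y 1) = c 0 \<star> x 0 + c 2 \<star> x 2"
      using con[of 0 1 1] con[of 0 2 1] con[of 1 2 1] n J by (simp add: contr_add[OF L(2)] contr_scl[OF L(2)] del: One_nat_def)
    then have e1: "c 0 \<star> x 0 + c 2 \<star> x 2 = 0" unfolding e contr_0[OF L(2)] by (rule sym)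
    have l: "lin (\<phi> 1)" "lin (\<phi> 2)" using l\<phi> p by simp_all
    have "\<phi> 1 (c 0 \<star> x 1 + c 1 \<star> x 2) = c 0" "\<phi> 2 (c 0 \<star> x 1 + c 1 \<star> x 2) = c 1" "\<phi> 2 (c 0 \<star> x 0 + c 2 \<star> x 2) = c 2"
      using \<phi>x[of 1 1] \<phi>x[of 2 1] \<phi>x[of 1 2] \<phi>x[of 2 2] \<phi>x[of 0 2]
      by (simp_all add: lin_add[OF l(1)] lin_scl[OF l(1)] lin_add[OF l(2)] lin_scl[OF l(2)] del: One_nat_def)
    then have "c 0 = 0" "c 1 = 0" "c 2 = 0" unfolding e0 e1 lin_0[OF l(1)] lin_0[OF l(2)] by simp_all
    then show "c j = 0" using j by auto
  qed
  have gK: "g k \<in> Tkers T ?B y" for k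
  proof -
    have "contr (g k) (y b) = 0" if "b \<in> ?B" for b
      using con[of 0 1 b] con[of 0 2 b] con[of 1 2 b] that by (simp add: g_def)
    moreover have "g k \<in> T" using \<tau>T[of 0 1] \<tau>T[of 0 2] \<tau>T[of 1 2] n by (simp add: g_def)
    ultimately show ?thesis by (simp add: Tkers_def)
  qed
  have c: "2 * n - 3 = Suc 2 + 2 * card ?B" using n by simp
  have n3: "n = 3"
  proof (rule ccontr)
    assume "n \<noteq> 3"
    then have b: "3 \<in> ?B" "3 < n" using n by simp_all
    \<comment> \<open>Kills the three tensors and the chain, yet takes the value 1 at
      \<open>\<tau> 3 2\<close>.\<close>
    define s where "s = rk1 (\<phi> 2) (y 3)"
    have l2: "lin (\<phi> 2)" using l\<phi> p by simp
    have ls: "lin s" unfolding s_def by (rule lin_rk1[OF l2 ly[OF b(2)]])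
    have st: "s (\<tau> i j) = \<phi> 2 (contr (\<tau> i j) (y 3))" for i j by (simp add: s_def rk1_def)
    have sK: "\<forall>t\<in>Tkers T ?B y. s t = 0" using b(1) lin_0[OF l2] by (auto simp: Tkers_def s_def rk1_def)
    have kill: "\<forall>b\<in>?B. s (J (\<xi> b) \<Otimes> \<xi> 0 + J (\<xi> 0) \<Otimes> \<xi> b) = 0 \<and> s (J (\<xi> b) \<Otimes> \<xi> 1 + J (\<xi> 1) \<Otimes> \<xi> b) = 0"
    proof
      fix a assume a: "a \<in> ?B"
      have "s (\<tau> a 0) = 0" "s (\<tau> a 1) = 0"
        unfolding st using con[of a 0 3] con[of a 1 3] a b(2) n J \<phi>x[of 0 2] \<phi>x[of 1 2] lin_0[OF l2] by auto
      then show "s (J (\<xi> a) \<Otimes> \<xi> 0 + J (\<xi> 0) \<Otimes> \<xi> a) = 0 \<and> s (J (\<xi> a) \<Otimes> \<xi> 1 + J (\<xi> 1) \<Otimes> \<xi> a) = 0" by (simp only: \<tau>_def)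
    qed
    have "\<not> dimle (Tkers T ?B y) 2" using dimleD[of "Tkers T ?B y" 2 "{0,1,2}" g] gK gind by auto
    from chain_spans[OF _ T ch _ this ls sK kill \<tau>T[of 3 2]] have "s (\<tau> 3 2) = 0" using dim c b n by simp
    moreover have "s (\<tau> 3 2) = 1" unfolding st using con[of 3 2 3] b n J \<phi>x[of 2 2] by simp
    ultimately show False by simp
  qed
  have d3: "dimle T 3" using dim n3 by simp
  have "s t = 0" if s: "lin s" and sym: "\<forall>i<3. \<forall>j<3. s (x j \<Otimes> \<xi> i) = s (x i \<Otimes> \<xi> j)" and t: "t \<in> T" for s t
  proof -
    have gT: "g k \<in> T" for k using gK by (simp add: Tkers_def)
    obtain c where "t = (\<Sum>k\<in>{0,1,2}. c k \<star> g k)"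
      by (rule dimle_spanned[OF d3 T _ gT gind _ t]) auto
    then have t': "t = c 0 \<star> \<tau> 0 1 + (c 1 \<star> \<tau> 0 2 + c 2 \<star> \<tau> 1 2)" by (simp only: gsum)
    have "s (\<tau> i j) = 0" if "i < 3" "j < 3" for i j
    proof -
      have "s (\<tau> i j) = s (x i \<Otimes> \<xi> j) + s (x j \<Otimes> \<xi> i)" using Jx that by (simp add: \<tau>_def lin_add[OF s])
      also have "\<dots> = 2 * s (x i \<Otimes> \<xi> j)" using sym that by simp
      finally show ?thesis using two by simp
    qed
    then have "s (\<tau> 0 1) = 0" "s (\<tau> 0 2) = 0" "s (\<tau> 1 2) = 0" by simp_all
    then show ?thesis unfolding t' by (simp add: lin_add[OF s] lin_scl[OF s])
  qed
  then show ?thesis using n3 by blast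
qed

end

lemma char_two:
  assumes "(2::'a::field) = 0"
  shows "CHAR('a) = 2"
proof -
  have d: "CHAR('a) dvd 2" using of_nat_eq_0_iff_char_dvd[where 'a = 'a, of 2] assms by simp
  moreover have "\<not> CHAR('a) dvd 1" using of_nat_eq_0_iff_char_dvd[where 'a = 'a, of 1] by simp
  moreover have "CHAR('a) \<le> 2" by (rule dvd_imp_le[OF d]) simp
  moreover have "CHAR('a) \<noteq> 0" using d by (metis dvd_0_left_iff zero_neq_numeral)
  moreover have "CHAR('a) \<noteq> 1" using \<open>\<not> CHAR('a) dvd 1\<close> by auto
  ultimately show ?thesis by linarith
qed

text \<open>The rank of \<open>J\<close> on \<open>UU n\<close>, at least two by
  \<open>formC_rank\<close>, decides between the types. Taking \<open>J (\<xi> i)\<close> as column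
  basis vector number \<open>i\<close> for the first two or three indices turns the relations of
  \<open>formC_sym\<close> into symmetry of the leading block.\<close>

lemma type23_if_typeC:
  fixes S :: "'a::field mat set"
  assumes S: "mat_subspace n p S" and rcs: "rcs p (UU n) (perp n p S) F" and typeC: "typeC p (UU n) (perp n p S) F"
    and nl: "\<not> localF p (UU n) (perp n p S) F" and n1: "\<not> type1F p (UU n) (perp n p S)"
    and dim: "dimle (perp n p S) (2 * n - 3)" and n2: "2 \<le> n"
  shows "type2 n p S \<or> type3 n p S"
proof -
  interpret rcs p "UU n" "perp n p S" F by fact
  obtain x0 J \<alpha> where two: "(2::'a) = 0" and C: "formC p (UU n) (perp n p S) F x0 J \<alpha>"
    using typeC unfolding typeC_def by blast
  have lJ: "linm J" and JU: "\<And>\<xi>. \<xi> \<in> UU n \<Longrightarrow> J \<xi> \<in> UU p" using C by (auto simp: formC_def)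
  have char: "CHAR('a) = 2" by (rule char_two[OF two])
  have eq_if: "a = b" if "a + b = (0::'a)" for a b
  proof -
    have "a = (a + b) + b - 2 * b" by simp
    then show ?thesis using that two by simp
  qed
  obtain \<xi>0 where \<xi>0: "\<xi>0 \<in> UU n" "J \<xi>0 \<noteq> 0" using formC_rank(1)[OF C nl n1] by blast
  obtain \<xi>1 where \<xi>1: "\<xi>1 \<in> UU n" and ind: "indep2 (J \<xi>0) (J \<xi>1)" using formC_rank(2)[OF C nl n1 \<xi>0] by blast
  have mfun0: "mfun n p M t = 0" if "M \<in> S" "t \<in> perp n p S" for M t using that by (simp add: perp_def)
  show ?thesis
  proof (cases "\<forall>\<xi>\<in>UU n. \<exists>a b. J \<xi> = a \<star> J \<xi>0 + b \<star> J \<xi>1")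
    case True
    obtain l0 l1 x \<phi> where l: "l0 \<in> {..<p}" "l1 \<in> {..<p}" "l0 \<noteq> l1" and dbU: "db {..<p} (UU p) x \<phi>"
      and xl: "x l0 = J \<xi>0" "x l1 = J \<xi>1"
      using db_two_vec[OF db_ev JU[OF \<xi>0(1)] JU[OF \<xi>1] ind] .
    have l\<phi>: "lin (\<phi> l0)" "lin (\<phi> l1)" using db_lin[OF dbU] l by blast+
    have dual: "\<phi> l0 (J \<xi>0) = 1" "\<phi> l0 (J \<xi>1) = 0" "\<phi> l1 (J \<xi>0) = 0" "\<phi> l1 (J \<xi>1) = 1"
      using db_dual[OF dbU] l xl by metis+
    \<comment> \<open>Coordinates of \<open>J\<close> with respect to \<open>J \<xi>0\<close> and
      \<open>J \<xi>1\<close>. Used as two of the dual functionals, they make \<open>J\<close>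
      vanish at all other basis vectors, which gives the zero block.\<close>
    define a where "a \<xi> = \<phi> l0 (J \<xi>)" for \<xi>
    define b where "b \<xi> = \<phi> l1 (J \<xi>)" for \<xi>
    have lin: "lin a" "lin b" unfolding a_def[abs_def] b_def[abs_def]
      by (rule linI; simp add: linm_add[OF lJ] linm_scl[OF lJ] lin_add[OF l\<phi>(1)] lin_scl[OF l\<phi>(1)] lin_add[OF l\<phi>(2)] lin_scl[OF l\<phi>(2)])+
    have Jab: "J \<xi> = a \<xi> \<star> J \<xi>0 + b \<xi> \<star> J \<xi>1" if \<xi>: "\<xi> \<in> UU n" for \<xi>
    proof -
      obtain r s where rs: "J \<xi> = r \<star> J \<xi>0 + s \<star> J \<xi>1" using True \<xi> by blast
      have "a \<xi> = r" "b \<xi> = s" unfolding a_def b_def rs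
        by (simp_all add: lin_add[OF l\<phi>(1)] lin_scl[OF l\<phi>(1)] lin_add[OF l\<phi>(2)] lin_scl[OF l\<phi>(2)] dual)
      then show ?thesis using rs by simp
    qed
    have "indX (UU n) a b"
      unfolding indX_def
    proof (intro allI impI)
      fix r s assume rs: "\<forall>\<xi>\<in>UU n. r * a \<xi> + s * b \<xi> = 0"
      from bspec[OF rs \<xi>0(1)] bspec[OF rs \<xi>1] show "r = 0 \<and> s = 0" by (simp add: a_def b_def dual)
    qed
    then obtain k0 k1 \<xi> y where k: "k0 \<in> {..<n}" "k1 \<in> {..<n}" "k0 \<noteq> k1" and dbX: "db {..<n} (UU n) \<xi> y"
      and yk: "y k0 = a" "y k1 = b"
      using db_two_fun[OF db_ev sub_UU lin] by metis
    have J\<xi>: "J (\<xi> i) = y k0 (\<xi> i) \<star> J \<xi>0 + y k1 (\<xi> i) \<star> J \<xi>1" if "i < n" for i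
      using Jab[OF db_mem[OF dbX, of i]] that yk by simp
    have Jk: "J (\<xi> k0) = J \<xi>0" "J (\<xi> k1) = J \<xi>1"
      using J\<xi>[of k0] J\<xi>[of k1] db_dual[OF dbX k(1,1)] db_dual[OF dbX k(1,2)] db_dual[OF dbX k(2,1)] db_dual[OF dbX k(2,2)] k by simp_all
    have J0: "J (\<xi> i) = 0" if "i < n" "i \<noteq> k0" "i \<noteq> k1" for i
      using J\<xi>[OF that(1)] db_dual[OF dbX k(1), of i] db_dual[OF dbX k(2), of i] that by simp
    have "distinct [k0, k1]" "set [k0, k1] \<subseteq> {..<n}" using k by auto
    from db_reorder[OF dbX this card_lessThan] obtain \<xi>' y' where dbX': "db {..<n} (UU n) \<xi>' y'"
      and r1: "\<forall>i<length [k0, k1]. \<xi>' i = \<xi> ([k0, k1] ! i)"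
      and r2: "\<forall>i. length [k0, k1] \<le> i \<longrightarrow> i < n \<longrightarrow> (\<exists>k\<in>{..<n} - set [k0, k1]. \<xi>' i = \<xi> k)" by blast
    have "distinct [l0, l1]" "set [l0, l1] \<subseteq> {..<p}" using l by auto
    from db_reorder[OF dbU this card_lessThan] obtain x' \<phi>' where dbU': "db {..<p} (UU p) x' \<phi>'"
      and r3: "\<forall>i<length [l0, l1]. x' i = x ([l0, l1] ! i)" and p2: "length [l0, l1] \<le> p" by blast
    have p2: "2 \<le> p" using p2 by simp
    have J': "J (\<xi>' 0) = x' 0" "J (\<xi>' 1) = x' 1"
      using r1[rule_format, of 0] r1[rule_format, of 1] r3[rule_format, of 0] r3[rule_format, of 1] Jk xl by simp_all
    have J0': "J (\<xi>' i) = 0" if i: "2 \<le> i" "i < n" for i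
    proof -
      obtain k where "k \<in> {..<n} - set [k0, k1]" "\<xi>' i = \<xi> k" using r2[rule_format, of i] i by auto
      then show ?thesis using J0[of k] by simp
    qed
    have ind': "indep2 (J (\<xi>' 0)) (J (\<xi>' 1))"
      using ind r1[rule_format, of 0] r1[rule_format, of 1] Jk by simp
    have mem: "\<xi>' i \<in> UU n" if "i < n" for i using db_mem[OF dbX', of i] that by simp
    note sym = formC_sym[OF C mem mem]
    have RC: "sym2_join n p \<subseteq> carrier_mat n p" by (auto simp: sym2_join_def)
    have "\<exists>P Q Qi. P \<in> carrier_mat n n \<and> invertible_mat P \<and> Q \<in> carrier_mat p p \<and>
        Qi \<in> carrier_mat p p \<and> Q * Qi = 1\<^sub>m p \<and> Qi * Q = 1\<^sub>m p \<and> (\<lambda>M. P * M * Qi) ` S = sym2_join n p"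
    proof (rule equivalent_image[OF S dbX' dbU' RC])
      fix A M assume M: "M \<in> S" and A: "A \<in> carrier_mat n p"
        and e: "\<And>i j. i < n \<Longrightarrow> j < p \<Longrightarrow> A $$ (i, j) = mfun n p M (x' j \<Otimes> \<xi>' i)"
      have "mfun n p M (J (\<xi>' 0) \<Otimes> \<xi>' 1 + J (\<xi>' 1) \<Otimes> \<xi>' 0) = 0"
        by (rule mfun0[OF M sym]) (use n2 in simp_all)
      then have "A $$ (1, 0) + A $$ (0, 1) = 0"
        using e[of 1 0] e[of 0 1] n2 p2 J' by (simp add: lin_add[OF lin_mfun])
      then have s01: "A $$ (0, 1) = A $$ (1, 0)" using eq_if by (metis add.commute)
      have z: "A $$ (i, j) = 0" if "2 \<le> i" "i < n" "j < 2" for i j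
      proof -
        have "J (\<xi>' j) \<Otimes> \<xi>' i + J (\<xi>' i) \<Otimes> \<xi>' j \<in> perp n p S" by (rule sym) (use that in simp_all)
        then have "J (\<xi>' j) \<Otimes> \<xi>' i \<in> perp n p S" using J0'[OF that(1,2)] by simp
        moreover have "J (\<xi>' j) = x' j" using J' that(3) by (auto simp: less_2_cases_iff)
        ultimately show ?thesis using e[of i j] mfun0[OF M] that p2 by simp
      qed
      show "A \<in> sym2_join n p" unfolding sym2_join_def using A s01 z by blast
    next
      fix A s assume A: "A \<in> sym2_join n p" and s: "lin s"
        and e: "\<And>i j. i < n \<Longrightarrow> j < p \<Longrightarrow> s (x' j \<Otimes> \<xi>' i) = A $$ (i, j)"
      show "s \<in> Ann (perp n p S)"
      proof (rule AnnI[OF s])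
        fix t assume t: "t \<in> perp n p S"
        show "s t = 0"
        proof (rule formC_rank_two_span[OF two C dbX' n2 dim ind' J0' s _ _ t])
          show "s (J (\<xi>' 0) \<Otimes> \<xi>' 1) = s (J (\<xi>' 1) \<Otimes> \<xi>' 0)"
            using e[of 1 0] e[of 0 1] n2 p2 J' A by (simp add: sym2_join_def)
          fix i assume "2 \<le> i" "i < n"
          then show "s (J (\<xi>' 0) \<Otimes> \<xi>' i) = 0 \<and> s (J (\<xi>' 1) \<Otimes> \<xi>' i) = 0"
            using e[of i 0] e[of i 1] p2 J' A by (simp add: sym2_join_def)
        qed
      qed
    qed
    then have "type2 n p S" unfolding type2_def using char n2 p2 by blast
    then show ?thesis ..
  next
    case False
    then obtain \<xi>2 where \<xi>2: "\<xi>2 \<in> UU n" "\<forall>a b. J \<xi>2 \<noteq> a \<star> J \<xi>0 + b \<star> J \<xi>1" by blast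
    have J0: "J 0 = 0" using linm_scl[OF lJ, of 0 0] by simp
    have ind\<xi>: "indep2 \<xi>0 \<xi>1"
      unfolding indep2_def
    proof (intro allI impI)
      fix r s assume "r \<star> \<xi>0 + s \<star> \<xi>1 = 0"
      then have "J (r \<star> \<xi>0 + s \<star> \<xi>1) = 0" using J0 by simp
      then have "r \<star> J \<xi>0 + s \<star> J \<xi>1 = 0" by (simp add: linm_add[OF lJ] linm_scl[OF lJ])
      then show "r = 0 \<and> s = 0" by (rule indep2D[OF ind])
    qed
    have n\<xi>2: "\<forall>a b. \<xi>2 \<noteq> a \<star> \<xi>0 + b \<star> \<xi>1"
    proof (intro allI notI)
      fix r s assume "\<xi>2 = r \<star> \<xi>0 + s \<star> \<xi>1"
      then have "J \<xi>2 = r \<star> J \<xi>0 + s \<star> J \<xi>1" by (simp add: linm_add[OF lJ] linm_scl[OF lJ])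
      then show False using \<xi>2(2) by blast
    qed
    obtain k0 k1 k2 \<xi> y where k: "distinct [k0, k1, k2]" "set [k0, k1, k2] \<subseteq> {..<n}" and dbX: "db {..<n} (UU n) \<xi> y"
      and \<xi>k: "\<xi> k0 = \<xi>0" "\<xi> k1 = \<xi>1" "\<xi> k2 = \<xi>2"
      using db_three_vec[OF db_ev \<xi>0(1) \<xi>1 \<xi>2(1) ind\<xi> n\<xi>2] by blast
    obtain l0 l1 l2 x \<phi> where l: "distinct [l0, l1, l2]" "set [l0, l1, l2] \<subseteq> {..<p}" and dbU: "db {..<p} (UU p) x \<phi>"
      and xl: "x l0 = J \<xi>0" "x l1 = J \<xi>1" "x l2 = J \<xi>2"
      using db_three_vec[OF db_ev JU[OF \<xi>0(1)] JU[OF \<xi>1] JU[OF \<xi>2(1)] ind \<xi>2(2)] by blast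
    from db_reorder[OF dbX k card_lessThan] obtain \<xi>' y' where dbX': "db {..<n} (UU n) \<xi>' y'"
      and r1: "\<forall>i<length [k0, k1, k2]. \<xi>' i = \<xi> ([k0, k1, k2] ! i)" and n3: "length [k0, k1, k2] \<le> n" by blast
    from db_reorder[OF dbU l card_lessThan] obtain x' \<phi>' where dbU': "db {..<p} (UU p) x' \<phi>'"
      and r3: "\<forall>i<length [l0, l1, l2]. x' i = x ([l0, l1, l2] ! i)" and p3: "length [l0, l1, l2] \<le> p" by blast
    have n3: "3 \<le> n" and p3: "3 \<le> p" using n3 p3 by simp_all
    have J': "J (\<xi>' i) = x' i" if "i < 3" for i
    proof -
      have "i = 0 \<or> i = 1 \<or> i = 2" using that by auto
      then consider "i = 0" | "i = 1" | "i = 2" by blast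
      then show ?thesis using r1[rule_format, of i] r3[rule_format, of i] \<xi>k xl by cases simp_all
    qed
    note span = formC_rank_three_span[OF two C dbX' n3 dim dbU' p3 J']
    have neq: "n = 3" using span by blast
    have mem: "\<xi>' i \<in> UU n" if "i < n" for i using db_mem[OF dbX', of i] that by simp
    have RC: "sym3_row p \<subseteq> carrier_mat n p" by (auto simp: sym3_row_def neq)
    have "\<exists>P Q Qi. P \<in> carrier_mat n n \<and> invertible_mat P \<and> Q \<in> carrier_mat p p \<and>
        Qi \<in> carrier_mat p p \<and> Q * Qi = 1\<^sub>m p \<and> Qi * Q = 1\<^sub>m p \<and> (\<lambda>M. P * M * Qi) ` S = sym3_row p"
    proof (rule equivalent_image[OF S dbX' dbU' RC])
      fix A M assume M: "M \<in> S" and A: "A \<in> carrier_mat n p"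
        and e: "\<And>i j. i < n \<Longrightarrow> j < p \<Longrightarrow> A $$ (i, j) = mfun n p M (x' j \<Otimes> \<xi>' i)"
      have "A $$ (i, j) = A $$ (j, i)" if ij: "i < 3" "j < 3" for i j
      proof -
        have "mfun n p M (J (\<xi>' j) \<Otimes> \<xi>' i + J (\<xi>' i) \<Otimes> \<xi>' j) = 0"
          by (rule mfun0[OF M formC_sym[OF C mem mem]]) (use ij neq in simp_all)
        then have "A $$ (i, j) + A $$ (j, i) = 0"
          using e[of i j] e[of j i] ij neq p3 J' by (simp add: lin_add[OF lin_mfun])
        then show ?thesis by (rule eq_if)
      qed
      then show "A \<in> sym3_row p" unfolding sym3_row_def using A neq by blast
    next
      fix A s assume A: "A \<in> sym3_row p" and s: "lin s"
        and e: "\<And>i j. i < n \<Longrightarrow> j < p \<Longrightarrow> s (x' j \<Otimes> \<xi>' i) = A $$ (i, j)"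
      have "\<forall>i<3. \<forall>j<3. s (x' j \<Otimes> \<xi>' i) = s (x' i \<Otimes> \<xi>' j)"
        using e A neq p3 by (simp add: sym3_row_def)
      then show "s \<in> Ann (perp n p S)" using span s by (intro AnnI[OF s]) blast
    qed
    then have "type3 n p S" unfolding type3_def using char neq p3 by blast
    then show ?thesis ..
  qed
qed

lemma additive_if_linear: "linear_on S F \<Longrightarrow> additive_on S F"
  by (simp add: linear_on_def)

theorem theorem7p1:
  fixes S :: "'a::field mat set" and n p q :: nat
  assumes "mat_subspace n p S"
    and "mat_codim n p S \<le> d_bound TYPE('a) n"
    and "1 \<le> q"
  shows "(\<forall>F. (F ` S \<subseteq> carrier_mat n q \<and> linear_on S F \<and> range_restricting S F)
              \<longleftrightarrow> (\<exists>P\<in>carrier_mat p q. \<forall>M\<in>S. F M = M * P))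
      \<and> (\<not> type1 n p S \<and> \<not> type2 n p S \<and> \<not> type3 n p S \<longrightarrow>
         (\<forall>F. (F ` S \<subseteq> carrier_mat n q \<and> additive_on S F \<and> range_restricting S F)
              \<longleftrightarrow> (\<exists>P\<in>carrier_mat p q. \<forall>M\<in>S. F M = M * P)))"
proof -
  note S = assms(1)
  let ?c = "\<lambda>F k (s :: (nat \<times> nat \<Rightarrow> 'a) \<Rightarrow> 'a) \<xi>. \<Sum>i<n. \<xi> i * F (mat_of n p s) $$ (i, k)"
  note perp = perp_dim[OF S]
  have codim: "int (n * p - mat_space_dim n p S) \<le> d_bound TYPE('a) n"
    using assms(2) perp(1) by (simp add: mat_codim_def)
  \<comment> \<open>A codimension is nonnegative, so the bound forces
    \<open>n \<ge> 2\<close>.\<close>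
  have "0 \<le> d_bound TYPE('a) n" using codim by linarith
  then have n2: "2 \<le> n" by (auto simp: d_bound_def split: if_splits)
  have dims: "dimle (perp n p S) (if card (UNIV :: 'a set) = 2 then 2 * (n - 2) else 2 * (n - 2) + 1)"
    by (rule dimle_mono[OF perp(2) order_refl]) (use codim n2 in \<open>auto simp: d_bound_def split: if_splits\<close>)
  have two: "\<forall>c::'a. c = 0 \<or> c = 1" if c2: "card (UNIV :: 'a set) = 2"
  proof -
    have "finite (UNIV :: 'a set)" using c2 card.infinite by fastforce
    then have "{0, 1} = (UNIV :: 'a set)" by (intro card_subset_eq) (use c2 in auto)
    then show ?thesis by blast
  qed
  \<comment> \<open>\<open>card\<close> is 0 for an infinite field, which therefore falls under the
    case of more than two elements.\<close>
  have c01: "\<exists>c::'a. c \<noteq> 0 \<and> c \<noteq> 1" if "card (UNIV :: 'a set) \<noteq> 2"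
  proof (rule ccontr)
    assume "\<not> ?thesis"
    then have "(UNIV :: 'a set) = {0, 1}" by blast
    then have "card (UNIV :: 'a set) = card {0, 1 :: 'a}" by simp
    then show False using that by simp
  qed
  have cardI: "card {..<n} = (n - 2) + 2" using n2 by simp
  have loc: "localF p (UU n) (perp n p S) (?c F k)"
    if F: "F ` S \<subseteq> carrier_mat n q" "additive_on S F" "range_restricting S F" and k: "k < q"
      and h: "linear_on S F \<or> \<not> type1 n p S \<and> \<not> type2 n p S \<and> \<not> type3 n p S" for F k
  proof -
    note rcs = rcs_column[OF S F k]
    show ?thesis
    proof (cases "card (UNIV :: 'a set) = 2")
      case True
      then show ?thesis using rcs_local_two[OF two rcs db_ev cardI] dims by simp
    next
      case False
      have d: "dimle (perp n p S) (2 * (n - 2) + 1)" using dims False by simp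
      have d3: "dimle (perp n p S) (2 * n - 3)" by (rule dimle_mono[OF d order_refl]) (use n2 in simp)
      show ?thesis
      proof (rule ccontr)
        assume nl: "\<not> ?thesis"
        have tri: "\<not> homogF (UU n) (perp n p S) (?c F k) \<and> type1F p (UU n) (perp n p S) \<or> typeC p (UU n) (perp n p S) (?c F k)"
          using rcs_trichotomy[OF c01[OF False] rcs db_ev cardI d] nl by blast
        show False
        proof (cases "linear_on S F")
          case True
          \<comment> \<open>A linear \<open>F\<close> has homogeneous columns. This rules out Type
            1, and it turns the exceptional form into a right multiplication.\<close>
          have hom: "homogF (UU n) (perp n p S) (?c F k)"
            unfolding homogF_def
          proof (intro allI ballI)
            fix c s and \<xi> :: "nat \<Rightarrow> 'a" assume s: "s \<in> Ann (perp n p S)"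
            have M: "mat_of n p s \<in> S" by (rule mat_of_mem[OF S s])
            have FM: "F (mat_of n p s) \<in> carrier_mat n q" using M F(1) by blast
            have "F (mat_of n p (c \<star> s)) = c \<cdot>\<^sub>m F (mat_of n p s)"
              unfolding mat_of_scl using True M by (simp add: linear_on_def)
            then show "?c F k (c \<star> s) \<xi> = c * ?c F k s \<xi>"
              using FM k by (simp add: sum_distrib_left mult_ac)
          qed
          then show False using tri rcs.homog_typeC_local[OF rcs hom _ c01[OF False]] nl by blast
        next
          case nlin: False
          have n1: "\<not> type1F p (UU n) (perp n p S)" using type1_if_type1F[OF S] h nlin by blast
          then show False using type23_if_typeC[OF S rcs _ nl n1 d3 n2] tri h nlin by blast
        qed
      qed
    qed
  qed
  have main: "\<exists>P\<in>carrier_mat p q. \<forall>M\<in>S. F M = M * P"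
    if "F ` S \<subseteq> carrier_mat n q" "additive_on S F" "range_restricting S F"
      "linear_on S F \<or> \<not> type1 n p S \<and> \<not> type2 n p S \<and> \<not> type3 n p S" for F
    by (rule right_mult_if_local[OF S that(1)]) (rule loc[OF that(1-3) _ that(4)])
  have conv: "F ` S \<subseteq> carrier_mat n q \<and> linear_on S F \<and> range_restricting S F"
    if "\<exists>P\<in>carrier_mat p q. \<forall>M\<in>S. F M = M * P" for F
    using right_mult_conv[OF S] that by blast
  show ?thesis using main conv additive_if_linear by blast
qed

end
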